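(* (1) For every integer $m$ with $1\le m\le 4$, there exist a number field $k$ and a double cover $\pi\colon X\to\mathbb{P}^2_k$ branched over a smooth curve $D\subset\mathbb{P}^2_k$ of degree $2m$ such that the set $\{x\in X: [k(x):k]=2,\ k(\pi(x))=k(x)\}$ is Zariski dense in $X$. (2) There exist double covers $\pi\colon X\to\mathbb{P}^2_k$ over a number field $k$, branched over singular curves $D$ of degree $2m$ with $m$ arbitrarily large, such that the set $\{x\in X: [k(x):k]=2,\ k(\pi(x))=k(x)\}$ is Zariski dense in $X$; moreover, as $m\to\infty$ these surfaces $X$ are of general type with volume increasing in $m$.
   Context: For a closed point $x$ of a variety over $k$, $k(x)$ denotes its residue field. A double cover $\pi\colon X\to\mathbb{P}^2$ branched over $D$ means the degree 2 cyclic cover ramified exactly over the curve $D$. *)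

theory Defs
  imports
    "HOL-Analysis.Analysis"
    "HOL-Algebra.Algebraic_Closure_Type"
    "HOL-Library.Poly_Mapping"
    "HOL-Computational_Algebra.Squarefree"
begin

text \<open>
  Number fields, and all other fields below, are realized as subfields of the complex numbers.
  This is no restriction: the complex numbers contain every finitely generated extension of every
  number field. In particular they serve as a universal domain, i.e. every scheme-theoretic point
  (closed or not) of a projective variety over a number field \<open>k\<close> is represented by a complex
  coordinate vector, and its residue field is a subfield of the complex numbers.
\<close>

abbreviation CC :: "complex ring" where
  "CC \<equiv> ring_of_type_algebra"

definition number_field :: "complex set \<Rightarrow> bool" where
  "number_field k \<longleftrightarrow> subfield k CC \<and> ring.finite_dimension CC \<rat> k"


section \<open>Weighted homogeneous polynomials\<close>

type_synonym mpol = "(nat \<Rightarrow>\<^sub>0 nat) \<Rightarrow>\<^sub>0 complex"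

definition mp_eval :: "complex list \<Rightarrow> mpol \<Rightarrow> complex" where
  "mp_eval v F =
     (\<Sum>\<mu>\<in>Poly_Mapping.keys F.
        Poly_Mapping.lookup F \<mu> * (\<Prod>i<length v. (v ! i) ^ Poly_Mapping.lookup \<mu> i))"

definition mp_deriv :: "nat \<Rightarrow> mpol \<Rightarrow> mpol" where
  "mp_deriv i F =
     (\<Sum>\<mu>\<in>Poly_Mapping.keys F. Poly_Mapping.single (\<mu> - Poly_Mapping.single i 1)
                    (of_nat (Poly_Mapping.lookup \<mu> i) * Poly_Mapping.lookup F \<mu>))"

text \<open>
  \<open>wform k a d F\<close>: \<open>F\<close> is zero or homogeneous of degree \<open>d\<close> in the variables with indices
  \<open>0, \<dots>, length a - 1\<close>, where the variable with index \<open>i\<close> has weight \<open>a ! i\<close>, and has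
  coefficients in \<open>k\<close>.
\<close>

definition wform :: "complex set \<Rightarrow> nat list \<Rightarrow> nat \<Rightarrow> mpol \<Rightarrow> bool" where
  "wform k a d F \<longleftrightarrow>
     (\<forall>\<mu>\<in>Poly_Mapping.keys F. Poly_Mapping.lookup F \<mu> \<in> k \<and>
                  Poly_Mapping.keys \<mu> \<subseteq> {..<length a} \<and>
                  (\<Sum>i<length a. a ! i * Poly_Mapping.lookup \<mu> i) = d)"


section \<open>Points of weighted projective space over k\<close>

definition nonzero_vecs :: "nat \<Rightarrow> complex list set" where
  "nonzero_vecs n = {v. length v = n \<and> (\<exists>c\<in>set v. c \<noteq> 0)}"

text \<open>
  The point of the scheme \<open>P(a) = Proj k[x\<^sub>0, \<dots>, x\<^sub>n]\<close> represented by the vector \<open>v\<close>: the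
  homogeneous prime ideal (given by its homogeneous elements) of the forms over \<open>k\<close> that vanish
  at \<open>v\<close>. Vectors that agree up to weighted scaling and conjugation over \<open>k\<close> represent the same
  point.
\<close>

type_synonym point = "mpol set"

definition pt :: "complex set \<Rightarrow> nat list \<Rightarrow> complex list \<Rightarrow> point" where
  "pt k a v = {F. (\<exists>d. wform k a d F) \<and> mp_eval v F = 0}"

text \<open>
  The residue field of \<open>pt k a v\<close>, embedded into the complex numbers by evaluation at \<open>v\<close>:
  the local ring of \<open>P(a)\<close> at \<open>pt k a v\<close> consists of the fractions \<open>F / G\<close> of forms of equal
  degree with \<open>G\<close> not vanishing at \<open>v\<close>.
\<close>

definition res_field :: "complex set \<Rightarrow> nat list \<Rightarrow> complex list \<Rightarrow> complex set" where
  "res_field k a v =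
     {mp_eval v F / mp_eval v G | F G d. wform k a d F \<and> wform k a d G \<and> mp_eval v G \<noteq> 0}"

text \<open>
  The Zariski topology on a set \<open>S\<close> of points of \<open>P(a)\<close>, generated by the basic open sets
  \<open>D\<^sub>+(F)\<close>.
\<close>

definition zariski :: "complex set \<Rightarrow> nat list \<Rightarrow> point set \<Rightarrow> point topology" where
  "zariski k a S = topology_generated_by ((\<lambda>F. {x \<in> S. F \<notin> x}) ` {F. \<exists>d. wform k a d F})"

lemma topspace_zariski:
  assumes "subfield k CC" and "S \<subseteq> range (pt k a)"
  shows "topspace (zariski k a S) = S"
proof -
  interpret ring CC by (rule ring_from_type_algebra)
  have one: "(1::complex) \<in> k"
    using subringE(3)[OF subfieldE(1)[OF assms(1)]] by (simp add: ring_of_type_algebra_def)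
  have w: "wform k a 0 1"
    using one by (simp add: wform_def lookup_one)
  have e: "mp_eval v 1 = 1" for v
    by (simp add: mp_eval_def)
  have "S = {x \<in> S. (1::mpol) \<notin> x}"
    using assms(2) e by (auto simp: pt_def)
  then have "S \<in> (\<lambda>F. {x \<in> S. F \<notin> x}) ` {F. \<exists>d. wform k a d F}"
    using w by blast
  then show ?thesis
    unfolding zariski_def topology_generated_by_topspace by auto
qed


section \<open>Plane curves and their double covers\<close>

text \<open>
  The curve \<open>D = {f = 0}\<close> of degree \<open>d\<close> in the projective plane over \<open>k\<close>. The equation is
  squarefree, so that \<open>D\<close> is a reduced curve; it may be reducible.
\<close>

definition plane_curve :: "complex set \<Rightarrow> nat \<Rightarrow> mpol \<Rightarrow> bool" where
  "plane_curve k d f \<longleftrightarrow> wform k [1, 1, 1] d f \<and> squarefree f"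

definition smooth_curve :: "mpol \<Rightarrow> bool" where
  "smooth_curve f \<longleftrightarrow>
     (\<forall>v\<in>nonzero_vecs 3. mp_eval v f = 0 \<longrightarrow> (\<exists>i<3. mp_eval v (mp_deriv i f) \<noteq> 0))"

text \<open>
  The double cover of the plane branched over a curve \<open>f = 0\<close> of degree \<open>2m\<close> is the cyclic cover
  \<open>Spec (O \<oplus> O(-m))\<close> with multiplication given by \<open>f\<close>, that is, the hypersurface \<open>w\<^sup>2 = f(x, y, z)\<close>
  in \<open>P(1, 1, 1, m)\<close>, with \<open>\<pi>\<close> forgetting the coordinate \<open>w\<close>. All quadratic twists occur, since
  the equation \<open>f\<close> of the curve can be multiplied by any element of \<open>k\<close>.
\<close>

abbreviation plane_wts :: "nat list" where
  "plane_wts \<equiv> [1, 1, 1]"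

abbreviation cover_wts :: "nat \<Rightarrow> nat list" where
  "cover_wts m \<equiv> [1, 1, 1, m]"

definition cover_proj :: "complex list \<Rightarrow> complex list" where
  "cover_proj v = take 3 v"

definition cover_vecs :: "mpol \<Rightarrow> complex list set" where
  "cover_vecs f = {v \<in> nonzero_vecs 4. (v ! 3)\<^sup>2 = mp_eval (cover_proj v) f}"

definition cover_points :: "complex set \<Rightarrow> nat \<Rightarrow> mpol \<Rightarrow> point set" where
  "cover_points k m f = pt k (cover_wts m) ` cover_vecs f"

text \<open>
  The closed points \<open>x\<close> of the double cover with \<open>[k(x) : k] = 2\<close> and \<open>k(\<pi>(x)) = k(x)\<close>. The
  embedding of \<open>k(x)\<close> given by a vector \<open>v\<close> maps the subfield \<open>k(\<pi>(x))\<close> onto the residue field of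
  the image of \<open>v\<close>.
\<close>

definition quadratic_points :: "complex set \<Rightarrow> nat \<Rightarrow> mpol \<Rightarrow> point set" where
  "quadratic_points k m f =
     {x \<in> cover_points k m f.
        closedin (zariski k (cover_wts m) (cover_points k m f)) {x} \<and>
        (\<exists>v\<in>cover_vecs f. x = pt k (cover_wts m) v \<and>
           ring.dimension CC 2 k (res_field k (cover_wts m) v) \<and>
           res_field k plane_wts (cover_proj v) = res_field k (cover_wts m) v)}"

definition quadratic_points_dense :: "complex set \<Rightarrow> nat \<Rightarrow> mpol \<Rightarrow> bool" where
  "quadratic_points_dense k m f \<longleftrightarrow>
     zariski k (cover_wts m) (cover_points k m f) closure_of quadratic_points k m f
       = cover_points k m f"

definition cover_generic :: "complex set \<Rightarrow> nat \<Rightarrow> mpol \<Rightarrow> complex list \<Rightarrow> bool" where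
  "cover_generic k m f v \<longleftrightarrow>
     v \<in> cover_vecs f \<and> (\<forall>u\<in>cover_vecs f. pt k (cover_wts m) v \<subseteq> pt k (cover_wts m) u)"


section \<open>Smooth projective surfaces\<close>

text \<open>
  An integral closed subvariety \<open>Y\<close> of a projective space over \<open>k\<close> is given by (a vector
  representing) its generic point \<open>g\<close>. The residue field at \<open>g\<close> is the function field of \<open>Y\<close>.
\<close>

abbreviation ones :: "complex list \<Rightarrow> nat list" where
  "ones g \<equiv> replicate (length g) 1"

definition locus :: "complex set \<Rightarrow> complex list \<Rightarrow> complex list set" where
  "locus k g = {y \<in> nonzero_vecs (length g). pt k (ones g) g \<subseteq> pt k (ones g) y}"

abbreviation fun_field :: "complex set \<Rightarrow> complex list \<Rightarrow> complex set" where
  "fun_field k g \<equiv> res_field k (ones g) g"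

text \<open>The local ring of \<open>Y\<close> at \<open>y\<close>, as a subring of the function field.\<close>

definition local_ring :: "complex set \<Rightarrow> complex list \<Rightarrow> complex list \<Rightarrow> complex set" where
  "local_ring k g y =
     {mp_eval g F / mp_eval g G | F G d.
        wform k (ones g) d F \<and> wform k (ones g) d G \<and> mp_eval y G \<noteq> 0}"

text \<open>
  Smoothness of a surface by the Jacobian criterion: in projective space of dimension
  \<open>length g - 1\<close>, the gradients of the equations of \<open>Y\<close> have rank at least the codimension
  \<open>length g - 3\<close> at every point of \<open>Y\<close>.
\<close>

definition smooth_surface :: "complex set \<Rightarrow> complex list \<Rightarrow> bool" where
  "smooth_surface k g \<longleftrightarrow>
     (\<forall>y\<in>locus k g. \<exists>Fs. length Fs = length g - 3 \<and> set Fs \<subseteq> pt k (ones g) g \<and>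
        (\<forall>c. (\<forall>i<length g. (\<Sum>j<length Fs. c j * mp_eval y (mp_deriv i (Fs ! j))) = 0)
               \<longrightarrow> (\<forall>j<length Fs. c j = 0)))"

text \<open>
  \<open>g\<close> gives a smooth projective model of the double cover: the two varieties are birational over
  \<open>k\<close>, that is, generic points can be chosen with the same residue field.
\<close>

definition smooth_model :: "complex set \<Rightarrow> nat \<Rightarrow> mpol \<Rightarrow> complex list \<Rightarrow> bool" where
  "smooth_model k m f g \<longleftrightarrow>
     g \<in> nonzero_vecs (length g) \<and> smooth_surface k g \<and>
     (\<exists>v. cover_generic k m f v \<and> res_field k (cover_wts m) v = fun_field k g)"


section \<open>Plurigenera, Kodaira dimension and volume\<close>

definition derivation :: "complex set \<Rightarrow> complex set \<Rightarrow> (complex \<Rightarrow> complex) \<Rightarrow> bool" where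
  "derivation k K D \<longleftrightarrow>
     (\<forall>u\<in>K. D u \<in> K) \<and> (\<forall>c\<in>k. D c = 0) \<and>
     (\<forall>u\<in>K. \<forall>v\<in>K. D (u + v) = D u + D v \<and> D (u * v) = u * D v + v * D u)"

text \<open>\<open>D\<^sub>1, D\<^sub>2\<close> form a basis of the \<open>K\<close>-vector space of \<open>k\<close>-derivations of \<open>K\<close>.\<close>

definition deriv_basis ::
  "complex set \<Rightarrow> complex set \<Rightarrow> (complex \<Rightarrow> complex) \<Rightarrow> (complex \<Rightarrow> complex) \<Rightarrow> bool" where
  "deriv_basis k K D\<^sub>1 D\<^sub>2 \<longleftrightarrow>
     derivation k K D\<^sub>1 \<and> derivation k K D\<^sub>2 \<and>
     (\<forall>D. derivation k K D \<longrightarrow>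
        (\<exists>!p. p \<in> K \<times> K \<and> (\<forall>u\<in>K. D u = fst p * D\<^sub>1 u + snd p * D\<^sub>2 u)))"

text \<open>
  With such a basis, the one-dimensional \<open>K\<close>-vector space of rational \<open>2\<close>-forms is identified with
  \<open>K\<close> by \<open>\<omega> \<mapsto> \<omega>(D\<^sub>1, D\<^sub>2)\<close>, under which \<open>du \<and> dv\<close> corresponds to the following element.
\<close>

definition wedge ::
  "(complex \<Rightarrow> complex) \<Rightarrow> (complex \<Rightarrow> complex) \<Rightarrow> complex \<Rightarrow> complex \<Rightarrow> complex" where
  "wedge D\<^sub>1 D\<^sub>2 u v = D\<^sub>1 u * D\<^sub>2 v - D\<^sub>1 v * D\<^sub>2 u"

text \<open>
  The stalk of the \<open>n\<close>-th tensor power of the canonical sheaf at a point with local ring \<open>R\<close>: the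
  \<open>R\<close>-module generated by the products of \<open>n\<close> forms \<open>du \<and> dv\<close> with \<open>u\<close> and \<open>v\<close> in \<open>R\<close>.
\<close>

definition canonical_stalk ::
  "(complex \<Rightarrow> complex) \<Rightarrow> (complex \<Rightarrow> complex) \<Rightarrow> complex set \<Rightarrow> nat \<Rightarrow> complex set" where
  "canonical_stalk D\<^sub>1 D\<^sub>2 R n =
     {\<Sum>i<r. c i * (\<Prod>j<n. wedge D\<^sub>1 D\<^sub>2 (u i j) (v i j)) | (r::nat) c u v.
        (\<forall>i<r. c i \<in> R \<and> (\<forall>j<n. u i j \<in> R \<and> v i j \<in> R))}"

definition canonical_sections ::
  "complex set \<Rightarrow> complex list \<Rightarrow> (complex \<Rightarrow> complex) \<Rightarrow> (complex \<Rightarrow> complex) \<Rightarrow> nat \<Rightarrow> complex set"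
  where
  "canonical_sections k g D\<^sub>1 D\<^sub>2 n =
     {h \<in> fun_field k g. \<forall>y\<in>locus k g. h \<in> canonical_stalk D\<^sub>1 D\<^sub>2 (local_ring k g y) n}"

text \<open>
  The plurigenus \<open>h\<^sup>0(Y, nK\<^sub>Y)\<close>; a change of the basis \<open>D\<^sub>1, D\<^sub>2\<close> multiplies the space of sections
  by a nonzero element of the function field.
\<close>

definition plurigenus :: "complex set \<Rightarrow> complex list \<Rightarrow> nat \<Rightarrow> nat" where
  "plurigenus k g n =
     (THE d. \<exists>D\<^sub>1 D\<^sub>2. deriv_basis k (fun_field k g) D\<^sub>1 D\<^sub>2 \<and>
                    ring.dimension CC d k (canonical_sections k g D\<^sub>1 D\<^sub>2 n))"

text \<open>
  The Kodaira dimension is the order of growth of the plurigenera (negative infinity if they all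
  vanish); a surface is of general type if it is \<open>2\<close>.
\<close>

definition kodaira_dim :: "complex set \<Rightarrow> complex list \<Rightarrow> ereal" where
  "kodaira_dim k g =
     (if \<forall>n\<ge>1. plurigenus k g n = 0 then - \<infinity>
      else ereal (real (LEAST \<kappa>. \<exists>C::real. \<forall>n\<ge>1. real (plurigenus k g n) \<le> C * real n ^ \<kappa>)))"

definition general_type :: "complex set \<Rightarrow> complex list \<Rightarrow> bool" where
  "general_type k g \<longleftrightarrow> kodaira_dim k g = 2"

text \<open>The volume of the canonical divisor of a surface.\<close>

definition canonical_volume :: "complex set \<Rightarrow> complex list \<Rightarrow> ereal" where
  "canonical_volume k g = limsup (\<lambda>n. ereal (real (plurigenus k g n) / (real n ^ 2 / fact 2)))"

end

theory Submission
  imports Defs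
begin

text \<open>
  Part 1 uses \<open>w\<^sup>2 = x\<^bsup>2m\<^esup> - c y\<^bsup>2m\<^esup> + c z\<^bsup>2m\<^esup>\<close>. Put \<open>x = 1\<close>, fix an integer \<open>y\<close> and let \<open>z\<^sup>2 = t\<close> be
  rational: a rational point of the curve \<open>w\<^sup>2 = 1 - c y\<^bsup>2m\<^esup> + c t\<^sup>m\<close>, of genus at most one, with \<open>t\<close> not
  a square gives a quadratic point with \<open>k(\<pi>(x)) = k(x)\<close>. For a suitable \<open>c\<close> and the parity of \<open>y\<close>,
  infinitely many points have a \<open>t\<close> of odd negative 2-adic valuation: they come from a parametrization
  if \<open>m \<le> 2\<close> and from repeated duplication of the obvious point if \<open>m = 3, 4\<close>. The curves for infinitely
  many \<open>y\<close> sweep out the surface.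

  Part 2 uses \<open>w\<^sup>2 = x\<^bsup>2a\<^esup> (y\<^sup>6 + 3) + (y\<^sup>6 - 1)\<close>. For odd \<open>x\<close> this is again an elliptic curve in
  \<open>t = y\<^sup>2\<close>, with the point \<open>t = 1\<close>, \<open>w = 2 x\<^sup>a\<close>. The surface is also a double cover of the product of two
  lines, branched over a smooth curve of bidegree \<open>(2a, 6)\<close>, which gives the smooth model. The sections
  \<open>x\<^sup>i y\<^sup>j (dx \<and> dy / w)\<^sup>n\<close> with \<open>i \<le> n (a - 2)\<close> and \<open>j \<le> n\<close> bound the plurigenera from below. From
  above, a section is determined by its values over a sufficiently large grid of points \<open>(x, y)\<close>, since
  it has bounded poles along the lines at infinity. The volume lies between \<open>2 (a - 2)\<close> and \<open>96 a\<close>, so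
  it increases along \<open>a = 3, 150, 7500, \<dots>\<close>.
\<close>

section \<open>Polynomial functions\<close>

text \<open>2-adic valuations replace heights and ranks: once t has negative odd valuation on a
  cubic fibre, each duplication lowers it by 2, so the points are distinct and no t is a square. The
  plane branch curve of part 2 is singular only at two points at infinity. Compactifying the (x,
  y)-plane by a product of two lines makes the branch curve smooth, with canonical class the
  pullback of O(a - 2, 1); hence a \<ge> 3. Exponent 6 is the least even y-degree that makes the
  second entry positive, while y^6 = t^3 still leaves genus one in t. The plurigenera are bounded
  only up to constant factors, so a has to grow geometrically. All geometry takes place at a generic
  point: for algebraically independent complex \<xi>, \<eta> and \<omega> with \<omega>^2 = B(\<xi>,
  \<eta>), function field and local rings are subrings of the complex numbers, and a rational
  polynomial vanishing at (\<xi>, \<eta>, \<omega>) vanishes on the whole affine surface. Only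
  values matter for this, so polynomials are represented by functions of a coordinate sequence that
  are built from constants and coordinates.\<close>

inductive polyf :: "complex set \<Rightarrow> nat \<Rightarrow> ((nat \<Rightarrow> complex) \<Rightarrow> complex) \<Rightarrow> bool"
  for k :: "complex set" and n :: nat where
  polyf_const: "c \<in> k \<Longrightarrow> polyf k n (\<lambda>u. c)"
| polyf_var: "i < n \<Longrightarrow> polyf k n (\<lambda>u. u i)"
| polyf_add: "polyf k n f \<Longrightarrow> polyf k n g \<Longrightarrow> polyf k n (\<lambda>u. f u + g u)"
| polyf_mult: "polyf k n f \<Longrightarrow> polyf k n g \<Longrightarrow> polyf k n (\<lambda>u. f u * g u)"

lemma polyf_uminus: "-1 \<in> k \<Longrightarrow> polyf k n f \<Longrightarrow> polyf k n (\<lambda>u. - f u)"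
  using polyf_mult[OF polyf_const[of "-1" k n], of f] by simp

lemma polyf_diff: "-1 \<in> k \<Longrightarrow> polyf k n f \<Longrightarrow> polyf k n g \<Longrightarrow> polyf k n (\<lambda>u. f u - g u)"
  using polyf_add[OF _ polyf_uminus[of k n g], of f] by simp

lemma polyf_power: "1 \<in> k \<Longrightarrow> polyf k n f \<Longrightarrow> polyf k n (\<lambda>u. f u ^ m)"
  by (induction m) (auto intro: polyf_const polyf_mult)

lemma polyf_sum:
  "0 \<in> k \<Longrightarrow> (\<And>i. i \<in> I \<Longrightarrow> polyf k n (f i)) \<Longrightarrow> polyf k n (\<lambda>u. \<Sum>i\<in>I. f i u)"
  by (induction I rule: infinite_finite_induct) (auto intro: polyf_const polyf_add)

lemma polyf_prod:
  "1 \<in> k \<Longrightarrow> (\<And>i. i \<in> I \<Longrightarrow> polyf k n (f i)) \<Longrightarrow> polyf k n (\<lambda>u. \<Prod>i\<in>I. f i u)"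
  by (induction I rule: infinite_finite_induct) (auto intro: polyf_const polyf_mult)

lemmas polyf_Rats_intros =
  polyf_const[of _ \<rat>] polyf_var polyf_add polyf_mult polyf_uminus[of \<rat>] polyf_diff[of \<rat>]
  polyf_power[of \<rat>] polyf_sum[of \<rat>] polyf_prod[of \<rat>]

lemma polyf_cong_vars: "polyf k n f \<Longrightarrow> (\<And>i. i < n \<Longrightarrow> u i = v i) \<Longrightarrow> f u = f v"
  by (induction rule: polyf.induct) auto

lemma polyf_subst:
  "polyf k n f \<Longrightarrow> (\<And>i. i < n \<Longrightarrow> polyf k m (\<sigma> i)) \<Longrightarrow> polyf k m (\<lambda>u. f (\<lambda>i. \<sigma> i u))"
  by (induction rule: polyf.induct) (auto intro: polyf.intros)

lemma polyf_mono: "polyf k n f \<Longrightarrow> n \<le> m \<Longrightarrow> polyf k m f"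
  by (induction rule: polyf.induct) (auto intro: polyf.intros)

text \<open>Freezing all coordinates but one reduces questions in several variables to counting
  roots of one-variable polynomials.\<close>

lemma polyf_slice: "polyf k n f \<Longrightarrow> \<exists>p. \<forall>z. f (u(i := z)) = poly p z"
proof (induction rule: polyf.induct)
  case (polyf_const c)
  show ?case by (rule exI[of _ "[:c:]"]) simp
next
  case (polyf_var j)
  show ?case by (rule exI[of _ "if j = i then [:0,1:] else [:u j:]"]) simp
next
  case (polyf_add f g)
  then obtain p q where "\<And>z. f (u(i := z)) = poly p z" "\<And>z. g (u(i := z)) = poly q z" by metis
  then have "\<forall>z. f (u(i := z)) + g (u(i := z)) = poly (p + q) z" by (simp only: poly_add simp_thms)
  then show ?case by (rule exI)
next
  case (polyf_mult f g)
  then obtain p q where "\<And>z. f (u(i := z)) = poly p z" "\<And>z. g (u(i := z)) = poly q z" by metis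
  then have "\<forall>z. f (u(i := z)) * g (u(i := z)) = poly (p * q) z" by (simp only: poly_mult simp_thms)
  then show ?case by (rule exI)
qed

lemma polyf_slice_zero:
  assumes "polyf k n f" and "infinite {z. f (u(i := z)) = 0}"
  shows "f (u(i := z)) = 0"
proof -
  obtain p where p: "\<And>z. f (u(i := z)) = poly p z" using polyf_slice[OF assms(1)] by metis
  have "p = 0" using assms(2) poly_roots_finite[of p] by (auto simp: p)
  then show ?thesis by (simp add: p)
qed

lemma polyf_Rats: "polyf \<rat> n f \<Longrightarrow> (\<And>i. i < n \<Longrightarrow> u i \<in> \<rat>) \<Longrightarrow> f u \<in> \<rat>"
  by (induction rule: polyf.induct) auto

text \<open>Reduction modulo the quadratic equation of the last variable. It yields the normal form
  F0 + F1 w on the double cover and, with a constant \<open>b\<close>, the normal form p + q z in a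
  quadratic field.\<close>

lemma polyf_split:
  assumes "polyf k (Suc n) f" and "polyf k n b" and k: "0 \<in> k" "1 \<in> k"
  shows "\<exists>f0 f1. polyf k n f0 \<and> polyf k n f1 \<and> (\<forall>u. (u n)\<^sup>2 = b u \<longrightarrow> f u = f0 u + f1 u * u n)"
  using assms(1)
proof (induction rule: polyf.induct)
  case (polyf_const c)
  show ?case
    by (rule exI[of _ "\<lambda>u. c"], rule exI[of _ "\<lambda>u. 0"]) (auto intro: polyf.intros polyf_const k)
next
  case (polyf_var i)
  show ?case
  proof (cases "i = n")
    case True
    then show ?thesis
      by (intro exI[of _ "\<lambda>u. 0"] exI[of _ "\<lambda>u. 1"]) (auto intro: polyf.intros k)
  next
    case False
    with polyf_var show ?thesis
      by (intro exI[of _ "\<lambda>u. u i"] exI[of _ "\<lambda>u. 0"]) (auto intro: polyf.intros k)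
  qed
next
  case (polyf_add f g)
  then obtain f0 f1 g0 g1 where *: "polyf k n f0" "polyf k n f1" "polyf k n g0" "polyf k n g1"
    "\<And>u. (u n)\<^sup>2 = b u \<Longrightarrow> f u = f0 u + f1 u * u n"
    "\<And>u. (u n)\<^sup>2 = b u \<Longrightarrow> g u = g0 u + g1 u * u n" by metis
  show ?case
    by (rule exI[of _ "\<lambda>u. f0 u + g0 u"], rule exI[of _ "\<lambda>u. f1 u + g1 u"])
      (auto intro: polyf.intros * simp: *(5,6) algebra_simps)
next
  case (polyf_mult f g)
  then obtain f0 f1 g0 g1 where *: "polyf k n f0" "polyf k n f1" "polyf k n g0" "polyf k n g1"
    "\<And>u. (u n)\<^sup>2 = b u \<Longrightarrow> f u = f0 u + f1 u * u n"
    "\<And>u. (u n)\<^sup>2 = b u \<Longrightarrow> g u = g0 u + g1 u * u n" by metis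
  have "(f0 u + f1 u * u n) * (g0 u + g1 u * u n)
      = (f0 u * g0 u + f1 u * g1 u * b u) + (f0 u * g1 u + f1 u * g0 u) * u n" if "(u n)\<^sup>2 = b u" for u
    unfolding that[symmetric] by (simp add: algebra_simps power2_eq_square)
  then show ?case
    by (intro exI[of _ "\<lambda>u. f0 u * g0 u + f1 u * g1 u * b u"] exI[of _ "\<lambda>u. f0 u * g1 u + f1 u * g0 u"])
      (auto intro!: polyf.intros * assms(2) simp: *(5,6))
qed

text \<open>Passage to the chart at infinity: substituting 1 / u i and clearing denominators gives a
  polynomial again. Every large \<open>M\<close> is allowed, so that several functions can be
  reversed with exponents that fit together.\<close>

lemma polyf_reverse:
  assumes "polyf k n f" and "i < n" and k: "1 \<in> k"
  shows "\<exists>M0. \<forall>M\<ge>M0. \<exists>g. polyf k n g \<and> (\<forall>u. u i \<noteq> 0 \<longrightarrow> g u = u i ^ M * f (u(i := 1 / u i)))"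
  using assms(1)
proof (induction rule: polyf.induct)
  case (polyf_const c)
  have "polyf k n (\<lambda>u. u i ^ M * c)" for M
    by (intro polyf.intros polyf_power polyf_const assms k)
  then show ?case by (intro exI[of _ 0]) blast
next
  case (polyf_var j)
  show ?case
  proof (cases "j = i")
    case True
    have "\<exists>g. polyf k n g \<and> (\<forall>u. u i \<noteq> 0 \<longrightarrow> g u = u i ^ M * (u(i := 1 / u i)) j)" if "M \<ge> 1" for M
    proof (intro exI conjI allI impI)
      show "polyf k n (\<lambda>u. u i ^ (M - 1))" by (intro polyf_power polyf.intros assms k)
      fix u :: "nat \<Rightarrow> complex" assume "u i \<noteq> 0"
      then show "u i ^ (M - 1) = u i ^ M * (u(i := 1 / u i)) j"
        using that True by (cases M) auto
    qed
    then show ?thesis by blast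
  next
    case False
    have "polyf k n (\<lambda>u. u i ^ M * u j)" for M
      by (intro polyf.intros polyf_power assms k polyf_var)
    then show ?thesis using False by (intro exI[of _ 0]) auto
  qed
next
  case (polyf_add f g)
  then obtain Mf Mg where
    f: "\<And>M. M \<ge> Mf \<Longrightarrow> \<exists>g. polyf k n g \<and> (\<forall>u. u i \<noteq> 0 \<longrightarrow> g u = u i ^ M * f (u(i := 1 / u i)))" and
    g: "\<And>M. M \<ge> Mg \<Longrightarrow> \<exists>h. polyf k n h \<and> (\<forall>u. u i \<noteq> 0 \<longrightarrow> h u = u i ^ M * g (u(i := 1 / u i)))"
    by metis
  have "\<exists>h. polyf k n h \<and> (\<forall>u. u i \<noteq> 0 \<longrightarrow>
      h u = u i ^ M * (f (u(i := 1 / u i)) + g (u(i := 1 / u i))))" if M: "M \<ge> max Mf Mg" for M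
  proof -
    obtain f' where f': "polyf k n f'" "\<And>u. u i \<noteq> 0 \<Longrightarrow> f' u = u i ^ M * f (u(i := 1 / u i))"
      using f[of M] M by (metis max.boundedE)
    obtain g' where g': "polyf k n g'" "\<And>u. u i \<noteq> 0 \<Longrightarrow> g' u = u i ^ M * g (u(i := 1 / u i))"
      using g[of M] M by (metis max.boundedE)
    show ?thesis
      by (intro exI[of _ "\<lambda>u. f' u + g' u"]) (auto intro: polyf.intros f' g' simp: f'(2) g'(2) algebra_simps)
  qed
  then show ?case by blast
next
  case (polyf_mult f g)
  then obtain Mf Mg where
    f: "\<And>M. M \<ge> Mf \<Longrightarrow> \<exists>g. polyf k n g \<and> (\<forall>u. u i \<noteq> 0 \<longrightarrow> g u = u i ^ M * f (u(i := 1 / u i)))" and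
    g: "\<And>M. M \<ge> Mg \<Longrightarrow> \<exists>h. polyf k n h \<and> (\<forall>u. u i \<noteq> 0 \<longrightarrow> h u = u i ^ M * g (u(i := 1 / u i)))"
    by metis
  have "\<exists>h. polyf k n h \<and> (\<forall>u. u i \<noteq> 0 \<longrightarrow>
      h u = u i ^ M * (f (u(i := 1 / u i)) * g (u(i := 1 / u i))))" if M: "M \<ge> Mf + Mg" for M
  proof -
    obtain f' where f': "polyf k n f'" "\<And>u. u i \<noteq> 0 \<Longrightarrow> f' u = u i ^ Mf * f (u(i := 1 / u i))"
      using f[of Mf] by (metis order_refl)
    obtain g' where g': "polyf k n g'" "\<And>u. u i \<noteq> 0 \<Longrightarrow> g' u = u i ^ (M - Mf) * g (u(i := 1 / u i))"
      using g[of "M - Mf"] M by (metis le_diff_conv2 add.commute add_leD1)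
    have "u i ^ M = u i ^ Mf * u i ^ (M - Mf)" for u :: "nat \<Rightarrow> complex"
      using M by (simp flip: power_add)
    then show ?thesis
      by (intro exI[of _ "\<lambda>u. f' u * g' u"]) (auto intro: polyf.intros f' g' simp: f'(2) g'(2))
  qed
  then show ?case by blast
qed

section \<open>Countability of the rational polynomial functions\<close>

datatype pexp = Cst rat | Var nat | Add pexp pexp | Mul pexp pexp

instance pexp :: countable
  by countable_datatype

fun pexp_eval :: "pexp \<Rightarrow> (nat \<Rightarrow> complex) \<Rightarrow> complex" where
  "pexp_eval (Cst c) u = of_rat c"
| "pexp_eval (Var i) u = u i"
| "pexp_eval (Add d e) u = pexp_eval d u + pexp_eval e u"
| "pexp_eval (Mul d e) u = pexp_eval d u * pexp_eval e u"

text \<open>Each such function is the value of a syntax tree from a countable type. Countability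
  later allows complex numbers to be chosen off the zeros of all nonzero rational
  polynomials.\<close>

lemma countable_polyf_Rats: "countable {f. polyf \<rat> n f}"
proof (rule countable_subset)
  have "\<exists>e. f = pexp_eval e" if "polyf \<rat> n f" for f
    using that
  proof (induction rule: polyf.induct)
    case (polyf_const c)
    then obtain r where "c = of_rat r" by (auto elim: Rats_cases)
    then show ?case by (intro exI[of _ "Cst r"]) auto
  next
    case (polyf_var i)
    show ?case by (intro exI[of _ "Var i"]) auto
  next
    case (polyf_add f g)
    then obtain d e where "f = pexp_eval d" "g = pexp_eval e" by auto
    then show ?case by (intro exI[of _ "Add d e"]) auto
  next
    case (polyf_mult f g)
    then obtain d e where "f = pexp_eval d" "g = pexp_eval e" by auto
    then show ?case by (intro exI[of _ "Mul d e"]) auto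
  qed
  then show "{f. polyf \<rat> n f} \<subseteq> range pexp_eval" by auto
qed simp

section \<open>Evaluation of weighted forms\<close>

lemma mp_eval_superset:
  assumes "finite S" "Poly_Mapping.keys F \<subseteq> S"
  shows "mp_eval v F = (\<Sum>\<mu>\<in>S. Poly_Mapping.lookup F \<mu> * (\<Prod>i<length v. (v ! i) ^ Poly_Mapping.lookup \<mu> i))"
  unfolding mp_eval_def by (rule sum.mono_neutral_left) (use assms in \<open>auto simp: in_keys_iff\<close>)

lemma mp_eval_0 [simp]: "mp_eval v 0 = 0"
  by (simp add: mp_eval_def)

lemma mp_eval_add [simp]: "mp_eval v (F + G) = mp_eval v F + mp_eval v G"
proof -
  let ?S = "Poly_Mapping.keys F \<union> Poly_Mapping.keys G"
  have "Poly_Mapping.keys (F + G) \<subseteq> ?S" by (rule keys_add)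
  then show ?thesis
    by (simp add: mp_eval_superset[of ?S] lookup_add distrib_right sum.distrib)
qed

lemma mp_eval_uminus [simp]: "mp_eval v (- F) = - mp_eval v F"
  by (metis add.right_inverse mp_eval_0 mp_eval_add minus_unique)

lemma mp_eval_diff [simp]: "mp_eval v (F - G) = mp_eval v F - mp_eval v G"
  by (metis add_uminus_conv_diff mp_eval_add mp_eval_uminus)

lemma mp_eval_sum [simp]: "mp_eval v (\<Sum>i\<in>I. F i) = (\<Sum>i\<in>I. mp_eval v (F i))"
  by (induction I rule: infinite_finite_induct) auto

lemma mp_eval_single:
  "mp_eval v (Poly_Mapping.single \<mu> c) = c * (\<Prod>i<length v. (v ! i) ^ Poly_Mapping.lookup \<mu> i)"
  by (cases "c = 0") (auto simp: mp_eval_def)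

lemma mpol_expand:
  fixes F :: mpol
  shows "F = (\<Sum>\<mu>\<in>Poly_Mapping.keys F. Poly_Mapping.single \<mu> (Poly_Mapping.lookup F \<mu>))"
proof (rule poly_mapping_eqI)
  fix \<nu>
  have "(\<Sum>\<mu>\<in>Poly_Mapping.keys F. Poly_Mapping.lookup F \<mu> when \<mu> = \<nu>) = Poly_Mapping.lookup F \<nu>"
    by (cases "\<nu> \<in> Poly_Mapping.keys F") (auto simp: when_def sum.delta in_keys_iff)
  then show "Poly_Mapping.lookup F \<nu> = Poly_Mapping.lookup
      (\<Sum>\<mu>\<in>Poly_Mapping.keys F. Poly_Mapping.single \<mu> (Poly_Mapping.lookup F \<mu>)) \<nu>"
    by (simp add: lookup_sum lookup_single)
qed

lemma mpol_induct [case_names zero single add]: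
  fixes F :: mpol
  assumes "P 0" "\<And>\<mu> c. c \<noteq> 0 \<Longrightarrow> P (Poly_Mapping.single \<mu> c)" "\<And>F G. P F \<Longrightarrow> P G \<Longrightarrow> P (F + G)"
  shows "P F"
proof -
  have "P (\<Sum>\<mu>\<in>S. Poly_Mapping.single \<mu> (Poly_Mapping.lookup F \<mu>))" if "S \<subseteq> Poly_Mapping.keys F" for S
    using finite_subset[OF that finite_keys] that
    by (induction S rule: finite_induct) (auto intro!: assms simp: in_keys_iff)
  from this[of "Poly_Mapping.keys F"] show ?thesis using mpol_expand[of F] by simp
qed

lemma mp_eval_single_mult:
  "mp_eval v (Poly_Mapping.single \<mu> c * G) = mp_eval v (Poly_Mapping.single \<mu> c) * mp_eval v G"
  by (induction G rule: mpol_induct)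
    (simp_all add: mult_single mp_eval_single lookup_add power_add prod.distrib distrib_left)

lemma mp_eval_mult [simp]: "mp_eval v (F * G) = mp_eval v F * mp_eval v G"
  by (induction F rule: mpol_induct) (simp_all add: mp_eval_single_mult distrib_right)

lemma mp_eval_1 [simp]: "mp_eval v 1 = 1"
  using mp_eval_single[of v 0 1] by simp

lemma mp_eval_power [simp]: "mp_eval v (F ^ n) = mp_eval v F ^ n"
  by (induction n) auto

lemma mp_eval_numeral [simp]: "mp_eval v (numeral n) = numeral n"
  using mp_eval_single[of v 0 "numeral n"] by simp

definition mvar :: "nat \<Rightarrow> mpol" where
  "mvar i = Poly_Mapping.single (Poly_Mapping.single i 1) 1"

definition mconst :: "complex \<Rightarrow> mpol" where
  "mconst c = Poly_Mapping.single 0 c"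

lemma mp_eval_mvar [simp]: "i < length v \<Longrightarrow> mp_eval v (mvar i) = v ! i"
proof -
  assume i: "i < length v"
  have "(\<Prod>j<length v. v ! j ^ Poly_Mapping.lookup (Poly_Mapping.single i 1) j) =
      (\<Prod>j<length v. if j = i then v ! i else 1)"
    by (rule prod.cong) (auto simp: lookup_single when_def)
  then show ?thesis using i by (simp add: mvar_def mp_eval_single)
qed

lemma mp_eval_mconst [simp]: "mp_eval v (mconst c) = c"
  by (simp add: mconst_def mp_eval_single)

lemma wform_0 [simp]: "wform k a d 0"
  by (simp add: wform_def)

lemma wform_mconst: "c \<in> k \<Longrightarrow> wform k a 0 (mconst c)"
  by (auto simp: wform_def mconst_def lookup_single when_def split: if_splits)

lemma wform_mvar:
  assumes "1 \<in> k" "i < length a"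
  shows "wform k a (a ! i) (mvar i)"
proof -
  have "(\<Sum>j<length a. a ! j * Poly_Mapping.lookup (Poly_Mapping.single i 1) j) =
      (\<Sum>j<length a. if j = i then a ! i else 0)"
    by (rule sum.cong) (auto simp: lookup_single when_def)
  then show ?thesis
    using assms by (auto simp: wform_def mvar_def lookup_single when_def split: if_splits)
qed

text \<open>Closure under the ring operations, in type class notation, so that the same lemmas serve
  \<open>\<rat>\<close> and \<open>UNIV\<close>. The second is used for squarefreeness, where
  factors may have arbitrary complex coefficients.\<close>

locale coeff_ring =
  fixes k :: "complex set"
  assumes zero: "0 \<in> k" and one: "1 \<in> k" and minus_one: "-1 \<in> k"
    and add: "\<And>x y. x \<in> k \<Longrightarrow> y \<in> k \<Longrightarrow> x + y \<in> k" and mult: "\<And>x y. x \<in> k \<Longrightarrow> y \<in> k \<Longrightarrow> x * y \<in> k"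
begin

lemma sum: "(\<And>i. i \<in> I \<Longrightarrow> f i \<in> k) \<Longrightarrow> (\<Sum>i\<in>I. f i) \<in> k"
  by (induction I rule: infinite_finite_induct) (auto intro: zero add)

lemma wform_add:
  assumes "wform k a d F" "wform k a d G"
  shows "wform k a d (F + G)"
  unfolding wform_def
proof (intro ballI conjI)
  fix \<mu> assume "\<mu> \<in> Poly_Mapping.keys (F + G)"
  then have "\<mu> \<in> Poly_Mapping.keys F \<or> \<mu> \<in> Poly_Mapping.keys G"
    using keys_add[of F G] by auto
  then show "Poly_Mapping.keys \<mu> \<subseteq> {..<length a}" "(\<Sum>i<length a. a ! i * Poly_Mapping.lookup \<mu> i) = d"
    using assms by (auto simp: wform_def)
  show "Poly_Mapping.lookup (F + G) \<mu> \<in> k"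
    unfolding lookup_add using assms zero by (intro add) (auto simp: wform_def in_keys_iff)
qed

lemma wform_sum: "(\<And>i. i \<in> I \<Longrightarrow> wform k a d (F i)) \<Longrightarrow> wform k a d (\<Sum>i\<in>I. F i)"
  by (induction I rule: infinite_finite_induct) (auto intro: wform_add)

lemma wform_mult:
  assumes "wform k a d F" "wform k a e G"
  shows "wform k a (d + e) (F * G)"
proof -
  have *: "wform k a (d + e) (Poly_Mapping.single \<mu> (Poly_Mapping.lookup F \<mu>) *
      Poly_Mapping.single \<nu> (Poly_Mapping.lookup G \<nu>))"
    if "\<mu> \<in> Poly_Mapping.keys F" "\<nu> \<in> Poly_Mapping.keys G" for \<mu> \<nu>
  proof -
    have "Poly_Mapping.keys (\<mu> + \<nu>) \<subseteq> {..<length a}"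
      using keys_add[of \<mu> \<nu>] that assms by (fastforce simp: wform_def)
    moreover have "Poly_Mapping.lookup F \<mu> * Poly_Mapping.lookup G \<nu> \<in> k"
      using that assms by (intro mult) (auto simp: wform_def)
    moreover have "(\<Sum>i<length a. a ! i * Poly_Mapping.lookup (\<mu> + \<nu>) i) = d + e"
      using that assms by (simp add: wform_def lookup_add distrib_left sum.distrib)
    ultimately show ?thesis
      by (simp add: wform_def mult_single)
  qed
  have "F * G = (\<Sum>\<mu>\<in>Poly_Mapping.keys F. \<Sum>\<nu>\<in>Poly_Mapping.keys G.
      Poly_Mapping.single \<mu> (Poly_Mapping.lookup F \<mu>) * Poly_Mapping.single \<nu> (Poly_Mapping.lookup G \<nu>))"
    unfolding sum_product[symmetric] by (rule arg_cong2[OF mpol_expand mpol_expand])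
  then show ?thesis by (auto intro!: wform_sum *)
qed

lemma wform_power: "wform k a d F \<Longrightarrow> wform k a (n * d) (F ^ n)"
proof (induction n)
  case 0
  then show ?case using wform_mconst[OF one, of a] by (simp add: mconst_def)
qed (auto intro: wform_mult)

lemma wform_uminus: "wform k a d F \<Longrightarrow> wform k a d (- F)"
proof -
  assume F: "wform k a d F"
  have "mconst (-1) = -1" unfolding mconst_def single_uminus by simp
  then show ?thesis using wform_mult[OF wform_mconst[OF minus_one] F] by simp
qed

lemma wform_diff: "wform k a d F \<Longrightarrow> wform k a d G \<Longrightarrow> wform k a d (F - G)"
  using wform_add[OF _ wform_uminus, of a d F G] by simp

lemma polyf_mp_eval:
  assumes "\<And>\<mu>. \<mu> \<in> Poly_Mapping.keys F \<Longrightarrow> Poly_Mapping.lookup F \<mu> \<in> k"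
    and "\<And>i. i < l \<Longrightarrow> polyf k n (\<sigma> i)"
  shows "polyf k n (\<lambda>u. mp_eval (map (\<lambda>i. \<sigma> i u) [0..<l]) F)"
proof -
  have "polyf k n (\<lambda>u. \<Sum>\<mu>\<in>Poly_Mapping.keys F. Poly_Mapping.lookup F \<mu> *
      (\<Prod>i<l. \<sigma> i u ^ Poly_Mapping.lookup \<mu> i))"
    using assms
    by (intro polyf_sum[OF zero] polyf_mult polyf_const polyf_prod[OF one] polyf_power[OF one])
      (auto simp: assms)
  moreover have "(\<Prod>i<l. map (\<lambda>i. \<sigma> i u) [0..<l] ! i ^ Poly_Mapping.lookup \<mu> i) =
      (\<Prod>i<l. \<sigma> i u ^ Poly_Mapping.lookup \<mu> i)" for u \<mu>
    by (rule prod.cong) auto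
  ultimately show ?thesis by (simp add: mp_eval_def)
qed

lemma polyf_wform:
  "wform k a d F \<Longrightarrow> (\<And>i. i < l \<Longrightarrow> polyf k n (\<sigma> i)) \<Longrightarrow> polyf k n (\<lambda>u. mp_eval (map (\<lambda>i. \<sigma> i u) [0..<l]) F)"
  by (rule polyf_mp_eval) (auto simp: wform_def)

end

interpretation rats: coeff_ring \<rat>
  by unfold_locales auto

interpretation cplx: coeff_ring UNIV
  by unfold_locales auto

lemma mp_eval_weighted:
  assumes "wform k a d F" "length v = length a"
  shows "mp_eval (map (\<lambda>i. c ^ (a ! i) * v ! i) [0..<length a]) F = c ^ d * mp_eval v F"
proof -
  have "(\<Prod>i<length a. map (\<lambda>i. c ^ (a ! i) * v ! i) [0..<length a] ! i ^ Poly_Mapping.lookup \<mu> i)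
      = c ^ d * (\<Prod>i<length a. v ! i ^ Poly_Mapping.lookup \<mu> i)" if "\<mu> \<in> Poly_Mapping.keys F" for \<mu>
  proof -
    have "(\<Prod>i<length a. map (\<lambda>i. c ^ (a ! i) * v ! i) [0..<length a] ! i ^ Poly_Mapping.lookup \<mu> i)
       = (\<Prod>i<length a. c ^ (a ! i * Poly_Mapping.lookup \<mu> i) * v ! i ^ Poly_Mapping.lookup \<mu> i)"
      by (rule prod.cong) (auto simp: power_mult_distrib power_mult)
    also have "\<dots> = c ^ (\<Sum>i<length a. a ! i * Poly_Mapping.lookup \<mu> i) *
        (\<Prod>i<length a. v ! i ^ Poly_Mapping.lookup \<mu> i)"
      by (simp add: prod.distrib power_sum)
    also have "(\<Sum>i<length a. a ! i * Poly_Mapping.lookup \<mu> i) = d"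
      using assms that by (auto simp: wform_def)
    finally show ?thesis .
  qed
  then show ?thesis
    using assms(2) by (simp add: mp_eval_def sum_distrib_left mult_ac)
qed

lemma mp_eval_scale:
  assumes "wform k (replicate l 1) d F" "length v = l"
  shows "mp_eval (map ((*) c) v) F = c ^ d * mp_eval v F"
proof -
  have "map ((*) c) v = map (\<lambda>i. c ^ (replicate l 1 ! i) * v ! i) [0..<l]"
    using assms(2) by (intro nth_equalityI) auto
  then show ?thesis using mp_eval_weighted[OF assms(1), of v c] assms(2) by simp
qed

lemma DERIV_mp_eval:
  assumes "i < length v"
  shows "((\<lambda>z. mp_eval (v[i := z]) F) has_field_derivative mp_eval v (mp_deriv i F)) (at (v ! i))"
proof -
  have *: "((\<lambda>z. \<Prod>j<length v. v[i := z] ! j ^ Poly_Mapping.lookup \<mu> j) has_field_derivative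
     of_nat (Poly_Mapping.lookup \<mu> i) *
       (\<Prod>j<length v. v ! j ^ Poly_Mapping.lookup (\<mu> - Poly_Mapping.single i 1) j)) (at (v ! i))" for \<mu>
  proof -
    let ?P = "\<Prod>j\<in>{..<length v} - {i}. v ! j ^ Poly_Mapping.lookup \<mu> j"
    have 1: "(\<Prod>j<length v. v[i := z] ! j ^ Poly_Mapping.lookup \<mu> j) = z ^ Poly_Mapping.lookup \<mu> i * ?P" for z
    proof -
      have "(\<Prod>j\<in>{..<length v} - {i}. v[i := z] ! j ^ Poly_Mapping.lookup \<mu> j) = ?P"
        by (rule prod.cong) auto
      then show ?thesis using assms by (subst prod.remove[of _ i]) auto
    qed
    \<comment> \<open>For exponent 0 the truncated subtraction leaves the exponent at 0, and the
      factor \<open>of_nat 0\<close> in front removes the term.\<close>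
    have 2: "(\<Prod>j<length v. v ! j ^ Poly_Mapping.lookup (\<mu> - Poly_Mapping.single i 1) j)
        = v ! i ^ (Poly_Mapping.lookup \<mu> i - 1) * ?P"
    proof -
      have "(\<Prod>j\<in>{..<length v} - {i}. v ! j ^ Poly_Mapping.lookup (\<mu> - Poly_Mapping.single i 1) j) = ?P"
        by (rule prod.cong) (auto simp: lookup_minus lookup_single)
      then show ?thesis using assms by (subst prod.remove[of _ i]) (auto simp: lookup_minus)
    qed
    show ?thesis
      unfolding 1 2 by (auto intro!: derivative_eq_intros simp: mult_ac)
  qed
  have "((\<lambda>z. \<Sum>\<mu>\<in>Poly_Mapping.keys F. Poly_Mapping.lookup F \<mu> *
        (\<Prod>j<length v. v[i := z] ! j ^ Poly_Mapping.lookup \<mu> j)) has_field_derivative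
      (\<Sum>\<mu>\<in>Poly_Mapping.keys F. Poly_Mapping.lookup F \<mu> * (of_nat (Poly_Mapping.lookup \<mu> i) *
       (\<Prod>j<length v. v ! j ^ Poly_Mapping.lookup (\<mu> - Poly_Mapping.single i 1) j)))) (at (v ! i))"
    by (intro DERIV_sum DERIV_cmult *)
  moreover have "mp_eval v (mp_deriv i F) =
      (\<Sum>\<mu>\<in>Poly_Mapping.keys F. Poly_Mapping.lookup F \<mu> * (of_nat (Poly_Mapping.lookup \<mu> i) *
       (\<Prod>j<length v. v ! j ^ Poly_Mapping.lookup (\<mu> - Poly_Mapping.single i 1) j)))"
    unfolding mp_deriv_def mp_eval_sum mp_eval_single by (rule sum.cong) simp_all
  moreover have "mp_eval (v[i := z]) F = (\<Sum>\<mu>\<in>Poly_Mapping.keys F. Poly_Mapping.lookup F \<mu> *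
        (\<Prod>j<length v. v[i := z] ! j ^ Poly_Mapping.lookup \<mu> j))" for z
    by (simp only: mp_eval_def length_list_update)
  ultimately show ?thesis by (simp only:)
qed

text \<open>Formal partial derivatives can thus be computed by differentiating the evaluated
  expression with the analytic rules.\<close>

lemma mp_deriv_eval_eq:
  assumes "i < length v" "((\<lambda>z. mp_eval (v[i := z]) F) has_field_derivative d) (at (v ! i))"
  shows "mp_eval v (mp_deriv i F) = d"
  using DERIV_unique[OF DERIV_mp_eval[OF assms(1)] assms(2)] .

section \<open>Subspaces of the complex numbers over the rationals\<close>

lemma CC_simps [simp]:
  "carrier CC = UNIV" "x \<otimes>\<^bsub>CC\<^esub> y = x * y" "x \<oplus>\<^bsub>CC\<^esub> y = x + y" "\<one>\<^bsub>CC\<^esub> = 1" "\<zero>\<^bsub>CC\<^esub> = 0"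
  by (simp_all add: ring_of_type_algebra_def)

interpretation CC: cring CC
  by (rule cring_from_type_algebra)

lemma CC_uminus [simp]: "\<ominus>\<^bsub>CC\<^esub> x = - x"
  using CC.add.inv_equality[of "- x" x] by (simp add: a_inv_def)

lemma CC_inv: "x \<noteq> 0 \<Longrightarrow> inv\<^bsub>CC\<^esub> x = inverse x"
  using CC.comm_inv_char[of x "inverse x"] by simp

lemma subfield_Rats: "subfield \<rat> CC"
proof (rule field.subfieldI'[OF field_from_type_algebra])
  show "subring \<rat> CC" by (rule CC.subringI) auto
  show "inv\<^bsub>CC\<^esub> x \<in> \<rat>" if "x \<in> \<rat> - {\<zero>\<^bsub>CC\<^esub>}" for x
    using that by (simp add: CC_inv)
qed

lemma CC_line_extension: "CC.line_extension K v E = {c * v + e | c e. c \<in> K \<and> e \<in> E}"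
  by (auto simp: CC.line_extension_def set_add_def' r_coset_def set_mult_def)

lemma number_field_Rats: "number_field \<rat>"
  unfolding number_field_def CC.finite_dimension_def
  using subfield_Rats CC.dimension_one[OF subfield_Rats] by blast

lemma dimension_quadratic:
  assumes "z \<notin> \<rat>"
  shows "CC.dimension 2 \<rat> {p + q * z | p q. p \<in> \<rat> \<and> q \<in> \<rat>}"
proof -
  have "CC.dimension (Suc 1) \<rat> (CC.line_extension \<rat> z \<rat>)"
    by (rule CC.Suc_dim) (use assms CC.dimension_one[OF subfield_Rats] in auto)
  also have "CC.line_extension \<rat> z \<rat> = {p + q * z | p q. p \<in> \<rat> \<and> q \<in> \<rat>}"
    unfolding CC_line_extension by (auto simp: add.commute)
  finally show ?thesis by (simp add: numeral_2_eq_2)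
qed

interpretation QV: vector_space "\<lambda>(r::rat) (z::complex). of_rat r * z"
  by unfold_locales (auto simp: algebra_simps of_rat_add of_rat_mult)

lemma QV_subspaceI:
  "0 \<in> V \<Longrightarrow> (\<And>x y. x \<in> V \<Longrightarrow> y \<in> V \<Longrightarrow> x + y \<in> V) \<Longrightarrow> (\<And>c x. c \<in> \<rat> \<Longrightarrow> x \<in> V \<Longrightarrow> c * x \<in> V)
   \<Longrightarrow> QV.subspace V"
  by (rule QV.subspaceI) auto

text \<open>Bridge between the two theories of dimension: each element of an independent set lies
  outside the span of the earlier ones, so adding it is one line extension.\<close>

lemma dimension_span:
  assumes "finite B" "QV.independent B"
  shows "CC.dimension (card B) \<rat> (QV.span B)"
  using assms
proof (induction B rule: finite_induct)
  case empty
  show ?case using CC.zero_dim[of \<rat>] by simp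
next
  case (insert b B)
  then have b: "b \<notin> QV.span B" and "QV.independent B"
    by (auto simp: QV.independent_insert split: if_splits)
  then have "CC.dimension (Suc (card B)) \<rat> (CC.line_extension \<rat> b (QV.span B))"
    using insert by (intro CC.Suc_dim) auto
  also have "CC.line_extension \<rat> b (QV.span B) = QV.span (insert b B)"
  proof (intro Set.set_eqI iffI)
    fix x assume "x \<in> CC.line_extension \<rat> b (QV.span B)"
    then obtain c e where x: "x = of_rat c * b + e" "e \<in> QV.span B"
      by (auto simp: CC_line_extension elim!: Rats_cases)
    then show "x \<in> QV.span (insert b B)"
      by (auto simp: QV.span_insert intro!: exI[of _ c])
  next
    fix x assume "x \<in> QV.span (insert b B)"
    then obtain c where "x - of_rat c * b \<in> QV.span B"
      by (auto simp: QV.span_insert)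
    then show "x \<in> CC.line_extension \<rat> b (QV.span B)"
      unfolding CC_line_extension
      by (intro CollectI exI[of _ "of_rat c"] exI[of _ "x - of_rat c * b"]) auto
  qed
  finally show ?case using insert by simp
qed

text \<open>No basis has to be known. The bound on independent sets makes a maximal one finite, and
  any independent set bounds the dimension from below.\<close>

lemma dimension_between:
  assumes V: "QV.subspace V"
    and upper: "\<And>S. finite S \<Longrightarrow> S \<subseteq> V \<Longrightarrow> QV.independent S \<Longrightarrow> card S \<le> D"
    and lower: "finite S0" "S0 \<subseteq> V" "QV.independent S0"
  shows "\<exists>d. CC.dimension d \<rat> V \<and> card S0 \<le> d \<and> d \<le> D"
proof -
  obtain B where B: "B \<subseteq> V" "QV.independent B" "V \<subseteq> QV.span B"
    using QV.maximal_independent_subset[of V] by blast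
  have fin: "finite B"
  proof (rule ccontr)
    assume "infinite B"
    then obtain S where "finite S" "S \<subseteq> B" "card S = Suc D"
      using infinite_arbitrarily_large by blast
    then show False using upper[of S] B QV.independent_mono[of B S] by auto
  qed
  have "QV.span B = V"
    using B V QV.span_minimal[of B V] by blast
  moreover have "card S0 \<le> card B"
    using QV.independent_span_bound[OF fin lower(3)] lower(2) B(3) by auto
  ultimately show ?thesis
    using dimension_span[OF fin B(2)] upper[OF fin B(1,2)] by auto
qed

text \<open>Used for a change of basis of the derivations, which multiplies the space of sections by
  a nonzero function.\<close>

lemma dimension_scale:
  assumes "CC.dimension d \<rat> V" "c \<noteq> 0"
  shows "CC.dimension d \<rat> ((*) c ` V)"
proof -
  have "CC.dimension d K ((*) c ` V)" if "CC.dimension d K V" for K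
    using that
  proof (induction rule: CC.dimension.induct)
    case (zero_dim K)
    show ?case using CC.zero_dim[of K] by simp
  next
    case (Suc_dim v E n K)
    have "(*) c ` CC.line_extension K v E = CC.line_extension K (c * v) ((*) c ` E)"
    proof (intro Set.set_eqI iffI)
      fix x assume "x \<in> (*) c ` CC.line_extension K v E"
      then obtain r e where "x = c * (r * v + e)" "r \<in> K" "e \<in> E" by (auto simp: CC_line_extension)
      then show "x \<in> CC.line_extension K (c * v) ((*) c ` E)"
        unfolding CC_line_extension
        by (intro CollectI exI[of _ r] exI[of _ "c * e"]) (auto simp: algebra_simps)
    next
      fix x assume "x \<in> CC.line_extension K (c * v) ((*) c ` E)"
      then obtain r e where "x = r * (c * v) + c * e" "r \<in> K" "e \<in> E" by (auto simp: CC_line_extension)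
      then show "x \<in> (*) c ` CC.line_extension K v E"
        unfolding CC_line_extension
        by (intro image_eqI[of _ _ "r * v + e"]) (auto simp: algebra_simps)
    qed
    moreover have "c * v \<notin> (*) c ` E" using Suc_dim(2) assms(2) by auto
    ultimately show ?case using CC.Suc_dim[of "c * v" "(*) c ` E" n K] Suc_dim by simp
  qed
  then show ?thesis using assms by blast
qed

text \<open>Gaussian elimination by induction on the set of equations: an unknown \<open>y\<close>
  with nonzero coefficient in equation \<open>i\<close> is eliminated from the others.\<close>

lemma homogeneous_system_solution:
  fixes A :: "'a \<Rightarrow> 'b \<Rightarrow> 'c::field"
  assumes "finite S" "finite I" "card I < card S"
  shows "\<exists>c. (\<exists>x\<in>S. c x \<noteq> 0) \<and> (\<forall>i\<in>I. (\<Sum>x\<in>S. c x * A x i) = 0)"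
  using assms(2,1,3)
proof (induction I arbitrary: S A rule: finite_induct)
  case empty
  then obtain x where "x \<in> S" by fastforce
  then show ?case by (intro exI[of _ "\<lambda>_. 1"]) auto
next
  case (insert i I)
  show ?case
  proof (cases "\<forall>x\<in>S. A x i = 0")
    case True
    have "card I < card S" using insert by simp
    then obtain c where "\<exists>x\<in>S. c x \<noteq> 0" "\<forall>i\<in>I. (\<Sum>x\<in>S. c x * A x i) = 0"
      using insert.IH[of S A] insert.prems by blast
    then show ?thesis using True by (intro exI[of _ c]) auto
  next
    case False
    then obtain y where y: "y \<in> S" "A y i \<noteq> 0" by auto
    define A' where "A' x j = A x j - A x i / A y i * A y j" for x j
    have "card I < card (S - {y})" using insert y by (simp add: card_Diff_singleton)
    then obtain c where c: "\<exists>x\<in>S - {y}. c x \<noteq> 0" "\<forall>j\<in>I. (\<Sum>x\<in>S - {y}. c x * A' x j) = 0"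
      using insert.IH[of "S - {y}" A'] insert.prems by blast
    \<comment> \<open>The value at the pivot \<open>y\<close> is forced by equation
      \<open>i\<close>.\<close>
    define d where "d = c(y := - (\<Sum>x\<in>S - {y}. c x * (A x i / A y i)))"
    have *: "(\<Sum>x\<in>S. d x * A x j) = (\<Sum>x\<in>S - {y}. c x * A' x j)" for j
    proof -
      have "(\<Sum>x\<in>S. d x * A x j) = d y * A y j + (\<Sum>x\<in>S - {y}. d x * A x j)"
        using y insert.prems by (simp add: sum.remove)
      also have "(\<Sum>x\<in>S - {y}. d x * A x j) = (\<Sum>x\<in>S - {y}. c x * A x j)"
        by (rule sum.cong) (auto simp: d_def)
      finally show ?thesis
        by (simp add: d_def A'_def right_diff_distrib sum_subtractf sum_distrib_right mult.assoc)
    qed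
    have "(\<Sum>x\<in>S - {y}. c x * A' x i) = 0"
      using y by (simp add: A'_def)
    then show ?thesis
      using c * by (intro exI[of _ d]) (auto simp: d_def)
  qed
qed

section \<open>Residue fields\<close>

lemma (in coeff_ring) res_field_const:
  "c \<in> k \<Longrightarrow> c \<in> res_field k a v"
  unfolding res_field_def
  by (intro CollectI exI[of _ "mconst c"] exI[of _ "mconst 1"] exI[of _ 0]) (auto intro!: wform_mconst one)

lemma (in coeff_ring) res_field_add:
  assumes "x \<in> res_field k a v" "y \<in> res_field k a v"
  shows "x + y \<in> res_field k a v"
proof -
  obtain F G d where x: "x = mp_eval v F / mp_eval v G" "wform k a d F" "wform k a d G" "mp_eval v G \<noteq> 0"
    using assms(1) by (auto simp: res_field_def)
  obtain F' G' e where y: "y = mp_eval v F' / mp_eval v G'" "wform k a e F'" "wform k a e G'" "mp_eval v G' \<noteq> 0"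
    using assms(2) by (auto simp: res_field_def)
  have "wform k a (d + e) (F * G' + F' * G)" "wform k a (d + e) (G * G')"
    using wform_mult[OF y(2) x(3)] by (auto intro!: wform_add wform_mult x y simp: add.commute)
  then show ?thesis
    unfolding res_field_def using x y
    by (intro CollectI exI[of _ "F * G' + F' * G"] exI[of _ "G * G'"] exI[of _ "d + e"]) (auto simp: field_simps)
qed

lemma (in coeff_ring) res_field_mult:
  assumes "x \<in> res_field k a v" "y \<in> res_field k a v"
  shows "x * y \<in> res_field k a v"
proof -
  obtain F G d where x: "x = mp_eval v F / mp_eval v G" "wform k a d F" "wform k a d G" "mp_eval v G \<noteq> 0"
    using assms(1) by (auto simp: res_field_def)
  obtain F' G' e where y: "y = mp_eval v F' / mp_eval v G'" "wform k a e F'" "wform k a e G'" "mp_eval v G' \<noteq> 0"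
    using assms(2) by (auto simp: res_field_def)
  show ?thesis
    unfolding res_field_def using x y
    by (intro CollectI exI[of _ "F * F'"] exI[of _ "G * G'"] exI[of _ "d + e"]) (auto intro: wform_mult)
qed

lemma (in coeff_ring) res_field_divide:
  assumes "x \<in> res_field k a v" "y \<in> res_field k a v"
  shows "x / y \<in> res_field k a v"
proof (cases "y = 0")
  case False
  obtain F G d where y: "y = mp_eval v F / mp_eval v G" "wform k a d F" "wform k a d G" "mp_eval v G \<noteq> 0"
    using assms(2) by (auto simp: res_field_def)
  then have "inverse y \<in> res_field k a v"
    unfolding res_field_def using False
    by (intro CollectI exI[of _ G] exI[of _ F] exI[of _ d]) auto
  then show ?thesis using res_field_mult[OF assms(1)] by (simp add: divide_inverse)
qed (use res_field_const[OF zero] in auto)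

text \<open>Dehomogenisation: at a vector with first coordinate 1 of weight 1, the degree 0 fraction
  of variable i by a power of variable 0 has the coordinate itself as value.\<close>

lemma (in coeff_ring) res_field_nth:
  assumes "i < length v" "length a = length v" "v ! 0 = 1" "a ! 0 = 1"
  shows "v ! i \<in> res_field k a v"
proof -
  have "wform k a 1 (mvar 0)"
    using assms wform_mvar[OF one, of 0 a] by fastforce
  from wform_power[OF this, of "a ! i"] have "wform k a (a ! i) (mvar 0 ^ (a ! i))" by simp
  moreover have "wform k a (a ! i) (mvar i)" using assms by (intro wform_mvar one) simp
  moreover have "0 < length v" using assms(1) by (cases v) auto
  ultimately show ?thesis
    unfolding res_field_def using assms
    by (intro CollectI exI[of _ "mvar i"] exI[of _ "mvar 0 ^ (a ! i)"] exI[of _ "a ! i"]) auto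
qed

lemma mp_eval_closed:
  assumes "wform k a d F" "k \<subseteq> L" "set v \<subseteq> L" "0 \<in> L" "1 \<in> L"
    and "\<And>x y. x \<in> L \<Longrightarrow> y \<in> L \<Longrightarrow> x + y \<in> L" "\<And>x y. x \<in> L \<Longrightarrow> y \<in> L \<Longrightarrow> x * y \<in> L"
  shows "mp_eval v F \<in> L"
proof -
  have sumL: "(\<And>i. i \<in> I \<Longrightarrow> f i \<in> L) \<Longrightarrow> sum f I \<in> L" for I :: "(nat \<Rightarrow>\<^sub>0 nat) set" and f
    by (induction I rule: infinite_finite_induct) (auto intro: assms)
  have prodL: "(\<And>i. i \<in> I \<Longrightarrow> f i \<in> L) \<Longrightarrow> prod f I \<in> L" for I :: "nat set" and f
    by (induction I rule: infinite_finite_induct) (auto intro: assms)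
  have powL: "x \<in> L \<Longrightarrow> x ^ n \<in> L" for x n
    by (induction n) (auto intro: assms)
  show ?thesis
    unfolding mp_eval_def
    by (intro sumL assms(7) prodL powL) (use assms in \<open>auto simp: wform_def\<close>)
qed

lemma res_field_subset:
  assumes "k \<subseteq> L" "set v \<subseteq> L" "0 \<in> L" "1 \<in> L"
    and "\<And>x y. x \<in> L \<Longrightarrow> y \<in> L \<Longrightarrow> x + y \<in> L" "\<And>x y. x \<in> L \<Longrightarrow> y \<in> L \<Longrightarrow> x * y \<in> L"
    and "\<And>x y. x \<in> L \<Longrightarrow> y \<in> L \<Longrightarrow> x / y \<in> L"
  shows "res_field k a v \<subseteq> L"
  unfolding res_field_def using mp_eval_closed[OF _ assms(1-6)] assms(7) by blast

lemma quadratic_field_closed: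
  fixes z :: complex
  assumes t: "z\<^sup>2 = t" "t \<in> \<rat>"
  defines "L \<equiv> {p + q * z | p q. p \<in> \<rat> \<and> q \<in> \<rat>}"
  shows "x \<in> L \<Longrightarrow> y \<in> L \<Longrightarrow> x + y \<in> L" "x \<in> L \<Longrightarrow> y \<in> L \<Longrightarrow> x * y \<in> L"
    "z \<notin> \<rat> \<Longrightarrow> x \<in> L \<Longrightarrow> y \<in> L \<Longrightarrow> x / y \<in> L"
proof -
  show "x + y \<in> L" if "x \<in> L" "y \<in> L"
  proof -
    from that obtain p q p' q' where "x = p + q * z" "y = p' + q' * z" "{p, q, p', q'} \<subseteq> \<rat>"
      by (auto simp: L_def)
    then show ?thesis unfolding L_def
      by (intro CollectI exI[of _ "p + p'"] exI[of _ "q + q'"]) (auto simp: algebra_simps)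
  qed
  show mult: "x * y \<in> L" if "x \<in> L" "y \<in> L" for x y
  proof -
    from that obtain p q p' q' where "x = p + q * z" "y = p' + q' * z" "{p, q, p', q'} \<subseteq> \<rat>"
      by (auto simp: L_def)
    moreover have "(p + q * z) * (p' + q' * z) = (p * p' + q * q' * t) + (p * q' + q * p') * z"
      unfolding t(1)[symmetric] by (simp add: algebra_simps power2_eq_square)
    ultimately show ?thesis unfolding L_def using t(2)
      by (intro CollectI exI[of _ "p * p' + q * q' * t"] exI[of _ "p * q' + q * p'"]) auto
  qed
  show "x / y \<in> L" if z: "z \<notin> \<rat>" and "x \<in> L" "y \<in> L"
  proof -
    from that obtain p q where y: "y = p + q * z" "p \<in> \<rat>" "q \<in> \<rat>" by (auto simp: L_def)
    have "inverse y \<in> L"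
    proof (cases "y = 0")
      case True
      then show ?thesis by (auto simp: L_def intro!: exI[of _ 0])
    next
      case False
      have nz: "p - q * z \<noteq> 0"
      proof
        assume *: "p - q * z = 0"
        then have "q \<noteq> 0" using False y by auto
        then have "z = p / q" using * by (simp add: field_simps)
        then show False using y z by simp
      qed
      \<comment> \<open>The norm of \<open>y\<close>, which is nonzero because \<open>z\<close> is
        irrational; the conjugate divided by it is the inverse.\<close>
      define N where "N = p\<^sup>2 - q\<^sup>2 * t"
      have N: "N = y * (p - q * z)" by (simp add: N_def y algebra_simps power2_eq_square flip: t(1))
      then have "N \<noteq> 0" using False nz by simp
      have "inverse y = (p - q * z) / N"
        using False nz unfolding N by (simp add: field_simps)
      also have "\<dots> = p / N + (- q / N) * z" using \<open>N \<noteq> 0\<close> by (simp add: field_simps)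
      finally show ?thesis
        unfolding L_def using y t(2)
        by (intro CollectI exI[of _ "p / N"] exI[of _ "- q / N"]) (auto simp: N_def)
    qed
    then show ?thesis using mult[OF that(2)] by (simp add: divide_inverse)
  qed
qed

lemma res_field_quadratic:
  assumes "z\<^sup>2 = t" "t \<in> \<rat>" "z \<notin> \<rat>" "length a = length v" "v ! 0 = 1" "a ! 0 = 1"
    and "z \<in> set v" "\<And>c. c \<in> set v \<Longrightarrow> c \<in> \<rat> \<or> c = z"
  shows "res_field \<rat> a v = {p + q * z | p q. p \<in> \<rat> \<and> q \<in> \<rat>}" (is "_ = ?L")
proof
  have R: "\<rat> \<subseteq> ?L"
  proof
    fix x :: complex assume "x \<in> \<rat>"
    then show "x \<in> ?L" by (intro CollectI exI[of _ x] exI[of _ 0]) auto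
  qed
  show "res_field \<rat> a v \<subseteq> ?L"
  proof (rule res_field_subset)
    have "z \<in> ?L" by (intro CollectI exI[of _ 0] exI[of _ 1]) auto
    then show "set v \<subseteq> ?L" using assms(8) R by blast
    show "0 \<in> ?L" "1 \<in> ?L" using R by (meson Rats_0 Rats_1 subsetD)+
    show "x + y \<in> ?L" "x * y \<in> ?L" "x / y \<in> ?L" if "x \<in> ?L" "y \<in> ?L" for x y
      by (rule quadratic_field_closed[OF assms(1,2)] that assms(3))+
  qed (rule R)
  show "?L \<subseteq> res_field \<rat> a v"
  proof
    fix x assume "x \<in> ?L"
    then obtain p q where x: "x = p + q * z" "p \<in> \<rat>" "q \<in> \<rat>" by auto
    obtain i where "i < length v" "z = v ! i" using assms(7) by (metis in_set_conv_nth)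
    then have "z \<in> res_field \<rat> a v" using rats.res_field_nth assms by blast
    then show "x \<in> res_field \<rat> a v"
      unfolding x(1) using rats.res_field_const x(2,3) by (blast intro: rats.res_field_add rats.res_field_mult)
  qed
qed

section \<open>Density of quadratic points\<close>

lemma pt_weighted:
  assumes "length v = length a" "c \<noteq> 0"
  shows "pt k a (map (\<lambda>i. c ^ (a ! i) * v ! i) [0..<length a]) = pt k a v"
  unfolding pt_def using mp_eval_weighted[OF _ assms(1)] assms(2) by fastforce

text \<open>The sets that generate the topology form a base and not only a subbase: the intersection
  of the sets of F and G is that of F G, since the points are prime ideals.\<close>

lemma zariski_basis:
  assumes "openin (zariski k a S) U" "x \<in> U" "S \<subseteq> range (pt k a)" "coeff_ring k"
  shows "\<exists>F d. wform k a d F \<and> F \<notin> x \<and> {y \<in> S. F \<notin> y} \<subseteq> U"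
proof -
  interpret coeff_ring k by fact
  have "generate_topology_on ((\<lambda>F. {x \<in> S. F \<notin> x}) ` {F. \<exists>d. wform k a d F}) U"
    using assms(1) unfolding zariski_def openin_topology_generated_by_iff .
  then have "x \<in> S \<and> (\<exists>F d. wform k a d F \<and> F \<notin> x \<and> {y \<in> S. F \<notin> y} \<subseteq> U)"
    using assms(2)
  proof (induction arbitrary: x rule: generate_topology_on.induct)
    case (Int U V)
    from Int.prems have "x \<in> U" "x \<in> V" by auto
    from Int.IH(1)[OF this(1)] obtain F d where
      F: "wform k a d F" "F \<notin> x" "{y \<in> S. F \<notin> y} \<subseteq> U" and "x \<in> S" by blast
    from Int.IH(2)[OF \<open>x \<in> V\<close>] obtain G e where
      G: "wform k a e G" "G \<notin> x" "{y \<in> S. G \<notin> y} \<subseteq> V" by blast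
    have iff: "F * G \<notin> y \<longleftrightarrow> F \<notin> y \<and> G \<notin> y" if "y \<in> S" for y
    proof -
      obtain v where "y = pt k a v" using \<open>y \<in> S\<close> assms(3) by auto
      then show ?thesis using wform_mult[OF F(1) G(1)] F(1) G(1) by (auto simp: pt_def)
    qed
    have "F * G \<notin> x" using iff[OF \<open>x \<in> S\<close>] F(2) G(2) by simp
    moreover have "{y \<in> S. F * G \<notin> y} \<subseteq> U \<inter> V" using iff F(3) G(3) by blast
    ultimately show ?case using wform_mult[OF F(1) G(1)] \<open>x \<in> S\<close> by blast
  next
    case (UN K)
    from UN.prems obtain V where V: "V \<in> K" "x \<in> V" by blast
    from UN.IH[OF this] show ?case using Union_upper[OF V(1)] by blast
  qed auto
  then show ?thesis by blast
qed

text \<open>Turns density into a statement about forms: a basic open set that misses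
  \<open>Q\<close> is given by a form that vanishes on \<open>Q\<close>.\<close>

lemma closure_of_zariski:
  assumes "subfield k CC" "coeff_ring k" "S \<subseteq> range (pt k a)" "Q \<subseteq> S"
    and vanish: "\<And>F d x. wform k a d F \<Longrightarrow> (\<And>y. y \<in> Q \<Longrightarrow> F \<in> y) \<Longrightarrow> x \<in> S \<Longrightarrow> F \<in> x"
  shows "zariski k a S closure_of Q = S"
proof
  have top: "topspace (zariski k a S) = S" using topspace_zariski assms by blast
  show "zariski k a S closure_of Q \<subseteq> S" using closure_of_subset_topspace top by metis
  show "S \<subseteq> zariski k a S closure_of Q"
  proof
    fix x assume x: "x \<in> S"
    have "\<exists>y\<in>Q. y \<in> U" if U: "x \<in> U" "openin (zariski k a S) U" for U
    proof -
      obtain F d where F: "wform k a d F" "F \<notin> x" "{y \<in> S. F \<notin> y} \<subseteq> U"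
        using zariski_basis[OF U(2,1) assms(3,2)] by blast
      then obtain y where "y \<in> Q" "F \<notin> y" using vanish[OF F(1)] x by blast
      then show ?thesis using F(3) assms(4) by blast
    qed
    then show "x \<in> zariski k a S closure_of Q"
      by (auto simp: in_closure_of top x)
  qed
qed

section \<open>Points and forms on the double cover in coordinates\<close>

lemma cover_vecs_4:
  "v \<in> cover_vecs f \<longleftrightarrow> (\<exists>x y z w. v = [x, y, z, w] \<and> (x \<noteq> 0 \<or> y \<noteq> 0 \<or> z \<noteq> 0 \<or> w \<noteq> 0) \<and>
     w\<^sup>2 = mp_eval [x, y, z] f)"
proof
  assume v: "v \<in> cover_vecs f"
  then have "length v = 4" by (simp add: cover_vecs_def nonzero_vecs_def)
  then obtain x y z w where "v = [x, y, z, w]"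
    by (auto simp: numeral_eq_Suc length_Suc_conv)
  then show "\<exists>x y z w. v = [x, y, z, w] \<and> (x \<noteq> 0 \<or> y \<noteq> 0 \<or> z \<noteq> 0 \<or> w \<noteq> 0) \<and> w\<^sup>2 = mp_eval [x, y, z] f"
    using v by (auto simp: cover_vecs_def nonzero_vecs_def cover_proj_def)
qed (auto simp: cover_vecs_def nonzero_vecs_def cover_proj_def)

text \<open>A triple as a coordinate sequence. The padding by 0 has no influence on polynomial
  functions in at most three variables.\<close>

definition as3 :: "complex \<Rightarrow> complex \<Rightarrow> complex \<Rightarrow> nat \<Rightarrow> complex" where
  "as3 x y z = (\<lambda>i. if i = 0 then x else if i = 1 then y else if i = 2 then z else 0)"

lemma as3_simps [simp]:
  "as3 x y z 0 = x" "as3 x y z 1 = y" "as3 x y z (Suc 0) = y" "as3 x y z 2 = z"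
  by (simp_all add: as3_def)

lemma as3_upd:
  "(as3 x y z)(0 := c) = as3 c y z" "(as3 x y z)(1 := c) = as3 x c z" "(as3 x y z)(2 := c) = as3 x y c"
  by (auto simp: as3_def)

lemma upt_4: "[0..<4] = [0, 1, 2, 3 :: nat]" and upt_3: "[0..<3] = [0, 1, 2 :: nat]"
  by (simp_all add: upt_rec)

text \<open>The restriction of a form to the cover is decomposed into its even and odd part under w
  -> -w.\<close>

lemma cover_form_split:
  assumes F: "wform \<rat> (cover_wts m) d F" and f: "wform \<rat> plane_wts e f"
  shows "\<exists>F0 F1. polyf \<rat> 3 F0 \<and> polyf \<rat> 3 F1 \<and>
    (\<forall>x y z w. w\<^sup>2 = mp_eval [x, y, z] f \<longrightarrow> mp_eval [x, y, z, w] F = F0 (as3 x y z) + F1 (as3 x y z) * w)"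
proof -
  have "polyf \<rat> (Suc 3) (\<lambda>u. mp_eval (map (\<lambda>i. u i) [0..<4]) F)"
    by (rule rats.polyf_wform[OF F]) (auto intro: polyf_var)
  moreover have "polyf \<rat> 3 (\<lambda>u. mp_eval (map (\<lambda>i. u i) [0..<3]) f)"
    by (rule rats.polyf_wform[OF f]) (auto intro: polyf_var)
  ultimately obtain F0 F1 where F01: "polyf \<rat> 3 F0" "polyf \<rat> 3 F1"
    "\<And>u. (u 3)\<^sup>2 = mp_eval (map (\<lambda>i. u i) [0..<3]) f \<Longrightarrow> mp_eval (map (\<lambda>i. u i) [0..<4]) F = F0 u + F1 u * u 3"
    using polyf_split[of \<rat> 3] by fastforce
  have "mp_eval [x, y, z, w] F = F0 (as3 x y z) + F1 (as3 x y z) * w" if "w\<^sup>2 = mp_eval [x, y, z] f" for x y z w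
  proof -
    define u where "u = (as3 x y z)(3 := w)"
    have u: "u 0 = x" "u 1 = y" "u (Suc 0) = y" "u 2 = z" "u 3 = w" by (simp_all add: u_def)
    have "F0 u = F0 (as3 x y z)" "F1 u = F1 (as3 x y z)"
      by (rule polyf_cong_vars[OF F01(1)] polyf_cong_vars[OF F01(2)], simp add: u_def)+
    then show ?thesis using F01(3)[of u] that by (simp add: u upt_3 upt_4)
  qed
  with F01(1,2) show ?thesis by blast
qed

text \<open>The chart x = 1 is dense in the cover. Weighted scaling takes care of x \<noteq> 0, and
  polynomial dependence on x carries the vanishing over to x = 0.\<close>

lemma cover_vanishI:
  assumes F: "wform \<rat> (cover_wts m) d F" and f: "wform \<rat> plane_wts (2 * m) f"
    and affine: "\<And>y z w. w\<^sup>2 = mp_eval [1, y, z] f \<Longrightarrow> mp_eval [1, y, z, w] F = 0"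
    and v: "v \<in> cover_vecs f"
  shows "mp_eval v F = 0"
proof -
  obtain x y z w where v: "v = [x, y, z, w]" "w\<^sup>2 = mp_eval [x, y, z] f"
    using v by (auto simp: cover_vecs_4)
  have nz: "mp_eval [x, y, z, w] F = 0" if "x \<noteq> 0" "w\<^sup>2 = mp_eval [x, y, z] f" for x y z w
  proof -
    have "mp_eval [x, y, z] f = x ^ (2 * m) * mp_eval [1, y / x, z / x] f"
      using mp_eval_weighted[OF f, of "[1, y / x, z / x]" x] \<open>x \<noteq> 0\<close> by (simp add: upt_3)
    then have "(w / x ^ m)\<^sup>2 = mp_eval [1, y / x, z / x] f"
      using that by (simp add: power_divide power_mult[symmetric] mult.commute)
    then have "mp_eval [1, y / x, z / x, w / x ^ m] F = 0" by (rule affine)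
    then show ?thesis
      using mp_eval_weighted[OF F, of "[1, y / x, z / x, w / x ^ m]" x] \<open>x \<noteq> 0\<close> by (simp add: upt_4)
  qed
  obtain F0 F1 where F01: "polyf \<rat> 3 F0" "polyf \<rat> 3 F1"
    "\<And>x y z w. w\<^sup>2 = mp_eval [x, y, z] f \<Longrightarrow> mp_eval [x, y, z, w] F = F0 (as3 x y z) + F1 (as3 x y z) * w"
    using cover_form_split[OF F f] by metis
  \<comment> \<open>Both signs of the square root kill F0 and F1 w separately. As w is not
    polynomial in x, the second is recorded through F1^2 f = (F1 w)^2, which is.\<close>
  have zero: "F0 (as3 x y z) = 0" "F1 (as3 x y z) * F1 (as3 x y z) * mp_eval (map (as3 x y z) [0..<3]) f = 0"
    if "x \<noteq> 0" for x y z
  proof -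
    define w where "w = csqrt (mp_eval [x, y, z] f)"
    have w: "w\<^sup>2 = mp_eval [x, y, z] f" "(- w)\<^sup>2 = mp_eval [x, y, z] f" by (simp_all add: w_def)
    have "F0 (as3 x y z) + F1 (as3 x y z) * w = 0" "F0 (as3 x y z) + F1 (as3 x y z) * (- w) = 0"
      using nz[OF that w(1)] nz[OF that w(2)] F01(3)[OF w(1)] F01(3)[OF w(2)] by simp_all
    then have *: "F0 (as3 x y z) = 0" "F1 (as3 x y z) * w = 0" by (auto simp: add_eq_0_iff2)
    then show "F0 (as3 x y z) = 0" "F1 (as3 x y z) * F1 (as3 x y z) * mp_eval (map (as3 x y z) [0..<3]) f = 0"
      using w by (auto simp: upt_3)
  qed
  have inf: "infinite {c. P c}" if "\<And>c::complex. c \<noteq> 0 \<Longrightarrow> P c" for P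
  proof -
    have "infinite (UNIV - {0 :: complex})" by (simp add: infinite_UNIV_char_0)
    then show ?thesis using that by (elim infinite_super[rotated]) auto
  qed
  have "F0 ((as3 x y z)(0 := x)) = 0"
    by (rule polyf_slice_zero[OF F01(1)], rule inf) (simp add: as3_upd zero)
  moreover have "polyf \<rat> 3 (\<lambda>u. F1 u * F1 u * mp_eval (map (\<lambda>i. u i) [0..<3]) f)"
    by (intro polyf_mult F01 rats.polyf_wform[OF f] polyf_var)
  from polyf_slice_zero[OF this, of "as3 x y z" 0 x]
  have "F1 (as3 x y z) * F1 (as3 x y z) * mp_eval (map (as3 x y z) [0..<3]) f = 0"
    using inf[OF zero(2)] by (simp only: as3_upd simp_thms)
  then have "F1 (as3 x y z) * w = 0" using v(2) by (auto simp: upt_3)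
  ultimately show ?thesis using F01(3)[OF v(2)] v by (simp add: as3_upd)
qed

text \<open>Galois conjugation z -> -z: the value has the form p + q z with rational p and q, so it
  vanishes only if p = q = 0.\<close>

lemma mp_eval_conjugate:
  assumes F: "wform \<rat> (cover_wts m) d F" and "y \<in> \<rat>" "w \<in> \<rat>" "z\<^sup>2 \<in> \<rat>" "z \<notin> \<rat>"
    and zero: "mp_eval [1, y, z, w] F = 0"
  shows "mp_eval [1, y, - z, w] F = 0"
proof -
  define \<sigma> where "\<sigma> i = (if i = (0::nat) then (\<lambda>u::nat\<Rightarrow>complex. 1) else if i = 1 then (\<lambda>u. y)
    else if i = 2 then (\<lambda>u. u 0) else (\<lambda>u. w))" for i
  have \<sigma>: "map (\<lambda>i. \<sigma> i u) [0..<4] = [1, y, u 0, w]" for u by (simp add: \<sigma>_def upt_4)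
  have "polyf \<rat> (Suc 0) (\<lambda>u. mp_eval (map (\<lambda>i. \<sigma> i u) [0..<4]) F)"
    by (rule rats.polyf_wform[OF F]) (auto intro!: polyf.intros assms simp: \<sigma>_def)
  then have "polyf \<rat> (Suc 0) (\<lambda>u. mp_eval [1, y, u 0, w] F)" by (simp only: \<sigma>)
  from polyf_split[OF this polyf_const[OF assms(4)]]
  obtain A B where AB: "polyf \<rat> 0 A" "polyf \<rat> 0 B"
    "\<And>u. (u 0)\<^sup>2 = z\<^sup>2 \<Longrightarrow> mp_eval [1, y, u 0, w] F = A u + B u * u 0" by auto
  obtain p q where pq: "p \<in> \<rat>" "q \<in> \<rat>" "\<And>u. A u = p" "\<And>u. B u = q"
    using polyf_cong_vars[OF AB(1)] polyf_cong_vars[OF AB(2)] polyf_Rats[OF AB(1), of "\<lambda>_. 0"]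
      polyf_Rats[OF AB(2), of "\<lambda>_. 0"] by (metis not_less_zero)
  have "p + q * z = 0" using AB(3)[of "\<lambda>_. z"] zero by (simp add: pq)
  moreover have "q = 0"
  proof (rule ccontr)
    assume "q \<noteq> 0"
    then have "z = - p / q" using \<open>p + q * z = 0\<close> by (simp add: field_simps add_eq_0_iff2)
    then show False using assms(5) pq by auto
  qed
  ultimately show ?thesis using AB(3)[of "\<lambda>_. - z"] by (simp add: pq)
qed

text \<open>Both residue fields are generated by \<open>z\<close> over the rationals. The point is
  closed because three rational forms cut it out: the only other geometric solution is the
  conjugate, which is the same scheme point.\<close>

lemma quadratic_points_memI:
  assumes f: "wform \<rat> plane_wts (2 * m) f" and m: "m \<ge> 1"
    and y: "y \<in> \<rat>" and w: "w \<in> \<rat>" and z: "z\<^sup>2 \<in> \<rat>" "z \<notin> \<rat>" and eq: "w\<^sup>2 = mp_eval [1, y, z] f"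
  shows "pt \<rat> (cover_wts m) [1, y, z, w] \<in> quadratic_points \<rat> m f"
proof -
  let ?v = "[1, y, z, w]" and ?a = "cover_wts m"
  let ?S = "cover_points \<rat> m f"
  have v: "?v \<in> cover_vecs f" by (auto simp: cover_vecs_4 eq)
  have L: "res_field \<rat> ?a ?v = {p + q * z | p q. p \<in> \<rat> \<and> q \<in> \<rat>}"
    by (rule res_field_quadratic[OF refl z]) (use y w in auto)
  have L': "res_field \<rat> plane_wts (cover_proj ?v) = {p + q * z | p q. p \<in> \<rat> \<and> q \<in> \<rat>}"
    by (rule res_field_quadratic[OF refl z]) (use y w in \<open>auto simp: cover_proj_def\<close>)
  \<comment> \<open>The equations of the conjugate pair (1 : y : \<plusminus>z : w). The middle one
    involves only z^2, so all three have rational coefficients.\<close>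
  define F1 F2 F3 where F: "F1 = mvar 1 - mconst y * mvar 0" "F2 = mvar 2 ^ 2 - mconst (z\<^sup>2) * mvar 0 ^ 2"
    "F3 = mvar 3 - mconst w * mvar 0 ^ m"
  have wvar: "wform \<rat> ?a 1 (mvar 0)" "wform \<rat> ?a 1 (mvar 1)" "wform \<rat> ?a 1 (mvar 2)" "wform \<rat> ?a m (mvar 3)"
    using wform_mvar[OF Rats_1, of 0 ?a] wform_mvar[OF Rats_1, of 1 ?a] wform_mvar[OF Rats_1, of 2 ?a]
      wform_mvar[OF Rats_1, of 3 ?a] by simp_all
  have wF: "wform \<rat> ?a 1 F1" "wform \<rat> ?a 2 F2" "wform \<rat> ?a m F3"
    unfolding F using rats.wform_mult[OF wform_mconst wvar(1), of y]
      rats.wform_mult[OF wform_mconst rats.wform_power[OF wvar(1)], of "z\<^sup>2" 2]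
      rats.wform_mult[OF wform_mconst rats.wform_power[OF wvar(1)], of w m]
      rats.wform_power[OF wvar(3), of 2] wvar y w z
    by (auto intro!: rats.wform_diff simp del: One_nat_def simp: numeral_2_eq_2)
  have inF: "{F1, F2, F3} \<subseteq> pt \<rat> ?a ?v"
    using wF by (auto simp: pt_def F numeral_eq_Suc)
  have eq_pt: "x = pt \<rat> ?a ?v" if x: "x \<in> ?S" "{F1, F2, F3} \<subseteq> x" for x
  proof -
    obtain u where u: "u \<in> cover_vecs f" "x = pt \<rat> ?a u" using x by (auto simp: cover_points_def)
    then obtain a b c d where abcd: "u = [a, b, c, d]" "a \<noteq> 0 \<or> b \<noteq> 0 \<or> c \<noteq> 0 \<or> d \<noteq> 0" by (auto simp: cover_vecs_4)
    have rel: "b = y * a" "c\<^sup>2 = z\<^sup>2 * a\<^sup>2" "d = w * a ^ m"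
      using x(2) by (auto simp: u abcd pt_def F)
    \<comment> \<open>If a = 0, the relations force b = c = 0, and also d = 0 because m \<ge>
      1.\<close>
    have "a \<noteq> 0" using rel abcd(2) m by (auto simp: power_0_left)
    have "c = z * a \<or> c = - z * a" using rel(2) by (metis power_mult_distrib power2_eq_iff mult_minus_left)
    then obtain z' where z': "c = z' * a" "z' = z \<or> z' = - z" by blast
    have "pt \<rat> ?a [1, y, z', w] = x"
      using pt_weighted[of "[1, y, z', w]" ?a a \<rat>] \<open>a \<noteq> 0\<close> rel z' by (simp add: u abcd upt_4 mult.commute)
    moreover have "pt \<rat> ?a [1, y, - z, w] = pt \<rat> ?a ?v"
      using mp_eval_conjugate[OF _ y w z] mp_eval_conjugate[OF _ y w, where z = "- z"] z
      by (auto simp: pt_def)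
    ultimately show ?thesis using z' by auto
  qed
  have top: "topspace (zariski \<rat> ?a ?S) = ?S"
    by (rule topspace_zariski[OF subfield_Rats]) (auto simp: cover_points_def)
  have vS: "pt \<rat> ?a ?v \<in> ?S" using v by (auto simp: cover_points_def)
  have "openin (zariski \<rat> ?a ?S) {x \<in> ?S. G \<notin> x}" if "wform \<rat> ?a e G" for G e
    unfolding zariski_def by (rule topology_generated_by_Basis) (use that in auto)
  then have "openin (zariski \<rat> ?a ?S) ({x \<in> ?S. F1 \<notin> x} \<union> {x \<in> ?S. F2 \<notin> x} \<union> {x \<in> ?S. F3 \<notin> x})"
    using wF by (intro openin_Un) blast+
  also have "{x \<in> ?S. F1 \<notin> x} \<union> {x \<in> ?S. F2 \<notin> x} \<union> {x \<in> ?S. F3 \<notin> x} = ?S - {pt \<rat> ?a ?v}"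
    using eq_pt inF by auto
  finally have "closedin (zariski \<rat> ?a ?S) {pt \<rat> ?a ?v}"
    unfolding closedin_def top using vS by blast
  then show ?thesis
    unfolding quadratic_points_def
  proof (intro CollectI conjI bexI)
    show "CC.dimension 2 \<rat> (res_field \<rat> ?a ?v)" unfolding L by (rule dimension_quadratic[OF z(2)])
    show "res_field \<rat> plane_wts (cover_proj ?v) = res_field \<rat> ?a ?v" unfolding L L' by (rule refl)
  qed (use v vS in simp_all)
qed

text \<open>A form that vanishes at the quadratic points vanishes at w and at -w above each (y, z),
  so both of its parts F0 and F1 vanish there. Infinitely many z for each of infinitely many y make
  both parts identically zero on x = 1.\<close>

lemma quadratic_points_denseI:
  assumes f: "wform \<rat> plane_wts (2 * m) f" and m: "m \<ge> 1"
    and Y: "infinite Y" "Y \<subseteq> \<rat>"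
    and T: "\<And>y. y \<in> Y \<Longrightarrow> infinite {z. z\<^sup>2 \<in> \<rat> \<and> z \<notin> \<rat> \<and> (\<exists>w\<in>\<rat>. w \<noteq> 0 \<and> w\<^sup>2 = mp_eval [1, y, z] f)}"
  shows "quadratic_points_dense \<rat> m f"
  unfolding quadratic_points_dense_def
proof (rule closure_of_zariski[OF subfield_Rats rats.coeff_ring_axioms])
  show "cover_points \<rat> m f \<subseteq> range (pt \<rat> (cover_wts m))" by (auto simp: cover_points_def)
  show "quadratic_points \<rat> m f \<subseteq> cover_points \<rat> m f" by (auto simp: quadratic_points_def)
  fix F d x assume F: "wform \<rat> (cover_wts m) d F" and van: "\<And>x. x \<in> quadratic_points \<rat> m f \<Longrightarrow> F \<in> x"
    and x: "x \<in> cover_points \<rat> m f"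
  obtain F0 F1 where F01: "polyf \<rat> 3 F0" "polyf \<rat> 3 F1"
    "\<And>x y z w. w\<^sup>2 = mp_eval [x, y, z] f \<Longrightarrow> mp_eval [x, y, z, w] F = F0 (as3 x y z) + F1 (as3 x y z) * w"
    using cover_form_split[OF F f] by metis
  have "F0 (as3 1 y z) = 0 \<and> F1 (as3 1 y z) = 0"
    if "y \<in> Y" "z\<^sup>2 \<in> \<rat>" "z \<notin> \<rat>" "w \<in> \<rat>" "w \<noteq> 0" "w\<^sup>2 = mp_eval [1, y, z] f" for y z w
  proof -
    have w: "(- w)\<^sup>2 = mp_eval [1, y, z] f" "- w \<in> \<rat>" using that by auto
    have "mp_eval [1, y, z, w] F = 0"
      using van[OF quadratic_points_memI[OF f m _ that(4,2,3,6)]] that Y by (auto simp: pt_def)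
    moreover have "mp_eval [1, y, z, - w] F = 0"
      using van[OF quadratic_points_memI[OF f m _ w(2) that(2,3) w(1)]] that Y by (auto simp: pt_def)
    ultimately have "F0 (as3 1 y z) + F1 (as3 1 y z) * w = 0" "F0 (as3 1 y z) + F1 (as3 1 y z) * (- w) = 0"
      using F01(3)[OF that(6)] F01(3)[OF w(1)] by simp_all
    then show ?thesis using that(5) by (auto simp: add_eq_0_iff2)
  qed
  then have sub: "{z. z\<^sup>2 \<in> \<rat> \<and> z \<notin> \<rat> \<and> (\<exists>w\<in>\<rat>. w \<noteq> 0 \<and> w\<^sup>2 = mp_eval [1, y, z] f)}
      \<subseteq> {z. F0 (as3 1 y z) = 0 \<and> F1 (as3 1 y z) = 0}" if "y \<in> Y" for y
    using that by blast
  have zero: "G (as3 1 y z) = 0" if "polyf \<rat> 3 G" "\<And>y. y \<in> Y \<Longrightarrow> infinite {z. G (as3 1 y z) = 0}" for G y z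
  proof -
    have "G (as3 1 y z) = 0" if "y \<in> Y" for y z
      using polyf_slice_zero[OF \<open>polyf \<rat> 3 G\<close>, of "as3 1 y z" 2 z] \<open>\<And>y. y \<in> Y \<Longrightarrow> infinite {z. G (as3 1 y z) = 0}\<close> that
      by (simp only: as3_upd simp_thms)
    then have "Y \<subseteq> {y. G (as3 1 y z) = 0}" by blast
    then have "infinite {y. G (as3 1 y z) = 0}" using Y(1) infinite_super by blast
    then show ?thesis
      using polyf_slice_zero[OF \<open>polyf \<rat> 3 G\<close>, of "as3 1 y z" 1 y] by (simp only: as3_upd simp_thms)
  qed
  have "F0 (as3 1 y z) = 0" "F1 (as3 1 y z) = 0" for y z
  proof -
    show "F0 (as3 1 y z) = 0"
      using zero[OF F01(1)] infinite_super[OF order_trans[OF sub] T] by (simp add: Collect_mono)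
    show "F1 (as3 1 y z) = 0"
      using zero[OF F01(2)] infinite_super[OF order_trans[OF sub] T] by (simp add: Collect_mono)
  qed
  then have "mp_eval [1, y, z, w] F = 0" if "w\<^sup>2 = mp_eval [1, y, z] f" for y z w
    using F01(3)[OF that] by simp
  moreover obtain v where "v \<in> cover_vecs f" "x = pt \<rat> (cover_wts m) v" using x by (auto simp: cover_points_def)
  ultimately show "F \<in> x"
    using cover_vanishI[OF F f] F by (auto simp: pt_def)
qed

section \<open>Squarefree forms\<close>

text \<open>Induction on the number of variables, comparing coefficients in the last one. The
  abstract index set with exponents \<open>e\<close> covers both multi-indices of polynomials and
  pairs (i, j).\<close>

lemma monomials_independent:
  fixes c :: "'a \<Rightarrow> complex" and e :: "'a \<Rightarrow> nat \<Rightarrow> nat"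
  assumes "finite S" "\<And>\<mu> \<nu>. \<mu> \<in> S \<Longrightarrow> \<nu> \<in> S \<Longrightarrow> (\<forall>i<N. e \<mu> i = e \<nu> i) \<Longrightarrow> \<mu> = \<nu>"
    and "\<And>u. (\<Sum>\<mu>\<in>S. c \<mu> * (\<Prod>i<N. u i ^ e \<mu> i)) = 0" and "\<nu> \<in> S"
  shows "c \<nu> = 0"
  using assms
proof (induction N arbitrary: S)
  case 0
  then have "S = {\<nu>}" by auto
  then show ?case using 0(3)[of "\<lambda>_. 1"] by simp
next
  case (Suc N)
  define T where "T = {\<mu> \<in> S. e \<mu> N = e \<nu> N}"
  show ?case
  proof (rule Suc.IH[of T])
    show "finite T" "\<nu> \<in> T" using Suc.prems by (auto simp: T_def)
    show "\<mu> = \<mu>'" if "\<mu> \<in> T" "\<mu>' \<in> T" "\<forall>i<N. e \<mu> i = e \<mu>' i" for \<mu> \<mu>'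
      using that Suc.prems(2)[of \<mu> \<mu>'] by (auto simp: T_def less_Suc_eq)
    fix u :: "nat \<Rightarrow> complex"
    define P where "P = (\<Sum>\<mu>\<in>S. Polynomial.monom (c \<mu> * (\<Prod>i<N. u i ^ e \<mu> i)) (e \<mu> N))"
    have "poly P z = 0" for z
    proof -
      have "poly P z = (\<Sum>\<mu>\<in>S. c \<mu> * (\<Prod>i<Suc N. (u(N := z)) i ^ e \<mu> i))"
        unfolding P_def poly_sum by (rule sum.cong) (auto simp: poly_monom)
      then show ?thesis using Suc.prems(3)[of "u(N := z)"] by (simp only:)
    qed
    then have "P = 0" by (simp add: poly_eq_poly_eq_iff[symmetric] fun_eq_iff)
    then have "0 = Polynomial.coeff P (e \<nu> N)" by simp
    also have "\<dots> = (\<Sum>\<mu>\<in>S. if e \<mu> N = e \<nu> N then c \<mu> * (\<Prod>i<N. u i ^ e \<mu> i) else 0)"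
      unfolding P_def coeff_sum by (rule sum.cong) auto
    also have "\<dots> = (\<Sum>\<mu>\<in>T. c \<mu> * (\<Prod>i<N. u i ^ e \<mu> i))"
      unfolding T_def using Suc.prems(1) by (simp add: sum.inter_filter)
    finally show "(\<Sum>\<mu>\<in>T. c \<mu> * (\<Prod>i<N. u i ^ e \<mu> i)) = 0" by simp
  qed
qed

lemma mpol_eq_0I:
  fixes G :: mpol
  assumes vars: "\<And>\<mu>. \<mu> \<in> Poly_Mapping.keys G \<Longrightarrow> Poly_Mapping.keys \<mu> \<subseteq> {..<N}"
    and zero: "\<And>u. mp_eval (map u [0..<N]) G = 0"
  shows "G = 0"
proof (rule ccontr)
  assume "G \<noteq> 0"
  then obtain \<nu> where \<nu>: "\<nu> \<in> Poly_Mapping.keys G" by (metis all_not_in_conv keys_eq_empty)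
  have "Poly_Mapping.lookup G \<nu> = 0"
  proof (rule monomials_independent[of "Poly_Mapping.keys G" N Poly_Mapping.lookup])
    show "\<mu> = \<mu>'" if "\<mu> \<in> Poly_Mapping.keys G" "\<mu>' \<in> Poly_Mapping.keys G"
      "\<forall>i<N. Poly_Mapping.lookup \<mu> i = Poly_Mapping.lookup \<mu>' i" for \<mu> \<mu>'
    proof (rule poly_mapping_eqI)
      fix i
      show "Poly_Mapping.lookup \<mu> i = Poly_Mapping.lookup \<mu>' i"
      proof (cases "i < N")
        case False
        then have "i \<notin> Poly_Mapping.keys \<mu>" "i \<notin> Poly_Mapping.keys \<mu>'" using vars that by blast+
        then show ?thesis by (simp add: in_keys_iff)
      qed (use that in auto)
    qed
    fix u :: "nat \<Rightarrow> complex"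
    show "(\<Sum>\<mu>\<in>Poly_Mapping.keys G. Poly_Mapping.lookup G \<mu> * (\<Prod>i<N. u i ^ Poly_Mapping.lookup \<mu> i)) = 0"
      using zero[of u] by (simp add: mp_eval_def)
  qed (use \<nu> in auto)
  with \<nu> show False by (simp add: in_keys_iff)
qed

lemma poly_no_root_const:
  fixes p :: "complex poly"
  assumes "\<And>z. poly p z \<noteq> 0"
  shows "poly p x = poly p y"
  using fundamental_theorem_of_algebra[of p] assms unfolding constant_def by blast

text \<open>
  A zero of a factor that occurs twice is a singular point. So if the singular points of \<open>f\<close> lie
  in a set of codimension two, such a factor has no zeros on the lines that avoid this set, and it
  is constant along them.
\<close>

lemma squarefree_by_singular_locus:
  fixes f :: mpol
  assumes sing: "\<And>v. length v \<ge> 3 \<Longrightarrow> mp_eval v f = 0 \<Longrightarrow> (\<forall>i<3. mp_eval v (mp_deriv i f) = 0) \<Longrightarrow>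
      v ! 0 = 0 \<and> (v ! 1 = 0 \<or> v ! 2 = 0)"
  shows "squarefree f"
proof (rule squarefreeI)
  fix g assume "g\<^sup>2 dvd f"
  then obtain h where f: "f = g\<^sup>2 * h" by (elim dvdE)
  have "finite (\<Union>\<mu>\<in>Poly_Mapping.keys g. Poly_Mapping.keys \<mu>)" by simp
  then obtain N0 where "(\<Union>\<mu>\<in>Poly_Mapping.keys g. Poly_Mapping.keys \<mu>) \<subseteq> {..<N0}"
    using finite_nat_iff_bounded by blast
  \<comment> \<open>A divisor of \<open>f\<close> in the ring of all polynomials might involve
    further variables, so evaluation takes place in enough coordinates for all those of
    \<open>g\<close>.\<close>
  then obtain N where N: "N \<ge> 3" "(\<Union>\<mu>\<in>Poly_Mapping.keys g. Poly_Mapping.keys \<mu>) \<subseteq> {..<N}"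
    using that[of "max 3 N0"] by fastforce
  define ev where "ev F u = mp_eval (map u [0..<N]) F" for F u
  have upd: "(map u [0..<N])[i := z] = map (u(i := z)) [0..<N]" if "i < N" for u :: "nat \<Rightarrow> complex" and i z
    using that by (intro nth_equalityI) (auto simp: nth_list_update)
  have slice: "\<exists>p. \<forall>z. ev F (u(i := z)) = poly p z" for F u i
  proof -
    have "polyf UNIV N (\<lambda>u. mp_eval (map (\<lambda>i. u i) [0..<N]) F)"
      by (rule cplx.polyf_mp_eval) (auto intro: polyf_var)
    from polyf_slice[OF this, of u i] show ?thesis by (simp only: ev_def)
  qed
  have nz: "ev g u \<noteq> 0" if "\<not> (u 0 = 0 \<and> (u 1 = 0 \<or> u 2 = 0))" for u
  proof
    assume zero: "ev g u = 0"
    have "mp_eval (map u [0..<N]) (mp_deriv i f) = 0" if i: "i < 3" for i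
    proof (rule mp_deriv_eval_eq)
      show "i < length (map u [0..<N])" using N(1) i by simp
      have iN: "i < N" using N(1) i by simp
      have "((\<lambda>z. mp_eval ((map u [0..<N])[i := z]) g) has_field_derivative ev (mp_deriv i g) u) (at (u i))"
           "((\<lambda>z. mp_eval ((map u [0..<N])[i := z]) h) has_field_derivative ev (mp_deriv i h) u) (at (u i))"
        using DERIV_mp_eval[of i "map u [0..<N]"] iN by (simp_all add: ev_def)
      from DERIV_mult[OF DERIV_power[OF this(1), of 2] this(2)] iN
      show "((\<lambda>z. mp_eval ((map u [0..<N])[i := z]) f) has_field_derivative 0) (at (map u [0..<N] ! i))"
        using zero by (simp add: f upd ev_def)
    qed
    moreover have "mp_eval (map u [0..<N]) f = 0" using zero by (simp add: f ev_def)
    ultimately show False using sing[of "map u [0..<N]"] that N(1) by (simp add: numeral_2_eq_2)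
  qed
  have line: "ev g (u(i := z)) = ev g u" if "\<And>z. \<not> ((u(i := z)) 0 = 0 \<and> ((u(i := z)) 1 = 0 \<or> (u(i := z)) 2 = 0))" for u i z
  proof -
    obtain p where p: "\<And>z. ev g (u(i := z)) = poly p z" using slice by blast
    have "poly p z = poly p (u i)" by (rule poly_no_root_const) (metis nz that p)
    then show ?thesis using p by (metis fun_upd_triv)
  qed
  \<comment> \<open>The coordinates from index 1 on are replaced by 1 one at a time. As coordinate 0
    stays nonzero, all lines used avoid the exceptional set.\<close>
  have step: "ev g (\<lambda>j. if 1 \<le> j \<and> j < i then 1 else u j) = ev g u" if "u 0 \<noteq> 0" for u i
  proof (induction i)
    case 0
    have "(\<lambda>j. if 1 \<le> j \<and> j < 0 then 1 else u j) = u" by auto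
    then show ?case by (simp only:)
  next
    case (Suc i)
    show ?case
    proof (cases "i = 0")
      case True
      have "(\<lambda>j. if 1 \<le> j \<and> j < Suc i then 1 else u j) = u" by (auto simp: True)
      then show ?thesis by (simp only:)
    next
      case False
      define v where "v = (\<lambda>j. if 1 \<le> j \<and> j < i then 1 else u j)"
      have "(\<lambda>j. if 1 \<le> j \<and> j < Suc i then 1 else u j) = v(i := 1)"
        using False by (auto simp: v_def fun_eq_iff)
      moreover have "ev g (v(i := 1)) = ev g v"
        by (rule line) (use False that in \<open>auto simp: v_def\<close>)
      ultimately show ?thesis using Suc by (simp only: v_def)
    qed
  qed
  define c where "c = ev g (\<lambda>_. 1)"
  have const0: "ev g u = c" if "u 0 \<noteq> 0" for u
  proof -
    have "ev g u = ev g (\<lambda>j. if 1 \<le> j \<and> j < N then 1 else u j)" using step[of u N] that by simp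
    also have "\<dots> = ev g ((\<lambda>_. 1)(0 := u 0))"
      unfolding ev_def by (intro arg_cong2[of _ _ _ _ mp_eval] map_cong) auto
    also have "\<dots> = c" unfolding c_def by (rule line) auto
    finally show ?thesis .
  qed
  \<comment> \<open>A polynomial in coordinate 0 that is constant off 0 is constant, so the value
    extends to points with first coordinate 0.\<close>
  have const: "ev g u = c" for u
  proof -
    obtain p where p: "\<And>z. ev g (u(0 := z)) = poly p z" using slice by blast
    have "poly (p - [:c:]) z = 0" if "z \<noteq> 0" for z
      using const0[of "u(0 := z)"] that by (simp add: p[symmetric])
    then have "UNIV - {0} \<subseteq> {z. poly (p - [:c:]) z = 0}" by auto
    moreover have "infinite (UNIV - {0 :: complex})" by (simp add: infinite_UNIV_char_0)
    ultimately have "p - [:c:] = 0" using poly_roots_finite finite_subset by metis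
    then show ?thesis using p[of "u 0"] by simp
  qed
  have "g - mconst c = 0"
  proof (rule mpol_eq_0I[of _ N])
    fix \<mu> assume "\<mu> \<in> Poly_Mapping.keys (g - mconst c)"
    then have "\<mu> \<in> Poly_Mapping.keys g \<or> \<mu> = 0"
      by (auto simp: in_keys_iff lookup_minus mconst_def lookup_single when_def split: if_splits)
    then show "Poly_Mapping.keys \<mu> \<subseteq> {..<N}" using N(2) by auto
  qed (use const in \<open>simp add: ev_def\<close>)
  then have g: "g = mconst c" by simp
  have "c \<noteq> 0" using nz[of "\<lambda>_. 1"] by (simp add: c_def)
  then have "g * mconst (1 / c) = 1" by (simp add: g mconst_def mult_single)
  then show "g dvd 1" by (metis dvd_triv_left)
qed

section \<open>Rational points on the genus one fibres\<close>

definition val2 :: "int \<Rightarrow> rat \<Rightarrow> bool" where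
  "val2 n x \<longleftrightarrow> (\<exists>p q::int. odd p \<and> odd q \<and> x = of_int p / of_int q * 2 powi n)"

definition ge2 :: "int \<Rightarrow> rat \<Rightarrow> bool" where
  "ge2 n x \<longleftrightarrow> (\<exists>p q::int. odd q \<and> x = of_int p / of_int q * 2 powi n)"

lemma odd_nonzero: "odd (p::int) \<Longrightarrow> (of_int p :: rat) \<noteq> 0"
  by auto

lemma val2_nonzero: "val2 n x \<Longrightarrow> x \<noteq> 0"
  by (auto simp: val2_def)

lemma val2_mult: "val2 m x \<Longrightarrow> val2 n y \<Longrightarrow> val2 (m + n) (x * y)"
proof -
  assume "val2 m x" "val2 n y"
  then obtain p q p' q' where "odd p" "odd q" "odd p'" "odd q'"
    "x = of_int p / of_int q * 2 powi m" "y = of_int p' / of_int q' * 2 powi n" by (auto simp: val2_def)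
  then show ?thesis unfolding val2_def
    by (intro exI[of _ "p * p'"] exI[of _ "q * q'"]) (auto simp: power_int_add)
qed

lemma val2_inverse: "val2 m x \<Longrightarrow> val2 (- m) (inverse x)"
proof -
  assume "val2 m x"
  then obtain p q where "odd p" "odd q" "x = of_int p / of_int q * 2 powi m" by (auto simp: val2_def)
  then have "odd q \<and> odd p \<and> inverse x = of_int q / of_int p * 2 powi (- m)"
    by (simp add: power_int_minus divide_inverse)
  then show ?thesis unfolding val2_def by blast
qed

lemma val2_divide: "val2 m x \<Longrightarrow> val2 n y \<Longrightarrow> val2 (m - n) (x / y)"
  using val2_mult[of m x "- n" "inverse y"] val2_inverse by (simp add: divide_inverse)

lemma val2_odd: "odd p \<Longrightarrow> val2 0 (of_int p)"
  unfolding val2_def by (intro exI[of _ p] exI[of _ 1]) auto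

lemma val2_1: "val2 0 1"
  using val2_odd[of 1] by simp

lemma val2_power: "val2 m x \<Longrightarrow> val2 (int k * m) (x ^ k)"
  by (induction k) (auto simp: val2_1 algebra_simps dest: val2_mult)

lemma val2_powi: "val2 n (2 powi n)"
  unfolding val2_def by (intro exI[of _ 1]) auto

lemma val2_imp_ge2: "val2 n x \<Longrightarrow> ge2 n x"
  by (auto simp: val2_def ge2_def)

lemma ge2_of_int: "ge2 0 (of_int p)"
  unfolding ge2_def by (intro exI[of _ p] exI[of _ 1]) auto

lemma ge2_mono:
  assumes "ge2 n x" "m \<le> n"
  shows "ge2 m x"
proof -
  obtain p q where pq: "odd q" "x = of_int p / of_int q * 2 powi n" using assms by (auto simp: ge2_def)
  have "(2::rat) powi n = 2 powi (n - m) * 2 powi m" by (simp flip: power_int_add)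
  also have "(2::rat) powi (n - m) = of_int (2 ^ nat (n - m))" using assms by (simp add: power_int_def)
  finally have "x = of_int (p * 2 ^ nat (n - m)) / of_int q * 2 powi m" by (simp add: pq)
  then show ?thesis unfolding ge2_def using pq(1) by blast
qed

lemma ge2_mult: "ge2 m x \<Longrightarrow> ge2 n y \<Longrightarrow> ge2 (m + n) (x * y)"
proof -
  assume "ge2 m x" "ge2 n y"
  then obtain p q p' q' where "odd q" "odd q'"
    "x = of_int p / of_int q * 2 powi m" "y = of_int p' / of_int q' * 2 powi n" by (auto simp: ge2_def)
  then show ?thesis unfolding ge2_def
    by (intro exI[of _ "p * p'"] exI[of _ "q * q'"]) (auto simp: power_int_add)
qed

lemma ge2_uminus: "ge2 m x \<Longrightarrow> ge2 m (- x)"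
  using ge2_mult[OF ge2_of_int[of "-1"]] by simp

lemma ge2_add: "ge2 n x \<Longrightarrow> ge2 n y \<Longrightarrow> ge2 n (x + y)"
proof -
  assume "ge2 n x" "ge2 n y"
  then obtain p q p' q' where *: "odd q" "odd q'"
    "x = of_int p / of_int q * 2 powi n" "y = of_int p' / of_int q' * 2 powi n" by (auto simp: ge2_def)
  have "x + y = of_int (p * q' + p' * q) / of_int (q * q') * 2 powi n"
    using odd_nonzero[OF *(1)] odd_nonzero[OF *(2)] by (simp add: *(3,4) add_divide_distrib distrib_right)
  then show ?thesis unfolding ge2_def using * by (metis even_mult_iff)
qed

lemma val2_add:
  assumes "val2 m x" "ge2 n y" "m < n"
  shows "val2 m (x + y)"
proof -
  obtain p q where x: "odd p" "odd q" "x = of_int p / of_int q * 2 powi m" using assms by (auto simp: val2_def)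
  have "ge2 (m + 1) y" by (rule ge2_mono[OF assms(2)]) (use assms(3) in simp)
  then obtain r s where y: "odd s" "y = of_int r / of_int s * 2 powi (m + 1)" unfolding ge2_def by blast
  have "x + y = of_int (p * s + 2 * r * q) / of_int (q * s) * 2 powi m"
  proof -
    have "p' / q' * z + r' / s' * (z * 2) = (p' * s' + 2 * r' * q') / (q' * s') * z"
      if "q' \<noteq> 0" "s' \<noteq> 0" for p' q' r' s' z :: rat
      using that by (simp add: add_divide_distrib distrib_right)
    from this[OF odd_nonzero[OF x(2)] odd_nonzero[OF y(1)]] show ?thesis
      by (simp add: x(3) y(2) power_int_add)
  qed
  moreover have "odd (p * s + 2 * r * q)" "odd (q * s)" using x y by auto
  ultimately show ?thesis unfolding val2_def by blast
qed

lemma val2_unique: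
  assumes "val2 m x" "val2 n x"
  shows "m = n"
proof -
  have False if "val2 m x" "val2 n x" "m < n" for m n
    using val2_add[OF that(1) ge2_uminus[OF val2_imp_ge2[OF that(2)]] that(3)] val2_nonzero by fastforce
  then show ?thesis using assms by (meson linorder_neqE)
qed

lemma val2_exists:
  assumes "x \<noteq> 0"
  shows "\<exists>n. val2 n x"
proof -
  have int: "\<exists>n. val2 n (of_int p)" if p: "p \<noteq> 0" for p :: int
  proof -
    define k where "k = multiplicity 2 p"
    obtain r where r: "p = 2 ^ k * r" "\<not> 2 dvd r"
      unfolding k_def by (rule multiplicity_decompose'[of p 2]) (use p in auto)
    have "val2 (int k * 1) (2 ^ k)" by (rule val2_power) (use val2_powi[of 1] in simp)
    from val2_mult[OF this val2_odd[of r]] r show ?thesis by (intro exI[of _ "int k"]) auto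
  qed
  obtain p q where "quotient_of x = (p, q)" by (cases "quotient_of x")
  then have "x = of_int p / of_int q" "q > 0" using quotient_of_div quotient_of_denom_pos by auto
  then have "p \<noteq> 0" "q \<noteq> 0" using assms by auto
  then obtain m n where "val2 m (of_int p)" "val2 n (of_int q)" using int by blast
  then show ?thesis using val2_divide \<open>x = of_int p / of_int q\<close> by blast
qed

text \<open>The criterion that makes z = sqrt t irrational and the point quadratic.\<close>

lemma val2_odd_not_square:
  assumes "val2 n x" "odd n"
  shows "s\<^sup>2 \<noteq> x"
proof
  assume s: "s\<^sup>2 = x"
  then have "s \<noteq> 0" using val2_nonzero[OF assms(1)] by auto
  then obtain k where "val2 k s" using val2_exists by blast
  then have "val2 (2 * k) x" using val2_power[of k s 2] s by simp
  then have "n = 2 * k" using val2_unique assms by blast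
  then show False using assms by simp
qed

text \<open>A finite set has a least valuation. It suffices therefore to produce points whose
  valuations tend to minus infinity.\<close>

lemma infinite_val2:
  assumes "\<And>n::nat. \<exists>t\<in>T. \<exists>m. val2 m t \<and> m \<le> - int n"
  shows "infinite T"
proof
  assume fin: "finite T"
  define v where "v t = (SOME m. val2 m t)" for t
  have v: "v t = m" if "val2 m t" for t m
    unfolding v_def by (rule some_equality[of "\<lambda>m. val2 m t", OF that]) (rule val2_unique[OF _ that])
  obtain t m where t: "t \<in> T" "val2 m t" "m \<le> - int (nat (1 - Min (v ` T)))" using assms by meson
  then have "Min (v ` T) \<le> m" using v[OF t(2)] fin by (metis Min_le finite_imageI imageI)
  then show False using t(3) by linarith
qed

text \<open>Duplication on a cubic: the tangent at (t, w) has slope \<open>l\<close> and meets the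
  curve again at t' = l^2 / c - 2 t, which is the stated fraction once \<open>l\<close> is
  eliminated. The witness is the height \<open>w + l * u\<close> of the tangent over t'.\<close>

lemma cubic_double:
  fixes c e t w :: "'a::field_char_0"
  assumes eq: "w\<^sup>2 = c * t ^ 3 + e" and nz: "w \<noteq> 0" "c \<noteq> 0"
  shows "\<exists>w'. w'\<^sup>2 = c * (t * (c * t ^ 3 - 8 * e) / (4 * w\<^sup>2)) ^ 3 + e"
proof -
  define t' where "t' = t * (c * t ^ 3 - 8 * e) / (4 * w\<^sup>2)"
  define l where "l = 3 * c * t\<^sup>2 / (2 * w)"
  define u where "u = t' - t"
  have l: "2 * l * w = 3 * c * t\<^sup>2" using nz by (simp add: l_def)
  have "l\<^sup>2 * (4 * w\<^sup>2) = (2 * l * w)\<^sup>2" by (simp add: power_mult_distrib)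
  also have "\<dots> = 9 * c\<^sup>2 * t ^ 4" unfolding l by (simp add: power_mult_distrib flip: power_mult)
  also have "\<dots> = c * (t * (c * t ^ 3 - 8 * (w\<^sup>2 - c * t ^ 3)) + 2 * t * (4 * w\<^sup>2))"
    by (simp add: algebra_simps power2_eq_square power3_eq_cube power4_eq_xxxx)
  also have "t * (c * t ^ 3 - 8 * (w\<^sup>2 - c * t ^ 3)) = t' * (4 * w\<^sup>2)"
    using nz(1) by (simp add: t'_def eq[symmetric]) (simp add: eq)
  also have "c * (t' * (4 * w\<^sup>2) + 2 * t * (4 * w\<^sup>2)) = c * (t' + 2 * t) * (4 * w\<^sup>2)"
    by (simp add: algebra_simps)
  finally have l2: "l\<^sup>2 = c * (u + 3 * t)" using nz by (simp add: u_def)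
  have "(w + l * u)\<^sup>2 = w\<^sup>2 + (2 * l * w) * u + l\<^sup>2 * u\<^sup>2" by (simp add: power2_eq_square algebra_simps)
  also have "\<dots> = c * (t + u) ^ 3 + e"
    unfolding l l2 eq by (simp add: power2_eq_square power3_eq_cube algebra_simps)
  also have "t + u = t'" by (simp add: u_def)
  finally show ?thesis unfolding t'_def by blast
qed

text \<open>If c t^3 has valuation below 3, it dominates 8 e in the duplication formula. From the
  unit \<open>t0\<close>, where c t^3 has valuation 1, the first duplication gives valuation 1 - (2
  + 2 i) = -1 - 2 i. For odd j < 0 the equation forces w to have valuation (1 + 3 j) / 2, and
  duplication takes j to j - 2. So the valuation stays odd and decreases.\<close>

lemma cubic_points_infinite:
  fixes c e t0 w0 :: rat
  assumes c: "val2 1 c" and e: "ge2 0 e" and t0: "val2 0 t0" and w0: "val2 i w0" "i \<ge> 0"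
    and eq0: "w0\<^sup>2 = c * t0 ^ 3 + e"
  shows "infinite {t. (\<forall>s. s\<^sup>2 \<noteq> t) \<and> (\<exists>w. w \<noteq> 0 \<and> w\<^sup>2 = c * t ^ 3 + e)}"
proof (rule infinite_val2)
  have "val2 3 8" using val2_power[OF val2_powi[of 1], of 3] by simp
  then have e8: "ge2 3 (- (8 * e))" using ge2_uminus[OF ge2_mult[OF val2_imp_ge2 e, of 3 8]] by simp
  have v4: "val2 2 4" using val2_power[OF val2_powi[of 1], of 2] by simp
  have c0: "c \<noteq> 0" using val2_nonzero[OF c] .
  have dbl: "val2 (j + l - (2 + 2 * k)) (t * (c * t ^ 3 - 8 * e) / (4 * w\<^sup>2))"
    if "val2 j t" "val2 k w" "val2 l (c * t ^ 3)" "l < 3" for j k l t w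
    using val2_divide[OF val2_mult[OF that(1) val2_add[OF that(3) e8 that(4)]] val2_mult[OF v4 val2_power[OF that(2), of 2]]]
    by simp
  have "\<exists>t w j. w\<^sup>2 = c * t ^ 3 + e \<and> val2 j t \<and> odd j \<and> j \<le> - int (Suc n)" for n
  proof (induction n)
    case 0
    have "val2 1 (c * t0 ^ 3)" using val2_mult[OF c val2_power[OF t0, of 3]] by simp
    from dbl[OF t0 w0(1) this]
    have "val2 (- 1 - 2 * i) (t0 * (c * t0 ^ 3 - 8 * e) / (4 * w0\<^sup>2))" by (simp add: algebra_simps)
    moreover have "odd (- 1 - 2 * i)" "- 1 - 2 * i \<le> - int (Suc 0)" using w0(2) by auto
    ultimately show ?case
      using cubic_double[OF eq0 val2_nonzero[OF w0(1)] c0] by blast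
  next
    case (Suc n)
    then obtain t w j where t: "w\<^sup>2 = c * t ^ 3 + e" "val2 j t" "odd j" "j \<le> - int (Suc n)" by blast
    have ct: "val2 (1 + 3 * j) (c * t ^ 3)" using val2_mult[OF c val2_power[OF t(2), of 3]] by simp
    have "val2 (1 + 3 * j) (w\<^sup>2)" unfolding t(1) by (rule val2_add[OF ct e]) (use t(4) in simp)
    moreover have w: "w \<noteq> 0" using val2_nonzero[OF \<open>val2 (1 + 3 * j) (w\<^sup>2)\<close>] by auto
    obtain k where k: "val2 k w" using val2_exists[OF w] by blast
    ultimately have "2 * k = 1 + 3 * j" using val2_power[OF k, of 2] val2_unique by fastforce
    then have j2: "j + (1 + 3 * j) - (2 + 2 * k) = j - 2" by simp
    have "val2 (j + (1 + 3 * j) - (2 + 2 * k)) (t * (c * t ^ 3 - 8 * e) / (4 * w\<^sup>2))"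
      by (rule dbl[OF t(2) k ct]) (use t(4) in simp)
    then have "val2 (j - 2) (t * (c * t ^ 3 - 8 * e) / (4 * w\<^sup>2))" by (simp only: j2)
    moreover have "odd (j - 2)" "j - 2 \<le> - int (Suc (Suc n))" using t(3,4) by auto
    ultimately show ?case using cubic_double[OF t(1) w c0] by blast
  qed
  fix n
  obtain t w j where t: "w\<^sup>2 = c * t ^ 3 + e" "val2 j t" "odd j" "j \<le> - int (Suc n)"
    using \<open>\<exists>t w j. w\<^sup>2 = c * t ^ 3 + e \<and> val2 j t \<and> odd j \<and> j \<le> - int (Suc n)\<close> by blast
  have ct: "val2 (1 + 3 * j) (c * t ^ 3)" using val2_mult[OF c val2_power[OF t(2), of 3]] by simp
  have "val2 (1 + 3 * j) (w\<^sup>2)" unfolding t(1) by (rule val2_add[OF ct e]) (use t(4) in simp)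
  then have "w \<noteq> 0" using val2_nonzero by fastforce
  then show "\<exists>t\<in>{t. (\<forall>s. s\<^sup>2 \<noteq> t) \<and> (\<exists>w. w \<noteq> 0 \<and> w\<^sup>2 = c * t ^ 3 + e)}. \<exists>m. val2 m t \<and> m \<le> - int n"
    using t val2_odd_not_square[OF t(2,3)] by (intro bexI[of _ t] exI[of _ j]) auto
qed

text \<open>Any w determines t = (w^2 - 1) / 2 + y^2. With w a negative power of 2, the term w^2 / 2
  dominates and has odd valuation; the coefficient 2 of the equation is what makes it odd.\<close>

lemma linear_points_infinite:
  "infinite {t::rat. (\<forall>s. s\<^sup>2 \<noteq> t) \<and> (\<exists>w. w \<noteq> 0 \<and> w\<^sup>2 = 1 - 2 * of_int y ^ 2 + 2 * t ^ 1)}"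
proof (rule infinite_val2)
  fix n
  define w :: rat where "w = 2 powi (- int (Suc n))"
  define t where "t = (w\<^sup>2 + (-1)) * 2 powi (-1) + of_int (y\<^sup>2)"
  have v: "val2 (- 2 * int (Suc n)) (w\<^sup>2)" using val2_power[OF val2_powi, of 2 "- int (Suc n)"] by (simp add: w_def)
  have "val2 (- 2 * int (Suc n)) (w\<^sup>2 + (-1))"
    by (rule val2_add[OF v, of 0]) (use ge2_of_int[of "-1"] in auto)
  from val2_mult[OF this val2_powi[of "-1"]]
  have "val2 (- 2 * int (Suc n) - 1) ((w\<^sup>2 + (-1)) * 2 powi (-1))" by simp
  then have t: "val2 (- 2 * int (Suc n) - 1) t"
    unfolding t_def by (rule val2_add[OF _ ge2_of_int]) simp
  have "w\<^sup>2 = 1 - 2 * of_int y ^ 2 + 2 * t ^ 1" by (simp add: t_def power_int_minus)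
  moreover have "w \<noteq> 0" by (simp add: w_def)
  ultimately show "\<exists>t\<in>{t. (\<forall>s. s\<^sup>2 \<noteq> t) \<and> (\<exists>w. w \<noteq> 0 \<and> w\<^sup>2 = 1 - 2 * of_int y ^ 2 + 2 * t ^ 1)}.
      \<exists>m. val2 m t \<and> m \<le> - int n"
    using val2_odd_not_square[OF t] by (intro bexI[of _ t] exI[of _ "- 2 * int (Suc n) - 1"] conjI t) auto
qed

text \<open>The factorisation (w - t) (w + t) = r parametrises the conic by s = w - t. If s is an
  even power 2^k with k > 0, then r / s dominates and t has the odd valuation -k - 1.\<close>

lemma conic_points_infinite:
  assumes "odd (r::int)"
  shows "infinite {t::rat. (\<forall>s. s\<^sup>2 \<noteq> t) \<and> (\<exists>w. w \<noteq> 0 \<and> w\<^sup>2 = of_int r + t\<^sup>2)}"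
proof (rule infinite_val2)
  fix n
  define k where "k = 2 * int (Suc n)"
  define s :: rat where "s = 2 powi k"
  define t where "t = (of_int r / s + - s) * 2 powi (-1)"
  define w where "w = (of_int r / s + s) * 2 powi (-1)"
  have s: "val2 k s" by (simp add: s_def val2_powi)
  have rs: "val2 (- k) (of_int r / s)" using val2_divide[OF val2_odd[OF assms] s] by simp
  have kk: "- k < k" by (simp add: k_def)
  have t: "val2 (- k - 1) t"
    using val2_mult[OF val2_add[OF rs ge2_uminus[OF val2_imp_ge2[OF s]] kk] val2_powi[of "-1"]] by (simp add: t_def)
  have w: "val2 (- k - 1) w"
    using val2_mult[OF val2_add[OF rs val2_imp_ge2[OF s] kk] val2_powi[of "-1"]] by (simp add: w_def)
  have "2 * w = of_int r / s + s" "2 * t = of_int r / s - s"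
    by (simp_all add: w_def t_def power_int_minus)
  moreover have "(u + v)\<^sup>2 - (u - v)\<^sup>2 = 4 * (u * v)" for u v :: rat
    by (simp add: power2_eq_square algebra_simps)
  ultimately have "(2 * w)\<^sup>2 - (2 * t)\<^sup>2 = 4 * (of_int r / s * s)" by (simp only:)
  then have "w\<^sup>2 = of_int r + t\<^sup>2" using val2_nonzero[OF s] by (simp add: power_mult_distrib)
  moreover have "w \<noteq> 0" using val2_nonzero[OF w] .
  moreover have "odd (- k - 1)" by (simp add: k_def)
  ultimately show "\<exists>t\<in>{t. (\<forall>s. s\<^sup>2 \<noteq> t) \<and> (\<exists>w. w \<noteq> 0 \<and> w\<^sup>2 = of_int r + t\<^sup>2)}.
      \<exists>m. val2 m t \<and> m \<le> - int n"
    using val2_odd_not_square[OF t] by (intro bexI[of _ t] exI[of _ "- k - 1"] conjI t) (auto simp: k_def)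
qed

text \<open>
  In the coordinates \<open>s = 1 / t\<close> and \<open>W = w / t\<^sup>2\<close> the doubling map of \<open>w\<^sup>2 = t\<^sup>4 + r\<close> is the
  duplication formula of the lemniscate.
\<close>

lemma quartic_points_infinite:
  assumes "odd (y::int)"
  shows "infinite {t::rat. (\<forall>s. s\<^sup>2 \<noteq> t) \<and> (\<exists>w. w \<noteq> 0 \<and> w\<^sup>2 = 1 - of_int y ^ 8 + t ^ 4)}"
proof (rule infinite_val2)
  define r :: rat where "r = 1 - of_int y ^ 8"
  have "even (1 - y ^ 8)" using assms by simp
  then obtain r' where "1 - y ^ 8 = 2 * r'" by (elim dvdE)
  then have "r = of_int (2 * r')" unfolding r_def by (metis of_int_1 of_int_diff of_int_power)
  then have "r = 2 powi 1 * of_int r'" by simp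
  then have r: "ge2 1 r" using ge2_mult[OF val2_imp_ge2[OF val2_powi] ge2_of_int, of 1] by simp
  have v2: "val2 1 2" using val2_powi[of 1] by simp
  have step: "\<exists>s W. val2 (int n) s \<and> val2 0 W \<and> W\<^sup>2 = 1 + r * s ^ 4" for n
  proof (induction n)
    case 0
    \<comment> \<open>The start is the obvious point t = y^2, w = 1.\<close>
    have y: "val2 0 (of_int y)" by (rule val2_odd[OF assms])
    have "val2 0 (1 / of_int y ^ 2)" "val2 0 (1 / of_int y ^ 4)"
      using val2_divide[OF val2_1 val2_power[OF y, of 2]] val2_divide[OF val2_1 val2_power[OF y, of 4]] by simp_all
    moreover have "(1 / of_int y ^ 4)\<^sup>2 = 1 + r * (1 / of_int y ^ 2) ^ 4"
      using val2_nonzero[OF y] by (simp add: r_def left_diff_distrib diff_divide_distrib power_divide flip: power_mult)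
    ultimately show ?case by (intro exI conjI) simp_all
  next
    case (Suc n)
    then obtain s W where s: "val2 (int n) s" "val2 0 W" "W\<^sup>2 = 1 + r * s ^ 4" by blast
    define q where "q = r * s ^ 4"
    have "ge2 (1 + 4 * int n) q" unfolding q_def using ge2_mult[OF r val2_imp_ge2[OF val2_power[OF s(1), of 4]]] by simp
    then have q: "ge2 1 q" by (rule ge2_mono) simp
    have q1: "val2 0 (1 - q)" using val2_add[OF val2_1 ge2_uminus[OF q]] by simp
    have "ge2 1 ((6 + q) * q)"
    proof -
      have "ge2 0 6" using ge2_of_int[of 6] by simp
      have "ge2 1 (6 * q)" "ge2 1 (q * q)"
        using ge2_mult[OF \<open>ge2 0 6\<close> q] ge2_mult[OF ge2_mono[OF q, of 0] q] by simp_all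
      from ge2_add[OF this] show ?thesis by (simp only: distrib_right)
    qed
    from val2_add[OF val2_1 this] have q6: "val2 0 (1 + 6 * q + q\<^sup>2)"
      by (simp add: algebra_simps power2_eq_square)
    \<comment> \<open>Since q is even at 2, both 1 - q and 1 + 6 q + q^2 are units there. The factor
      2 therefore raises the valuation of s by exactly one.\<close>
    define s' W' where "s' = 2 * s * W / (1 - q)" "W' = (1 + 6 * q + q\<^sup>2) / (1 - q)\<^sup>2"
    have "val2 (1 + int n) s'"
      unfolding s'_W'_def using val2_divide[OF val2_mult[OF val2_mult[OF v2 s(1)] s(2)] q1] by simp
    moreover have "val2 0 W'"
      unfolding s'_W'_def using val2_divide[OF q6 val2_power[OF q1, of 2]] by simp
    moreover have "W'\<^sup>2 = 1 + r * s' ^ 4"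
    proof -
      have nz: "1 - q \<noteq> 0" using val2_nonzero[OF q1] .
      have "r * s' ^ 4 = 16 * q * (W\<^sup>2)\<^sup>2 / (1 - q) ^ 4"
        by (simp add: s'_W'_def q_def power_divide power_mult_distrib flip: power_mult)
      also have "W\<^sup>2 = 1 + q" by (simp add: s q_def)
      finally have "1 + r * s' ^ 4 = ((1 - q) ^ 4 + 16 * q * (1 + q)\<^sup>2) / (1 - q) ^ 4"
        using nz by (simp add: add_divide_distrib)
      also have "(1 - q) ^ 4 + 16 * q * (1 + q)\<^sup>2 = (1 + 6 * q + q\<^sup>2)\<^sup>2"
        by (simp add: power2_eq_square power4_eq_xxxx algebra_simps)
      finally show ?thesis by (simp add: s'_W'_def power_divide flip: power_mult)
    qed
    ultimately show ?case by (intro exI conjI) auto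
  qed
  fix n
  \<comment> \<open>Consecutive duplications alternate the parity of the valuation; an odd index is
    chosen so that t is not a square.\<close>
  obtain s W where s: "val2 (int (2 * n + 1)) s" "val2 0 W" "W\<^sup>2 = 1 + r * s ^ 4" using step by blast
  define t w where "t = inverse s" "w = W * t\<^sup>2"
  have t: "val2 (- int (2 * n + 1)) t" unfolding t_w_def by (rule val2_inverse[OF s(1)])
  have "w\<^sup>2 = W\<^sup>2 * t ^ 4" by (simp add: t_w_def power_mult_distrib flip: power_mult)
  also have "\<dots> = r + t ^ 4" using val2_nonzero[OF s(1)] by (simp add: s(3) t_w_def distrib_right power_inverse)
  finally have "w\<^sup>2 = 1 - of_int y ^ 8 + t ^ 4" by (simp add: r_def)
  moreover have "w \<noteq> 0" using val2_nonzero[OF s(2)] val2_nonzero[OF t] by (simp add: t_w_def(2))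
  ultimately show "\<exists>t\<in>{t. (\<forall>s. s\<^sup>2 \<noteq> t) \<and> (\<exists>w. w \<noteq> 0 \<and> w\<^sup>2 = 1 - of_int y ^ 8 + t ^ 4)}.
      \<exists>m. val2 m t \<and> m \<le> - int n"
    using val2_odd_not_square[OF t] by (intro bexI[of _ t] exI[of _ "- int (2 * n + 1)"] conjI t) auto
qed

section \<open>The branch curves\<close>

definition fermat_form :: "nat \<Rightarrow> complex \<Rightarrow> mpol" where
  "fermat_form m c = mvar 0 ^ (2 * m) - mconst c * mvar 1 ^ (2 * m) + mconst c * mvar 2 ^ (2 * m)"

text \<open>Homogenisation of x^(2a) (y^(2b) + 3) + (y^(2b) - 1) by variable 0. The constants are
  such that y = 1 gives the square 4 x^(2a), and such that the two brackets have no common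
  zero.\<close>

definition biquad_form :: "nat \<Rightarrow> nat \<Rightarrow> mpol" where
  "biquad_form a b = mvar 1 ^ (2 * a) * (mvar 2 ^ (2 * b) + 3 * mvar 0 ^ (2 * b)) +
     mvar 0 ^ (2 * a) * (mvar 2 ^ (2 * b) - mvar 0 ^ (2 * b))"

lemma wform_plane_vars:
  "wform \<rat> plane_wts n (mvar 0 ^ n)" "wform \<rat> plane_wts n (mvar 1 ^ n)" "wform \<rat> plane_wts n (mvar 2 ^ n)"
  using rats.wform_power[OF wform_mvar[OF Rats_1, of 0 plane_wts], of n]
    rats.wform_power[OF wform_mvar[OF Rats_1, of 1 plane_wts], of n]
    rats.wform_power[OF wform_mvar[OF Rats_1, of 2 plane_wts], of n] by simp_all

lemma wform_numeral: "wform \<rat> a 0 (numeral n)"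
  using wform_mconst[of "numeral n" \<rat> a] by (simp add: mconst_def)

lemma wform_fermat: "c \<in> \<rat> \<Longrightarrow> wform \<rat> plane_wts (2 * m) (fermat_form m c)"
  unfolding fermat_form_def
  using rats.wform_mult[OF wform_mconst wform_plane_vars(2), of c]
    rats.wform_mult[OF wform_mconst wform_plane_vars(3), of c] wform_plane_vars(1)
  by (intro rats.wform_add rats.wform_diff) simp_all

lemma wform_biquad: "wform \<rat> plane_wts (2 * (a + b)) (biquad_form a b)"
proof -
  have "wform \<rat> plane_wts (2 * b) (3 * mvar 0 ^ (2 * b))"
    using rats.wform_mult[OF wform_numeral wform_plane_vars(1)] by simp
  then show ?thesis
    unfolding biquad_form_def distrib_left[of 2]
    by (intro rats.wform_add rats.wform_mult rats.wform_diff wform_plane_vars)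
qed

lemma mp_eval_fermat:
  "length v \<ge> 3 \<Longrightarrow> mp_eval v (fermat_form m c) = v ! 0 ^ (2 * m) - c * v ! 1 ^ (2 * m) + c * v ! 2 ^ (2 * m)"
  by (subgoal_tac "v \<noteq> []") (auto simp: fermat_form_def simp del: One_nat_def)

lemma mp_eval_biquad:
  "length v \<ge> 3 \<Longrightarrow> mp_eval v (biquad_form a b) =
     v ! 1 ^ (2 * a) * (v ! 2 ^ (2 * b) + 3 * v ! 0 ^ (2 * b)) + v ! 0 ^ (2 * a) * (v ! 2 ^ (2 * b) - v ! 0 ^ (2 * b))"
  by (subgoal_tac "v \<noteq> []") (auto simp: biquad_form_def simp del: One_nat_def)

lemma fermat_singular:
  assumes v: "length v \<ge> 3" and m: "m \<ge> 1" and c: "c \<noteq> 0"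
    and d: "\<And>i. i < 3 \<Longrightarrow> mp_eval v (mp_deriv i (fermat_form m c)) = 0"
  shows "v ! 0 = 0" "v ! 1 = 0" "v ! 2 = 0"
proof -
  have len: "0 < length v" "1 < length v" "2 < length v" using v by auto
  have "mp_eval v (mp_deriv 0 (fermat_form m c)) = of_nat (2 * m) * v ! 0 ^ (2 * m - 1)"
    by (rule mp_deriv_eval_eq[OF len(1)])
      (use v len in \<open>auto simp: mp_eval_fermat intro!: derivative_eq_intros\<close>)
  then show "v ! 0 = 0" using d[of 0] m by simp
  have "mp_eval v (mp_deriv 1 (fermat_form m c)) = - c * (of_nat (2 * m) * v ! 1 ^ (2 * m - 1))"
    by (rule mp_deriv_eval_eq[OF len(2)])
      (use v len in \<open>auto simp: mp_eval_fermat intro!: derivative_eq_intros\<close>)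
  then show "v ! 1 = 0" using d[of 1] m c by simp
  have "mp_eval v (mp_deriv 2 (fermat_form m c)) = c * (of_nat (2 * m) * v ! 2 ^ (2 * m - 1))"
    by (rule mp_deriv_eval_eq[OF len(3)])
      (use v len in \<open>auto simp: mp_eval_fermat intro!: derivative_eq_intros\<close>)
  then show "v ! 2 = 0" using d[of 2] m c by simp
qed

lemma plane_curve_fermat:
  assumes "m \<ge> 1" "c \<noteq> 0" "c \<in> \<rat>"
  shows "plane_curve \<rat> (2 * m) (fermat_form m c)"
  unfolding plane_curve_def
  using wform_fermat[OF assms(3)] squarefree_by_singular_locus fermat_singular[OF _ assms(1,2)] by metis

lemma smooth_curve_fermat:
  assumes "m \<ge> 1" "c \<noteq> 0"
  shows "smooth_curve (fermat_form m c)"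
  unfolding smooth_curve_def
proof (intro ballI impI)
  fix v :: "complex list" assume v: "v \<in> nonzero_vecs 3"
  then have len: "length v \<ge> 3" by (simp add: nonzero_vecs_def)
  show "\<exists>i<3. mp_eval v (mp_deriv i (fermat_form m c)) \<noteq> 0"
  proof (rule ccontr)
    assume "\<not> ?thesis"
    then have "v ! 0 = 0" "v ! 1 = 0" "v ! 2 = 0" using fermat_singular[OF len assms] by blast+
    moreover have "\<exists>i<3. v ! i \<noteq> 0" using v by (auto simp: nonzero_vecs_def in_set_conv_nth)
    ultimately show False by (auto simp: numeral_eq_Suc less_Suc_eq)
  qed
qed

lemma biquad_deriv:
  assumes len: "length v \<ge> 3" and ab: "a \<ge> 1" "b \<ge> 1"
  shows "mp_eval v (mp_deriv 0 (biquad_form a b)) =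
      v ! 1 ^ (2 * a) * (3 * (of_nat (2 * b) * v ! 0 ^ (2 * b - 1))) +
      (of_nat (2 * a) * v ! 0 ^ (2 * a - 1) * (v ! 2 ^ (2 * b) - v ! 0 ^ (2 * b)) -
        v ! 0 ^ (2 * a) * (of_nat (2 * b) * v ! 0 ^ (2 * b - 1)))"
    "mp_eval v (mp_deriv 1 (biquad_form a b)) =
      of_nat (2 * a) * v ! 1 ^ (2 * a - 1) * (v ! 2 ^ (2 * b) + 3 * v ! 0 ^ (2 * b))"
    "mp_eval v (mp_deriv 2 (biquad_form a b)) =
      of_nat (2 * b) * v ! 2 ^ (2 * b - 1) * (v ! 1 ^ (2 * a) + v ! 0 ^ (2 * a))"
proof -
  have l: "0 < length v" "1 < length v" "2 < length v" using len by auto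
  show "mp_eval v (mp_deriv 0 (biquad_form a b)) =
      v ! 1 ^ (2 * a) * (3 * (of_nat (2 * b) * v ! 0 ^ (2 * b - 1))) +
      (of_nat (2 * a) * v ! 0 ^ (2 * a - 1) * (v ! 2 ^ (2 * b) - v ! 0 ^ (2 * b)) -
        v ! 0 ^ (2 * a) * (of_nat (2 * b) * v ! 0 ^ (2 * b - 1)))"
    by (rule mp_deriv_eval_eq[OF l(1)])
      (use len l in \<open>auto simp: mp_eval_biquad intro!: derivative_eq_intros\<close>)
  show "mp_eval v (mp_deriv 1 (biquad_form a b)) =
      of_nat (2 * a) * v ! 1 ^ (2 * a - 1) * (v ! 2 ^ (2 * b) + 3 * v ! 0 ^ (2 * b))"
    by (rule mp_deriv_eval_eq[OF l(2)])
      (use len l in \<open>auto simp: mp_eval_biquad intro!: derivative_eq_intros\<close>)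
  show "mp_eval v (mp_deriv 2 (biquad_form a b)) =
      of_nat (2 * b) * v ! 2 ^ (2 * b - 1) * (v ! 1 ^ (2 * a) + v ! 0 ^ (2 * a))"
    by (rule mp_deriv_eval_eq[OF l(3)])
      (use len l in \<open>auto simp: mp_eval_biquad distrib_left intro!: derivative_eq_intros\<close>)
qed

text \<open>At a singular point with nonzero first coordinate, normalised to 1, the equation and the
  x-derivative force y^(2b) = 1. The y-derivative then forces x^(2a) = -1, so the x-derivative
  requires y^(2b) + 3 = 0, that is 4 = 0. On the line at infinity the equation reads x^(2a) y^(2b) =
  0.\<close>

lemma biquad_singular:
  assumes len: "length v \<ge> 3" and ab: "a \<ge> 1" "b \<ge> 1" and f: "mp_eval v (biquad_form a b) = 0"
    and d: "\<And>i. i < 3 \<Longrightarrow> mp_eval v (mp_deriv i (biquad_form a b)) = 0"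
  shows "v ! 0 = 0 \<and> (v ! 1 = 0 \<or> v ! 2 = 0)"
proof -
  have f': "v ! 1 ^ (2 * a) * (v ! 2 ^ (2 * b) + 3 * v ! 0 ^ (2 * b)) +
      v ! 0 ^ (2 * a) * (v ! 2 ^ (2 * b) - v ! 0 ^ (2 * b)) = 0"
    using f mp_eval_biquad[OF len] by simp
  have d1: "v ! 1 = 0 \<or> v ! 2 ^ (2 * b) + 3 * v ! 0 ^ (2 * b) = 0"
    and d2: "v ! 2 = 0 \<or> v ! 1 ^ (2 * a) + v ! 0 ^ (2 * a) = 0"
    using d[of 1] d[of 2] biquad_deriv(2,3)[OF len ab] ab by (auto simp del: One_nat_def)
  have "v ! 0 = 0"
  proof (rule ccontr)
    assume x0: "v ! 0 \<noteq> 0"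
    define A where "A = v ! 0 ^ (2 * b)"
    have "A \<noteq> 0" using x0 by (simp add: A_def)
    have eq: "v ! 2 ^ (2 * b) = A"
      using d1 f' x0 ab by (auto simp: A_def power_0_left)
    then have "v ! 2 \<noteq> 0" using \<open>A \<noteq> 0\<close> ab by auto
    then have "v ! 1 ^ (2 * a) = - (v ! 0 ^ (2 * a))" using d2 by (simp add: eq_neg_iff_add_eq_0)
    then have "v ! 1 \<noteq> 0" using x0 ab by (auto simp: power_0_left)
    then show False using d1 eq \<open>A \<noteq> 0\<close> by (simp add: A_def)
  qed
  then show ?thesis using f' ab by (auto simp: power_0_left)
qed

lemma plane_curve_biquad:
  "a \<ge> 1 \<Longrightarrow> b \<ge> 1 \<Longrightarrow> plane_curve \<rat> (2 * (a + b)) (biquad_form a b)"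
  unfolding plane_curve_def using wform_biquad squarefree_by_singular_locus biquad_singular by metis

lemma not_smooth_curve_biquad:
  assumes "a \<ge> 1" "b \<ge> 1"
  shows "\<not> smooth_curve (biquad_form a b)"
proof
  assume *: "smooth_curve (biquad_form a b)"
  let ?v = "[0, 1, 0] :: complex list"
  have ab: "2 * a - 1 \<noteq> 0" "2 * b - 1 \<noteq> 0" using assms by auto
  have "?v \<in> nonzero_vecs 3" by (simp add: nonzero_vecs_def)
  moreover have "mp_eval ?v (biquad_form a b) = 0" using assms by (simp add: mp_eval_biquad)
  moreover have "mp_eval ?v (mp_deriv i (biquad_form a b)) = 0" if "i < 3" for i
    using biquad_deriv[of ?v a b] assms ab that
    by (auto simp: numeral_eq_Suc less_Suc_eq power_0_left)
  ultimately show False using * unfolding smooth_curve_def by blast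
qed

text \<open>Here w^2 = R t is the quotient of a fibre of the surface by z -> -z. Distinct t have
  distinct square roots, so infinitude is preserved.\<close>

lemma infinite_csqrt:
  fixes R :: "rat \<Rightarrow> rat"
  assumes inf: "infinite {t. (\<forall>s. s\<^sup>2 \<noteq> t) \<and> (\<exists>w. w \<noteq> 0 \<and> w\<^sup>2 = R t)}"
    and f: "\<And>t z. z\<^sup>2 = of_rat t \<Longrightarrow> mp_eval [1, y, z] f = of_rat (R t)"
  shows "infinite {z. z\<^sup>2 \<in> \<rat> \<and> z \<notin> \<rat> \<and> (\<exists>w\<in>\<rat>. w \<noteq> 0 \<and> w\<^sup>2 = mp_eval [1, y, z] f)}"
proof -
  let ?T = "{t. (\<forall>s. s\<^sup>2 \<noteq> t) \<and> (\<exists>w. w \<noteq> 0 \<and> w\<^sup>2 = R t)}"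
  define h where "h t = csqrt (of_rat t)" for t
  have h: "(h t)\<^sup>2 = of_rat t" for t by (simp add: h_def)
  have "inj_on h ?T" by (rule inj_onI) (metis h of_rat_eq_iff)
  then have "infinite (h ` ?T)" using inf finite_imageD by blast
  moreover have "h ` ?T \<subseteq> {z. z\<^sup>2 \<in> \<rat> \<and> z \<notin> \<rat> \<and> (\<exists>w\<in>\<rat>. w \<noteq> 0 \<and> w\<^sup>2 = mp_eval [1, y, z] f)}"
  proof safe
    fix t w assume t: "\<forall>s. s\<^sup>2 \<noteq> t" and w: "w \<noteq> 0" "w\<^sup>2 = R t"
    show "(h t)\<^sup>2 \<in> \<rat>" by (simp add: h)
    show False if "h t \<in> \<rat>"
    proof -
      from that obtain s where "h t = of_rat s" by (auto elim: Rats_cases)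
      then have "of_rat (s\<^sup>2) = (of_rat t :: complex)" using h[of t] by (simp add: of_rat_power)
      then show False using t by (simp del: of_rat_power)
    qed
    show "\<exists>w\<in>\<rat>. w \<noteq> 0 \<and> w\<^sup>2 = mp_eval [1, y, h t] f"
      using w f[OF h, of t] by (intro bexI[of _ "of_rat w"]) (auto simp: of_rat_power[symmetric])
  qed
  ultimately show ?thesis using infinite_super by blast
qed

lemma infinite_odd_ints: "infinite (of_int ` {y::int. odd y} :: complex set)"
  and infinite_even_ints: "infinite (of_int ` {y::int. even y} :: complex set)"
proof -
  have inj: "inj_on (of_int :: int \<Rightarrow> complex) S" for S by (simp add: inj_on_def)
  have "infinite (range (\<lambda>n::nat. 2 * int n + 1))" "infinite (range (\<lambda>n::nat. 2 * int n))"
    by (rule range_inj_infinite, simp add: inj_def)+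
  then have "infinite {y::int. odd y}" "infinite {y::int. even y}"
    using infinite_super[of "range (\<lambda>n. 2 * int n + 1)" "{y. odd y}"]
      infinite_super[of "range (\<lambda>n. 2 * int n)" "{y. even y}"] by force+
  then show "infinite (of_int ` {y::int. odd y} :: complex set)" "infinite (of_int ` {y::int. even y} :: complex set)"
    using inj finite_imageD by blast+
qed

text \<open>For t of very negative odd valuation, c t^m dominates the equation, so its valuation has
  to be even. This dictates that the valuation of c has the parity of m: c = 2 for m = 1, 3 and c =
  1 for m = 2, 4.\<close>

lemma fermat_dense:
  assumes "1 \<le> m" "m \<le> 4"
  shows "\<exists>c. c \<noteq> 0 \<and> c \<in> \<rat> \<and> quadratic_points_dense \<rat> m (fermat_form m c)"
proof -
  have dense: "quadratic_points_dense \<rat> m (fermat_form m (of_rat c))"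
    if inf: "infinite (of_int ` Y :: complex set)"
      and T: "\<And>y. y \<in> Y \<Longrightarrow> infinite {t::rat. (\<forall>s. s\<^sup>2 \<noteq> t) \<and> (\<exists>w. w \<noteq> 0 \<and> w\<^sup>2 = 1 - c * of_int y ^ (2 * m) + c * t ^ m)}"
    for Y :: "int set" and c
  proof (rule quadratic_points_denseI[OF wform_fermat _ inf])
    fix y :: complex assume "y \<in> of_int ` Y"
    then obtain i where i: "y = of_int i" "i \<in> Y" by auto
    show "infinite {z. z\<^sup>2 \<in> \<rat> \<and> z \<notin> \<rat> \<and> (\<exists>w\<in>\<rat>. w \<noteq> 0 \<and> w\<^sup>2 = mp_eval [1, y, z] (fermat_form m (of_rat c)))}"
    proof (rule infinite_csqrt[OF T[OF i(2)]])
      fix t z assume "z\<^sup>2 = complex_of_rat t"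
      then show "mp_eval [1, y, z] (fermat_form m (of_rat c)) = of_rat (1 - c * of_int i ^ (2 * m) + c * t ^ m)"
        by (simp add: mp_eval_fermat i of_rat_add of_rat_diff of_rat_mult of_rat_power power_mult)
    qed
  qed (use assms in auto)
  from assms consider "m = 1" | "m = 2" | "m = 3" | "m = 4" by linarith
  then show ?thesis
  proof cases
    case 1
    have "quadratic_points_dense \<rat> m (fermat_form m (of_rat 2))"
      by (rule dense[OF infinite_odd_ints]) (use linear_points_infinite in \<open>simp add: 1\<close>)
    then show ?thesis by (intro exI[of _ "of_rat 2"]) simp
  next
    case 2
    have "quadratic_points_dense \<rat> m (fermat_form m (of_rat 1))"
    proof (rule dense[OF infinite_even_ints])
      fix y :: int assume "y \<in> {y. even y}"
      then show "infinite {t::rat. (\<forall>s. s\<^sup>2 \<noteq> t) \<and> (\<exists>w. w \<noteq> 0 \<and> w\<^sup>2 = 1 - 1 * of_int y ^ (2 * m) + 1 * t ^ m)}"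
        using conic_points_infinite[of "1 - y ^ 4"] by (simp add: 2)
    qed
    then show ?thesis by (intro exI[of _ "of_rat 1"]) simp
  next
    case 3
    have "quadratic_points_dense \<rat> m (fermat_form m (of_rat 2))"
    proof (rule dense[OF infinite_odd_ints])
      fix y :: int assume y: "y \<in> {y. odd y}"
      have "val2 1 2" using val2_powi[of 1] by simp
      moreover have "ge2 0 (1 - 2 * of_int y ^ 6)" using ge2_of_int[of "1 - 2 * y ^ 6"] by simp
      moreover have "val2 0 ((of_int y)\<^sup>2)" using val2_odd[of "y\<^sup>2"] y by simp
      ultimately have "infinite {t::rat. (\<forall>s. s\<^sup>2 \<noteq> t) \<and> (\<exists>w. w \<noteq> 0 \<and> w\<^sup>2 = 2 * t ^ 3 + (1 - 2 * of_int y ^ 6))}"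
        using val2_1 by (rule cubic_points_infinite) (simp_all flip: power_mult)
      then show "infinite {t::rat. (\<forall>s. s\<^sup>2 \<noteq> t) \<and> (\<exists>w. w \<noteq> 0 \<and> w\<^sup>2 = 1 - 2 * of_int y ^ (2 * m) + 2 * t ^ m)}"
        by (simp add: 3 algebra_simps)
    qed
    then show ?thesis by (intro exI[of _ "of_rat 2"]) simp
  next
    case 4
    have "quadratic_points_dense \<rat> m (fermat_form m (of_rat 1))"
      by (rule dense[OF infinite_odd_ints]) (use quartic_points_infinite in \<open>simp add: 4\<close>)
    then show ?thesis by (intro exI[of _ "of_rat 1"]) simp
  qed
qed

text \<open>With P = x^a odd the fibre is w^2 = (P^2 + 1) t^3 + (3 P^2 - 1). An odd square is 1
  modulo 4, so the leading coefficient has valuation exactly 1, and (1, 2 P) is a point from which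
  duplication can start.\<close>

lemma biquad_dense:
  assumes "a \<ge> 1"
  shows "quadratic_points_dense \<rat> (a + 3) (biquad_form a 3)"
proof (rule quadratic_points_denseI[OF wform_biquad _ infinite_odd_ints])
  fix x :: complex assume "x \<in> of_int ` {y. odd y}"
  then obtain i where i: "x = of_int i" "odd i" by auto
  define P where "P = i ^ a"
  have P: "odd P" using i by (simp add: P_def)
  then obtain j where j: "P = 2 * j + 1" by (elim oddE)
  define c e :: rat where "c = of_int (P\<^sup>2 + 1)" "e = of_int (3 * P\<^sup>2 - 1)"
  have "P\<^sup>2 + 1 = (2 * j\<^sup>2 + 2 * j + 1) * 2" by (simp add: j power2_eq_square algebra_simps)
  then have "c = of_int (2 * j\<^sup>2 + 2 * j + 1) * 2 powi 1" by (simp add: c_e_def)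
  then have c: "val2 1 c" using val2_mult[OF val2_odd val2_powi, of "2 * j\<^sup>2 + 2 * j + 1" 1] by simp
  have e: "ge2 0 e" unfolding c_e_def by (rule ge2_of_int)
  have w: "val2 1 (of_int P * 2 powi 1)" using val2_mult[OF val2_odd[OF P] val2_powi[of 1]] by simp
  have "infinite {t. (\<forall>s. s\<^sup>2 \<noteq> t) \<and> (\<exists>w. w \<noteq> 0 \<and> w\<^sup>2 = c * t ^ 3 + e)}"
    by (rule cubic_points_infinite[OF c e val2_1 w]) (simp_all add: c_e_def power_mult_distrib)
  then show "infinite {z. z\<^sup>2 \<in> \<rat> \<and> z \<notin> \<rat> \<and> (\<exists>w\<in>\<rat>. w \<noteq> 0 \<and> w\<^sup>2 = mp_eval [1, x, z] (biquad_form a 3))}"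
  proof (rule infinite_csqrt)
    fix t z assume z: "z\<^sup>2 = complex_of_rat t"
    have z6: "z ^ 6 = of_rat t ^ 3" using z power_mult[of z 2 3] by simp
    have x: "x ^ (2 * a) = (of_int P)\<^sup>2" "x ^ (a * 2) = (of_int P)\<^sup>2"
      by (simp_all add: i P_def mult.commute flip: power_mult)
    show "mp_eval [1, x, z] (biquad_form a 3) = of_rat (c * t ^ 3 + e)"
      by (simp add: mp_eval_biquad x z6 c_e_def of_rat_add of_rat_diff of_rat_mult of_rat_power algebra_simps)
  qed
qed auto

section \<open>Generic points of double covers of a product of two lines\<close>

text \<open>Algebraic independence of \<xi> and \<eta> over the rationals, stated through polynomial
  functions.\<close>

definition generic2 :: "complex \<Rightarrow> complex \<Rightarrow> bool" where
  "generic2 \<xi> \<eta> \<longleftrightarrow> (\<forall>f. polyf \<rat> 2 f \<longrightarrow> f (as3 \<xi> \<eta> 0) = 0 \<longrightarrow> (\<forall>x y. f (as3 x y 0) = 0))"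

lemma polyf_as3: "polyf k 2 f \<Longrightarrow> f (as3 x y w) = f (as3 x y 0)"
  by (rule polyf_cong_vars[of k 2]) (auto simp: less_2_cases_iff)

lemma polyf_slice_as3:
  assumes "polyf k n f"
  shows "\<exists>P. \<forall>x. f (as3 x y w) = poly P x" "\<exists>P. \<forall>y. f (as3 x y w) = poly P y"
  using polyf_slice[OF assms, of "as3 0 y w" 0] polyf_slice[OF assms, of "as3 x 0 w" 1]
  by (simp_all only: as3_upd)

lemma finite_slice_zeros:
  assumes "polyf k n f"
  shows "f (as3 x0 y w) \<noteq> 0 \<Longrightarrow> finite {x. f (as3 x y w) = 0}" "f (as3 x y0 w) \<noteq> 0 \<Longrightarrow> finite {y. f (as3 x y w) = 0}"
proof -
  obtain P where P: "\<And>x. f (as3 x y w) = poly P x" using polyf_slice_as3(1)[OF assms] by blast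
  show "finite {x. f (as3 x y w) = 0}" if "f (as3 x0 y w) \<noteq> 0"
    using that poly_roots_finite[of P] by (cases "P = 0") (auto simp: P)
  obtain Q where Q: "\<And>y. f (as3 x y w) = poly Q y" using polyf_slice_as3(2)[OF assms] by blast
  show "finite {y. f (as3 x y w) = 0}" if "f (as3 x y0 w) \<noteq> 0"
    using that poly_roots_finite[of Q] by (cases "Q = 0") (auto simp: Q)
qed

lemma avoid_countable:
  assumes "countable (C :: complex set)"
  shows "\<exists>z. z \<noteq> 0 \<and> z \<notin> C \<and> 1 / z \<notin> C"
proof -
  have "countable (insert 0 (C \<union> (\<lambda>z. 1 / z) ` C))" using assms by simp
  then obtain z where "z \<notin> insert 0 (C \<union> (\<lambda>z. 1 / z) ` C)"
    using uncountable_UNIV_complex by (metis UNIV_eq_I)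
  then show ?thesis by (intro exI[of _ z]) (force simp: image_iff)
qed

text \<open>For every nonzero f there is some y such that f(x, y) is nonzero in x; \<xi> and 1 /
  \<xi> avoid the countably many roots that arise. Then \<eta> and 1 / \<eta> avoid the roots of all
  f(\<xi>, y) and f(1 / \<xi>, y). Treating the inverses together provides generic coordinates in
  all four charts.\<close>

lemma exists_generic2:
  "\<exists>\<xi> \<eta>. generic2 \<xi> \<eta> \<and> generic2 (1 / \<xi>) \<eta> \<and> generic2 \<xi> (1 / \<eta>) \<and> generic2 (1 / \<xi>) (1 / \<eta>)"
proof -
  let ?N = "{f. polyf \<rat> 2 f \<and> (\<exists>x y. f (as3 x y 0) \<noteq> 0)}"
  have cN: "countable ?N" by (rule countable_subset[OF _ countable_polyf_Rats[of 2]]) auto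
  define yf :: "((nat \<Rightarrow> complex) \<Rightarrow> complex) \<Rightarrow> complex"
    where "yf f = (SOME y. \<exists>x. f (as3 x y 0) \<noteq> 0)" for f
  have yf: "\<exists>x. f (as3 x (yf f) 0) \<noteq> 0" if "f \<in> ?N" for f
    unfolding yf_def by (rule someI_ex) (use that in blast)
  have "countable (\<Union>f\<in>?N. {x. f (as3 x (yf f) 0) = 0})"
  proof (rule countable_UN[OF cN])
    fix f assume "f \<in> ?N"
    then show "countable {x. f (as3 x (yf f) 0) = 0}"
      using finite_slice_zeros(1)[of \<rat> 2 f _ "yf f" 0] yf[of f] by (auto intro: countable_finite)
  qed
  then obtain \<xi> where \<xi>: "\<xi> \<notin> (\<Union>f\<in>?N. {x. f (as3 x (yf f) 0) = 0})"
    "1 / \<xi> \<notin> (\<Union>f\<in>?N. {x. f (as3 x (yf f) 0) = 0})" using avoid_countable by meson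
  define C where "C = (\<Union>f\<in>?N. {y. f (as3 \<xi> y 0) = 0}) \<union> (\<Union>f\<in>?N. {y. f (as3 (1 / \<xi>) y 0) = 0})"
  have "countable {y. f (as3 \<xi> y 0) = 0}" "countable {y. f (as3 (1 / \<xi>) y 0) = 0}" if "f \<in> ?N" for f
  proof -
    have f: "polyf \<rat> 2 f" "f (as3 \<xi> (yf f) 0) \<noteq> 0" "f (as3 (1 / \<xi>) (yf f) 0) \<noteq> 0"
      using \<xi> that by blast+
    show "countable {y. f (as3 \<xi> y 0) = 0}" "countable {y. f (as3 (1 / \<xi>) y 0) = 0}"
      using finite_slice_zeros(2)[OF f(1)] f(2,3) by (auto intro: countable_finite)
  qed
  then have "countable C" unfolding C_def by (intro countable_Un countable_UN cN)
  then obtain \<eta> where \<eta>: "\<eta> \<notin> C" "1 / \<eta> \<notin> C" using avoid_countable by blast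
  have g: "generic2 z v" if "\<And>f. f \<in> ?N \<Longrightarrow> f (as3 z v 0) \<noteq> 0" for z v
    unfolding generic2_def using that by blast
  have notin: "f (as3 \<xi> v 0) \<noteq> 0" "f (as3 (1 / \<xi>) v 0) \<noteq> 0" if "v \<notin> C" "f \<in> ?N" for f v
    using that unfolding C_def by blast+
  show ?thesis
    by (rule exI[of _ \<xi>], rule exI[of _ \<eta>]) (intro conjI g notin \<eta>)
qed

definition biquad :: "nat \<Rightarrow> nat \<Rightarrow> complex \<Rightarrow> complex \<Rightarrow> complex \<Rightarrow> complex \<Rightarrow> complex \<Rightarrow> complex \<Rightarrow> complex" where
  "biquad a b p q r s x y = x ^ (2 * a) * (p * y ^ (2 * b) + q) + (r * y ^ (2 * b) + s)"

text \<open>The affine double cover with its generic point (\<xi>, \<eta>, \<omega>). Free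
  coefficients make the family stable under exchanging x and y and under inverting either one,
  operations that only permute p, q, r, s; so one affine analysis serves all charts.\<close>

locale dcover =
  fixes a b :: nat and p q r s \<xi> \<eta> \<omega> :: complex
  assumes a: "a \<ge> 1" and b: "b \<ge> 1"
    and rat: "p \<in> \<rat>" "q \<in> \<rat>" "r \<in> \<rat>" "s \<in> \<rat>"
    and nz: "p \<noteq> 0" "q \<noteq> 0" "r \<noteq> 0" "s \<noteq> 0" and det: "p * s \<noteq> q * r"
    and gen: "generic2 \<xi> \<eta>" and \<omega>: "\<omega>\<^sup>2 = biquad a b p q r s \<xi> \<eta>"
begin

abbreviation "B \<equiv> biquad a b p q r s"

lemma swap: "dcover b a p r q s \<eta> \<xi> \<omega>"
proof
  show "generic2 \<eta> \<xi>"
    unfolding generic2_def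
  proof (intro allI impI)
    fix f x y assume f: "polyf \<rat> 2 f" and "f (as3 \<eta> \<xi> 0) = 0"
    define \<sigma> where "\<sigma> i = (\<lambda>u::nat\<Rightarrow>complex. u (1 - i))" for i :: nat
    have *: "f (\<lambda>i. \<sigma> i (as3 x y 0)) = f (as3 y x 0)" for x y
      by (rule polyf_cong_vars[OF f]) (auto simp: \<sigma>_def less_2_cases_iff)
    have "polyf \<rat> 2 (\<lambda>u. f (\<lambda>i. \<sigma> i u))"
      by (rule polyf_subst[OF f]) (auto simp: \<sigma>_def intro: polyf_var)
    then show "f (as3 x y 0) = 0"
      using gen \<open>f (as3 \<eta> \<xi> 0) = 0\<close> unfolding generic2_def by (metis *)
  qed
qed (use a b rat nz det \<omega> in \<open>auto simp: biquad_def algebra_simps\<close>)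

lemma genericD: "polyf \<rat> 2 f \<Longrightarrow> f (as3 \<xi> \<eta> 0) = 0 \<Longrightarrow> f (as3 x y w) = 0"
  using gen polyf_as3[of \<rat> f x y w] unfolding generic2_def by metis

lemma polyf_B: "polyf \<rat> 2 (\<lambda>u. B (u 0) (u 1))"
  unfolding biquad_def by (intro polyf_Rats_intros rat) auto

lemma X_nonzero: "\<xi> \<noteq> 0" and Y_nonzero: "\<eta> \<noteq> 0"
  using genericD[OF polyf_var[where i = 0], of 1 1 0] genericD[OF polyf_var[where i = 1], of 1 1 0] by auto

text \<open>Except for finitely many y, \<open>B\<close> is a binomial in x with nonzero
  coefficients and has a simple root. There f0^2 has even order and f1^2 B odd order, unless both
  vanish.\<close>

lemma B_not_square:
  assumes f: "polyf k 2 f0" "polyf k 2 f1" and sq: "\<And>x y. (f0 (as3 x y 0))\<^sup>2 = (f1 (as3 x y 0))\<^sup>2 * B x y"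
  shows "f0 (as3 x y 0) = 0 \<and> f1 (as3 x y 0) = 0"
proof -
  define bad where "bad = {y. p * y ^ (2 * b) + q = 0} \<union> {y. r * y ^ (2 * b) + s = 0}"
  have fin: "finite bad"
  proof -
    have "finite {y. c * y ^ (2 * b) + d = 0}" if "c \<noteq> 0" for c d :: complex
    proof -
      let ?P = "Polynomial.monom c (2 * b) + [:d:]"
      have "Polynomial.coeff ?P (2 * b) = c" using b by (cases b) auto
      then have "?P \<noteq> 0" using that by (metis coeff_0)
      from poly_roots_finite[OF this] show ?thesis by (simp add: poly_monom)
    qed
    then show ?thesis using nz by (simp add: bad_def)
  qed
  have good: "f0 (as3 x y 0) = 0 \<and> f1 (as3 x y 0) = 0" if y: "y \<notin> bad" for x y
  proof -
    define \<alpha> \<beta> where ab_def: "\<alpha> = p * y ^ (2 * b) + q" "\<beta> = r * y ^ (2 * b) + s"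
    have \<alpha>\<beta>: "\<alpha> \<noteq> 0" "\<beta> \<noteq> 0" using y by (auto simp: bad_def ab_def)
    obtain P0 where P0: "\<And>x. f0 (as3 x y 0) = poly P0 x" using polyf_slice_as3(1)[OF f(1)] by blast
    obtain P1 where P1: "\<And>x. f1 (as3 x y 0) = poly P1 x" using polyf_slice_as3(1)[OF f(2)] by blast
    define Q where "Q = Polynomial.monom \<alpha> (2 * a) + [:\<beta>:]"
    have Q: "poly Q x = B x y" for x by (simp add: Q_def poly_monom biquad_def ab_def mult.commute)
    have "Polynomial.coeff Q (2 * a) = \<alpha>" using a by (cases a) (auto simp: Q_def)
    then have "Polynomial.degree Q \<noteq> 0" "Q \<noteq> 0" using \<alpha>\<beta>(1) a le_degree[of Q "2 * a"] by auto
    then obtain z where z: "poly Q z = 0"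
      using fundamental_theorem_of_algebra[of Q] constant_degree[of Q] by auto
    have "z \<noteq> 0" using z \<alpha>\<beta>(2) a by (auto simp: Q_def poly_monom power_0_left)
    have "poly (pderiv Q) z = \<alpha> * of_nat (2 * a) * z ^ (2 * a - 1)"
      by (simp add: Q_def pderiv_add pderiv_monom poly_monom pderiv_pCons)
    then have "poly (pderiv Q) z \<noteq> 0" using \<open>z \<noteq> 0\<close> \<alpha>\<beta>(1) a by simp
    then have ord: "Polynomial.order z Q = 1"
      using order_pderiv[of Q z] z \<open>Q \<noteq> 0\<close> order_root[of Q z] order_root[of "pderiv Q" z] by auto
    have PQ: "P0\<^sup>2 = P1\<^sup>2 * Q"
      using sq[of _ y] by (simp add: P0 P1 Q poly_eq_poly_eq_iff[symmetric] fun_eq_iff)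
    have "P1 = 0"
    proof (rule ccontr)
      assume P1: "P1 \<noteq> 0"
      then have "P0 \<noteq> 0" using PQ \<open>Q \<noteq> 0\<close> by auto
      have "Polynomial.order z (P0\<^sup>2) = 2 * Polynomial.order z P0" using \<open>P0 \<noteq> 0\<close> by (simp add: power2_eq_square order_mult)
      moreover have "Polynomial.order z (P1\<^sup>2 * Q) = 2 * Polynomial.order z P1 + 1"
        using P1 \<open>Q \<noteq> 0\<close> by (simp add: power2_eq_square order_mult ord)
      ultimately have "2 * Polynomial.order z P0 = 2 * Polynomial.order z P1 + 1" using PQ by simp
      then show False by presburger
    qed
    then show ?thesis using PQ P0 P1 by simp
  qed
  have inf: "infinite (UNIV - bad)" using fin by (simp add: infinite_UNIV_char_0)
  have "infinite {y. f0 (as3 x y 0) = 0}" "infinite {y. f1 (as3 x y 0) = 0}"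
    by (rule infinite_super[OF _ inf]; use good in blast)+
  then show ?thesis
    using finite_slice_zeros(2)[OF f(1), of x y 0] finite_slice_zeros(2)[OF f(2), of x y 0] by blast
qed

text \<open>Linear independence of 1 and \<omega> over the field of \<xi> and \<eta>: a relation
  makes the norm f0^2 - f1^2 B vanish at the generic point, hence identically.\<close>

lemma split_unique:
  assumes f: "polyf \<rat> 2 f0" "polyf \<rat> 2 f1" and zero: "f0 (as3 \<xi> \<eta> 0) + f1 (as3 \<xi> \<eta> 0) * \<omega> = 0"
  shows "f0 (as3 x y w) = 0" "f1 (as3 x y w) = 0"
proof -
  let ?g = "\<lambda>u. (f0 u)\<^sup>2 - (f1 u)\<^sup>2 * B (u 0) (u 1)"
  have "polyf \<rat> 2 ?g"
    by (intro polyf_Rats_intros f polyf_B) auto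
  moreover have "f0 (as3 \<xi> \<eta> 0) = - f1 (as3 \<xi> \<eta> 0) * \<omega>" using zero by (simp add: eq_neg_iff_add_eq_0)
  then have "?g (as3 \<xi> \<eta> 0) = 0" using \<omega> by (simp add: power_mult_distrib)
  ultimately have "?g (as3 x y 0) = 0" for x y using genericD by blast
  then have "f0 (as3 x y 0) = 0 \<and> f1 (as3 x y 0) = 0"
    by (intro B_not_square[OF f]) simp
  then show "f0 (as3 x y w) = 0" "f1 (as3 x y w) = 0" 
    by (simp_all only: polyf_as3[OF f(1), of x y w] polyf_as3[OF f(2), of x y w])
qed

lemma split:
  assumes "polyf \<rat> 3 F"
  shows "\<exists>F0 F1. polyf \<rat> 2 F0 \<and> polyf \<rat> 2 F1 \<and>
    (\<forall>x y w. w\<^sup>2 = B x y \<longrightarrow> F (as3 x y w) = F0 (as3 x y 0) + F1 (as3 x y 0) * w)"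
proof -
  have "polyf \<rat> (Suc 2) F" using assms by (simp add: numeral_3_eq_3)
  from polyf_split[OF this polyf_B] obtain F0 F1 where F: "polyf \<rat> 2 F0" "polyf \<rat> 2 F1"
    "\<And>u. (u 2)\<^sup>2 = B (u 0) (u 1) \<Longrightarrow> F u = F0 u + F1 u * u 2" by auto
  have "F (as3 x y w) = F0 (as3 x y 0) + F1 (as3 x y 0) * w" if "w\<^sup>2 = B x y" for x y w
    using F(3)[of "as3 x y w"] that polyf_as3[OF F(1), of x y w] polyf_as3[OF F(2), of x y w] by simp
  then show ?thesis using F(1,2) by blast
qed

text \<open>This is what makes (\<xi>, \<eta>, \<omega>) a generic point of the cover: a rational
  polynomial relation there holds at every complex point.\<close>

lemma specialize:
  assumes "polyf \<rat> 3 F" "F (as3 \<xi> \<eta> \<omega>) = 0" "w\<^sup>2 = B x y"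
  shows "F (as3 x y w) = 0"
proof -
  obtain F0 F1 where F: "polyf \<rat> 2 F0" "polyf \<rat> 2 F1"
    "\<And>x y w. w\<^sup>2 = B x y \<Longrightarrow> F (as3 x y w) = F0 (as3 x y 0) + F1 (as3 x y 0) * w"
    using split[OF assms(1)] by blast
  have "F0 (as3 \<xi> \<eta> 0) + F1 (as3 \<xi> \<eta> 0) * \<omega> = 0" using F(3)[OF \<omega>] assms(2) by simp
  from split_unique[OF F(1,2) this, of x y 0] F(3)[OF assms(3)] show ?thesis by simp
qed

lemma W_nonzero: "\<omega> \<noteq> 0"
  using specialize[OF polyf_var[where i = 2], of "csqrt (B 0 0)" 0 0] nz a b by (auto simp: biquad_def power_0_left)

text \<open>Smoothness of the affine branch curve. For x \<noteq> 0 both brackets of the equation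
  would vanish at y, against \<open>det\<close>; for x = 0 the y-derivative leaves only the origin,
  where the equation reads s = 0.\<close>

lemma biquad_nonsingular:
  assumes "B x y = 0"
  shows "of_nat (2 * a) * x ^ (2 * a - 1) * (p * y ^ (2 * b) + q) \<noteq> 0 \<or>
    of_nat (2 * b) * y ^ (2 * b - 1) * (p * x ^ (2 * a) + r) \<noteq> 0"
proof (rule ccontr)
  assume "\<not> ?thesis"
  then have c: "x = 0 \<or> p * y ^ (2 * b) + q = 0" "y = 0 \<or> p * x ^ (2 * a) + r = 0" using a b by auto
  have B0: "x ^ (2 * a) * (p * y ^ (2 * b) + q) + (r * y ^ (2 * b) + s) = 0" using assms by (simp add: biquad_def)
  show False
  proof (cases "x = 0")
    case True
    then show ?thesis using c(2) B0 nz a b by (auto simp: power_0_left)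
  next
    case False
    then have 1: "p * y ^ (2 * b) + q = 0" using c by simp
    then have "y \<noteq> 0" using nz b by (auto simp: power_0_left)
    have "r * y ^ (2 * b) + s = 0" using B0 1 by simp
    then have "p * (r * y ^ (2 * b) + s) - r * (p * y ^ (2 * b) + q) = 0" using 1 by simp
    then show ?thesis using det by (simp add: algebra_simps)
  qed
qed

end

section \<open>Local rings and differentials\<close>

text \<open>The local ring of the affine surface at (x, y, w), embedded into the complex numbers by
  evaluation at the generic point. At the generic point itself it is the function field
  \<open>FF\<close>.\<close>

definition regring :: "complex \<Rightarrow> complex \<Rightarrow> complex \<Rightarrow> complex \<Rightarrow> complex \<Rightarrow> complex \<Rightarrow> complex set" where
  "regring \<xi> \<eta> \<omega> x y w =
     {A (as3 \<xi> \<eta> \<omega>) / G (as3 \<xi> \<eta> \<omega>) | A G. polyf \<rat> 3 A \<and> polyf \<rat> 3 G \<and> G (as3 x y w) \<noteq> 0}"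

lemma canonical_stalk_0: "0 \<in> canonical_stalk D1 D2 R n"
  unfolding canonical_stalk_def by (intro CollectI exI[of _ "0::nat"] exI conjI) auto

lemma canonical_stalk_add:
  assumes "h \<in> canonical_stalk D1 D2 R n" "h' \<in> canonical_stalk D1 D2 R n"
  shows "h + h' \<in> canonical_stalk D1 D2 R n"
proof -
  obtain l :: nat and c u v where h: "h = (\<Sum>i<l. c i * (\<Prod>j<n. wedge D1 D2 (u i j) (v i j)))"
    "\<forall>i<l. c i \<in> R \<and> (\<forall>j<n. u i j \<in> R \<and> v i j \<in> R)"
    using assms(1) unfolding canonical_stalk_def by blast
  obtain l' :: nat and c' u' v' where h': "h' = (\<Sum>i<l'. c' i * (\<Prod>j<n. wedge D1 D2 (u' i j) (v' i j)))"
    "\<forall>i<l'. c' i \<in> R \<and> (\<forall>j<n. u' i j \<in> R \<and> v' i j \<in> R)"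
    using assms(2) unfolding canonical_stalk_def by blast
  define c'' u'' v'' where "c'' i = (if i < l then c i else c' (i - l))"
    "u'' i = (if i < l then u i else u' (i - l))" "v'' i = (if i < l then v i else v' (i - l))" for i
  have "(\<Sum>i<l + l'. c'' i * (\<Prod>j<n. wedge D1 D2 (u'' i j) (v'' i j))) =
      (\<Sum>i<l. c'' i * (\<Prod>j<n. wedge D1 D2 (u'' i j) (v'' i j))) +
      (\<Sum>i<l'. c'' (l + i) * (\<Prod>j<n. wedge D1 D2 (u'' (l + i) j) (v'' (l + i) j)))"
    by (induction l') (auto simp: add.assoc)
  also have "\<dots> = h + h'" unfolding h h' by (simp add: c''_u''_v''_def)
  finally show ?thesis
    unfolding canonical_stalk_def
    by (intro CollectI exI[of _ "l + l'"] exI[of _ c''] exI[of _ u''] exI[of _ v''] conjI)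
      (use h(2) h'(2) in \<open>auto simp: c''_u''_v''_def\<close>)
qed

lemma canonical_stalk_mult:
  assumes "h \<in> canonical_stalk D1 D2 R n" "\<And>e. e \<in> R \<Longrightarrow> d * e \<in> R"
  shows "d * h \<in> canonical_stalk D1 D2 R n"
proof -
  obtain l :: nat and c u v where h: "h = (\<Sum>i<l. c i * (\<Prod>j<n. wedge D1 D2 (u i j) (v i j)))"
    "\<forall>i<l. c i \<in> R \<and> (\<forall>j<n. u i j \<in> R \<and> v i j \<in> R)"
    using assms(1) unfolding canonical_stalk_def by blast
  then show ?thesis
    unfolding canonical_stalk_def
    by (intro CollectI exI[of _ l] exI[of _ "\<lambda>i. d * c i"] exI[of _ u] exI[of _ v] conjI)
      (use assms(2) in \<open>auto simp: sum_distrib_left mult.assoc\<close>)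
qed

context dcover
begin

abbreviation "reg \<equiv> regring \<xi> \<eta> \<omega>"
abbreviation "FF \<equiv> regring \<xi> \<eta> \<omega> \<xi> \<eta> \<omega>"

lemma reg_denominator: "polyf \<rat> 3 G \<Longrightarrow> G (as3 x y w) \<noteq> 0 \<Longrightarrow> w\<^sup>2 = B x y \<Longrightarrow> G (as3 \<xi> \<eta> \<omega>) \<noteq> 0"
  using specialize by blast

lemma regI: "polyf \<rat> 3 A \<Longrightarrow> polyf \<rat> 3 G \<Longrightarrow> G (as3 x y w) \<noteq> 0 \<Longrightarrow> A (as3 \<xi> \<eta> \<omega>) / G (as3 \<xi> \<eta> \<omega>) \<in> reg x y w"
  unfolding regring_def by blast

lemma regE:
  assumes "h \<in> reg x y w" "w\<^sup>2 = B x y"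
  obtains A G where "polyf \<rat> 3 A" "polyf \<rat> 3 G" "G (as3 x y w) \<noteq> 0" "G (as3 \<xi> \<eta> \<omega>) \<noteq> 0"
    "h = A (as3 \<xi> \<eta> \<omega>) / G (as3 \<xi> \<eta> \<omega>)"
  using assms reg_denominator unfolding regring_def by blast

lemma reg_polyf: "polyf \<rat> 3 A \<Longrightarrow> A (as3 \<xi> \<eta> \<omega>) \<in> reg x y w"
  using regI[of A "\<lambda>u. 1" x y w] by (simp add: polyf_const)

lemma reg_Rats: "c \<in> \<rat> \<Longrightarrow> c \<in> reg x y w"
  using reg_polyf[OF polyf_const] by simp

lemma reg_var: "\<xi> \<in> reg x y w" "\<eta> \<in> reg x y w" "\<omega> \<in> reg x y w"
  using reg_polyf[OF polyf_var[where i = 0]] reg_polyf[OF polyf_var[where i = 1]]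
    reg_polyf[OF polyf_var[where i = 2]] by simp_all

context
  fixes x y w
  assumes w: "w\<^sup>2 = B x y"
begin

lemma reg_add: "h \<in> reg x y w \<Longrightarrow> h' \<in> reg x y w \<Longrightarrow> h + h' \<in> reg x y w"
proof (elim regE[OF _ w])
  fix A G A' G' assume *: "polyf \<rat> 3 A" "polyf \<rat> 3 G" "polyf \<rat> 3 A'" "polyf \<rat> 3 G'"
    "G (as3 x y w) \<noteq> 0" "G' (as3 x y w) \<noteq> 0" "G (as3 \<xi> \<eta> \<omega>) \<noteq> 0" "G' (as3 \<xi> \<eta> \<omega>) \<noteq> 0"
    "h = A (as3 \<xi> \<eta> \<omega>) / G (as3 \<xi> \<eta> \<omega>)" "h' = A' (as3 \<xi> \<eta> \<omega>) / G' (as3 \<xi> \<eta> \<omega>)"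
  have "polyf \<rat> 3 (\<lambda>u. A u * G' u + A' u * G u)" "polyf \<rat> 3 (\<lambda>u. G u * G' u)"
    by (intro polyf_add polyf_mult *)+
  from regI[OF this, of x y w] * show ?thesis by (simp add: add_frac_eq)
qed

lemma reg_mult: "h \<in> reg x y w \<Longrightarrow> h' \<in> reg x y w \<Longrightarrow> h * h' \<in> reg x y w"
proof (elim regE[OF _ w])
  fix A G A' G' assume *: "polyf \<rat> 3 A" "polyf \<rat> 3 G" "polyf \<rat> 3 A'" "polyf \<rat> 3 G'"
    "G (as3 x y w) \<noteq> 0" "G' (as3 x y w) \<noteq> 0" "G (as3 \<xi> \<eta> \<omega>) \<noteq> 0" "G' (as3 \<xi> \<eta> \<omega>) \<noteq> 0"
    "h = A (as3 \<xi> \<eta> \<omega>) / G (as3 \<xi> \<eta> \<omega>)" "h' = A' (as3 \<xi> \<eta> \<omega>) / G' (as3 \<xi> \<eta> \<omega>)"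
  have "polyf \<rat> 3 (\<lambda>u. A u * A' u)" "polyf \<rat> 3 (\<lambda>u. G u * G' u)"
    by (intro polyf_mult *)+
  from regI[OF this, of x y w] * show ?thesis by simp
qed

lemma reg_diff: "h \<in> reg x y w \<Longrightarrow> h' \<in> reg x y w \<Longrightarrow> h - h' \<in> reg x y w"
  using reg_add[of h "- 1 * h'"] reg_mult[OF reg_Rats, of "- 1" h'] by simp

lemma reg_power: "h \<in> reg x y w \<Longrightarrow> h ^ n \<in> reg x y w"
  by (induction n) (auto intro: reg_mult reg_Rats)

lemma reg_sum: "(\<And>i. i \<in> I \<Longrightarrow> h i \<in> reg x y w) \<Longrightarrow> (\<Sum>i\<in>I. h i) \<in> reg x y w"
  by (induction I rule: infinite_finite_induct) (auto intro: reg_add reg_Rats)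

lemma reg_subset_FF: "reg x y w \<subseteq> FF"
  by (auto elim!: regE[OF _ w] intro: regI)

end

lemmas FF_add = reg_add[OF \<omega>] and FF_mult = reg_mult[OF \<omega>] and FF_power = reg_power[OF \<omega>]
  and FF_diff = reg_diff[OF \<omega>]

lemma FF_divide: "h \<in> FF \<Longrightarrow> h' \<in> FF \<Longrightarrow> h / h' \<in> FF"
proof (elim regE[OF _ \<omega>])
  fix A G A' G' assume *: "polyf \<rat> 3 A" "polyf \<rat> 3 G" "polyf \<rat> 3 A'" "polyf \<rat> 3 G'"
    "G (as3 \<xi> \<eta> \<omega>) \<noteq> 0" "G' (as3 \<xi> \<eta> \<omega>) \<noteq> 0"
    "h = A (as3 \<xi> \<eta> \<omega>) / G (as3 \<xi> \<eta> \<omega>)" "h' = A' (as3 \<xi> \<eta> \<omega>) / G' (as3 \<xi> \<eta> \<omega>)"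
  have "polyf \<rat> 3 (\<lambda>u. A u * G' u)" "polyf \<rat> 3 (\<lambda>u. G u * A' u)"
    by (intro polyf_mult *)+
  from regI[OF this, of \<xi> \<eta> \<omega>] * show "h / h' \<in> FF"
    by (cases "A' (as3 \<xi> \<eta> \<omega>) = 0") (auto intro: reg_Rats)
qed

lemma derivation_simps:
  assumes D: "derivation \<rat> FF D"
  shows "c \<in> \<rat> \<Longrightarrow> D c = 0"
    and "u \<in> FF \<Longrightarrow> v \<in> FF \<Longrightarrow> D (u + v) = D u + D v"
    and "u \<in> FF \<Longrightarrow> v \<in> FF \<Longrightarrow> D (u * v) = u * D v + v * D u"
    and "u \<in> FF \<Longrightarrow> D u \<in> FF"
  using D unfolding derivation_def by auto

lemma derivation_power:
  assumes D: "derivation \<rat> FF D" and u: "u \<in> FF"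
  shows "D (u ^ n) = of_nat n * u ^ (n - 1) * D u"
proof (induction n)
  case 0
  show ?case using derivation_simps(1)[OF D, of 1] by simp
next
  case (Suc n)
  have "D (u ^ Suc n) = u * D (u ^ n) + u ^ n * D u"
    using derivation_simps(3)[OF D u FF_power[OF u]] by simp
  also have "\<dots> = of_nat (Suc n) * u ^ (Suc n - 1) * D u"
    unfolding Suc by (cases n) (simp_all add: algebra_simps)
  finally show ?case .
qed

lemma derivation_divide:
  assumes D: "derivation \<rat> FF D" and u: "u \<in> FF" "v \<in> FF" "v \<noteq> 0"
  shows "D (u / v) = (v * D u - u * D v) / v\<^sup>2"
proof -
  have "D u = D (u / v * v)" using u by simp
  also have "\<dots> = u / v * D v + v * D (u / v)"
    by (rule derivation_simps(3)[OF D FF_divide[OF u(1,2)] u(2)])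
  finally have *: "v * D (u / v) = D u - u / v * D v" by simp
  have "D (u / v) * v\<^sup>2 = v * (v * D (u / v))" by (simp add: power2_eq_square)
  also have "\<dots> = v * D u - u * D v" unfolding * using u(3) by (simp add: right_diff_distrib)
  finally show ?thesis using u(3) by (simp add: nonzero_eq_divide_eq)
qed

definition "Bx x y = of_nat (2 * a) * x ^ (2 * a - 1) * (p * y ^ (2 * b) + q)"
definition "By x y = of_nat (2 * b) * y ^ (2 * b - 1) * (p * x ^ (2 * a) + r)"

lemma polyf_Bx: "polyf \<rat> 3 (\<lambda>u. Bx (u 0) (u 1))" and polyf_By: "polyf \<rat> 3 (\<lambda>u. By (u 0) (u 1))"
  unfolding Bx_def By_def by (intro polyf_Rats_intros rat; simp)+

lemma derivation_W:
  assumes D: "derivation \<rat> FF D"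
  shows "2 * \<omega> * D \<omega> = Bx \<xi> \<eta> * D \<xi> + By \<xi> \<eta> * D \<eta>"
proof -
  note d = derivation_simps(1-3)[OF D] derivation_power[OF D]
  have "2 * \<omega> * D \<omega> = D (\<omega>\<^sup>2)" using d(4)[OF reg_var(3), of 2] by simp
  also have "\<dots> = D (\<xi> ^ (2 * a) * (p * \<eta> ^ (2 * b) + q) + (r * \<eta> ^ (2 * b) + s))"
    unfolding \<omega> biquad_def ..
  also have "\<dots> = Bx \<xi> \<eta> * D \<xi> + By \<xi> \<eta> * D \<eta>"
    by (simp add: d FF_add FF_mult FF_power reg_var reg_Rats rat Bx_def By_def algebra_simps)
  finally show ?thesis .
qed

text \<open>The coefficients are chosen before the derivation: the same ones must serve both
  derivations in a wedge.\<close>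

lemma derivation_polyf:
  assumes "polyf \<rat> 3 A"
  shows "\<exists>\<alpha> \<beta> \<gamma>. polyf \<rat> 3 \<alpha> \<and> polyf \<rat> 3 \<beta> \<and> polyf \<rat> 3 \<gamma> \<and> (\<forall>D. derivation \<rat> FF D \<longrightarrow>
    D (A (as3 \<xi> \<eta> \<omega>)) = \<alpha> (as3 \<xi> \<eta> \<omega>) * D \<xi> + \<beta> (as3 \<xi> \<eta> \<omega>) * D \<eta> + \<gamma> (as3 \<xi> \<eta> \<omega>) * D \<omega>)"
  using assms
proof (induction rule: polyf.induct)
  case (polyf_const c)
  have z: "polyf \<rat> 3 (\<lambda>u. 0)" by (rule polyf.polyf_const) simp
  have "D c = 0 * D \<xi> + 0 * D \<eta> + 0 * D \<omega>" if "derivation \<rat> FF D" for D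
    using derivation_simps(1)[OF that polyf_const] by simp
  then show ?case using z by blast
next
  case (polyf_var i)
  define e where "e j = (\<lambda>u::nat \<Rightarrow> complex. if i = j then 1 else 0 :: complex)" for j
  have "polyf \<rat> 3 (e j)" for j unfolding e_def by (auto intro: polyf.intros)
  moreover have "D (as3 \<xi> \<eta> \<omega> i) = e 0 (as3 \<xi> \<eta> \<omega>) * D \<xi> + e 1 (as3 \<xi> \<eta> \<omega>) * D \<eta> + e 2 (as3 \<xi> \<eta> \<omega>) * D \<omega>" for D
    using polyf_var by (auto simp: e_def less_Suc_eq numeral_3_eq_3 numeral_2_eq_2 as3_def)
  ultimately show ?case by blast
next
  case (polyf_add f g)
  from polyf_add.IH(1) obtain \<alpha> \<beta> \<gamma> where *: "polyf \<rat> 3 \<alpha>" "polyf \<rat> 3 \<beta>" "polyf \<rat> 3 \<gamma>"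
    "\<forall>D. derivation \<rat> FF D \<longrightarrow> D (f (as3 \<xi> \<eta> \<omega>)) = \<alpha> (as3 \<xi> \<eta> \<omega>) * D \<xi> + \<beta> (as3 \<xi> \<eta> \<omega>) * D \<eta> + \<gamma> (as3 \<xi> \<eta> \<omega>) * D \<omega>"
    by (elim exE conjE)
  from polyf_add.IH(2) obtain \<alpha>' \<beta>' \<gamma>' where **: "polyf \<rat> 3 \<alpha>'" "polyf \<rat> 3 \<beta>'" "polyf \<rat> 3 \<gamma>'"
    "\<forall>D. derivation \<rat> FF D \<longrightarrow> D (g (as3 \<xi> \<eta> \<omega>)) = \<alpha>' (as3 \<xi> \<eta> \<omega>) * D \<xi> + \<beta>' (as3 \<xi> \<eta> \<omega>) * D \<eta> + \<gamma>' (as3 \<xi> \<eta> \<omega>) * D \<omega>"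
    by (elim exE conjE)
  have "D (f (as3 \<xi> \<eta> \<omega>) + g (as3 \<xi> \<eta> \<omega>)) = (\<alpha> (as3 \<xi> \<eta> \<omega>) + \<alpha>' (as3 \<xi> \<eta> \<omega>)) * D \<xi>
      + (\<beta> (as3 \<xi> \<eta> \<omega>) + \<beta>' (as3 \<xi> \<eta> \<omega>)) * D \<eta> + (\<gamma> (as3 \<xi> \<eta> \<omega>) + \<gamma>' (as3 \<xi> \<eta> \<omega>)) * D \<omega>"
    if D: "derivation \<rat> FF D" for D
    unfolding derivation_simps(2)[OF D reg_polyf[OF polyf_add(1)] reg_polyf[OF polyf_add(2)]]
      *(4)[rule_format, OF D] **(4)[rule_format, OF D] by (simp add: algebra_simps)
  moreover have "polyf \<rat> 3 (\<lambda>u. \<alpha> u + \<alpha>' u)" "polyf \<rat> 3 (\<lambda>u. \<beta> u + \<beta>' u)" "polyf \<rat> 3 (\<lambda>u. \<gamma> u + \<gamma>' u)"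
    by (intro polyf.polyf_add * **)+
  ultimately show ?case by (intro exI conjI allI impI)
next
  case (polyf_mult f g)
  from polyf_mult.IH(1) obtain \<alpha> \<beta> \<gamma> where *: "polyf \<rat> 3 \<alpha>" "polyf \<rat> 3 \<beta>" "polyf \<rat> 3 \<gamma>"
    "\<forall>D. derivation \<rat> FF D \<longrightarrow> D (f (as3 \<xi> \<eta> \<omega>)) = \<alpha> (as3 \<xi> \<eta> \<omega>) * D \<xi> + \<beta> (as3 \<xi> \<eta> \<omega>) * D \<eta> + \<gamma> (as3 \<xi> \<eta> \<omega>) * D \<omega>"
    by (elim exE conjE)
  from polyf_mult.IH(2) obtain \<alpha>' \<beta>' \<gamma>' where **: "polyf \<rat> 3 \<alpha>'" "polyf \<rat> 3 \<beta>'" "polyf \<rat> 3 \<gamma>'"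
    "\<forall>D. derivation \<rat> FF D \<longrightarrow> D (g (as3 \<xi> \<eta> \<omega>)) = \<alpha>' (as3 \<xi> \<eta> \<omega>) * D \<xi> + \<beta>' (as3 \<xi> \<eta> \<omega>) * D \<eta> + \<gamma>' (as3 \<xi> \<eta> \<omega>) * D \<omega>"
    by (elim exE conjE)
  have "D (f (as3 \<xi> \<eta> \<omega>) * g (as3 \<xi> \<eta> \<omega>)) =
        (f (as3 \<xi> \<eta> \<omega>) * \<alpha>' (as3 \<xi> \<eta> \<omega>) + g (as3 \<xi> \<eta> \<omega>) * \<alpha> (as3 \<xi> \<eta> \<omega>)) * D \<xi>
      + (f (as3 \<xi> \<eta> \<omega>) * \<beta>' (as3 \<xi> \<eta> \<omega>) + g (as3 \<xi> \<eta> \<omega>) * \<beta> (as3 \<xi> \<eta> \<omega>)) * D \<eta>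
      + (f (as3 \<xi> \<eta> \<omega>) * \<gamma>' (as3 \<xi> \<eta> \<omega>) + g (as3 \<xi> \<eta> \<omega>) * \<gamma> (as3 \<xi> \<eta> \<omega>)) * D \<omega>"
    if D: "derivation \<rat> FF D" for D
    unfolding derivation_simps(3)[OF D reg_polyf[OF polyf_mult(1)] reg_polyf[OF polyf_mult(2)]]
      *(4)[rule_format, OF D] **(4)[rule_format, OF D] by (simp add: algebra_simps)
  moreover have "polyf \<rat> 3 (\<lambda>u. f u * \<alpha>' u + g u * \<alpha> u)" "polyf \<rat> 3 (\<lambda>u. f u * \<beta>' u + g u * \<beta> u)"
    "polyf \<rat> 3 (\<lambda>u. f u * \<gamma>' u + g u * \<gamma> u)"
    by (intro polyf.polyf_add polyf.polyf_mult polyf_mult(1,2) *(1-3) **(1-3))+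
  ultimately show ?case by (intro exI conjI allI impI)
qed

lemma derivation_chain:
  assumes "h \<in> reg x y w" and w: "w\<^sup>2 = B x y"
  shows "\<exists>\<alpha>\<in>reg x y w. \<exists>\<beta>\<in>reg x y w. \<exists>\<gamma>\<in>reg x y w. \<forall>D. derivation \<rat> FF D \<longrightarrow> D h = \<alpha> * D \<xi> + \<beta> * D \<eta> + \<gamma> * D \<omega>"
proof -
  obtain A G where h: "polyf \<rat> 3 A" "polyf \<rat> 3 G" "G (as3 x y w) \<noteq> 0" "G (as3 \<xi> \<eta> \<omega>) \<noteq> 0"
    "h = A (as3 \<xi> \<eta> \<omega>) / G (as3 \<xi> \<eta> \<omega>)" using regE[OF assms] by blast
  obtain \<alpha> \<beta> \<gamma> where A: "polyf \<rat> 3 \<alpha>" "polyf \<rat> 3 \<beta>" "polyf \<rat> 3 \<gamma>"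
    "\<And>D. derivation \<rat> FF D \<Longrightarrow> D (A (as3 \<xi> \<eta> \<omega>)) = \<alpha> (as3 \<xi> \<eta> \<omega>) * D \<xi> + \<beta> (as3 \<xi> \<eta> \<omega>) * D \<eta> + \<gamma> (as3 \<xi> \<eta> \<omega>) * D \<omega>"
    using derivation_polyf[OF h(1)] by blast
  obtain \<alpha>' \<beta>' \<gamma>' where G: "polyf \<rat> 3 \<alpha>'" "polyf \<rat> 3 \<beta>'" "polyf \<rat> 3 \<gamma>'"
    "\<And>D. derivation \<rat> FF D \<Longrightarrow> D (G (as3 \<xi> \<eta> \<omega>)) = \<alpha>' (as3 \<xi> \<eta> \<omega>) * D \<xi> + \<beta>' (as3 \<xi> \<eta> \<omega>) * D \<eta> + \<gamma>' (as3 \<xi> \<eta> \<omega>) * D \<omega>"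
    using derivation_polyf[OF h(2)] by blast
  have R: "(G (as3 \<xi> \<eta> \<omega>) * f (as3 \<xi> \<eta> \<omega>) - A (as3 \<xi> \<eta> \<omega>) * g (as3 \<xi> \<eta> \<omega>)) / (G (as3 \<xi> \<eta> \<omega>))\<^sup>2 \<in> reg x y w"
    if "polyf \<rat> 3 f" "polyf \<rat> 3 g" for f g
    using regI[of "\<lambda>u. G u * f u - A u * g u" "\<lambda>u. (G u)\<^sup>2" x y w] h that
    by (simp add: polyf_diff polyf_mult polyf_power)
  have "D h = (G (as3 \<xi> \<eta> \<omega>) * \<alpha> (as3 \<xi> \<eta> \<omega>) - A (as3 \<xi> \<eta> \<omega>) * \<alpha>' (as3 \<xi> \<eta> \<omega>)) / (G (as3 \<xi> \<eta> \<omega>))\<^sup>2 * D \<xi>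
      + (G (as3 \<xi> \<eta> \<omega>) * \<beta> (as3 \<xi> \<eta> \<omega>) - A (as3 \<xi> \<eta> \<omega>) * \<beta>' (as3 \<xi> \<eta> \<omega>)) / (G (as3 \<xi> \<eta> \<omega>))\<^sup>2 * D \<eta>
      + (G (as3 \<xi> \<eta> \<omega>) * \<gamma> (as3 \<xi> \<eta> \<omega>) - A (as3 \<xi> \<eta> \<omega>) * \<gamma>' (as3 \<xi> \<eta> \<omega>)) / (G (as3 \<xi> \<eta> \<omega>))\<^sup>2 * D \<omega>"
    if D: "derivation \<rat> FF D" for D
    unfolding h(5) derivation_divide[OF D reg_polyf[OF h(1)] reg_polyf[OF h(2)] h(4)] A(4)[OF D] G(4)[OF D]
    by (simp add: add_divide_distrib diff_divide_distrib algebra_simps)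
  then show ?thesis using R[OF A(1) G(1)] R[OF A(2) G(2)] R[OF A(3) G(3)] by blast
qed

text \<open>Multiplication by \<omega> eliminates D \<omega> through 2 \<omega> D \<omega> = Bx D
  \<xi> + By D \<eta> without introducing denominators.\<close>

lemma derivation_chain_W:
  assumes "h \<in> reg x y w" and w: "w\<^sup>2 = B x y"
  shows "\<exists>\<alpha>\<in>reg x y w. \<exists>\<beta>\<in>reg x y w. \<forall>D. derivation \<rat> FF D \<longrightarrow> \<omega> * D h = \<alpha> * D \<xi> + \<beta> * D \<eta>"
proof -
  obtain \<alpha> \<beta> \<gamma> where c: "\<alpha> \<in> reg x y w" "\<beta> \<in> reg x y w" "\<gamma> \<in> reg x y w"
    "\<And>D. derivation \<rat> FF D \<Longrightarrow> D h = \<alpha> * D \<xi> + \<beta> * D \<eta> + \<gamma> * D \<omega>" using derivation_chain[OF assms] by blast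
  have "\<omega> * \<alpha> + \<gamma> * (Bx \<xi> \<eta> * (1/2)) \<in> reg x y w" "\<omega> * \<beta> + \<gamma> * (By \<xi> \<eta> * (1/2)) \<in> reg x y w"
  proof -
    have half: "1 / 2 \<in> reg x y w" by (rule reg_Rats) simp
    have Bxy: "Bx \<xi> \<eta> \<in> reg x y w" "By \<xi> \<eta> \<in> reg x y w"
      using reg_polyf[OF polyf_Bx, of x y w] reg_polyf[OF polyf_By, of x y w] by simp_all
    show "\<omega> * \<alpha> + \<gamma> * (Bx \<xi> \<eta> * (1/2)) \<in> reg x y w"
        "\<omega> * \<beta> + \<gamma> * (By \<xi> \<eta> * (1/2)) \<in> reg x y w"
      by (intro reg_add[OF w] reg_mult[OF w] reg_var c half Bxy)+
  qed
  moreover have "\<omega> * D h = (\<omega> * \<alpha> + \<gamma> * (Bx \<xi> \<eta> * (1/2))) * D \<xi> + (\<omega> * \<beta> + \<gamma> * (By \<xi> \<eta> * (1/2))) * D \<eta>"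
    if D: "derivation \<rat> FF D" for D
  proof -
    have "\<omega> * D h = \<omega> * \<alpha> * D \<xi> + \<omega> * \<beta> * D \<eta> + \<gamma> * (2 * \<omega> * D \<omega>) * (1/2)"
      by (simp add: c(4)[OF D] algebra_simps)
    then show ?thesis unfolding derivation_W[OF D] by (simp add: algebra_simps)
  qed
  ultimately show ?thesis by blast
qed

lemma derivation_eqI:
  assumes D: "derivation \<rat> FF D" and E: "derivation \<rat> FF E" and "D \<xi> = E \<xi>" "D \<eta> = E \<eta>" "h \<in> FF"
  shows "D h = E h"
  using derivation_chain_W[OF assms(5) \<omega>] D E assms(3,4) W_nonzero by (metis mult_left_cancel)

lemma wedge_chain:
  assumes D: "derivation \<rat> FF D1" "derivation \<rat> FF D2" and w: "w\<^sup>2 = B x y"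
    and "u \<in> reg x y w" "v \<in> reg x y w"
  shows "\<exists>\<rho>\<in>reg x y w. \<omega>\<^sup>2 * wedge D1 D2 u v = \<rho> * wedge D1 D2 \<xi> \<eta>"
proof -
  obtain \<alpha> \<beta> where u: "\<alpha> \<in> reg x y w" "\<beta> \<in> reg x y w"
    "\<And>D. derivation \<rat> FF D \<Longrightarrow> \<omega> * D u = \<alpha> * D \<xi> + \<beta> * D \<eta>" using derivation_chain_W assms by blast
  obtain \<alpha>' \<beta>' where v: "\<alpha>' \<in> reg x y w" "\<beta>' \<in> reg x y w"
    "\<And>D. derivation \<rat> FF D \<Longrightarrow> \<omega> * D v = \<alpha>' * D \<xi> + \<beta>' * D \<eta>" using derivation_chain_W assms by blast
  have "\<omega>\<^sup>2 * wedge D1 D2 u v = (\<omega> * D1 u) * (\<omega> * D2 v) - (\<omega> * D1 v) * (\<omega> * D2 u)"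
    by (simp add: wedge_def power2_eq_square algebra_simps)
  also have "\<dots> = (\<alpha> * \<beta>' - \<alpha>' * \<beta>) * wedge D1 D2 \<xi> \<eta>"
    unfolding u(3)[OF D(1)] u(3)[OF D(2)] v(3)[OF D(1)] v(3)[OF D(2)] by (simp add: wedge_def algebra_simps)
  finally show ?thesis
    by (intro bexI[of _ "\<alpha> * \<beta>' - \<alpha>' * \<beta>"]) (auto intro!: reg_diff[OF w] reg_mult[OF w] u v)
qed

text \<open>Each factor du \<and> dv becomes a regular multiple of d\<xi> \<and> d\<eta> after
  multiplication by \<omega>^2. This is coarser than the generator d\<xi> \<and> d\<eta> / \<omega>,
  but it costs only a constant factor in the final bound.\<close>

lemma canonical_stalk_upper:
  assumes D: "derivation \<rat> FF D1" "derivation \<rat> FF D2" and w: "w\<^sup>2 = B x y"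
    and h: "h \<in> canonical_stalk D1 D2 (reg x y w) n"
  shows "\<exists>\<rho>\<in>reg x y w. \<omega> ^ (2 * n) * h = \<rho> * wedge D1 D2 \<xi> \<eta> ^ n"
proof -
  obtain l :: nat and c u v where h: "h = (\<Sum>i<l. c i * (\<Prod>j<n. wedge D1 D2 (u i j) (v i j)))"
    and cuv: "\<forall>i<l. c i \<in> reg x y w \<and> (\<forall>j<n. u i j \<in> reg x y w \<and> v i j \<in> reg x y w)"
    using h unfolding canonical_stalk_def by blast
  have "\<exists>\<rho>\<in>reg x y w. \<omega> ^ (2 * m) * (\<Prod>j<m. wedge D1 D2 (u i j) (v i j)) = \<rho> * wedge D1 D2 \<xi> \<eta> ^ m"
    if i: "i < l" and "m \<le> n" for i m
    using that(2)
  proof (induction m)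
    case 0
    show ?case by (intro bexI[of _ 1]) (auto intro: reg_Rats)
  next
    case (Suc m)
    then obtain \<rho> where \<rho>: "\<rho> \<in> reg x y w"
      "\<omega> ^ (2 * m) * (\<Prod>j<m. wedge D1 D2 (u i j) (v i j)) = \<rho> * wedge D1 D2 \<xi> \<eta> ^ m" by auto
    obtain \<sigma> where \<sigma>: "\<sigma> \<in> reg x y w" "\<omega>\<^sup>2 * wedge D1 D2 (u i m) (v i m) = \<sigma> * wedge D1 D2 \<xi> \<eta>"
      using wedge_chain[OF D w, of "u i m" "v i m"] cuv i Suc.prems by auto
    have "\<omega> ^ (2 * Suc m) * (\<Prod>j<Suc m. wedge D1 D2 (u i j) (v i j))
        = (\<omega> ^ (2 * m) * (\<Prod>j<m. wedge D1 D2 (u i j) (v i j))) * (\<omega>\<^sup>2 * wedge D1 D2 (u i m) (v i m))"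
      by (simp add: power2_eq_square mult_ac)
    also have "\<dots> = (\<rho> * \<sigma>) * wedge D1 D2 \<xi> \<eta> ^ Suc m"
      unfolding \<rho>(2) \<sigma>(2) by (simp add: mult_ac)
    finally show ?case using reg_mult[OF w \<rho>(1) \<sigma>(1)] by blast
  qed
  then have "\<forall>i<l. \<exists>\<rho>\<in>reg x y w. \<omega> ^ (2 * n) * (\<Prod>j<n. wedge D1 D2 (u i j) (v i j)) = \<rho> * wedge D1 D2 \<xi> \<eta> ^ n"
    by blast
  then obtain \<rho> where \<rho>: "\<And>i. i < l \<Longrightarrow> \<rho> i \<in> reg x y w"
    "\<And>i. i < l \<Longrightarrow> \<omega> ^ (2 * n) * (\<Prod>j<n. wedge D1 D2 (u i j) (v i j)) = \<rho> i * wedge D1 D2 \<xi> \<eta> ^ n" by metis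
  have "\<omega> ^ (2 * n) * h = (\<Sum>i<l. c i * (\<omega> ^ (2 * n) * (\<Prod>j<n. wedge D1 D2 (u i j) (v i j))))"
    unfolding h sum_distrib_left by (rule sum.cong) (auto simp: mult_ac)
  also have "\<dots> = (\<Sum>i<l. c i * \<rho> i) * wedge D1 D2 \<xi> \<eta> ^ n"
    unfolding sum_distrib_right 
    by (rule sum.cong[OF refl]) (simp only: lessThan_iff \<rho>(2) mult.assoc)
  finally show ?thesis
    using \<rho>(1) cuv by (intro bexI[of _ "\<Sum>i<l. c i * \<rho> i"]) (auto intro!: reg_sum[OF w] reg_mult[OF w])
qed

text \<open>The form d\<xi> \<and> d\<eta> / \<omega> is regular everywhere. Where w \<noteq> 0,
  \<omega> is a unit. On the ramification curve one partial derivative of \<open>B\<close> is a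
  unit, and the form equals 2 d\<omega> \<and> d\<eta> / Bx or 2 d\<xi> \<and> d\<omega> /
  By.\<close>

lemma wedge_generator:
  assumes D: "derivation \<rat> FF D1" "derivation \<rat> FF D2" and w: "w\<^sup>2 = B x y"
  shows "\<exists>c\<in>reg x y w. \<exists>u\<in>reg x y w. \<exists>v\<in>reg x y w. c * wedge D1 D2 u v = wedge D1 D2 \<xi> \<eta> / \<omega>"
proof -
  have inv: "1 / G (as3 \<xi> \<eta> \<omega>) \<in> reg x y w" "G (as3 \<xi> \<eta> \<omega>) \<noteq> 0" if "polyf \<rat> 3 G" "G (as3 x y w) \<noteq> 0" for G
    using regI[of "\<lambda>u. 1" G x y w] reg_denominator[OF that w] that by (simp_all add: polyf_const)
  have dW: "2 * \<omega> * wedge D1 D2 \<xi> \<omega> = By \<xi> \<eta> * wedge D1 D2 \<xi> \<eta>" "2 * \<omega> * wedge D1 D2 \<omega> \<eta> = Bx \<xi> \<eta> * wedge D1 D2 \<xi> \<eta>"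
  proof -
    have "2 * \<omega> * wedge D1 D2 \<xi> \<omega> = D1 \<xi> * (2 * \<omega> * D2 \<omega>) - (2 * \<omega> * D1 \<omega>) * D2 \<xi>"
      by (simp add: wedge_def algebra_simps)
    also have "\<dots> = By \<xi> \<eta> * wedge D1 D2 \<xi> \<eta>"
      unfolding derivation_W[OF D(1)] derivation_W[OF D(2)] by (simp add: wedge_def algebra_simps)
    finally show "2 * \<omega> * wedge D1 D2 \<xi> \<omega> = By \<xi> \<eta> * wedge D1 D2 \<xi> \<eta>" .
    have "2 * \<omega> * wedge D1 D2 \<omega> \<eta> = (2 * \<omega> * D1 \<omega>) * D2 \<eta> - D1 \<eta> * (2 * \<omega> * D2 \<omega>)"
      by (simp add: wedge_def algebra_simps)
    also have "\<dots> = Bx \<xi> \<eta> * wedge D1 D2 \<xi> \<eta>"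
      unfolding derivation_W[OF D(1)] derivation_W[OF D(2)] by (simp add: wedge_def algebra_simps)
    finally show "2 * \<omega> * wedge D1 D2 \<omega> \<eta> = Bx \<xi> \<eta> * wedge D1 D2 \<xi> \<eta>" .
  qed
  have two: "2 * c \<in> reg x y w" if "c \<in> reg x y w" for c using reg_mult[OF w reg_Rats that, of 2] by simp
  consider "w \<noteq> 0" | "w = 0" "Bx x y \<noteq> 0" | "w = 0" "By x y \<noteq> 0"
    using biquad_nonsingular[of x y] w unfolding Bx_def By_def by fastforce
  then show ?thesis
  proof cases
    case 1
    show ?thesis
      by (rule bexI[of _ "1 / \<omega>"], rule bexI[of _ \<xi>], rule bexI[of _ \<eta>])
        (use inv(1)[OF polyf_var[where i = 2]] 1 in \<open>auto intro: reg_var\<close>)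
  next
    case 2
    have G: "1 / Bx \<xi> \<eta> \<in> reg x y w" "Bx \<xi> \<eta> \<noteq> 0" using inv[OF polyf_Bx] 2 by simp_all
    have "2 * (1 / Bx \<xi> \<eta>) * wedge D1 D2 \<omega> \<eta> = wedge D1 D2 \<xi> \<eta> / \<omega>"
      using dW(2) G(2) W_nonzero by (simp add: field_simps)
    then show ?thesis using two[OF G(1)] reg_var by blast
  next
    case 3
    have G: "1 / By \<xi> \<eta> \<in> reg x y w" "By \<xi> \<eta> \<noteq> 0" using inv[OF polyf_By] 3 by simp_all
    have "2 * (1 / By \<xi> \<eta>) * wedge D1 D2 \<xi> \<omega> = wedge D1 D2 \<xi> \<eta> / \<omega>"
      using dW(1) G(2) W_nonzero by (simp add: field_simps)
    then show ?thesis using two[OF G(1)] reg_var by blast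
  qed
qed

lemma canonical_stalk_lower:
  assumes D: "derivation \<rat> FF D1" "derivation \<rat> FF D2" and w: "w\<^sup>2 = B x y"
  shows "\<xi> ^ i * \<eta> ^ j * (wedge D1 D2 \<xi> \<eta> / \<omega>) ^ n \<in> canonical_stalk D1 D2 (reg x y w) n"
proof -
  obtain c u v where *: "c \<in> reg x y w" "u \<in> reg x y w" "v \<in> reg x y w" "c * wedge D1 D2 u v = wedge D1 D2 \<xi> \<eta> / \<omega>"
    using wedge_generator[OF assms] by blast
  have R: "\<xi> ^ i * \<eta> ^ j * c ^ n \<in> reg x y w"
    by (intro reg_mult[OF w] reg_power[OF w] reg_var *)
  show ?thesis
    unfolding canonical_stalk_def *(4)[symmetric]
    by (rule CollectI, rule exI[of _ "1::nat"], rule exI[of _ "\<lambda>_. \<xi> ^ i * \<eta> ^ j * c ^ n"],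
        rule exI[of _ "\<lambda>_ _. u"], rule exI[of _ "\<lambda>_ _. v"])
      (use R *(1-3) in \<open>simp add: power_mult_distrib\<close>)
qed

end

section \<open>Traces of functions and the derivations of the function field\<close>

context dcover
begin

text \<open>The denominator G0 + G1 \<omega> is rationalised by its conjugate, which is nonzero
  because 1 and \<omega> are linearly independent.\<close>

lemma FF_fraction:
  assumes "h \<in> FF"
  shows "\<exists>P Q S. polyf \<rat> 2 P \<and> polyf \<rat> 2 Q \<and> polyf \<rat> 2 S \<and> S (as3 \<xi> \<eta> 0) \<noteq> 0 \<and>
    h * S (as3 \<xi> \<eta> 0) = P (as3 \<xi> \<eta> 0) + Q (as3 \<xi> \<eta> 0) * \<omega>"
proof -
  obtain A G where h: "polyf \<rat> 3 A" "polyf \<rat> 3 G" "G (as3 \<xi> \<eta> \<omega>) \<noteq> 0" "h = A (as3 \<xi> \<eta> \<omega>) / G (as3 \<xi> \<eta> \<omega>)"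
    using regE[OF assms \<omega>] by blast
  obtain A0 A1 where A: "polyf \<rat> 2 A0" "polyf \<rat> 2 A1"
    "\<And>x y w. w\<^sup>2 = B x y \<Longrightarrow> A (as3 x y w) = A0 (as3 x y 0) + A1 (as3 x y 0) * w" using split[OF h(1)] by blast
  obtain G0 G1 where G: "polyf \<rat> 2 G0" "polyf \<rat> 2 G1"
    "\<And>x y w. w\<^sup>2 = B x y \<Longrightarrow> G (as3 x y w) = G0 (as3 x y 0) + G1 (as3 x y 0) * w" using split[OF h(2)] by blast
  define P where "P u = A0 u * G0 u - A1 u * G1 u * B (u 0) (u 1)" for u
  define Q where "Q u = A1 u * G0 u - A0 u * G1 u" for u
  define S where "S u = (G0 u)\<^sup>2 - (G1 u)\<^sup>2 * B (u 0) (u 1)" for u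
  have poly: "polyf \<rat> 2 P" "polyf \<rat> 2 Q" "polyf \<rat> 2 S"
    unfolding P_def Q_def S_def by (intro polyf_diff polyf_mult polyf_power A G polyf_B; simp)+
  define a0 a1 g0 g1 where ag: "a0 = A0 (as3 \<xi> \<eta> 0)" "a1 = A1 (as3 \<xi> \<eta> 0)" "g0 = G0 (as3 \<xi> \<eta> 0)" "g1 = G1 (as3 \<xi> \<eta> 0)"
  have conj: "g0 - g1 * \<omega> \<noteq> 0"
  proof
    assume "g0 - g1 * \<omega> = 0"
    then have "G0 (as3 \<xi> \<eta> 0) + (- G1 (as3 \<xi> \<eta> 0)) * \<omega> = 0" by (simp add: ag)
    from split_unique[OF G(1) polyf_uminus[OF _ G(2)] this, of \<xi> \<eta> 0]
    show False using h(3) G(3)[OF \<omega>] by simp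
  qed
  have gW: "g0 + g1 * \<omega> \<noteq> 0" using h(3) G(3)[OF \<omega>] by (simp add: ag)
  have S: "S (as3 \<xi> \<eta> 0) = (g0 + g1 * \<omega>) * (g0 - g1 * \<omega>)"
    by (simp add: S_def ag \<omega>[symmetric] power2_eq_square algebra_simps)
  have "h * S (as3 \<xi> \<eta> 0) = (a0 + a1 * \<omega>) * (g0 - g1 * \<omega>)"
    unfolding h(4) A(3)[OF \<omega>] G(3)[OF \<omega>] S using gW by (simp add: ag)
  also have "\<dots> = P (as3 \<xi> \<eta> 0) + Q (as3 \<xi> \<eta> 0) * \<omega>"
    by (simp add: P_def Q_def ag \<omega>[symmetric] power2_eq_square algebra_simps)
  finally have "h * S (as3 \<xi> \<eta> 0) = P (as3 \<xi> \<eta> 0) + Q (as3 \<xi> \<eta> 0) * \<omega>" .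
  moreover have "S (as3 \<xi> \<eta> 0) \<noteq> 0" unfolding S using conj gW by simp
  ultimately show ?thesis using poly by blast
qed

text \<open>
  Regularity of \<open>(P + Q \<omega>) / S\<close> at both points above \<open>(x, y)\<close> gives regularity of its trace
  \<open>2 P / S\<close> at \<open>(x, y)\<close>.
\<close>

lemma trace_regular:
  assumes poly: "polyf \<rat> 2 P" "polyf \<rat> 2 Q" "polyf \<rat> 2 S"
    and h: "h * S (as3 \<xi> \<eta> 0) = P (as3 \<xi> \<eta> 0) + Q (as3 \<xi> \<eta> 0) * \<omega>"
    and reg: "\<And>w. w\<^sup>2 = B x y \<Longrightarrow> h \<in> reg x y w"
  shows "\<exists>M N. polyf \<rat> 2 M \<and> polyf \<rat> 2 N \<and> M (as3 x y 0) \<noteq> 0 \<and>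
    (\<forall>x' y'. P (as3 x' y' 0) * M (as3 x' y' 0) = S (as3 x' y' 0) * N (as3 x' y' 0))"
proof -
  define w where "w = csqrt (B x y)"
  have w: "w\<^sup>2 = B x y" "(- w)\<^sup>2 = B x y" by (simp_all add: w_def)
  obtain A G where A: "polyf \<rat> 3 A" "polyf \<rat> 3 G" "G (as3 x y w) \<noteq> 0" "G (as3 \<xi> \<eta> \<omega>) \<noteq> 0"
    "h = A (as3 \<xi> \<eta> \<omega>) / G (as3 \<xi> \<eta> \<omega>)" using regE[OF reg[OF w(1)] w(1)] by blast
  obtain A' G' where A': "polyf \<rat> 3 A'" "polyf \<rat> 3 G'" "G' (as3 x y (- w)) \<noteq> 0" "G' (as3 \<xi> \<eta> \<omega>) \<noteq> 0"
    "h = A' (as3 \<xi> \<eta> \<omega>) / G' (as3 \<xi> \<eta> \<omega>)" using regE[OF reg[OF w(2)] w(2)] by blast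
  have p3: "polyf \<rat> 3 P" "polyf \<rat> 3 Q" "polyf \<rat> 3 S" using poly by (auto intro: polyf_mono)
  have gen_id: "(P (as3 x y 0) + Q (as3 x y 0) * w) * G (as3 x y w) = S (as3 x y 0) * A (as3 x y w)"
    if AG: "polyf \<rat> 3 A" "polyf \<rat> 3 G" "G (as3 \<xi> \<eta> \<omega>) \<noteq> 0" "h = A (as3 \<xi> \<eta> \<omega>) / G (as3 \<xi> \<eta> \<omega>)" and xyw: "w\<^sup>2 = B x y"
    for A G x y w
  proof -
    let ?F = "\<lambda>u. (P u + Q u * u 2) * G u - S u * A u"
    have "polyf \<rat> 3 ?F" by (intro polyf_diff polyf_mult polyf_add p3 AG polyf_var) simp_all
    moreover have "?F (as3 \<xi> \<eta> \<omega>) = 0"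
    proof -
      have "(P (as3 \<xi> \<eta> 0) + Q (as3 \<xi> \<eta> 0) * \<omega>) * G (as3 \<xi> \<eta> \<omega>) = S (as3 \<xi> \<eta> 0) * (h * G (as3 \<xi> \<eta> \<omega>))"
        unfolding h[symmetric] by simp
      also have "h * G (as3 \<xi> \<eta> \<omega>) = A (as3 \<xi> \<eta> \<omega>)" using AG(3,4) by simp
      finally show ?thesis
        by (simp add: polyf_as3[OF poly(1), of \<xi> \<eta> \<omega>] polyf_as3[OF poly(2), of \<xi> \<eta> \<omega>] polyf_as3[OF poly(3), of \<xi> \<eta> \<omega>])
    qed
    ultimately have "?F (as3 x y w) = 0" using xyw by (rule specialize)
    then show ?thesis
      by (simp add: polyf_as3[OF poly(1), of x y w] polyf_as3[OF poly(2), of x y w] polyf_as3[OF poly(3), of x y w])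
  qed
  \<comment> \<open>The covering involution on polynomials. It moves a denominator that is nonzero
    at (x, y, -w) to one that is nonzero at (x, y, w).\<close>
  define flip where "flip F u = F (\<lambda>i. if i = 2 then - u 2 else u i)" for F :: "(nat \<Rightarrow> complex) \<Rightarrow> complex" and u
  have flip_as3: "flip F (as3 x y w) = F (as3 x y (- w))" if "polyf \<rat> 3 F" for F x y w
    unfolding flip_def by (rule polyf_cong_vars[OF that]) (auto simp: as3_def)
  have flip_poly: "polyf \<rat> 3 (flip F)" if "polyf \<rat> 3 F" for F
  proof -
    have "polyf \<rat> 3 (\<lambda>u. F (\<lambda>i. (if i = 2 then (\<lambda>u. - u 2) else (\<lambda>u. u i)) u))"
      by (rule polyf_subst[OF that]) (auto intro: polyf_uminus polyf_var)
    moreover have "(\<lambda>u. F (\<lambda>i. (if i = 2 then (\<lambda>u. - u 2) else (\<lambda>u. u i)) u)) = flip F"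
      unfolding flip_def by (intro ext arg_cong[of _ _ F]) auto
    ultimately show ?thesis by simp
  qed
  \<comment> \<open>Common denominator and numerator of A / G + \<open>flip A'\<close> /
    \<open>flip G'\<close>, the sum of h and its conjugate; so 2 P / S = T / E at the generic
    point.\<close>
  let ?E = "\<lambda>u. G u * flip G' u" and ?T = "\<lambda>u. A u * flip G' u + flip A' u * G u"
  have ET: "polyf \<rat> 3 ?E" "polyf \<rat> 3 ?T" by (intro polyf_add polyf_mult A A' flip_poly)+
  obtain E0 E1 where E: "polyf \<rat> 2 E0" "polyf \<rat> 2 E1"
    "\<And>x y w. w\<^sup>2 = B x y \<Longrightarrow> ?E (as3 x y w) = E0 (as3 x y 0) + E1 (as3 x y 0) * w" using split[OF ET(1)] by blast
  obtain T0 T1 where T: "polyf \<rat> 2 T0" "polyf \<rat> 2 T1"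
    "\<And>x y w. w\<^sup>2 = B x y \<Longrightarrow> ?T (as3 x y w) = T0 (as3 x y 0) + T1 (as3 x y 0) * w" using split[OF ET(2)] by blast
  have "2 * P (as3 \<xi> \<eta> 0) * ?E (as3 \<xi> \<eta> \<omega>) = S (as3 \<xi> \<eta> 0) * ?T (as3 \<xi> \<eta> \<omega>)"
  proof -
    have \<omega>': "(- \<omega>)\<^sup>2 = B \<xi> \<eta>" using \<omega> by simp
    have 1: "(P (as3 \<xi> \<eta> 0) + Q (as3 \<xi> \<eta> 0) * \<omega>) * G (as3 \<xi> \<eta> \<omega>) = S (as3 \<xi> \<eta> 0) * A (as3 \<xi> \<eta> \<omega>)"
      using gen_id[OF A(1,2,4,5) \<omega>] .
    have 2: "(P (as3 \<xi> \<eta> 0) - Q (as3 \<xi> \<eta> 0) * \<omega>) * flip G' (as3 \<xi> \<eta> \<omega>) = S (as3 \<xi> \<eta> 0) * flip A' (as3 \<xi> \<eta> \<omega>)"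
      using gen_id[OF A'(1,2,4,5) \<omega>'] flip_as3[OF A'(1), of \<xi> \<eta> \<omega>] flip_as3[OF A'(2), of \<xi> \<eta> \<omega>] by simp
    have "2 * P (as3 \<xi> \<eta> 0) * ?E (as3 \<xi> \<eta> \<omega>) =
        ((P (as3 \<xi> \<eta> 0) + Q (as3 \<xi> \<eta> 0) * \<omega>) * G (as3 \<xi> \<eta> \<omega>)) * flip G' (as3 \<xi> \<eta> \<omega>) +
        ((P (as3 \<xi> \<eta> 0) - Q (as3 \<xi> \<eta> 0) * \<omega>) * flip G' (as3 \<xi> \<eta> \<omega>)) * G (as3 \<xi> \<eta> \<omega>)"
      by (simp add: algebra_simps)
    then show ?thesis unfolding 1 2 by (simp add: algebra_simps)
  qed
  then have "(2 * P (as3 \<xi> \<eta> 0) * E0 (as3 \<xi> \<eta> 0) - S (as3 \<xi> \<eta> 0) * T0 (as3 \<xi> \<eta> 0)) +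
      (2 * P (as3 \<xi> \<eta> 0) * E1 (as3 \<xi> \<eta> 0) - S (as3 \<xi> \<eta> 0) * T1 (as3 \<xi> \<eta> 0)) * \<omega> = 0"
    unfolding E(3)[OF \<omega>] T(3)[OF \<omega>] by (simp add: algebra_simps)
  moreover have "polyf \<rat> 2 (\<lambda>u. 2 * P u * E0 u - S u * T0 u)" "polyf \<rat> 2 (\<lambda>u. 2 * P u * E1 u - S u * T1 u)"
    by (intro polyf_diff polyf_mult poly E T polyf_const; simp)+
  ultimately have id: "2 * P (as3 x y 0) * E0 (as3 x y 0) - S (as3 x y 0) * T0 (as3 x y 0) = 0"
      "2 * P (as3 x y 0) * E1 (as3 x y 0) - S (as3 x y 0) * T1 (as3 x y 0) = 0" for x y
    using split_unique[of "\<lambda>u. 2 * P u * E0 u - S u * T0 u" "\<lambda>u. 2 * P u * E1 u - S u * T1 u"] by blast+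
  have "?E (as3 x y w) \<noteq> 0" using A(3) A'(3) flip_as3[OF A'(2)] by simp
  then have "E0 (as3 x y 0) + E1 (as3 x y 0) * w \<noteq> 0" using E(3)[OF w(1)] by simp
  \<comment> \<open>The identity 2 P E = S T holds for the even and the odd parts of E and T
    separately. As E is nonzero at (x, y, w), one of its parts can serve as the denominator at (x,
    y).\<close>
  then consider "E0 (as3 x y 0) \<noteq> 0" | "E1 (as3 x y 0) \<noteq> 0" by fastforce
  then show ?thesis
  proof cases
    case 1
    show ?thesis
      by (rule exI[of _ "\<lambda>u. 2 * E0 u"], rule exI[of _ T0])
        (use 1 id(1) in \<open>auto intro!: polyf_mult E T polyf_const simp: mult_ac\<close>)
  next
    case 2
    show ?thesis
      by (rule exI[of _ "\<lambda>u. 2 * E1 u"], rule exI[of _ T1])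
        (use 2 id(2) in \<open>auto intro!: polyf_mult E T polyf_const simp: mult_ac\<close>)
  qed
qed

text \<open>
  A field element is a rational function, and it determines the germ of this function along any
  line through \<open>(\<xi>, \<eta>)\<close> because the point is generic. Differentiating the germ gives derivations.
\<close>

definition branch :: "complex \<Rightarrow> complex \<Rightarrow> complex \<Rightarrow> complex" where
  "branch \<alpha> \<beta> z = \<omega> * csqrt (B (\<xi> + \<alpha> * z) (\<eta> + \<beta> * z) / B \<xi> \<eta>)"

definition curve :: "complex \<Rightarrow> complex \<Rightarrow> complex \<Rightarrow> nat \<Rightarrow> complex" where
  "curve \<alpha> \<beta> z = as3 (\<xi> + \<alpha> * z) (\<eta> + \<beta> * z) (branch \<alpha> \<beta> z)"

definition germ_deriv :: "complex \<Rightarrow> complex \<Rightarrow> complex \<Rightarrow> complex \<Rightarrow> bool" where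
  "germ_deriv \<alpha> \<beta> h d \<longleftrightarrow> (\<exists>A G. polyf \<rat> 3 A \<and> polyf \<rat> 3 G \<and> G (as3 \<xi> \<eta> \<omega>) \<noteq> 0 \<and>
     h = A (as3 \<xi> \<eta> \<omega>) / G (as3 \<xi> \<eta> \<omega>) \<and>
     ((\<lambda>z. A (curve \<alpha> \<beta> z) / G (curve \<alpha> \<beta> z)) has_field_derivative d) (at 0))"

definition dir_deriv :: "complex \<Rightarrow> complex \<Rightarrow> complex \<Rightarrow> complex" where
  "dir_deriv \<alpha> \<beta> h = (THE d. germ_deriv \<alpha> \<beta> h d)"

lemma B_nonzero: "B \<xi> \<eta> \<noteq> 0"
  using \<omega> W_nonzero by auto

lemma branch_square: "(branch \<alpha> \<beta> z)\<^sup>2 = B (\<xi> + \<alpha> * z) (\<eta> + \<beta> * z)"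
  using B_nonzero by (simp add: branch_def power_mult_distrib \<omega>)

lemma curve_0: "curve \<alpha> \<beta> 0 = as3 \<xi> \<eta> \<omega>"
  using B_nonzero by (simp add: curve_def branch_def)

lemma curve_specialize: "polyf \<rat> 3 F \<Longrightarrow> F (as3 \<xi> \<eta> \<omega>) = 0 \<Longrightarrow> F (curve \<alpha> \<beta> z) = 0"
  unfolding curve_def by (rule specialize) (auto simp: branch_square)

text \<open>In \<open>branch\<close> the square root is taken of a quotient with value 1 at z = 0,
  away from the branch cut of \<open>csqrt\<close>, and the factor \<omega> selects the
  sheet.\<close>

lemma branch_deriv:
  "(branch \<alpha> \<beta> has_field_derivative (\<alpha> * Bx \<xi> \<eta> + \<beta> * By \<xi> \<eta>) / (2 * \<omega>)) (at 0)"
proof -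
  have B: "((\<lambda>z. B (\<xi> + \<alpha> * z) (\<eta> + \<beta> * z)) has_field_derivative (\<alpha> * Bx \<xi> \<eta> + \<beta> * By \<xi> \<eta>)) (at 0)"
    unfolding biquad_def
    by (rule derivative_eq_intros refl | simp)+ (simp add: Bx_def By_def algebra_simps)
  have sq: "(csqrt has_field_derivative inverse (2 * csqrt (B (\<xi> + \<alpha> * 0) (\<eta> + \<beta> * 0) / B \<xi> \<eta>)))
      (at (B (\<xi> + \<alpha> * 0) (\<eta> + \<beta> * 0) / B \<xi> \<eta>))"
    using B_nonzero by (intro has_field_derivative_csqrt) simp
  from DERIV_cmult[OF DERIV_chain2[OF sq DERIV_cdivide[OF B]], of \<omega>]
  have "((\<lambda>z. \<omega> * csqrt (B (\<xi> + \<alpha> * z) (\<eta> + \<beta> * z) / B \<xi> \<eta>)) has_field_derivative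
      \<omega> * (inverse (2 * csqrt (B (\<xi> + \<alpha> * 0) (\<eta> + \<beta> * 0) / B \<xi> \<eta>)) * ((\<alpha> * Bx \<xi> \<eta> + \<beta> * By \<xi> \<eta>) / B \<xi> \<eta>))) (at 0)" .
  moreover have "\<omega> * (inverse (2 * csqrt (B (\<xi> + \<alpha> * 0) (\<eta> + \<beta> * 0) / B \<xi> \<eta>)) * ((\<alpha> * Bx \<xi> \<eta> + \<beta> * By \<xi> \<eta>) / B \<xi> \<eta>))
      = (\<alpha> * Bx \<xi> \<eta> + \<beta> * By \<xi> \<eta>) / (2 * \<omega>)"
    using B_nonzero W_nonzero by (simp add: \<omega>[symmetric] power2_eq_square)
  ultimately show ?thesis unfolding branch_def by simp
qed

lemma curve_nonzero:
  assumes "polyf \<rat> 3 F" "F (as3 \<xi> \<eta> \<omega>) \<noteq> 0"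
  shows "eventually (\<lambda>z. F (curve \<alpha> \<beta> z) \<noteq> 0) (nhds 0)"
proof -
  have cont: "isCont (branch \<alpha> \<beta>) 0" using branch_deriv DERIV_isCont by blast
  have "isCont (\<lambda>z. F (curve \<alpha> \<beta> z)) 0"
    using assms(1)
  proof (induction rule: polyf.induct)
    case (polyf_var i)
    then consider "i = 0" | "i = 1" | "i = 2" by linarith
    then show ?case by cases (auto simp: curve_def intro!: continuous_intros cont)
  qed (auto intro: continuous_intros)
  then have "eventually (\<lambda>z. F (curve \<alpha> \<beta> z) \<noteq> 0) (at 0)"
    unfolding isCont_def using assms(2) by (intro tendsto_imp_eventually_ne) (simp_all add: curve_0)
  then show ?thesis using assms(2) by (simp add: eventually_nhds_conv_at curve_0)
qed

lemma curve_deriv: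
  assumes "polyf \<rat> 3 A" "\<alpha> \<in> \<rat>" "\<beta> \<in> \<rat>"
  shows "\<exists>d\<in>FF. ((\<lambda>z. A (curve \<alpha> \<beta> z)) has_field_derivative d) (at 0)"
  using assms(1)
proof (induction rule: polyf.induct)
  case (polyf_const c)
  show ?case by (rule bexI[of _ 0]) (auto intro: reg_Rats)
next
  case (polyf_var i)
  then consider "i = 0" | "i = 1" | "i = 2" by linarith
  then show ?case
  proof cases
    case 1
    have "((\<lambda>z. \<xi> + \<alpha> * z) has_field_derivative \<alpha>) (at 0)" by (auto intro!: derivative_eq_intros)
    then show ?thesis by (intro bexI[of _ \<alpha>]) (use assms 1 in \<open>auto simp: curve_def intro: reg_Rats\<close>)
  next
    case 2
    have "((\<lambda>z. \<eta> + \<beta> * z) has_field_derivative \<beta>) (at 0)" by (auto intro!: derivative_eq_intros)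
    then show ?thesis by (intro bexI[of _ \<beta>]) (use assms 2 in \<open>auto simp: curve_def intro: reg_Rats\<close>)
  next
    case 3
    have "Bx \<xi> \<eta> \<in> FF" "By \<xi> \<eta> \<in> FF" "2 \<in> FF"
      using reg_polyf[OF polyf_Bx, of \<xi> \<eta> \<omega>] reg_polyf[OF polyf_By, of \<xi> \<eta> \<omega>] by (simp_all add: reg_Rats)
    then have "(\<alpha> * Bx \<xi> \<eta> + \<beta> * By \<xi> \<eta>) / (2 * \<omega>) \<in> FF"
      using reg_Rats[OF assms(2)] reg_Rats[OF assms(3)] reg_var(3) by (intro FF_divide FF_add FF_mult)
    then show ?thesis using branch_deriv 3 by (intro bexI) (auto simp: curve_def)
  qed
next
  case (polyf_add f g)
  then obtain d e where d: "d \<in> FF" "((\<lambda>z. f (curve \<alpha> \<beta> z)) has_field_derivative d) (at 0)"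
    and e: "e \<in> FF" "((\<lambda>z. g (curve \<alpha> \<beta> z)) has_field_derivative e) (at 0)" by blast
  from DERIV_add[OF d(2) e(2)] show ?case by (rule bexI) (rule FF_add[OF d(1) e(1)])
next
  case (polyf_mult f g)
  then obtain d e where d: "d \<in> FF" "((\<lambda>z. f (curve \<alpha> \<beta> z)) has_field_derivative d) (at 0)"
    and e: "e \<in> FF" "((\<lambda>z. g (curve \<alpha> \<beta> z)) has_field_derivative e) (at 0)" by blast
  from DERIV_mult[OF d(2) e(2)] show ?case
    by (rule bexI)
      (use FF_add[OF FF_mult[OF d(1) reg_polyf[OF polyf_mult(2)]] FF_mult[OF e(1) reg_polyf[OF polyf_mult(1)]]]
        in \<open>simp add: curve_0\<close>)
qed

lemma germ_deriv_exists:
  assumes "h \<in> FF" "\<alpha> \<in> \<rat>" "\<beta> \<in> \<rat>"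
  shows "\<exists>d\<in>FF. germ_deriv \<alpha> \<beta> h d"
proof -
  obtain A G where h: "polyf \<rat> 3 A" "polyf \<rat> 3 G" "G (as3 \<xi> \<eta> \<omega>) \<noteq> 0" "h = A (as3 \<xi> \<eta> \<omega>) / G (as3 \<xi> \<eta> \<omega>)"
    using regE[OF assms(1) \<omega>] by blast
  obtain d e where d: "d \<in> FF" "((\<lambda>z. A (curve \<alpha> \<beta> z)) has_field_derivative d) (at 0)"
    and e: "e \<in> FF" "((\<lambda>z. G (curve \<alpha> \<beta> z)) has_field_derivative e) (at 0)"
    using curve_deriv[OF h(1) assms(2,3)] curve_deriv[OF h(2) assms(2,3)] by blast
  have "G (curve \<alpha> \<beta> 0) \<noteq> 0" using h(3) by (simp add: curve_0)
  from DERIV_divide[OF d(2) e(2) this]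
  have "germ_deriv \<alpha> \<beta> h ((d * G (as3 \<xi> \<eta> \<omega>) - A (as3 \<xi> \<eta> \<omega>) * e) / (G (as3 \<xi> \<eta> \<omega>) * G (as3 \<xi> \<eta> \<omega>)))"
    unfolding germ_deriv_def curve_0 using h by blast
  moreover have "(d * G (as3 \<xi> \<eta> \<omega>) - A (as3 \<xi> \<eta> \<omega>) * e) / (G (as3 \<xi> \<eta> \<omega>) * G (as3 \<xi> \<eta> \<omega>)) \<in> FF"
    by (intro FF_divide FF_diff FF_mult reg_polyf h d e)
  ultimately show ?thesis by blast
qed

text \<open>Two fractions for the same h satisfy A G' = A' G at the generic point, hence along the
  whole curve, so their germs at 0 agree.\<close>

lemma germ_deriv_unique:
  assumes "germ_deriv \<alpha> \<beta> h d" "germ_deriv \<alpha> \<beta> h e"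
  shows "d = e"
proof -
  obtain A G where A: "polyf \<rat> 3 A" "polyf \<rat> 3 G" "G (as3 \<xi> \<eta> \<omega>) \<noteq> 0" "h = A (as3 \<xi> \<eta> \<omega>) / G (as3 \<xi> \<eta> \<omega>)"
    "((\<lambda>z. A (curve \<alpha> \<beta> z) / G (curve \<alpha> \<beta> z)) has_field_derivative d) (at 0)"
    using assms(1) unfolding germ_deriv_def by blast
  obtain A' G' where A': "polyf \<rat> 3 A'" "polyf \<rat> 3 G'" "G' (as3 \<xi> \<eta> \<omega>) \<noteq> 0" "h = A' (as3 \<xi> \<eta> \<omega>) / G' (as3 \<xi> \<eta> \<omega>)"
    "((\<lambda>z. A' (curve \<alpha> \<beta> z) / G' (curve \<alpha> \<beta> z)) has_field_derivative e) (at 0)"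
    using assms(2) unfolding germ_deriv_def by blast
  from curve_nonzero[OF A(2,3), of \<alpha> \<beta>] curve_nonzero[OF A'(2,3), of \<alpha> \<beta>]
  have "eventually (\<lambda>z. A (curve \<alpha> \<beta> z) / G (curve \<alpha> \<beta> z) = A' (curve \<alpha> \<beta> z) / G' (curve \<alpha> \<beta> z)) (nhds 0)"
  proof eventually_elim
    case (elim z)
    have "polyf \<rat> 3 (\<lambda>u. A u * G' u - A' u * G u)" by (intro polyf_diff polyf_mult A A') simp
    moreover have "A (as3 \<xi> \<eta> \<omega>) * G' (as3 \<xi> \<eta> \<omega>) - A' (as3 \<xi> \<eta> \<omega>) * G (as3 \<xi> \<eta> \<omega>) = 0"
      using A(3,4) A'(3,4) by (simp add: frac_eq_eq)
    ultimately have "A (curve \<alpha> \<beta> z) * G' (curve \<alpha> \<beta> z) - A' (curve \<alpha> \<beta> z) * G (curve \<alpha> \<beta> z) = 0"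
      by (rule curve_specialize)
    then show ?case using elim by (simp add: frac_eq_eq)
  qed
  then have "((\<lambda>z. A' (curve \<alpha> \<beta> z) / G' (curve \<alpha> \<beta> z)) has_field_derivative d) (at 0)"
    using iffD1[OF DERIV_cong_ev[OF refl _ refl] A(5)] by simp
  then show ?thesis using A'(5) by (rule DERIV_unique)
qed

lemma dir_deriv_eq: "germ_deriv \<alpha> \<beta> h d \<Longrightarrow> dir_deriv \<alpha> \<beta> h = d"
  unfolding dir_deriv_def using germ_deriv_unique by blast

lemma germ_deriv_polyf:
  assumes "polyf \<rat> 3 A" "((\<lambda>z. A (curve \<alpha> \<beta> z)) has_field_derivative d) (at 0)"
  shows "germ_deriv \<alpha> \<beta> (A (as3 \<xi> \<eta> \<omega>)) d"
  unfolding germ_deriv_def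
  by (rule exI[of _ A], rule exI[of _ "\<lambda>u. 1"]) (use assms in \<open>auto intro: polyf_const\<close>)

lemma germ_deriv_add:
  assumes "germ_deriv \<alpha> \<beta> h d" "germ_deriv \<alpha> \<beta> h' d'"
  shows "germ_deriv \<alpha> \<beta> (h + h') (d + d')" "germ_deriv \<alpha> \<beta> (h * h') (h * d' + h' * d)"
proof -
  obtain A G where A: "polyf \<rat> 3 A" "polyf \<rat> 3 G" "G (as3 \<xi> \<eta> \<omega>) \<noteq> 0" "h = A (as3 \<xi> \<eta> \<omega>) / G (as3 \<xi> \<eta> \<omega>)"
    "((\<lambda>z. A (curve \<alpha> \<beta> z) / G (curve \<alpha> \<beta> z)) has_field_derivative d) (at 0)"
    using assms(1) unfolding germ_deriv_def by blast
  obtain A' G' where A': "polyf \<rat> 3 A'" "polyf \<rat> 3 G'" "G' (as3 \<xi> \<eta> \<omega>) \<noteq> 0" "h' = A' (as3 \<xi> \<eta> \<omega>) / G' (as3 \<xi> \<eta> \<omega>)"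
    "((\<lambda>z. A' (curve \<alpha> \<beta> z) / G' (curve \<alpha> \<beta> z)) has_field_derivative d') (at 0)"
    using assms(2) unfolding germ_deriv_def by blast
  have "eventually (\<lambda>z. A (curve \<alpha> \<beta> z) / G (curve \<alpha> \<beta> z) + A' (curve \<alpha> \<beta> z) / G' (curve \<alpha> \<beta> z) =
      (A (curve \<alpha> \<beta> z) * G' (curve \<alpha> \<beta> z) + A' (curve \<alpha> \<beta> z) * G (curve \<alpha> \<beta> z)) /
      (G (curve \<alpha> \<beta> z) * G' (curve \<alpha> \<beta> z))) (nhds 0)"
    using curve_nonzero[OF A(2,3), of \<alpha> \<beta>] curve_nonzero[OF A'(2,3), of \<alpha> \<beta>] by eventually_elim (simp add: add_frac_eq)
  from iffD1[OF DERIV_cong_ev[OF refl this refl] DERIV_add[OF A(5) A'(5)]]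
  have "((\<lambda>z. (A (curve \<alpha> \<beta> z) * G' (curve \<alpha> \<beta> z) + A' (curve \<alpha> \<beta> z) * G (curve \<alpha> \<beta> z)) /
      (G (curve \<alpha> \<beta> z) * G' (curve \<alpha> \<beta> z))) has_field_derivative d + d') (at 0)" .
  then show "germ_deriv \<alpha> \<beta> (h + h') (d + d')"
    unfolding germ_deriv_def
    by (intro exI[of _ "\<lambda>u. A u * G' u + A' u * G u"] exI[of _ "\<lambda>u. G u * G' u"] conjI polyf_add polyf_mult A(1,2) A'(1,2))
      (use A(3,4) A'(3,4) in \<open>auto simp: add_frac_eq\<close>)
  from DERIV_mult[OF A(5) A'(5)]
  have "((\<lambda>z. (A (curve \<alpha> \<beta> z) * A' (curve \<alpha> \<beta> z)) / (G (curve \<alpha> \<beta> z) * G' (curve \<alpha> \<beta> z)))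
      has_field_derivative (h * d' + h' * d)) (at 0)"
    by (simp add: curve_0 A(4) A'(4) algebra_simps)
  then show "germ_deriv \<alpha> \<beta> (h * h') (h * d' + h' * d)"
    unfolding germ_deriv_def
    by (intro exI[of _ "\<lambda>u. A u * A' u"] exI[of _ "\<lambda>u. G u * G' u"] conjI polyf_mult A(1,2) A'(1,2))
      (use A(3,4) A'(3,4) in auto)
qed

lemma derivation_dir_deriv:
  assumes "\<alpha> \<in> \<rat>" "\<beta> \<in> \<rat>"
  shows "derivation \<rat> FF (dir_deriv \<alpha> \<beta>)" "dir_deriv \<alpha> \<beta> \<xi> = \<alpha>" "dir_deriv \<alpha> \<beta> \<eta> = \<beta>"
proof -
  have ex: "\<exists>d\<in>FF. germ_deriv \<alpha> \<beta> h d \<and> dir_deriv \<alpha> \<beta> h = d" if "h \<in> FF" for h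
    using germ_deriv_exists[OF that assms] dir_deriv_eq by blast
  show "derivation \<rat> FF (dir_deriv \<alpha> \<beta>)"
    unfolding derivation_def
  proof (intro conjI ballI)
    fix c :: complex assume "c \<in> \<rat>"
    then have "germ_deriv \<alpha> \<beta> c 0" using germ_deriv_polyf[OF polyf_const] by simp
    then show "dir_deriv \<alpha> \<beta> c = 0" by (rule dir_deriv_eq)
  next
    fix u assume "u \<in> FF"
    then show "dir_deriv \<alpha> \<beta> u \<in> FF" using ex by metis
  next
    fix u v assume "u \<in> FF" "v \<in> FF"
    then have "germ_deriv \<alpha> \<beta> u (dir_deriv \<alpha> \<beta> u)" "germ_deriv \<alpha> \<beta> v (dir_deriv \<alpha> \<beta> v)" using ex by metis+
    from germ_deriv_add[OF this]
    show "dir_deriv \<alpha> \<beta> (u + v) = dir_deriv \<alpha> \<beta> u + dir_deriv \<alpha> \<beta> v"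
      "dir_deriv \<alpha> \<beta> (u * v) = u * dir_deriv \<alpha> \<beta> v + v * dir_deriv \<alpha> \<beta> u"
      by (simp_all add: dir_deriv_eq)
  qed
  have "((\<lambda>z. \<xi> + \<alpha> * z) has_field_derivative \<alpha>) (at 0)" "((\<lambda>z. \<eta> + \<beta> * z) has_field_derivative \<beta>) (at 0)"
    by (auto intro!: derivative_eq_intros)
  then have "germ_deriv \<alpha> \<beta> \<xi> \<alpha>" "germ_deriv \<alpha> \<beta> \<eta> \<beta>"
    using germ_deriv_polyf[OF polyf_var[where i = 0], of \<alpha> \<beta> \<alpha>] germ_deriv_polyf[OF polyf_var[where i = 1], of \<alpha> \<beta> \<beta>]
    by (simp_all add: curve_def)
  then show "dir_deriv \<alpha> \<beta> \<xi> = \<alpha>" "dir_deriv \<alpha> \<beta> \<eta> = \<beta>" by (simp_all add: dir_deriv_eq)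
qed

lemma derivation_combine:
  assumes "derivation \<rat> FF D" "derivation \<rat> FF E" "\<phi> \<in> FF" "\<psi> \<in> FF"
  shows "derivation \<rat> FF (\<lambda>u. \<phi> * D u + \<psi> * E u)"
  using derivation_simps[OF assms(1)] derivation_simps[OF assms(2)] assms(3,4)
  unfolding derivation_def by (auto intro!: FF_add FF_mult simp: algebra_simps)

text \<open>By the chain rule a derivation is determined by its values at \<xi> and \<eta>, and the
  two coordinate directions realise the values (1, 0) and (0, 1).\<close>

lemma deriv_basis_dir_deriv: "deriv_basis \<rat> FF (dir_deriv 1 0) (dir_deriv 0 1)"
proof -
  note D1 = derivation_dir_deriv[OF Rats_1 Rats_0] and D2 = derivation_dir_deriv[OF Rats_0 Rats_1]
  have "\<exists>!v. v \<in> FF \<times> FF \<and> (\<forall>u\<in>FF. D u = fst v * dir_deriv 1 0 u + snd v * dir_deriv 0 1 u)"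
    if D: "derivation \<rat> FF D" for D
  proof (rule ex1I)
    have "D \<xi> \<in> FF" "D \<eta> \<in> FF" using derivation_simps(4)[OF D] reg_var by blast+
    moreover have "D u = D \<xi> * dir_deriv 1 0 u + D \<eta> * dir_deriv 0 1 u" if "u \<in> FF" for u
      using derivation_eqI[OF D derivation_combine[OF D1(1) D2(1) calculation] _ _ that] by (simp add: D1 D2)
    ultimately show "(D \<xi>, D \<eta>) \<in> FF \<times> FF \<and>
        (\<forall>u\<in>FF. D u = fst (D \<xi>, D \<eta>) * dir_deriv 1 0 u + snd (D \<xi>, D \<eta>) * dir_deriv 0 1 u)" by simp
  next
    fix v assume "v \<in> FF \<times> FF \<and> (\<forall>u\<in>FF. D u = fst v * dir_deriv 1 0 u + snd v * dir_deriv 0 1 u)"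
    then have "D \<xi> = fst v" "D \<eta> = snd v" using reg_var[of \<xi> \<eta> \<omega>] by (auto simp: D1 D2)
    then show "v = (D \<xi>, D \<eta>)" by simp
  qed
  then show ?thesis unfolding deriv_basis_def using D1(1) D2(1) by blast
qed

end

section \<open>The smooth projective model\<close>

text \<open>
  The surface is embedded by \<open>w\<close> and the monomials on the boundary of the grid
  \<open>{0, 1, a - 1, a} \<times> {0, 1, b - 1, b}\<close> of exponents of \<open>x\<close> and \<open>y\<close>. Reflecting the grid
  (flags \<open>sx\<close>, \<open>sy\<close>) corresponds to passing to the charts with coordinates \<open>1 / x\<close>, \<open>1 / y\<close>; in
  each chart, the monomials \<open>1\<close>, \<open>x\<close> and \<open>y\<close> occur.
\<close>

definition lev :: "nat \<Rightarrow> nat \<Rightarrow> nat" where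
  "lev a i = [0, 1, a - 1, a] ! i"

text \<open>Indices 0 to 3 are the corners of the grid, 4 to 7 the inner points of the two edges
  along x, and 8 to 11 those of the two edges along y. Coordinate 12 carries w.\<close>

definition xlev :: "nat \<Rightarrow> nat" where
  "xlev l = [0, 3, 0, 3, 1, 2, 1, 2, 0, 0, 3, 3] ! l"

definition ylev :: "nat \<Rightarrow> nat" where
  "ylev l = [0, 0, 3, 3, 0, 0, 3, 3, 1, 2, 1, 2] ! l"

definition xexp :: "nat \<Rightarrow> bool \<Rightarrow> nat \<Rightarrow> nat" where
  "xexp a sx l = lev a (if sx then 3 - xlev l else xlev l)"

definition yexp :: "nat \<Rightarrow> bool \<Rightarrow> nat \<Rightarrow> nat" where
  "yexp b sy l = lev b (if sy then 3 - ylev l else ylev l)"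

definition emb :: "nat \<Rightarrow> nat \<Rightarrow> bool \<Rightarrow> bool \<Rightarrow> complex \<Rightarrow> complex \<Rightarrow> complex \<Rightarrow> complex list" where
  "emb a b sx sy x y w = map (\<lambda>l. if l < 12 then x ^ xexp a sx l * y ^ yexp b sy l else w) [0..<13]"

text \<open>\<open>cidx\<close>, \<open>xidx\<close> and \<open>yidx\<close> give the coordinates
  that become 1, x and y in the chart with flags \<open>sx\<close>, \<open>sy\<close>.\<close>

definition cidx :: "bool \<Rightarrow> bool \<Rightarrow> nat" where
  "cidx sx sy = (if sx then 1 else 0) + (if sy then 2 else 0)"

definition xidx :: "bool \<Rightarrow> bool \<Rightarrow> nat" where
  "xidx sx sy = 4 + (if sx then 1 else 0) + (if sy then 2 else 0)"

definition yidx :: "bool \<Rightarrow> bool \<Rightarrow> nat" where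
  "yidx sx sy = 8 + (if sy then 1 else 0) + (if sx then 2 else 0)"

lemmas idx_defs = cidx_def xidx_def yidx_def

lemma less_12: "l < (12::nat) \<longleftrightarrow> l \<in> {0,1,2,3,4,5,6,7,8,9,10,11}"
  unfolding insert_iff empty_iff by arith

lemma exp_chart:
  "xexp a sx (cidx sx sy) = 0" "yexp b sy (cidx sx sy) = 0"
  "xexp a sx (xidx sx sy) = 1" "yexp b sy (xidx sx sy) = 0"
  "xexp a sx (yidx sx sy) = 0" "yexp b sy (yidx sx sy) = 1"
  by (cases sx; cases sy; simp add: idx_defs xexp_def yexp_def xlev_def ylev_def lev_def)+

lemma idx_less: "cidx sx sy < 4" "4 \<le> xidx sx sy" "xidx sx sy < 8" "8 \<le> yidx sx sy" "yidx sx sy < 12"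
  by (auto simp: idx_defs)

lemma exp_reflect:
  assumes "l < 12"
  shows "a \<ge> 1 \<Longrightarrow> xexp a sx l + xexp a (\<not> sx) l = a" "b \<ge> 1 \<Longrightarrow> yexp b sy l + yexp b (\<not> sy) l = b"
proof -
  show "xexp a sx l + xexp a (\<not> sx) l = a" if "a \<ge> 1"
    using assms that unfolding less_12 by (cases sx) (auto simp: xexp_def xlev_def lev_def)
  show "yexp b sy l + yexp b (\<not> sy) l = b" if "b \<ge> 1"
    using assms that unfolding less_12 by (cases sy) (auto simp: yexp_def ylev_def lev_def)
qed

lemma length_emb [simp]: "length (emb a b sx sy x y w) = 13"
  by (simp add: emb_def)

lemma nth_emb: "l < 12 \<Longrightarrow> emb a b sx sy x y w ! l = x ^ xexp a sx l * y ^ yexp b sy l" "emb a b sx sy x y w ! 12 = w"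
  by (simp_all add: emb_def)

lemma emb_idx:
  "emb a b sx sy x y w ! cidx sx sy = 1" "emb a b sx sy x y w ! xidx sx sy = x" "emb a b sx sy x y w ! yidx sx sy = y"
  using idx_less[of sx sy] by (simp_all add: nth_emb exp_chart)

lemma wform_coord: "i < 13 \<Longrightarrow> wform \<rat> (replicate 13 1) 1 (mvar i)"
  using wform_mvar[OF Rats_1, of i "replicate 13 1"] by simp

lemma polyf_emb:
  assumes "wform \<rat> v d F"
  shows "polyf \<rat> 3 (\<lambda>u. mp_eval (emb a b sx sy (u 0) (u 1) (u 2)) F)"
proof -
  have "polyf \<rat> 3 (\<lambda>u. mp_eval (map (\<lambda>l. (if l < 12 then (\<lambda>u. u 0 ^ xexp a sx l * u 1 ^ yexp b sy l) else (\<lambda>u. u 2)) u) [0..<13]) F)"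
    by (rule rats.polyf_wform[OF assms]) (auto intro!: polyf_mult polyf_power polyf_var)
  moreover have "map (\<lambda>l. (if l < 12 then (\<lambda>u. u 0 ^ xexp a sx l * u 1 ^ yexp b sy l) else (\<lambda>u. u 2)) u) [0..<13]
      = emb a b sx sy (u 0) (u 1) (u 2)" for u :: "nat \<Rightarrow> complex"
    by (auto simp: emb_def)
  ultimately show ?thesis by (simp only:)
qed

locale dmodel = dcover +
  assumes gen_inv: "generic2 (1 / \<xi>) \<eta>" "generic2 \<xi> (1 / \<eta>)" "generic2 (1 / \<xi>) (1 / \<eta>)"
begin

text \<open>The flags tell whether x^(2a) and y^(2b) divide the monomial. Inverting a variable
  reverses its flag, which gives the equation in each chart.\<close>

definition coef :: "bool \<Rightarrow> bool \<Rightarrow> complex" where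
  "coef hx hy = (if hx then (if hy then p else q) else (if hy then r else s))"

definition "Xc sx = (if sx then 1 / \<xi> else \<xi>)"
definition "Yc sy = (if sy then 1 / \<eta> else \<eta>)"
text \<open>The factor by which the coordinate vectors of the standard chart and of the chart
  \<open>sx\<close>, \<open>sy\<close> differ at the generic point.\<close>

definition "unt sx sy = (if sx then \<xi> ^ a else 1) * (if sy then \<eta> ^ b else 1)"
definition "Wc sx sy = \<omega> / unt sx sy"
definition "Bc sx sy = biquad a b (coef (\<not> sx) (\<not> sy)) (coef (\<not> sx) sy) (coef sx (\<not> sy)) (coef sx sy)"

lemma unt_nonzero: "unt sx sy \<noteq> 0"
  using X_nonzero Y_nonzero by (simp add: unt_def)

lemma chart: "dcover a b (coef (\<not> sx) (\<not> sy)) (coef (\<not> sx) sy) (coef sx (\<not> sy)) (coef sx sy) (Xc sx) (Yc sy) (Wc sx sy)"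
proof
  show "(Wc sx sy)\<^sup>2 = biquad a b (coef (\<not> sx) (\<not> sy)) (coef (\<not> sx) sy) (coef sx (\<not> sy)) (coef sx sy) (Xc sx) (Yc sy)"
    using X_nonzero Y_nonzero
    by (cases sx; cases sy)
      (simp_all add: Wc_def unt_def coef_def Xc_def Yc_def \<omega> biquad_def power_divide power_mult_distrib
        add_divide_distrib distrib_left distrib_right mult_ac flip: power_mult)
qed (use a b rat nz det gen gen_inv in \<open>auto simp: coef_def Xc_def Yc_def mult.commute\<close>)

sublocale ch: dcover a b "coef (\<not> sx) (\<not> sy)" "coef (\<not> sx) sy" "coef sx (\<not> sy)" "coef sx sy" "Xc sx" "Yc sy" "Wc sx sy"
  for sx sy
  by (rule chart)

definition "g = emb a b False False \<xi> \<eta> \<omega>"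

lemma length_g [simp]: "length g = 13"
  by (simp add: g_def)

lemma g_chart: "g = map ((*) (unt sx sy)) (emb a b sx sy (Xc sx) (Yc sy) (Wc sx sy))"
proof (rule nth_equalityI)
  fix l assume "l < length g"
  then consider "l < 12" | "l = 12" by fastforce
  then show "g ! l = map ((*) (unt sx sy)) (emb a b sx sy (Xc sx) (Yc sy) (Wc sx sy)) ! l"
  proof cases
    case 1
    have x: "\<xi> ^ xexp a False l = (if sx then \<xi> ^ a else 1) * Xc sx ^ xexp a sx l"
    proof (cases sx)
      case True
      have "\<xi> ^ a = \<xi> ^ xexp a False l * \<xi> ^ xexp a True l"
        using exp_reflect(1)[OF 1 a, of False] by (simp flip: power_add)
      then show ?thesis using X_nonzero True by (simp add: Xc_def power_divide)
    qed (simp add: Xc_def)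
    have y: "\<eta> ^ yexp b False l = (if sy then \<eta> ^ b else 1) * Yc sy ^ yexp b sy l"
    proof (cases sy)
      case True
      have "\<eta> ^ b = \<eta> ^ yexp b False l * \<eta> ^ yexp b True l"
        using exp_reflect(2)[OF 1 b, of False] by (simp flip: power_add)
      then show ?thesis using Y_nonzero True by (simp add: Yc_def power_divide)
    qed (simp add: Yc_def)
    show ?thesis using 1 by (simp add: g_def nth_emb x y unt_def mult_ac)
  next
    case 2
    then show ?thesis using unt_nonzero by (simp add: g_def nth_emb Wc_def)
  qed
qed simp

lemma mp_eval_g:
  "wform \<rat> (replicate 13 1) d F \<Longrightarrow>
    mp_eval g F = unt sx sy ^ d * mp_eval (emb a b sx sy (Xc sx) (Yc sy) (Wc sx sy)) F"
  by (subst g_chart[of sx sy]) (rule mp_eval_scale, simp_all)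

text \<open>Forms of equal degree pick up the same power of \<open>unt\<close>, so projective
  fractions are affine ones. Conversely 1, x, y and w all occur among the coordinates, so every
  affine fraction comes from forms.\<close>

lemma local_ring_chart:
  assumes w: "w\<^sup>2 = Bc sx sy x y"
  shows "local_ring \<rat> g (emb a b sx sy x y w) = regring (Xc sx) (Yc sy) (Wc sx sy) x y w"
proof
  let ?P = "emb a b sx sy x y w" and ?G = "emb a b sx sy (Xc sx) (Yc sy) (Wc sx sy)"
  let ?v = "replicate 13 (1::nat)"
  have w': "w\<^sup>2 = ch.B sx sy x y" using w by (simp add: Bc_def)
  show "local_ring \<rat> g ?P \<subseteq> regring (Xc sx) (Yc sy) (Wc sx sy) x y w"
  proof
    fix h assume "h \<in> local_ring \<rat> g ?P"
    then obtain F G d where h: "h = mp_eval g F / mp_eval g G" "wform \<rat> ?v d F" "wform \<rat> ?v d G" "mp_eval ?P G \<noteq> 0"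
      by (auto simp: local_ring_def)
    have "h = mp_eval ?G F / mp_eval ?G G"
      unfolding h(1) mp_eval_g[OF h(2), of sx sy] mp_eval_g[OF h(3), of sx sy] using unt_nonzero by simp
    then show "h \<in> regring (Xc sx) (Yc sy) (Wc sx sy) x y w"
      using ch.regI[OF polyf_emb[OF h(2), of a b sx sy] polyf_emb[OF h(3), of a b sx sy], of x y w sx sy] h(4) by simp
  qed
  \<comment> \<open>Records the values of one quotient of forms at the generic and at the special
    point simultaneously. The second value is needed to see that the image of an affine denominator
    is nonzero at the special point.\<close>
  define LV where "LV h c \<longleftrightarrow> (\<exists>F G d. wform \<rat> ?v d F \<and> wform \<rat> ?v d G \<and> mp_eval ?P G \<noteq> 0 \<and> mp_eval ?G G \<noteq> 0 \<and>
      h = mp_eval ?G F / mp_eval ?G G \<and> c = mp_eval ?P F / mp_eval ?P G)" for h c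
  have const: "LV c c" if "c \<in> \<rat>" for c
    unfolding LV_def
    by (rule exI[of _ "mconst c"], rule exI[of _ "mconst 1"], rule exI[of _ 0]) (use that in \<open>auto intro: wform_mconst\<close>)
  have coord: "LV (?G ! i) (?P ! i)" if "i < 13" for i
    unfolding LV_def
    by (rule exI[of _ "mvar i"], rule exI[of _ "mvar (cidx sx sy)"], rule exI[of _ 1])
      (use that idx_less(1)[of sx sy] in \<open>auto simp: wform_coord emb_idx simp del: One_nat_def\<close>)
  have LV_add: "LV (h + h') (c + c')" and LV_mult: "LV (h * h') (c * c')" if "LV h c" "LV h' c'" for h c h' c'
  proof -
    obtain F G d where *: "wform \<rat> ?v d F" "wform \<rat> ?v d G" "mp_eval ?P G \<noteq> 0" "mp_eval ?G G \<noteq> 0"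
      "h = mp_eval ?G F / mp_eval ?G G" "c = mp_eval ?P F / mp_eval ?P G" using \<open>LV h c\<close> unfolding LV_def by blast
    obtain F' G' d' where **: "wform \<rat> ?v d' F'" "wform \<rat> ?v d' G'" "mp_eval ?P G' \<noteq> 0" "mp_eval ?G G' \<noteq> 0"
      "h' = mp_eval ?G F' / mp_eval ?G G'" "c' = mp_eval ?P F' / mp_eval ?P G'" using \<open>LV h' c'\<close> unfolding LV_def by blast
    have wf: "wform \<rat> ?v (d + d') (F * G' + F' * G)" "wform \<rat> ?v (d + d') (F * F')" "wform \<rat> ?v (d + d') (G * G')"
      using rats.wform_mult[OF *(1) **(2)] rats.wform_mult[OF **(1) *(2)] rats.wform_mult[OF *(1) **(1)]
        rats.wform_mult[OF *(2) **(2)] rats.wform_add by (simp_all add: add.commute)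
    show "LV (h + h') (c + c')"
      unfolding LV_def
      by (rule exI[of _ "F * G' + F' * G"], rule exI[of _ "G * G'"], rule exI[of _ "d + d'"])
        (use wf * ** in \<open>simp add: add_frac_eq\<close>)
    show "LV (h * h') (c * c')"
      unfolding LV_def
      by (rule exI[of _ "F * F'"], rule exI[of _ "G * G'"], rule exI[of _ "d + d'"]) (use wf * ** in simp)
  qed
  have poly: "LV (A (as3 (Xc sx) (Yc sy) (Wc sx sy))) (A (as3 x y w))" if "polyf \<rat> 3 A" for A
    using that
  proof (induction rule: polyf.induct)
    case (polyf_var i)
    then consider "i = 0" | "i = 1" | "i = 2" by linarith
    then show ?case
      using coord[of "xidx sx sy"] coord[of "yidx sx sy"] coord[of 12] idx_less[of sx sy]
      by cases (simp_all add: emb_idx nth_emb)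
  qed (simp_all add: const LV_add LV_mult)
  show "regring (Xc sx) (Yc sy) (Wc sx sy) x y w \<subseteq> local_ring \<rat> g ?P"
  proof
    fix h assume "h \<in> regring (Xc sx) (Yc sy) (Wc sx sy) x y w"
    then obtain A B where h: "polyf \<rat> 3 A" "polyf \<rat> 3 B" "B (as3 x y w) \<noteq> 0" "B (as3 (Xc sx) (Yc sy) (Wc sx sy)) \<noteq> 0"
      "h = A (as3 (Xc sx) (Yc sy) (Wc sx sy)) / B (as3 (Xc sx) (Yc sy) (Wc sx sy))"
      using ch.regE[OF _ w'] by blast
    obtain F G d where F: "wform \<rat> ?v d F" "wform \<rat> ?v d G" "mp_eval ?P G \<noteq> 0" "mp_eval ?G G \<noteq> 0"
      "A (as3 (Xc sx) (Yc sy) (Wc sx sy)) = mp_eval ?G F / mp_eval ?G G"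
      using poly[OF h(1)] unfolding LV_def by blast
    obtain F' G' d' where F': "wform \<rat> ?v d' F'" "wform \<rat> ?v d' G'" "mp_eval ?P G' \<noteq> 0" "mp_eval ?G G' \<noteq> 0"
      "B (as3 (Xc sx) (Yc sy) (Wc sx sy)) = mp_eval ?G F' / mp_eval ?G G'" "B (as3 x y w) = mp_eval ?P F' / mp_eval ?P G'"
      using poly[OF h(2)] unfolding LV_def by blast
    have wf: "wform \<rat> ?v (d + d') (F * G')" "wform \<rat> ?v (d + d') (G * F')"
      using rats.wform_mult F(1,2) F'(1,2) by blast+
    have "h = mp_eval g (F * G') / mp_eval g (G * F')"
      unfolding mp_eval_g[OF wf(1), of sx sy] mp_eval_g[OF wf(2), of sx sy] h(5) F(5) F'(5) using unt_nonzero F'(4) by simp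
    moreover have "mp_eval ?P (G * F') \<noteq> 0" using F(3) F'(6) h(3) by auto
    ultimately show "h \<in> local_ring \<rat> g ?P"
      unfolding local_ring_def length_g using wf by blast
  qed
qed

lemma fun_field_g: "fun_field \<rat> g = FF"
proof -
  have "local_ring \<rat> g g = FF"
    using local_ring_chart[of \<omega> False False \<xi> \<eta>] \<omega> by (simp add: g_def Bc_def coef_def Xc_def Yc_def Wc_def unt_def)
  then show ?thesis by (simp add: local_ring_def res_field_def)
qed

lemma regring_chart_generic: "regring (Xc sx) (Yc sy) (Wc sx sy) (Xc sx) (Yc sy) (Wc sx sy) = FF"
proof -
  let ?G = "emb a b sx sy (Xc sx) (Yc sy) (Wc sx sy)"
  have "local_ring \<rat> g ?G = local_ring \<rat> g g"
  proof -
    have "mp_eval ?G F \<noteq> 0 \<longleftrightarrow> mp_eval g F \<noteq> 0" if "wform \<rat> (replicate 13 1) d F" for d F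
      using mp_eval_g[OF that, of sx sy] unt_nonzero by simp
    then show ?thesis unfolding local_ring_def length_g by blast
  qed
  then show ?thesis
    using local_ring_chart[of "Wc sx sy" sx sy "Xc sx" "Yc sy"] ch.\<omega> fun_field_g
    by (simp add: Bc_def local_ring_def res_field_def)
qed

end

text \<open>Homogenised monomial relation, with X_c, X_x, X_y the coordinates that are 1, x, y in
  the chart: where X_c \<noteq> 0, coordinate l is the corresponding monomial in x and y.\<close>

definition mon_form :: "nat \<Rightarrow> nat \<Rightarrow> bool \<Rightarrow> bool \<Rightarrow> nat \<Rightarrow> mpol" where
  "mon_form a b sx sy l = mvar l * mvar (cidx sx sy) ^ (xexp a sx l + yexp b sy l) -
     mvar (cidx sx sy) * (mvar (xidx sx sy) ^ xexp a sx l * mvar (yidx sx sy) ^ yexp b sy l)"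

text \<open>Relation between a point l on an edge of the grid and the corners i, j at its ends,
  whose weighted mean with weights m, k it is. It is used where all corner coordinates
  vanish.\<close>

definition edge_form :: "nat \<Rightarrow> nat \<Rightarrow> nat \<Rightarrow> nat \<Rightarrow> nat \<Rightarrow> mpol" where
  "edge_form i j l m k = mvar l ^ (m + k) - mvar i ^ m * mvar j ^ k"

lemma wform_coord_power: "i < 13 \<Longrightarrow> wform \<rat> (replicate 13 1) n (mvar i ^ n)"
  using rats.wform_power[OF wform_coord, of i n] by simp

lemma idx_13: "cidx sx sy < 13" "xidx sx sy < 13" "yidx sx sy < 13"
  using idx_less[of sx sy] by auto

lemma wform_mon_form:
  assumes "l < 13"
  shows "wform \<rat> (replicate 13 1) (1 + (xexp a sx l + yexp b sy l)) (mon_form a b sx sy l)"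
  unfolding mon_form_def
  by (intro rats.wform_diff rats.wform_mult wform_coord wform_coord_power idx_13 assms)

lemma wform_edge_form:
  "i < 13 \<Longrightarrow> j < 13 \<Longrightarrow> l < 13 \<Longrightarrow> wform \<rat> (replicate 13 1) (m + k) (edge_form i j l m k)"
  unfolding edge_form_def by (intro rats.wform_diff rats.wform_mult wform_coord_power)

lemma mp_eval_mon_form:
  assumes "length v = 13" "l < 13"
  shows "mp_eval v (mon_form a b sx sy l) = v ! l * v ! cidx sx sy ^ (xexp a sx l + yexp b sy l) -
     v ! cidx sx sy * (v ! xidx sx sy ^ xexp a sx l * v ! yidx sx sy ^ yexp b sy l)"
  using assms idx_13[of sx sy] by (simp add: mon_form_def)

lemma mp_eval_edge_form:
  "length v = 13 \<Longrightarrow> i < 13 \<Longrightarrow> j < 13 \<Longrightarrow> l < 13 \<Longrightarrow>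
    mp_eval v (edge_form i j l m k) = v ! l ^ (m + k) - v ! i ^ m * v ! j ^ k"
  by (simp add: edge_form_def)

lemma mon_form_deriv:
  assumes v: "length v = 13" and l: "l < 12" "l \<notin> {cidx sx sy, xidx sx sy, yidx sx sy}"
    and i: "i < 13" "i \<noteq> cidx sx sy"
  shows "mp_eval v (mp_deriv i (mon_form a b sx sy l)) =
    (if i = l then v ! cidx sx sy ^ (xexp a sx l + yexp b sy l)
     else if i = xidx sx sy then - v ! cidx sx sy * (of_nat (xexp a sx l) * v ! xidx sx sy ^ (xexp a sx l - 1) * v ! yidx sx sy ^ yexp b sy l)
     else if i = yidx sx sy then - v ! cidx sx sy * (v ! xidx sx sy ^ xexp a sx l * (of_nat (yexp b sy l) * v ! yidx sx sy ^ (yexp b sy l - 1)))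
     else 0)"
proof (rule mp_deriv_eval_eq)
  show "i < length v" using v i by simp
  have ne: "xidx sx sy \<noteq> yidx sx sy" "xidx sx sy \<noteq> cidx sx sy" "yidx sx sy \<noteq> cidx sx sy" using idx_less[of sx sy] by auto
  define ev where "ev z = mp_eval (v[i := z]) (mon_form a b sx sy l)" for z
  have e: "ev z = v[i := z] ! l * v[i := z] ! cidx sx sy ^ (xexp a sx l + yexp b sy l) -
     v[i := z] ! cidx sx sy * (v[i := z] ! xidx sx sy ^ xexp a sx l * v[i := z] ! yidx sx sy ^ yexp b sy l)" for z
    unfolding ev_def by (rule mp_eval_mon_form) (use v l in auto)
  consider "i = l" | "i = xidx sx sy" "i \<noteq> l" | "i = yidx sx sy" "i \<noteq> l" | "i \<noteq> l" "i \<noteq> xidx sx sy" "i \<noteq> yidx sx sy" by blast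
  then have "(ev has_field_derivative
    (if i = l then v ! cidx sx sy ^ (xexp a sx l + yexp b sy l)
     else if i = xidx sx sy then - v ! cidx sx sy * (of_nat (xexp a sx l) * v ! xidx sx sy ^ (xexp a sx l - 1) * v ! yidx sx sy ^ yexp b sy l)
     else if i = yidx sx sy then - v ! cidx sx sy * (v ! xidx sx sy ^ xexp a sx l * (of_nat (yexp b sy l) * v ! yidx sx sy ^ (yexp b sy l - 1)))
     else 0)) (at (v ! i))"
  proof cases
    case 1
    have "ev = (\<lambda>z. z * v ! cidx sx sy ^ (xexp a sx l + yexp b sy l) -
      v ! cidx sx sy * (v ! xidx sx sy ^ xexp a sx l * v ! yidx sx sy ^ yexp b sy l))"
      using 1 l i v by (auto simp: e fun_eq_iff)
    then show ?thesis using 1 by (auto intro!: derivative_eq_intros)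
  next
    case 2
    have "ev = (\<lambda>z. v ! l * v ! cidx sx sy ^ (xexp a sx l + yexp b sy l) -
      v ! cidx sx sy * (z ^ xexp a sx l * v ! yidx sx sy ^ yexp b sy l))"
      using 2 l i v ne by (auto simp: e fun_eq_iff)
    then show ?thesis using 2 by (auto intro!: derivative_eq_intros)
  next
    case 3
    have "ev = (\<lambda>z. v ! l * v ! cidx sx sy ^ (xexp a sx l + yexp b sy l) -
      v ! cidx sx sy * (v ! xidx sx sy ^ xexp a sx l * z ^ yexp b sy l))"
      using 3 l i v ne by (auto simp: e fun_eq_iff)
    then show ?thesis using 3 ne by (auto intro!: derivative_eq_intros)
  next
    case 4
    have "ev = (\<lambda>z. v ! l * v ! cidx sx sy ^ (xexp a sx l + yexp b sy l) -
      v ! cidx sx sy * (v ! xidx sx sy ^ xexp a sx l * v ! yidx sx sy ^ yexp b sy l))"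
      using 4 i by (auto simp: e fun_eq_iff)
    then show ?thesis using 4 by (auto intro!: derivative_eq_intros)
  qed
  then show "((\<lambda>z. mp_eval (v[i := z]) (mon_form a b sx sy l)) has_field_derivative
    (if i = l then v ! cidx sx sy ^ (xexp a sx l + yexp b sy l)
     else if i = xidx sx sy then - v ! cidx sx sy * (of_nat (xexp a sx l) * v ! xidx sx sy ^ (xexp a sx l - 1) * v ! yidx sx sy ^ yexp b sy l)
     else if i = yidx sx sy then - v ! cidx sx sy * (v ! xidx sx sy ^ xexp a sx l * (of_nat (yexp b sy l) * v ! yidx sx sy ^ (yexp b sy l - 1)))
     else 0)) (at (v ! i))" unfolding ev_def .
qed

section \<open>Equations, charts and smoothness of the model\<close>

context dmodel
begin

text \<open>The squares of the corner monomials are 1, x^(2a), y^(2b) and x^(2a) y^(2b), so the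
  equation of the cover becomes a quadric in the corner coordinates and w, with these
  coefficients.\<close>

definition corner :: "nat \<Rightarrow> complex" where
  "corner i = [s, q, r, p] ! i"

definition quad_form :: mpol where
  "quad_form = mvar 12 ^ 2 - (\<Sum>i<4. mconst (corner i) * mvar i ^ 2)"

lemma corner_Rats: "i < 4 \<Longrightarrow> corner i \<in> \<rat>"
  using rat by (auto simp: corner_def less_Suc_eq numeral_eq_Suc)

lemma wform_quad_form: "wform \<rat> (replicate 13 1) 2 quad_form"
proof -
  have "wform \<rat> (replicate 13 1) 2 (mconst (corner i) * mvar i ^ 2)" if i: "i < 4" for i
  proof -
    have "i < 13" using i by simp
    from rats.wform_mult[OF wform_mconst[OF corner_Rats[OF i]] wform_coord_power[OF this, of 2]]
    show ?thesis by (simp only: add_0)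
  qed
  then show ?thesis
    unfolding quad_form_def by (intro rats.wform_diff rats.wform_sum wform_coord_power) auto
qed

lemma mp_eval_quad_form:
  "length v = 13 \<Longrightarrow> mp_eval v quad_form = (v ! 12)\<^sup>2 - (\<Sum>i<4. corner i * (v ! i)\<^sup>2)"
  by (auto simp: quad_form_def intro!: sum.cong)

lemma sum_4: "(\<Sum>i<(4::nat). f i) = f 0 + f 1 + f 2 + f 3"
  by (simp add: eval_nat_numeral)

lemma corner_sum:
  "(\<Sum>i<4. corner i * (x ^ xexp a sx i * y ^ yexp b sy i)\<^sup>2) = Bc sx sy x y"
  unfolding sum_4
  by (cases sx; cases sy)
    (simp_all add: corner_def xexp_def yexp_def xlev_def ylev_def lev_def Bc_def coef_def biquad_def
      power_mult_distrib algebra_simps flip: power_mult)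

lemma corner_sum_deriv:
  "(\<Sum>i<4. corner i * (2 * of_nat (xexp a sx i) * x ^ (2 * xexp a sx i - 1) * y ^ (2 * yexp b sy i))) = ch.Bx sx sy x y"
  "(\<Sum>i<4. corner i * (2 * of_nat (yexp b sy i) * y ^ (2 * yexp b sy i - 1) * x ^ (2 * xexp a sx i))) = ch.By sx sy x y"
  unfolding sum_4 ch.Bx_def ch.By_def
  by (cases sx; cases sy;
      simp add: corner_def xexp_def yexp_def xlev_def ylev_def lev_def coef_def algebra_simps)+

lemma quad_form_emb: "mp_eval (emb a b sx sy x y w) quad_form = w\<^sup>2 - Bc sx sy x y"
  by (simp add: mp_eval_quad_form nth_emb corner_sum)

lemma quad_form_deriv:
  assumes v: "length v = 13" and i: "i < 13"
  shows "mp_eval v (mp_deriv i quad_form) = (if i = 12 then 2 * v ! 12 else if i < 4 then - (2 * corner i * v ! i) else 0)"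
proof (rule mp_deriv_eval_eq)
  show "i < length v" using v i by simp
  have e: "mp_eval (v[i := z]) quad_form = (v[i := z] ! 12)\<^sup>2 - (\<Sum>j<4. corner j * (v[i := z] ! j)\<^sup>2)" for z
    by (rule mp_eval_quad_form) (use v in auto)
  have "((\<lambda>z. (v[i := z] ! 12)\<^sup>2) has_field_derivative (if i = 12 then 2 * v ! 12 else 0)) (at (v ! i))"
    using v by (cases "i = 12") (auto intro!: derivative_eq_intros)
  moreover have "((\<lambda>z. \<Sum>j<4. corner j * (v[i := z] ! j)\<^sup>2) has_field_derivative
      (\<Sum>j<4. if j = i then 2 * corner i * v ! i else 0)) (at (v ! i))"
  proof (rule DERIV_sum)
    fix j assume "j \<in> {..<4::nat}"
    then show "((\<lambda>z. corner j * (v[i := z] ! j)\<^sup>2) has_field_derivative (if j = i then 2 * corner i * v ! i else 0)) (at (v ! i))"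
      using v by (cases "i = j") (auto intro!: derivative_eq_intros)
  qed
  ultimately show "((\<lambda>z. mp_eval (v[i := z]) quad_form) has_field_derivative
      (if i = 12 then 2 * v ! 12 else if i < 4 then - (2 * corner i * v ! i) else 0)) (at (v ! i))"
    unfolding e by (rule DERIV_cong[OF DERIV_diff]) (auto simp: sum.delta)
qed

lemma emb_in_locus:
  assumes w: "w\<^sup>2 = Bc sx sy x y"
  shows "emb a b sx sy x y w \<in> locus \<rat> g"
proof -
  have "\<exists>c\<in>set (emb a b sx sy x y w). c \<noteq> 0"
    using emb_idx(1)[of a b sx sy x y w] idx_13(1)[of sx sy] by (metis length_emb nth_mem zero_neq_one)
  moreover have "mp_eval (emb a b sx sy x y w) F = 0" if F: "wform \<rat> (replicate 13 1) d F" "mp_eval g F = 0" for F d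
  proof -
    have "mp_eval (emb a b sx sy (Xc sx) (Yc sy) (Wc sx sy)) F = 0"
      using F mp_eval_g[OF F(1), of sx sy] unt_nonzero[of sx sy] by simp
    then show ?thesis
      using ch.specialize[OF polyf_emb[OF F(1), of a b sx sy], of sx sy w x y] w by (simp add: Bc_def)
  qed
  ultimately show ?thesis unfolding locus_def pt_def nonzero_vecs_def by auto
qed

lemma form_vanish_g:
  assumes "wform \<rat> (replicate 13 1) d F" "mp_eval (emb a b sx sy (Xc sx) (Yc sy) (Wc sx sy)) F = 0"
  shows "mp_eval g F = 0" "F \<in> pt \<rat> (ones g) g"
  using assms mp_eval_g[OF assms(1), of sx sy] by (auto simp: pt_def simp del: One_nat_def)

lemma locus_vanish:
  "y \<in> locus \<rat> g \<Longrightarrow> wform \<rat> (replicate 13 1) d F \<Longrightarrow> mp_eval g F = 0 \<Longrightarrow> mp_eval y F = 0"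
  unfolding locus_def pt_def length_g by blast

lemma mon_form_vanish: "l < 12 \<Longrightarrow> mp_eval g (mon_form a b sx sy l) = 0" "l < 12 \<Longrightarrow> mon_form a b sx sy l \<in> pt \<rat> (ones g) g"
proof -
  assume l: "l < 12"
  have "mp_eval (emb a b sx sy (Xc sx) (Yc sy) (Wc sx sy)) (mon_form a b sx sy l) = 0"
    using l idx_13[of sx sy] by (simp add: mp_eval_mon_form emb_idx nth_emb)
  from form_vanish_g[OF wform_mon_form this] l
  show "mp_eval g (mon_form a b sx sy l) = 0" "mon_form a b sx sy l \<in> pt \<rat> (ones g) g" by auto
qed

lemma quad_form_vanish: "mp_eval g quad_form = 0" "quad_form \<in> pt \<rat> (ones g) g"
  using form_vanish_g[OF wform_quad_form, of False False] ch.\<omega>[of False False] by (simp_all add: quad_form_emb Bc_def)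

lemma edge_form_vanish:
  assumes "i < 12" "j < 12" "l < 12"
    and "xexp a False l * (m + k) = xexp a False i * m + xexp a False j * k"
    and "yexp b False l * (m + k) = yexp b False i * m + yexp b False j * k"
  shows "mp_eval g (edge_form i j l m k) = 0"
proof -
  have "\<xi> ^ (xexp a False l * (m + k)) * \<eta> ^ (yexp b False l * (m + k)) =
      \<xi> ^ (xexp a False i * m) * \<eta> ^ (yexp b False i * m) * (\<xi> ^ (xexp a False j * k) * \<eta> ^ (yexp b False j * k))"
    unfolding assms(4,5) by (simp add: power_add mult_ac)
  then show ?thesis
    using assms(1-3) by (simp add: mp_eval_edge_form g_def nth_emb power_mult_distrib power_mult)
qed

text \<open>Shows that the four charts cover the surface: if the corners vanished, a power of each
  edge coordinate would vanish by an edge relation, and w by the quadric.\<close>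

lemma corners_zero:
  assumes y: "y \<in> locus \<rat> g" and c: "\<And>i. i < 4 \<Longrightarrow> y ! i = 0"
  shows False
proof -
  have len: "length y = 13" and nz: "\<exists>c\<in>set y. c \<noteq> 0" using y by (auto simp: locus_def nonzero_vecs_def)
  have edge: "y ! l = 0" if "i < 4" "j < 4" "l < 12" "m + k > 0"
    "xexp a False l * (m + k) = xexp a False i * m + xexp a False j * k"
    "yexp b False l * (m + k) = yexp b False i * m + yexp b False j * k" for i j l m k
  proof -
    have "mp_eval y (edge_form i j l m k) = 0"
      by (rule locus_vanish[OF y wform_edge_form edge_form_vanish]) (use that in auto)
    then have "y ! l ^ (m + k) = 0 ^ m * 0 ^ k" using that len c by (simp add: mp_eval_edge_form)
    then show ?thesis using that(4) by (cases "m = 0") (auto simp: power_0_left)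
  qed
  note d = xexp_def yexp_def xlev_def ylev_def lev_def
  have "y ! 4 = 0" by (rule edge[of 0 1 _ "a - 1" 1]) (use a b in \<open>simp_all add: d\<close>)
  moreover have "y ! 5 = 0" by (rule edge[of 0 1 _ 1 "a - 1"]) (use a b in \<open>simp_all add: d algebra_simps\<close>)
  moreover have "y ! 6 = 0" by (rule edge[of 2 3 _ "a - 1" 1]) (use a b in \<open>simp_all add: d algebra_simps\<close>)
  moreover have "y ! 7 = 0" by (rule edge[of 2 3 _ 1 "a - 1"]) (use a b in \<open>simp_all add: d algebra_simps\<close>)
  moreover have "y ! 8 = 0" by (rule edge[of 0 2 _ "b - 1" 1]) (use a b in \<open>simp_all add: d\<close>)
  moreover have "y ! 9 = 0" by (rule edge[of 0 2 _ 1 "b - 1"]) (use a b in \<open>simp_all add: d algebra_simps\<close>)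
  moreover have "y ! 10 = 0" by (rule edge[of 1 3 _ "b - 1" 1]) (use a b in \<open>simp_all add: d algebra_simps\<close>)
  moreover have "y ! 11 = 0" by (rule edge[of 1 3 _ 1 "b - 1"]) (use a b in \<open>simp_all add: d algebra_simps\<close>)
  moreover have "y ! 0 = 0" "y ! 1 = 0" "y ! 2 = 0" "y ! 3 = 0" using c by auto
  moreover have "y ! 12 = 0"
    using locus_vanish[OF y wform_quad_form quad_form_vanish(1)] c by (simp add: mp_eval_quad_form len)
  ultimately have "y ! l = 0" if "l < 13" for l
    using that less_12[of l] by (cases "l = 12") auto
  then show False using nz len by (auto simp: in_set_conv_nth)
qed

lemma locus_chart:
  assumes y: "y \<in> locus \<rat> g"
  shows "\<exists>sx sy \<alpha> \<beta> w c. c \<noteq> 0 \<and> w\<^sup>2 = Bc sx sy \<alpha> \<beta> \<and> y = map ((*) c) (emb a b sx sy \<alpha> \<beta> w)"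
proof -
  have len: "length y = 13" using y by (auto simp: locus_def nonzero_vecs_def)
  obtain i where i: "i < 4" "y ! i \<noteq> 0" using corners_zero[OF y] by blast
  then obtain sx sy where c: "cidx sx sy = i"
    using that[of False False] that[of True False] that[of False True] that[of True True]
    by (auto simp: idx_defs less_Suc_eq numeral_eq_Suc)
  define c where "c = y ! i"
  define \<alpha> \<beta> w where abw_def: "\<alpha> = y ! xidx sx sy / c" "\<beta> = y ! yidx sx sy / c" "w = y ! 12 / c"
  have c0: "c \<noteq> 0" using i by (simp add: c_def)
  have xy: "y ! xidx sx sy = c * \<alpha>" "y ! yidx sx sy = c * \<beta>" "y ! 12 = c * w" using c0 by (simp_all add: abw_def)
  have mon: "y ! l = c * (\<alpha> ^ xexp a sx l * \<beta> ^ yexp b sy l)" if l: "l < 12" for l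
  proof -
    have "mp_eval y (mon_form a b sx sy l) = 0"
      by (rule locus_vanish[OF y wform_mon_form mon_form_vanish(1)]) (use l in auto)
    then have "y ! l * c ^ (xexp a sx l + yexp b sy l) = c * ((c * \<alpha>) ^ xexp a sx l * (c * \<beta>) ^ yexp b sy l)"
      using l by (simp add: mp_eval_mon_form len xy c c_def)
    also have "\<dots> = c * (\<alpha> ^ xexp a sx l * \<beta> ^ yexp b sy l) * c ^ (xexp a sx l + yexp b sy l)"
      by (simp add: power_mult_distrib power_add mult_ac)
    finally show ?thesis using c0 by simp
  qed
  have "y = map ((*) c) (emb a b sx sy \<alpha> \<beta> w)"
  proof (rule nth_equalityI)
    fix l assume "l < length y"
    then consider "l < 12" | "l = 12" using len by fastforce
    then show "y ! l = map ((*) c) (emb a b sx sy \<alpha> \<beta> w) ! l"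
      by cases (use mon xy in \<open>simp_all add: nth_emb\<close>)
  qed (simp add: len)
  moreover have "w\<^sup>2 = Bc sx sy \<alpha> \<beta>"
  proof -
    have "mp_eval y quad_form = 0" by (rule locus_vanish[OF y wform_quad_form quad_form_vanish(1)])
    then have "(c * w)\<^sup>2 = (\<Sum>i<4. corner i * (c * (\<alpha> ^ xexp a sx i * \<beta> ^ yexp b sy i))\<^sup>2)"
      by (simp add: mp_eval_quad_form len xy mon)
    also have "\<dots> = c\<^sup>2 * Bc sx sy \<alpha> \<beta>"
      unfolding corner_sum[symmetric] by (simp add: sum_distrib_left power_mult_distrib mult_ac)
    finally show ?thesis using c0 by (simp add: power_mult_distrib)
  qed
  ultimately show ?thesis using c0 by blast
qed

lemma local_ring_scale:
  assumes "c \<noteq> 0" "length y = 13"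
  shows "local_ring \<rat> g (map ((*) c) y) = local_ring \<rat> g y"
proof -
  have "mp_eval (map ((*) c) y) G \<noteq> 0 \<longleftrightarrow> mp_eval y G \<noteq> 0" if "wform \<rat> (replicate 13 1) d G" for d G
    using mp_eval_scale[OF that assms(2), of c] assms(1) by simp
  then show ?thesis unfolding local_ring_def length_g by blast
qed

text \<open>Ten equations for codimension 10: a monomial relation for each of the nine coordinates
  other than 1, x, y and w, and the quadric. The columns of these nine coordinates express the other
  coefficients of a linear relation between the gradients through that of the quadric. If this is
  nonzero, the column of w gives w = 0 and the columns of x and y give Bx = By = 0, against the
  smoothness of the branch curve.\<close>

lemma smooth_surface_g: "smooth_surface \<rat> g"
  unfolding smooth_surface_def
proof
  fix v assume "v \<in> locus \<rat> g"
  then obtain sx sy x y w c where c0: "c \<noteq> 0" and w: "w\<^sup>2 = Bc sx sy x y" and v: "v = map ((*) c) (emb a b sx sy x y w)"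
    using locus_chart by metis
  let ?c = "cidx sx sy" and ?x = "xidx sx sy" and ?y = "yidx sx sy"
  note lt = idx_less[of sx sy] idx_13[of sx sy]
  define I where "I = {..<12} - {?c, ?x, ?y}"
  define rest where "rest = sorted_list_of_set I"
  have rest: "set rest = I" "distinct rest" "length rest = 9"
  proof -
    have "finite I" by (simp add: I_def)
    then show "set rest = I" "distinct rest" by (simp_all add: rest_def)
    have "card I = 9" unfolding I_def using lt by (subst card_Diff_subset) auto
    then show "length rest = 9" by (simp add: rest_def)
  qed
  define Fs where "Fs = map (mon_form a b sx sy) rest @ [quad_form]"
  have len: "length v = 13" by (simp add: v)
  have vc: "v ! ?c = c" "v ! ?x = c * x" "v ! ?y = c * y" "v ! 12 = c * w"
    using lt emb_idx[of a b sx sy x y w] by (simp_all add: v nth_emb)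
  have vl: "v ! l = c * (x ^ xexp a sx l * y ^ yexp b sy l)" if "l < 12" for l using that by (simp add: v nth_emb)
  show "\<exists>Fs. length Fs = length g - 3 \<and> set Fs \<subseteq> pt \<rat> (ones g) g \<and>
     (\<forall>C. (\<forall>i<length g. (\<Sum>j<length Fs. C j * mp_eval v (mp_deriv i (Fs ! j))) = 0) \<longrightarrow> (\<forall>j<length Fs. C j = 0))"
  proof (intro exI[of _ Fs] conjI allI impI)
    show "length Fs = length g - 3" by (simp add: Fs_def rest)
    show "set Fs \<subseteq> pt \<rat> (ones g) g"
      using mon_form_vanish(2) quad_form_vanish(2) by (auto simp: Fs_def rest I_def simp del: length_g)
    fix C :: "nat \<Rightarrow> complex" and j
    assume C: "\<forall>i<length g. (\<Sum>j<length Fs. C j * mp_eval v (mp_deriv i (Fs ! j))) = 0" and j: "j < length Fs"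
    \<comment> \<open>The coefficients reindexed by the coordinate that the relation eliminates
      instead of the position in the list.\<close>
    define K where "K l = C (THE j. j < 9 \<and> rest ! j = l)" for l
    have K: "K (rest ! j) = C j" if "j < 9" for j
    proof -
      have "(THE j'. j' < 9 \<and> rest ! j' = rest ! j) = j"
        using that rest by (intro the_equality) (auto simp: nth_eq_iff_index_eq)
      then show ?thesis by (simp add: K_def)
    qed
    have eqn: "(\<Sum>l\<in>I. K l * mp_eval v (mp_deriv i (mon_form a b sx sy l))) + C 9 * mp_eval v (mp_deriv i quad_form) = 0"
      if "i < 13" for i
    proof -
      have "(\<Sum>l\<in>I. K l * mp_eval v (mp_deriv i (mon_form a b sx sy l))) =
          (\<Sum>j<9. K (rest ! j) * mp_eval v (mp_deriv i (mon_form a b sx sy (rest ! j))))"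
        using bij_betw_nth[OF rest(2), of "{..<9}" I] rest
        by (intro sum.reindex_bij_betw[symmetric]) auto
      also have "\<dots> = (\<Sum>j<9. C j * mp_eval v (mp_deriv i (Fs ! j)))"
        by (rule sum.cong) (auto simp: K Fs_def nth_append rest)
      finally have 1: "(\<Sum>l\<in>I. K l * mp_eval v (mp_deriv i (mon_form a b sx sy l))) =
          (\<Sum>j<9. C j * mp_eval v (mp_deriv i (Fs ! j)))" .
      have "length Fs = Suc 9" "Fs ! 9 = quad_form" by (simp_all add: Fs_def rest nth_append)
      moreover have "(\<Sum>j<length Fs. C j * mp_eval v (mp_deriv i (Fs ! j))) = 0" using C that by simp
      ultimately have "(\<Sum>j<9. C j * mp_eval v (mp_deriv i (Fs ! j))) + C 9 * mp_eval v (mp_deriv i quad_form) = 0"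
        by (simp only: sum.lessThan_Suc)
      then show ?thesis unfolding 1 .
    qed
    have finI: "finite I" by (simp add: I_def)
    have D: "mp_eval v (mp_deriv i (mon_form a b sx sy l)) =
    (if i = l then c ^ (xexp a sx l + yexp b sy l)
     else if i = ?x then - c * (of_nat (xexp a sx l) * (c * x) ^ (xexp a sx l - 1) * (c * y) ^ yexp b sy l)
     else if i = ?y then - c * ((c * x) ^ xexp a sx l * (of_nat (yexp b sy l) * (c * y) ^ (yexp b sy l - 1)))
     else 0)" if "l \<in> I" "i < 13" "i \<noteq> ?c" for i l
      using mon_form_deriv[OF len, of l sx sy i a b] that unfolding vc by (auto simp: I_def)
    \<comment> \<open>In the column of coordinate l only its own monomial relation and, for a
      corner, the quadric contribute.\<close>
    have Kl: "K l * c ^ (xexp a sx l + yexp b sy l) = (if l < 4 then 2 * corner l * v ! l * C 9 else 0)" if l: "l \<in> I" for l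
    proof -
      have l': "l < 12" "l \<noteq> ?c" "l \<noteq> ?x" "l \<noteq> ?y" using l by (auto simp: I_def)
      have "(\<Sum>l'\<in>I. K l' * mp_eval v (mp_deriv l (mon_form a b sx sy l'))) =
          (\<Sum>l'\<in>I. if l' = l then K l * c ^ (xexp a sx l + yexp b sy l) else 0)"
        by (rule sum.cong) (use l' in \<open>auto simp: D\<close>)
      then show ?thesis
        using eqn[of l] l' l finI by (auto simp: quad_form_deriv[OF len] sum.delta eq_neg_iff_add_eq_0 split: if_splits)
    qed
    have "C 9 = 0"
    proof (rule ccontr)
      assume C9: "C 9 \<noteq> 0"
      have "(\<Sum>l\<in>I. K l * mp_eval v (mp_deriv 12 (mon_form a b sx sy l))) = 0"
        by (rule sum.neutral) (use lt in \<open>auto simp: D I_def\<close>)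
      then have "v ! 12 = 0" using eqn[of 12] C9 by (simp add: quad_form_deriv[OF len])
      then have w0: "w = 0" using c0 vc by simp
      have sub: "{..<4} - {?c} \<subseteq> I" using lt by (auto simp: I_def)
      have corners: "(\<Sum>l\<in>I. K l * E l) = (\<Sum>l\<in>{..<4}. (if l = ?c then 0 else K l * E l))" for E
      proof -
        have "K l = 0" if "l \<in> I" "\<not> l < 4" for l using Kl[OF that(1)] that c0 by simp
        then have "(\<Sum>l\<in>I. K l * E l) = (\<Sum>l\<in>{..<4} - {?c}. K l * E l)"
          using sub finI by (intro sum.mono_neutral_right) (auto simp: I_def)
        also have "\<dots> = (\<Sum>l\<in>{..<4} - {?c}. (if l = ?c then 0 else K l * E l))" by (rule sum.cong) auto
        also have "\<dots> = (\<Sum>l\<in>{..<4}. (if l = ?c then 0 else K l * E l))"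
          by (rule sum.mono_neutral_left) auto
        finally show ?thesis .
      qed
      have K4: "K l * c ^ (xexp a sx l + yexp b sy l) = 2 * corner l * v ! l * C 9" if "l < 4" "l \<noteq> ?c" for l
        using Kl[of l] that sub by auto
      have "(\<Sum>l\<in>I. K l * mp_eval v (mp_deriv ?x (mon_form a b sx sy l))) = 0"
        using eqn[of ?x] lt by (simp add: quad_form_deriv[OF len])
      moreover have "(\<Sum>l\<in>I. K l * mp_eval v (mp_deriv ?x (mon_form a b sx sy l))) =
          (\<Sum>l\<in>I. K l * (- c * (of_nat (xexp a sx l) * (c * x) ^ (xexp a sx l - 1) * (c * y) ^ yexp b sy l)))"
        by (rule sum.cong) (use lt in \<open>auto simp: D I_def\<close>)
      \<comment> \<open>The chain rule in disguise: after substitution of the relation for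
        \<open>K\<close>, the column of x is the x-derivative of the sum over the corners, which is
        \<open>B\<close> in this chart.\<close>
      moreover have "\<dots> = - (c * C 9) * ch.Bx sx sy x y"
        unfolding corners corner_sum_deriv[symmetric] sum_distrib_left
      proof (rule sum.cong)
        fix l assume l: "l \<in> {..<4::nat}"
        show "(if l = ?c then 0 else K l * (- c * (of_nat (xexp a sx l) * (c * x) ^ (xexp a sx l - 1) * (c * y) ^ yexp b sy l))) =
           - (c * C 9) * (corner l * (2 * of_nat (xexp a sx l) * x ^ (2 * xexp a sx l - 1) * y ^ (2 * yexp b sy l)))"
        proof (cases "l = ?c \<or> xexp a sx l = 0")
          case False
          then obtain n where n: "xexp a sx l = Suc n" by (cases "xexp a sx l") auto
          have "K l * (- c * (of_nat (xexp a sx l) * (c * x) ^ (xexp a sx l - 1) * (c * y) ^ yexp b sy l)) =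
             - (K l * c ^ (xexp a sx l + yexp b sy l)) * of_nat (xexp a sx l) * x ^ n * y ^ yexp b sy l"
            by (simp add: n power_mult_distrib power_add mult_ac)
          also have "\<dots> = - (c * C 9) * (corner l * (2 * of_nat (xexp a sx l) * x ^ (2 * xexp a sx l - 1) * y ^ (2 * yexp b sy l)))"
          proof -
            have 1: "K l * c ^ (xexp a sx l + yexp b sy l) = 2 * corner l * (c * (x ^ xexp a sx l * y ^ yexp b sy l)) * C 9"
              using K4[of l] vl[of l] l False by simp
            have 2: "x ^ (2 * xexp a sx l - 1) = x ^ xexp a sx l * x ^ n" "y ^ (2 * yexp b sy l) = y ^ yexp b sy l * y ^ yexp b sy l"
              by (simp_all add: n mult_2 flip: power_add)
            show ?thesis unfolding 1 2 by (simp only: mult_minus_left mult_minus_right mult_ac)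
          qed
          finally show ?thesis using False by simp
        qed (auto simp: exp_chart)
      qed auto
      ultimately have 1: "ch.Bx sx sy x y = 0" using c0 C9 by simp
      have "(\<Sum>l\<in>I. K l * mp_eval v (mp_deriv ?y (mon_form a b sx sy l))) = 0"
        using eqn[of ?y] lt by (simp add: quad_form_deriv[OF len])
      moreover have "(\<Sum>l\<in>I. K l * mp_eval v (mp_deriv ?y (mon_form a b sx sy l))) =
          (\<Sum>l\<in>I. K l * (- c * ((c * x) ^ xexp a sx l * (of_nat (yexp b sy l) * (c * y) ^ (yexp b sy l - 1)))))"
        by (rule sum.cong) (use lt in \<open>auto simp: D I_def\<close>)
      moreover have "\<dots> = - (c * C 9) * ch.By sx sy x y"
        unfolding corners corner_sum_deriv[symmetric] sum_distrib_left
      proof (rule sum.cong)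
        fix l assume l: "l \<in> {..<4::nat}"
        show "(if l = ?c then 0 else K l * (- c * ((c * x) ^ xexp a sx l * (of_nat (yexp b sy l) * (c * y) ^ (yexp b sy l - 1))))) =
           - (c * C 9) * (corner l * (2 * of_nat (yexp b sy l) * y ^ (2 * yexp b sy l - 1) * x ^ (2 * xexp a sx l)))"
        proof (cases "l = ?c \<or> yexp b sy l = 0")
          case False
          then obtain n where n: "yexp b sy l = Suc n" by (cases "yexp b sy l") auto
          have "K l * (- c * ((c * x) ^ xexp a sx l * (of_nat (yexp b sy l) * (c * y) ^ (yexp b sy l - 1)))) =
             - (K l * c ^ (xexp a sx l + yexp b sy l)) * of_nat (yexp b sy l) * y ^ n * x ^ xexp a sx l"
            by (simp add: n power_mult_distrib power_add mult_ac)
          also have "\<dots> = - (c * C 9) * (corner l * (2 * of_nat (yexp b sy l) * y ^ (2 * yexp b sy l - 1) * x ^ (2 * xexp a sx l)))"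
          proof -
            have 1: "K l * c ^ (xexp a sx l + yexp b sy l) = 2 * corner l * (c * (x ^ xexp a sx l * y ^ yexp b sy l)) * C 9"
              using K4[of l] vl[of l] l False by simp
            have 2: "y ^ (2 * yexp b sy l - 1) = y ^ yexp b sy l * y ^ n" "x ^ (2 * xexp a sx l) = x ^ xexp a sx l * x ^ xexp a sx l"
              by (simp_all add: n mult_2 flip: power_add)
            show ?thesis unfolding 1 2 by (simp only: mult_minus_left mult_minus_right mult_ac)
          qed
          finally show ?thesis using False by simp
        qed (auto simp: exp_chart)
      qed auto
      ultimately have 2: "ch.By sx sy x y = 0" using c0 C9 by simp
      show False
        using ch.biquad_nonsingular[of sx sy x y] 1 2 w w0 unfolding ch.Bx_def ch.By_def Bc_def by auto
    qed
    then have K0: "K l = 0" if "l \<in> I" for l using Kl[OF that] c0 by (auto split: if_splits)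
    show "C j = 0"
    proof (cases "j = 9")
      case False
      then have "j < 9" using j by (simp add: Fs_def rest)
      then have "rest ! j \<in> I" using rest by (metis nth_mem)
      then show ?thesis using K[OF \<open>j < 9\<close>] K0 by simp
    qed (use \<open>C 9 = 0\<close> in simp)
  qed
qed

end

section \<open>Bounds for the plurigenera\<close>

text \<open>Regularity of P / S at every point of the line makes it a polynomial. A root of S is
  also one of P by the local identity there, and both can be divided by the linear factor.\<close>

lemma poly_local_dvd:
  fixes S P :: "complex poly"
  assumes "S \<noteq> 0" "\<And>z. \<exists>M N. poly M z \<noteq> 0 \<and> P * M = S * N"
  shows "S dvd P"
  using assms
proof (induction "Polynomial.degree S" arbitrary: S P)
  case 0
  then show ?case by (metis is_unit_iff_degree unit_imp_dvd)
next
  case (Suc n)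
  then have "\<not> constant (poly S)" using constant_degree[of S] by simp
  then obtain z where z: "poly S z = 0" using fundamental_theorem_of_algebra by blast
  then obtain S' where S': "S = [:- z, 1:] * S'" by (auto simp: poly_eq_0_iff_dvd elim: dvdE)
  obtain M N where MN: "poly M z \<noteq> 0" "P * M = S * N" using Suc.prems by blast
  then have "poly P z * poly M z = 0" using z by (metis mult_zero_left poly_mult)
  then obtain P' where P': "P = [:- z, 1:] * P'" using MN(1) by (auto simp: poly_eq_0_iff_dvd elim: dvdE)
  have "S' \<noteq> 0" using S' Suc.prems(1) by auto
  then have "Polynomial.degree S = 1 + Polynomial.degree S'" unfolding S' by (subst degree_mult_eq) auto
  moreover have "\<exists>M N. poly M y \<noteq> 0 \<and> P' * M = S' * N" for y
  proof -
    obtain M N where "poly M y \<noteq> 0" "P * M = S * N" using Suc.prems by blast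
    moreover from this(2) have "[:- z, 1:] * (P' * M) = [:- z, 1:] * (S' * N)" by (simp only: S' P' mult.assoc)
    then have "P' * M = S' * N" by (subst (asm) mult_cancel_left) auto
    ultimately show ?thesis by blast
  qed
  ultimately have "S' dvd P'" using Suc.hyps \<open>S' \<noteq> 0\<close> by simp
  then show ?case unfolding S' P' by (rule mult_dvd_mono[OF dvd_refl])
qed

lemma poly_zero_on_large_set:
  fixes T :: "complex poly"
  assumes "finite U" "\<And>x. x \<in> U \<Longrightarrow> poly T x = 0" "Polynomial.degree T < card U"
  shows "T = 0"
proof (rule ccontr)
  assume T: "T \<noteq> 0"
  have "U \<subseteq> {x. poly T x = 0}" using assms(2) by blast
  then have "card U \<le> card {x. poly T x = 0}" by (intro card_mono poly_roots_finite T)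
  also have "\<dots> \<le> Polynomial.degree T" by (rule card_poly_roots_bound[OF T])
  finally show False using assms(3) by simp
qed

lemma poly_eq_infinite:
  fixes P Q :: "complex poly"
  assumes "infinite {z. poly P z = poly Q z}"
  shows "P = Q"
  using poly_roots_finite[of "P - Q"] assms by (cases "P = Q") auto

context dcover
begin

lemma regring_swap: "h \<in> regring \<xi> \<eta> \<omega> x y w \<Longrightarrow> h \<in> regring \<eta> \<xi> \<omega> y x w"
proof -
  assume "h \<in> regring \<xi> \<eta> \<omega> x y w"
  then obtain A G where h: "polyf \<rat> 3 A" "polyf \<rat> 3 G" "G (as3 x y w) \<noteq> 0" "h = A (as3 \<xi> \<eta> \<omega>) / G (as3 \<xi> \<eta> \<omega>)"
    unfolding regring_def by blast
  define \<sigma> where "\<sigma> i = (if i = 0 then 1 else if i = 1 then 0 else (2::nat))" for i :: nat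
  have *: "F (\<lambda>i. as3 y x w (\<sigma> i)) = F (as3 x y w)" if "polyf \<rat> 3 F" for F x y w
    by (rule polyf_cong_vars[OF that]) (auto simp: \<sigma>_def as3_def)
  have "polyf \<rat> 3 (\<lambda>u. F (\<lambda>i. u (\<sigma> i)))" if "polyf \<rat> 3 F" for F
    by (rule polyf_subst[OF that]) (auto simp: \<sigma>_def intro: polyf_var)
  from this[OF h(1)] this[OF h(2)] show ?thesis
    unfolding regring_def using h(3,4) *[OF h(1)] *[OF h(2)]
    by (intro CollectI exI[of _ "\<lambda>u. A (\<lambda>i. u (\<sigma> i))"] exI[of _ "\<lambda>u. G (\<lambda>i. u (\<sigma> i))"]) simp
qed

text \<open>Half the trace of h is P / S. On a horizontal line it is regular at every finite x,
  hence a polynomial \<open>T\<close> in x, and regularity of h / \<xi>^n at infinity bounds its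
  degree by n.\<close>

lemma slice_polynomial:
  assumes inv: "dcover a b r s p q (1 / \<xi>) \<eta> (\<omega> / \<xi> ^ a)"
    and poly: "polyf \<rat> 2 P" "polyf \<rat> 2 Q" "polyf \<rat> 2 S"
    and h: "h * S (as3 \<xi> \<eta> 0) = P (as3 \<xi> \<eta> 0) + Q (as3 \<xi> \<eta> 0) * \<omega>"
    and affine: "\<And>x w. w\<^sup>2 = B x y \<Longrightarrow> h \<in> regring \<xi> \<eta> \<omega> x y w"
    and infty: "\<And>w. w\<^sup>2 = biquad a b r s p q 0 y \<Longrightarrow> h / \<xi> ^ n \<in> regring (1 / \<xi>) \<eta> (\<omega> / \<xi> ^ a) 0 y w"
    and S: "S (as3 x0 y 0) \<noteq> 0"
  shows "\<exists>T. Polynomial.degree T \<le> n \<and> (\<forall>x. P (as3 x y 0) = poly T x * S (as3 x y 0))"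
proof -
  interpret inv: dcover a b r s p q "1 / \<xi>" \<eta> "\<omega> / \<xi> ^ a" by (rule inv)
  obtain ps where ps: "\<And>x. S (as3 x y 0) = poly ps x" using polyf_slice_as3(1)[OF poly(3)] by blast
  obtain pp where pp: "\<And>x. P (as3 x y 0) = poly pp x" using polyf_slice_as3(1)[OF poly(1)] by blast
  have "ps \<noteq> 0" using S ps by auto
  have "ps dvd pp"
  proof (rule poly_local_dvd[OF \<open>ps \<noteq> 0\<close>])
    fix z
    obtain M N where MN: "polyf \<rat> 2 M" "polyf \<rat> 2 N" "M (as3 z y 0) \<noteq> 0"
      "\<And>x' y'. P (as3 x' y' 0) * M (as3 x' y' 0) = S (as3 x' y' 0) * N (as3 x' y' 0)"
      using trace_regular[OF poly h affine] by blast
    obtain pm where pm: "\<And>x. M (as3 x y 0) = poly pm x" using polyf_slice_as3(1)[OF MN(1)] by blast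
    obtain pn where pn: "\<And>x. N (as3 x y 0) = poly pn x" using polyf_slice_as3(1)[OF MN(2)] by blast
    have "pp * pm = ps * pn"
      using MN(4)[of _ y] by (simp add: pp pm ps pn poly_eq_poly_eq_iff[symmetric] fun_eq_iff)
    then show "\<exists>M N. poly M z \<noteq> 0 \<and> pp * M = ps * N" using MN(3) pm by metis
  qed
  then obtain T where T: "pp = ps * T" by (elim dvdE)
  have "Polynomial.degree T \<le> n"
  proof (rule ccontr)
    assume deg: "\<not> Polynomial.degree T \<le> n"
    obtain MP where MP: "\<And>M. M \<ge> MP \<Longrightarrow> \<exists>g. polyf \<rat> 2 g \<and> (\<forall>u. u 0 \<noteq> 0 \<longrightarrow> g u = u 0 ^ M * P (u(0 := 1 / u 0)))"
      using polyf_reverse[OF poly(1), of 0] by auto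
    obtain MQ where MQ: "\<And>M. M \<ge> MQ \<Longrightarrow> \<exists>g. polyf \<rat> 2 g \<and> (\<forall>u. u 0 \<noteq> 0 \<longrightarrow> g u = u 0 ^ M * Q (u(0 := 1 / u 0)))"
      using polyf_reverse[OF poly(2), of 0] by auto
    obtain MS where MS: "\<And>M. M \<ge> MS \<Longrightarrow> \<exists>g. polyf \<rat> 2 g \<and> (\<forall>u. u 0 \<noteq> 0 \<longrightarrow> g u = u 0 ^ M * S (u(0 := 1 / u 0)))"
      using polyf_reverse[OF poly(3), of 0] by auto
    \<comment> \<open>Large enough for all three reversals. The exponent for Q is smaller by a,
      because \<omega> equals \<xi>^a times the coordinate \<omega> / \<xi>^a of the chart at
      infinity.\<close>
    define L where "L = MP + MQ + MS + a"
    have "L + n \<ge> MP" "L + n - a \<ge> MQ" "L \<ge> MS" by (auto simp: L_def)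
    then obtain P' Q' S' where PQS: "polyf \<rat> 2 P'" "polyf \<rat> 2 Q'" "polyf \<rat> 2 S'"
      and "\<forall>u. u 0 \<noteq> 0 \<longrightarrow> P' u = u 0 ^ (L + n) * P (u(0 := 1 / u 0))"
        "\<forall>u. u 0 \<noteq> 0 \<longrightarrow> Q' u = u 0 ^ (L + n - a) * Q (u(0 := 1 / u 0))"
        "\<forall>u. u 0 \<noteq> 0 \<longrightarrow> S' u = u 0 ^ L * S (u(0 := 1 / u 0))"
      using MP[of "L + n"] MQ[of "L + n - a"] MS[of L] by auto
    from this(4-6)[rule_format, of "as3 _ _ 0"]
    have PQS': "P' (as3 x v 0) = x ^ (L + n) * P (as3 (1 / x) v 0)"
      "Q' (as3 x v 0) = x ^ (L + n - a) * Q (as3 (1 / x) v 0)" "S' (as3 x v 0) = x ^ L * S (as3 (1 / x) v 0)"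
      if "x \<noteq> 0" for x v using that by (simp_all add: as3_upd)
    have "h / \<xi> ^ n * S' (as3 (1 / \<xi>) \<eta> 0) = P' (as3 (1 / \<xi>) \<eta> 0) + Q' (as3 (1 / \<xi>) \<eta> 0) * (\<omega> / \<xi> ^ a)"
    proof -
      have X1: "1 / \<xi> \<noteq> 0" "1 / (1 / \<xi>) = \<xi>" using X_nonzero by auto
      have "L + n = (L + n - a) + a" by (simp add: L_def)
      then have "\<xi> ^ (L + n) = \<xi> ^ (L + n - a) * \<xi> ^ a" by (metis power_add)
      then have "P' (as3 (1 / \<xi>) \<eta> 0) + Q' (as3 (1 / \<xi>) \<eta> 0) * (\<omega> / \<xi> ^ a) = (P (as3 \<xi> \<eta> 0) + Q (as3 \<xi> \<eta> 0) * \<omega>) / \<xi> ^ (L + n)"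
        unfolding PQS'[OF X1(1)] X1(2) by (simp add: power_divide add_divide_distrib)
      also have "\<dots> = h * S (as3 \<xi> \<eta> 0) / \<xi> ^ (L + n)" by (simp only: h)
      also have "\<dots> = h / \<xi> ^ n * S' (as3 (1 / \<xi>) \<eta> 0)"
        unfolding PQS'[OF X1(1)] X1(2) by (simp add: power_divide power_add mult_ac)
      finally show ?thesis by simp
    qed
    from inv.trace_regular[OF PQS this infty]
    obtain M N where MN: "polyf \<rat> 2 M" "polyf \<rat> 2 N" "M (as3 0 y 0) \<noteq> 0"
      "\<And>x' y'. P' (as3 x' y' 0) * M (as3 x' y' 0) = S' (as3 x' y' 0) * N (as3 x' y' 0)" by blast
    obtain pm where pm: "\<And>x. M (as3 x y 0) = poly pm x" using polyf_slice_as3(1)[OF MN(1)] by blast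
    obtain pn where pn: "\<And>x. N (as3 x y 0) = poly pn x" using polyf_slice_as3(1)[OF MN(2)] by blast
    define d where "d = Polynomial.degree T"
    \<comment> \<open>Reversed identity with the common factor S cancelled. If the degree d of
      \<open>T\<close> exceeded n, the right side would vanish at 0, while the left side there is
      the leading coefficient of \<open>T\<close> times the nonzero value of M.\<close>
    have eq: "poly (reflect_poly T * pm) x = poly (Polynomial.monom 1 (d - n) * pn) x" if x: "x \<noteq> 0" "poly ps (1 / x) \<noteq> 0" for x
    proof -
      have "x ^ (L + n) * (poly ps (1 / x) * poly T (1 / x)) * poly pm x = x ^ L * poly ps (1 / x) * poly pn x"
        using MN(4)[of x y] PQS'[OF x(1), of y] by (simp add: ps pp T pm pn)
      then have "(x ^ L * poly ps (1 / x)) * (x ^ n * poly T (1 / x) * poly pm x) = (x ^ L * poly ps (1 / x)) * poly pn x"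
        by (simp add: power_add mult_ac)
      then have *: "x ^ n * poly T (1 / x) * poly pm x = poly pn x" using x by simp
      have "x ^ d = x ^ (d - n) * x ^ n" using deg by (simp add: d_def flip: power_add)
      then show ?thesis
        using x(1) *[symmetric] by (simp add: poly_reflect_poly_nz poly_monom d_def[symmetric] inverse_eq_divide mult_ac)
    qed
    have "finite (insert 0 {x. poly ps x = 0})" using poly_roots_finite[OF \<open>ps \<noteq> 0\<close>] by simp
    then have "infinite (UNIV - insert 0 {x. poly ps x = 0})" by (simp add: infinite_UNIV_char_0 Diff_infinite_finite)
    moreover have "inj_on (\<lambda>x. 1 / x) (UNIV - insert 0 {x. poly ps x = 0})" by (auto simp: inj_on_def)
    ultimately have "infinite ((\<lambda>x. 1 / x) ` (UNIV - insert 0 {x. poly ps x = 0}))" using finite_imageD by blast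
    then have "infinite {x. poly (reflect_poly T * pm) x = poly (Polynomial.monom 1 (d - n) * pn) x}"
    proof (rule infinite_super[rotated], intro image_subsetI CollectI)
      fix x assume "x \<in> UNIV - insert 0 {x. poly ps x = 0}"
      then show "poly (reflect_poly T * pm) (1 / x) = poly (Polynomial.monom 1 (d - n) * pn) (1 / x)"
        by (intro eq) auto
    qed
    from poly_eq_infinite[OF this]
    have "poly (reflect_poly T * pm) 0 = poly (Polynomial.monom 1 (d - n) * pn) 0" by simp
    then have "Polynomial.lead_coeff T * poly pm 0 = 0" using deg by (simp add: poly_monom d_def power_0_left)
    moreover have "Polynomial.lead_coeff T \<noteq> 0" using deg by auto
    moreover have "poly pm 0 \<noteq> 0" using MN(3) pm by metis
    ultimately show False by simp
  qed
  then show ?thesis using T ps pp by (intro exI[of _ T]) (simp add: mult.commute)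
qed

end

section \<open>Functions with bounded poles and pluricanonical sections\<close>

context dmodel
begin

lemma inv_x: "dcover a b r s p q (1 / \<xi>) \<eta> (\<omega> / \<xi> ^ a)"
  using chart[of True False] by (simp add: coef_def Xc_def Yc_def Wc_def unt_def)

lemma inv_y: "dcover a b q p s r \<xi> (1 / \<eta>) (\<omega> / \<eta> ^ b)"
  using chart[of False True] by (simp add: coef_def Xc_def Yc_def Wc_def unt_def)

text \<open>Regular on the affine chart, with poles of order at most n along x = \<infinity> and at
  most m along y = \<infinity>.\<close>

definition bounded_poles :: "nat \<Rightarrow> nat \<Rightarrow> complex \<Rightarrow> bool" where
  "bounded_poles n m h \<longleftrightarrow>
     (\<forall>x y w. w\<^sup>2 = B x y \<longrightarrow> h \<in> regring \<xi> \<eta> \<omega> x y w) \<and>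
     (\<forall>y w. w\<^sup>2 = biquad a b r s p q 0 y \<longrightarrow> h / \<xi> ^ n \<in> regring (1 / \<xi>) \<eta> (\<omega> / \<xi> ^ a) 0 y w) \<and>
     (\<forall>x w. w\<^sup>2 = biquad a b q p s r x 0 \<longrightarrow> h / \<eta> ^ m \<in> regring \<xi> (1 / \<eta>) (\<omega> / \<eta> ^ b) x 0 w)"

text \<open>Interpolation on a grid: P / S has degree at most n on each row y \<in> V, so it
  vanishes there; on almost every column it has degree at most m and vanishes at the points of
  V.\<close>

lemma bounded_poles_grid:
  assumes h: "bounded_poles n m h"
    and poly: "polyf \<rat> 2 P" "polyf \<rat> 2 Q" "polyf \<rat> 2 S"
    and hS: "h * S (as3 \<xi> \<eta> 0) = P (as3 \<xi> \<eta> 0) + Q (as3 \<xi> \<eta> 0) * \<omega>"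
    and fin: "finite U" "finite V" "card U > n" "card V > m"
    and S: "\<And>x y. x \<in> U \<Longrightarrow> y \<in> V \<Longrightarrow> S (as3 x y 0) \<noteq> 0"
    and P: "\<And>x y. x \<in> U \<Longrightarrow> y \<in> V \<Longrightarrow> P (as3 x y 0) = 0"
  shows "P (as3 x y 0) = 0"
proof -
  interpret sw: dcover b a p r q s \<eta> \<xi> \<omega> by (rule swap)
  have sw_inv: "dcover b a q s p r (1 / \<eta>) \<xi> (\<omega> / \<eta> ^ b)" by (rule dcover.swap[OF inv_y])
  have "U \<noteq> {}" using fin by auto
  then obtain x0 where x0: "x0 \<in> U" by blast
  have row: "P (as3 x y 0) = 0" if y: "y \<in> V" for x y
  proof -
    have "\<exists>T. Polynomial.degree T \<le> n \<and> (\<forall>x. P (as3 x y 0) = poly T x * S (as3 x y 0))"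
    proof (rule slice_polynomial[OF inv_x poly hS])
      show "h \<in> reg x y w" if "w\<^sup>2 = B x y" for x w
        using h that unfolding bounded_poles_def by blast
      show "h / \<xi> ^ n \<in> regring (1 / \<xi>) \<eta> (\<omega> / \<xi> ^ a) 0 y w" if "w\<^sup>2 = biquad a b r s p q 0 y" for w
        using h that unfolding bounded_poles_def by blast
      show "S (as3 x0 y 0) \<noteq> 0" by (rule S[OF x0 y])
    qed
    then obtain T where T: "Polynomial.degree T \<le> n" "\<And>x. P (as3 x y 0) = poly T x * S (as3 x y 0)" by blast
    have "poly T x = 0" if "x \<in> U" for x using T(2)[of x] P[OF that y] S[OF that y] by simp
    then have "T = 0" by (intro poly_zero_on_large_set[OF fin(1)]) (use T(1) fin(3) in auto)
    then show ?thesis using T(2) by simp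
  qed
  define flip where "flip F u = F (\<lambda>i. u (1 - i))" for F :: "(nat \<Rightarrow> complex) \<Rightarrow> complex" and u :: "nat \<Rightarrow> complex"
  have flip_as3: "flip F (as3 x y 0) = F (as3 y x 0)" if "polyf \<rat> 2 F" for F x y
    unfolding flip_def by (rule polyf_cong_vars[OF that]) (auto simp: less_2_cases_iff)
  have flip_poly: "polyf \<rat> 2 (flip F)" if "polyf \<rat> 2 F" for F
    unfolding flip_def by (rule polyf_subst[OF that]) (auto intro: polyf_var)
  have B_swap: "sw.B y x = B x y" "biquad b a q s p r y x = biquad a b q p s r x y" for x y
    by (auto simp: biquad_def algebra_simps)
  \<comment> \<open>The columns must avoid the zeros of S over V, which excludes only finitely many
    x.\<close>
  have col: "P (as3 x y 0) = 0" if x: "\<And>y. y \<in> V \<Longrightarrow> S (as3 x y 0) \<noteq> 0" for x y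
  proof -
    have "V \<noteq> {}" using fin by auto
    then obtain y0 where y0: "y0 \<in> V" by blast
    have "\<exists>T. Polynomial.degree T \<le> m \<and> (\<forall>y. flip P (as3 y x 0) = poly T y * flip S (as3 y x 0))"
    proof (rule sw.slice_polynomial[OF sw_inv flip_poly[OF poly(1)] flip_poly[OF poly(2)] flip_poly[OF poly(3)]])
      show "h * flip S (as3 \<eta> \<xi> 0) = flip P (as3 \<eta> \<xi> 0) + flip Q (as3 \<eta> \<xi> 0) * \<omega>"
        using hS by (simp add: flip_as3 poly)
      show "flip S (as3 y0 x 0) \<noteq> 0" using x[OF y0] by (simp add: flip_as3 poly)
      show "h \<in> regring \<eta> \<xi> \<omega> y x w" if "w\<^sup>2 = sw.B y x" for y w
        using h that regring_swap unfolding bounded_poles_def B_swap by blast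
      show "h / \<eta> ^ m \<in> regring (1 / \<eta>) \<xi> (\<omega> / \<eta> ^ b) 0 x w" if "w\<^sup>2 = biquad b a q s p r 0 x" for w
        using h that dcover.regring_swap[OF inv_y] unfolding bounded_poles_def B_swap by blast
    qed
    then obtain T where T: "Polynomial.degree T \<le> m" "\<And>y. P (as3 x y 0) = poly T y * S (as3 x y 0)"
      by (auto simp: flip_as3 poly)
    have "poly T y = 0" if "y \<in> V" for y using T(2)[of y] row[OF that] x[OF that] by simp
    then have "T = 0" by (intro poly_zero_on_large_set[OF fin(2)]) (use T(1) fin(4) in auto)
    then show ?thesis using T(2) by simp
  qed
  have "finite (\<Union>y\<in>V. {x. S (as3 x y 0) = 0})"
    using fin(2) finite_slice_zeros(1)[OF poly(3) S[OF x0]] by blast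
  then have "infinite (UNIV - (\<Union>y\<in>V. {x. S (as3 x y 0) = 0}))"
    by (simp add: infinite_UNIV_char_0 Diff_infinite_finite)
  then have "infinite {x. P (as3 x y 0) = 0}" by (rule infinite_super[rotated]) (use col in auto)
  then show ?thesis using finite_slice_zeros(1)[OF poly(1), of x y 0] by blast
qed

text \<open>Multiplying P + Q \<omega> by \<omega> gives Q B + P \<omega>, so the grid lemma applied
  to h \<omega> controls the odd part Q. The function \<omega> has poles of orders a and b.\<close>

lemma bounded_poles_mult:
  assumes "bounded_poles n m h"
  shows "bounded_poles (n + a) (m + b) h" "bounded_poles (n + a) (m + b) (h * \<omega>)"
proof -
  interpret x: dcover a b r s p q "1 / \<xi>" \<eta> "\<omega> / \<xi> ^ a" by (rule inv_x)
  interpret y: dcover a b q p s r \<xi> "1 / \<eta>" "\<omega> / \<eta> ^ b" by (rule inv_y)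
  have xa: "h / \<xi> ^ (n + a) = h / \<xi> ^ n * (1 / \<xi>) ^ a" "h * \<omega> / \<xi> ^ (n + a) = h / \<xi> ^ n * (\<omega> / \<xi> ^ a)"
    and yb: "h / \<eta> ^ (m + b) = h / \<eta> ^ m * (1 / \<eta>) ^ b" "h * \<omega> / \<eta> ^ (m + b) = h / \<eta> ^ m * (\<omega> / \<eta> ^ b)"
    by (simp_all add: power_add power_divide)
  show "bounded_poles (n + a) (m + b) h"
    unfolding bounded_poles_def
  proof (intro conjI allI impI)
    fix x y w assume w: "w\<^sup>2 = B x y"
    then have "h \<in> reg x y w" using assms unfolding bounded_poles_def by blast
    then show "h \<in> reg x y w" .
  next
    fix y w assume w: "w\<^sup>2 = biquad a b r s p q 0 y"
    then have "h / \<xi> ^ n \<in> regring (1 / \<xi>) \<eta> (\<omega> / \<xi> ^ a) 0 y w" using assms unfolding bounded_poles_def by blast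
    then show "h / \<xi> ^ (n + a) \<in> regring (1 / \<xi>) \<eta> (\<omega> / \<xi> ^ a) 0 y w"
      unfolding xa by (rule x.reg_mult[OF w]) (rule x.reg_power[OF w x.reg_var(1)])
  next
    fix x w assume w: "w\<^sup>2 = biquad a b q p s r x 0"
    then have "h / \<eta> ^ m \<in> regring \<xi> (1 / \<eta>) (\<omega> / \<eta> ^ b) x 0 w" using assms unfolding bounded_poles_def by blast
    then show "h / \<eta> ^ (m + b) \<in> regring \<xi> (1 / \<eta>) (\<omega> / \<eta> ^ b) x 0 w"
      unfolding yb by (rule y.reg_mult[OF w]) (rule y.reg_power[OF w y.reg_var(2)])
  qed
  show "bounded_poles (n + a) (m + b) (h * \<omega>)"
    unfolding bounded_poles_def
  proof (intro conjI allI impI)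
    fix x y w assume w: "w\<^sup>2 = B x y"
    then have "h \<in> reg x y w" using assms unfolding bounded_poles_def by blast
    then show "(h * \<omega>) \<in> reg x y w" by (rule reg_mult[OF w]) (rule reg_var)
  next
    fix y w assume w: "w\<^sup>2 = biquad a b r s p q 0 y"
    then have "h / \<xi> ^ n \<in> regring (1 / \<xi>) \<eta> (\<omega> / \<xi> ^ a) 0 y w" using assms unfolding bounded_poles_def by blast
    then show "(h * \<omega>) / \<xi> ^ (n + a) \<in> regring (1 / \<xi>) \<eta> (\<omega> / \<xi> ^ a) 0 y w"
      unfolding xa by (rule x.reg_mult[OF w]) (rule x.reg_var(3))
  next
    fix x w assume w: "w\<^sup>2 = biquad a b q p s r x 0"
    then have "h / \<eta> ^ m \<in> regring \<xi> (1 / \<eta>) (\<omega> / \<eta> ^ b) x 0 w" using assms unfolding bounded_poles_def by blast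
    then show "(h * \<omega>) / \<eta> ^ (m + b) \<in> regring \<xi> (1 / \<eta>) (\<omega> / \<eta> ^ b) x 0 w"
      unfolding yb by (rule y.reg_mult[OF w]) (rule y.reg_var(3))
  qed
qed

abbreviation "D1 \<equiv> dir_deriv 1 0"
abbreviation "D2 \<equiv> dir_deriv 0 1"

lemma D12: "derivation \<rat> FF D1" "derivation \<rat> FF D2" "D1 \<xi> = 1" "D1 \<eta> = 0" "D2 \<xi> = 0" "D2 \<eta> = 1"
  using derivation_dir_deriv[OF Rats_1 Rats_0] derivation_dir_deriv[OF Rats_0 Rats_1] by auto

lemma wedge_chart:
  "wedge D1 D2 (Xc sx) (Yc sy) = (if sx then - 1 / \<xi>\<^sup>2 else 1) * (if sy then - 1 / \<eta>\<^sup>2 else 1)"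
proof -
  have inv: "D (1 / u) = - D u / u\<^sup>2" if "derivation \<rat> FF D" "u \<in> FF" "u \<noteq> 0" for D u
    using derivation_divide[OF that(1) _ that(2,3), of 1] derivation_simps(1)[OF that(1), of 1] reg_Rats by simp
  show ?thesis
    using inv[OF D12(1) reg_var(1) X_nonzero] inv[OF D12(2) reg_var(1) X_nonzero]
      inv[OF D12(1) reg_var(2) Y_nonzero] inv[OF D12(2) reg_var(2) Y_nonzero]
    by (auto simp: wedge_def Xc_def Yc_def D12)
qed

lemma ch_derivation: "derivation \<rat> FF D \<Longrightarrow> derivation \<rat> (ch.FF sx sy) D"
  by (simp add: regring_chart_generic)

lemma sections_iff:
  "h \<in> canonical_sections \<rat> g E1 E2 n \<longleftrightarrow> h \<in> FF \<and> (\<forall>sx sy x y w. w\<^sup>2 = Bc sx sy x y \<longrightarrow>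
     h \<in> canonical_stalk E1 E2 (regring (Xc sx) (Yc sy) (Wc sx sy) x y w) n)"
proof -
  have "(\<forall>v\<in>locus \<rat> g. h \<in> canonical_stalk E1 E2 (local_ring \<rat> g v) n) \<longleftrightarrow>
    (\<forall>sx sy x y w. w\<^sup>2 = Bc sx sy x y \<longrightarrow> h \<in> canonical_stalk E1 E2 (regring (Xc sx) (Yc sy) (Wc sx sy) x y w) n)"
  proof (intro iffI allI impI ballI)
    fix sx sy x y w
    assume *: "\<forall>v\<in>locus \<rat> g. h \<in> canonical_stalk E1 E2 (local_ring \<rat> g v) n" and w: "w\<^sup>2 = Bc sx sy x y"
    show "h \<in> canonical_stalk E1 E2 (regring (Xc sx) (Yc sy) (Wc sx sy) x y w) n"
      using bspec[OF * emb_in_locus[OF w]] unfolding local_ring_chart[OF w] .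
  next
    fix v
    assume *: "\<forall>sx sy x y w. w\<^sup>2 = Bc sx sy x y \<longrightarrow> h \<in> canonical_stalk E1 E2 (regring (Xc sx) (Yc sy) (Wc sx sy) x y w) n"
      and "v \<in> locus \<rat> g"
    then obtain sx sy x y w c where v: "c \<noteq> 0" "w\<^sup>2 = Bc sx sy x y" "v = map ((*) c) (emb a b sx sy x y w)"
      using locus_chart by metis
    show "h \<in> canonical_stalk E1 E2 (local_ring \<rat> g v) n"
      unfolding v(3) local_ring_scale[OF v(1) length_emb] local_ring_chart[OF v(2)] using * v(2) by blast
  qed
  then show ?thesis unfolding canonical_sections_def fun_field_g by blast
qed

lemma chart_subset_FF: "w\<^sup>2 = Bc sx sy x y \<Longrightarrow> regring (Xc sx) (Yc sy) (Wc sx sy) x y w \<subseteq> FF"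
  using ch.reg_subset_FF[of w sx sy x y] regring_chart_generic[of sx sy] by (simp add: Bc_def)

lemma sections_subspace: "QV.subspace (canonical_sections \<rat> g E1 E2 n)"
proof (rule QV_subspaceI)
  show "0 \<in> canonical_sections \<rat> g E1 E2 n" by (auto simp: sections_iff canonical_stalk_0 intro: reg_Rats)
  fix x y assume "x \<in> canonical_sections \<rat> g E1 E2 n" "y \<in> canonical_sections \<rat> g E1 E2 n"
  then show "x + y \<in> canonical_sections \<rat> g E1 E2 n"
    by (auto simp: sections_iff intro: canonical_stalk_add FF_add)
next
  fix c h :: complex assume c: "c \<in> \<rat>" and h: "h \<in> canonical_sections \<rat> g E1 E2 n"
  have "c * e \<in> regring (Xc sx) (Yc sy) (Wc sx sy) x y w"
    if "e \<in> regring (Xc sx) (Yc sy) (Wc sx sy) x y w" "w\<^sup>2 = Bc sx sy x y" for e sx sy x y w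
    using ch.reg_mult[OF _ ch.reg_Rats[OF c] that(1)] that(2) by (simp add: Bc_def)
  then show "c * h \<in> canonical_sections \<rat> g E1 E2 n"
    using h by (auto simp: sections_iff intro!: canonical_stalk_mult FF_mult reg_Rats[OF c])
qed

text \<open>Along x = \<infinity> the factor \<omega>^(2n) contributes a pole of order 2 a n, and
  d(1 / \<xi>) \<and> d\<eta> = - d\<xi> \<and> d\<eta> / \<xi>^2 removes 2 n of it; likewise for
  y.\<close>

lemma section_bounded_poles:
  assumes h: "h \<in> canonical_sections \<rat> g D1 D2 n"
  shows "bounded_poles ((2 * a - 2) * n) ((2 * b - 2) * n) (\<omega> ^ (2 * n) * h)"
proof -
  have up: "\<exists>\<rho>\<in>regring (Xc sx) (Yc sy) (Wc sx sy) x y w. Wc sx sy ^ (2 * n) * h = \<rho> * wedge D1 D2 (Xc sx) (Yc sy) ^ n"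
    if "w\<^sup>2 = Bc sx sy x y" for sx sy x y w
    using ch.canonical_stalk_upper[OF ch_derivation[OF D12(1)] ch_derivation[OF D12(2)]] h that
    unfolding sections_iff Bc_def by blast
  have e: "z ^ (2 * n * k) = z ^ ((2 * k - 2) * n) * z ^ (2 * n)" if "k \<ge> 1" for z :: complex and k
  proof -
    have "2 * n * k = (2 * k - 2) * n + 2 * n" using that by (cases k) (auto simp: algebra_simps)
    then show ?thesis by (simp flip: power_add)
  qed
  have neg: "(- c) ^ n * \<rho> = (- 1) ^ n * (\<rho> * c ^ n)" for c \<rho> :: complex
    using power_minus[of c n] by simp
  show ?thesis
    unfolding bounded_poles_def
  proof (intro conjI allI impI)
    fix x y w assume w: "w\<^sup>2 = B x y"
    then show "\<omega> ^ (2 * n) * h \<in> reg x y w"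
      using up[of w False False x y] wedge_chart[of False False]
      by (auto simp: Bc_def coef_def Xc_def Yc_def Wc_def unt_def)
  next
    fix y w assume w: "w\<^sup>2 = biquad a b r s p q 0 y"
    interpret x: dcover a b r s p q "1 / \<xi>" \<eta> "\<omega> / \<xi> ^ a" by (rule inv_x)
    obtain \<rho> where \<rho>: "\<rho> \<in> regring (1 / \<xi>) \<eta> (\<omega> / \<xi> ^ a) 0 y w"
      "(\<omega> / \<xi> ^ a) ^ (2 * n) * h = \<rho> * (- 1 / \<xi>\<^sup>2) ^ n"
      using up[of w True False 0 y] w wedge_chart[of True False]
      by (auto simp: Bc_def coef_def Xc_def Yc_def Wc_def unt_def)
    have "\<omega> ^ (2 * n) * h = (\<omega> / \<xi> ^ a) ^ (2 * n) * h * \<xi> ^ (2 * n * a)"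
      using X_nonzero by (simp add: power_divide power_mult mult.commute flip: power_mult)
    also have "\<dots> = (- 1) ^ n * \<rho> * \<xi> ^ ((2 * a - 2) * n)"
    proof -
      have "(- 1 / \<xi>\<^sup>2) ^ n = (- 1) ^ n / \<xi> ^ (2 * n)" by (simp only: power_divide power_mult[symmetric])
      then show ?thesis unfolding \<rho>(2) e[OF a] using X_nonzero by simp
    qed
    finally have "\<omega> ^ (2 * n) * h / \<xi> ^ ((2 * a - 2) * n) = (- 1) ^ n * \<rho>" using X_nonzero by simp
    then show "\<omega> ^ (2 * n) * h / \<xi> ^ ((2 * a - 2) * n) \<in> regring (1 / \<xi>) \<eta> (\<omega> / \<xi> ^ a) 0 y w"
      using x.reg_mult[OF w x.reg_Rats \<rho>(1), of "(- 1) ^ n"] by simp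
  next
    fix x w assume w: "w\<^sup>2 = biquad a b q p s r x 0"
    interpret y: dcover a b q p s r \<xi> "1 / \<eta>" "\<omega> / \<eta> ^ b" by (rule inv_y)
    obtain \<rho> where \<rho>: "\<rho> \<in> regring \<xi> (1 / \<eta>) (\<omega> / \<eta> ^ b) x 0 w"
      "(\<omega> / \<eta> ^ b) ^ (2 * n) * h = \<rho> * (- 1 / \<eta>\<^sup>2) ^ n"
      using up[of w False True x 0] w wedge_chart[of False True]
      by (auto simp: Bc_def coef_def Xc_def Yc_def Wc_def unt_def)
    have "\<omega> ^ (2 * n) * h = (\<omega> / \<eta> ^ b) ^ (2 * n) * h * \<eta> ^ (2 * n * b)"
      using Y_nonzero by (simp add: power_divide power_mult mult.commute flip: power_mult)
    also have "\<dots> = (- 1) ^ n * \<rho> * \<eta> ^ ((2 * b - 2) * n)"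
    proof -
      have "(- 1 / \<eta>\<^sup>2) ^ n = (- 1) ^ n / \<eta> ^ (2 * n)" by (simp only: power_divide power_mult[symmetric])
      then show ?thesis unfolding \<rho>(2) e[OF b] using Y_nonzero by simp
    qed
    finally have "\<omega> ^ (2 * n) * h / \<eta> ^ ((2 * b - 2) * n) = (- 1) ^ n * \<rho>" using Y_nonzero by simp
    then show "\<omega> ^ (2 * n) * h / \<eta> ^ ((2 * b - 2) * n) \<in> regring \<xi> (1 / \<eta>) (\<omega> / \<eta> ^ b) x 0 w"
      using y.reg_mult[OF w y.reg_Rats \<rho>(1), of "(- 1) ^ n"] by simp
  qed
qed

text \<open>In a chart with x inverted, the generator dx \<and> dy / w corresponds to \<xi>^(a - 2)
  / \<omega> up to sign. The section is therefore the n-th power of the generator times 1 / \<xi> to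
  the exponent n (a - 2) - i, which is nonnegative exactly in the stated range.\<close>

lemma monomial_section:
  assumes ab: "a \<ge> 2" "b \<ge> 2" and ij: "i \<le> n * (a - 2)" "j \<le> n * (b - 2)"
  shows "\<xi> ^ i * \<eta> ^ j / \<omega> ^ n \<in> canonical_sections \<rat> g D1 D2 n"
  unfolding sections_iff
proof (intro conjI allI impI)
  show "\<xi> ^ i * \<eta> ^ j / \<omega> ^ n \<in> FF" by (intro FF_divide FF_mult FF_power reg_var)
  fix sx sy x y w assume w: "w\<^sup>2 = Bc sx sy x y"
  define \<epsilon> :: complex where "\<epsilon> = (if sx then - 1 else 1) * (if sy then - 1 else 1)"
  define k l where k_l_def: "k = (if sx then n * (a - 2) - i else i)" "l = (if sy then n * (b - 2) - j else j)"
  have st: "Xc sx ^ k * Yc sy ^ l * (wedge D1 D2 (Xc sx) (Yc sy) / Wc sx sy) ^ n \<in>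
      canonical_stalk D1 D2 (regring (Xc sx) (Yc sy) (Wc sx sy) x y w) n"
    using ch.canonical_stalk_lower[OF ch_derivation[OF D12(1)] ch_derivation[OF D12(2)]] w unfolding Bc_def by blast
  have xa: "\<xi> ^ a = \<xi> ^ (a - 2) * \<xi>\<^sup>2" and yb: "\<eta> ^ b = \<eta> ^ (b - 2) * \<eta>\<^sup>2" using ab by (metis le_add_diff_inverse2 power_add)+
  have w1: "wedge D1 D2 (Xc sx) (Yc sy) / Wc sx sy =
      \<epsilon> * (if sx then \<xi> ^ (a - 2) else 1) * (if sy then \<eta> ^ (b - 2) else 1) / \<omega>"
    unfolding wedge_chart Wc_def unt_def \<epsilon>_def using X_nonzero Y_nonzero by (auto simp: xa yb)
  have w2: "Xc sx ^ k * (if sx then \<xi> ^ (a - 2) else 1) ^ n = \<xi> ^ i"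
  proof (cases sx)
    case True
    have "(\<xi> ^ (a - 2)) ^ n = \<xi> ^ (n * (a - 2) - i) * \<xi> ^ i"
      using ij by (simp add: mult.commute flip: power_mult power_add)
    then show ?thesis using True X_nonzero by (simp add: Xc_def k_l_def power_divide)
  qed (simp add: Xc_def k_l_def)
  have w3: "Yc sy ^ l * (if sy then \<eta> ^ (b - 2) else 1) ^ n = \<eta> ^ j"
  proof (cases sy)
    case True
    have "(\<eta> ^ (b - 2)) ^ n = \<eta> ^ (n * (b - 2) - j) * \<eta> ^ j"
      using ij by (simp add: mult.commute flip: power_mult power_add)
    then show ?thesis using True Y_nonzero by (simp add: Yc_def k_l_def power_divide)
  qed (simp add: Yc_def k_l_def)
  have "u * v * (e * A * A' / c) ^ n = e ^ n * ((u * A ^ n) * (v * A' ^ n) / c ^ n)" for u v e A A' c :: complex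
    by (simp add: power_divide power_mult_distrib mult_ac)
  then have "Xc sx ^ k * Yc sy ^ l * (wedge D1 D2 (Xc sx) (Yc sy) / Wc sx sy) ^ n = \<epsilon> ^ n * (\<xi> ^ i * \<eta> ^ j / \<omega> ^ n)"
    unfolding w1 w2[symmetric] w3[symmetric] .
  moreover have "\<epsilon> ^ n * \<epsilon> ^ n = 1" by (simp add: \<epsilon>_def flip: power_mult_distrib)
  ultimately have *: "\<xi> ^ i * \<eta> ^ j / \<omega> ^ n =
      \<epsilon> ^ n * (Xc sx ^ k * Yc sy ^ l * (wedge D1 D2 (Xc sx) (Yc sy) / Wc sx sy) ^ n)"
    by (metis mult.assoc mult_1)
  have "\<epsilon> ^ n \<in> \<rat>" by (auto simp: \<epsilon>_def)
  then show "\<xi> ^ i * \<eta> ^ j / \<omega> ^ n \<in> canonical_stalk D1 D2 (regring (Xc sx) (Yc sy) (Wc sx sy) x y w) n"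
    unfolding * by (intro canonical_stalk_mult[OF st] ch.reg_mult[OF _ ch.reg_Rats]) (use w in \<open>simp_all add: Bc_def\<close>)
qed

end

lemma canonical_stalk_rescale:
  assumes "\<And>u v. u \<in> R \<Longrightarrow> v \<in> R \<Longrightarrow> wedge E1 E2 u v = \<delta> * wedge D1 D2 u v"
  shows "canonical_stalk E1 E2 R n = (*) (\<delta> ^ n) ` canonical_stalk D1 D2 R n"
proof -
  have *: "(\<Sum>i<l. c i * (\<Prod>j<n. wedge E1 E2 (u i j) (v i j))) =
      \<delta> ^ n * (\<Sum>i<l. c i * (\<Prod>j<n. wedge D1 D2 (u i j) (v i j)))"
    if "\<forall>i<l. c i \<in> R \<and> (\<forall>j<n. u i j \<in> R \<and> v i j \<in> R)" for l :: nat and c u v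
    unfolding sum_distrib_left
  proof (rule sum.cong)
    fix i assume "i \<in> {..<l}"
    then have "(\<Prod>j<n. wedge E1 E2 (u i j) (v i j)) = (\<Prod>j<n. \<delta> * wedge D1 D2 (u i j) (v i j))"
      using that assms by (intro prod.cong) auto
    then show "c i * (\<Prod>j<n. wedge E1 E2 (u i j) (v i j)) = \<delta> ^ n * (c i * (\<Prod>j<n. wedge D1 D2 (u i j) (v i j)))"
      by (simp add: prod.distrib)
  qed simp
  show ?thesis
  proof (intro Set.equalityI subsetI)
    fix h assume "h \<in> canonical_stalk E1 E2 R n"
    then obtain l :: nat and c u v where "h = (\<Sum>i<l. c i * (\<Prod>j<n. wedge E1 E2 (u i j) (v i j)))"
      and cuv: "\<forall>i<l. c i \<in> R \<and> (\<forall>j<n. u i j \<in> R \<and> v i j \<in> R)" unfolding canonical_stalk_def by blast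
    then have "h = \<delta> ^ n * (\<Sum>i<l. c i * (\<Prod>j<n. wedge D1 D2 (u i j) (v i j)))" by (simp only: *)
    then show "h \<in> (*) (\<delta> ^ n) ` canonical_stalk D1 D2 R n"
      using cuv unfolding canonical_stalk_def by blast
  next
    fix h assume "h \<in> (*) (\<delta> ^ n) ` canonical_stalk D1 D2 R n"
    then obtain l :: nat and c u v where "h = \<delta> ^ n * (\<Sum>i<l. c i * (\<Prod>j<n. wedge D1 D2 (u i j) (v i j)))"
      and cuv: "\<forall>i<l. c i \<in> R \<and> (\<forall>j<n. u i j \<in> R \<and> v i j \<in> R)" unfolding canonical_stalk_def by blast
    then have "h = (\<Sum>i<l. c i * (\<Prod>j<n. wedge E1 E2 (u i j) (v i j)))" by (simp only: *)
    then show "h \<in> canonical_stalk E1 E2 R n" using cuv unfolding canonical_stalk_def by blast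
  qed
qed

lemma rational_points_avoiding:
  assumes "finite (Z :: complex set)"
  shows "\<exists>U. finite U \<and> card U = k \<and> U \<subseteq> \<rat> \<and> U \<inter> Z = {}"
proof -
  have "infinite (range (of_nat :: nat \<Rightarrow> complex) - Z)"
    using assms by (intro Diff_infinite_finite) (auto simp: range_inj_infinite inj_on_def)
  then obtain U where "finite U" "card U = k" "U \<subseteq> range of_nat - Z"
    using infinite_arbitrarily_large by blast
  then show ?thesis by (intro exI[of _ U]) auto
qed

section \<open>Counting pluricanonical sections\<close>

context dmodel
begin

text \<open>A rational linear relation between these products is a polynomial relation between \<xi>
  and \<eta>, which genericity makes trivial.\<close>

lemma monomials_rational_independent:
  assumes "c \<noteq> 0" "finite I"
  shows "inj_on (\<lambda>(i, j). \<xi> ^ i * \<eta> ^ j * c) I \<and> QV.independent ((\<lambda>(i, j). \<xi> ^ i * \<eta> ^ j * c) ` I)"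
proof -
  define m where "m = (\<lambda>(i, j). \<xi> ^ i * \<eta> ^ j * c)"
  have zero: "f t = 0" if f: "(\<Sum>t\<in>J. of_rat (f t) * m t) = 0" and J: "finite J" and "t \<in> J" for f :: "nat \<times> nat \<Rightarrow> rat" and t J
  proof -
    let ?F = "\<lambda>u::nat \<Rightarrow> complex. \<Sum>t\<in>J. of_rat (f t) * (u 0 ^ fst t * u 1 ^ snd t)"
    have poly: "polyf \<rat> 2 ?F" by (intro polyf_sum polyf_mult polyf_power polyf_const polyf_var) auto
    have "c * ?F (as3 \<xi> \<eta> 0) = (\<Sum>t\<in>J. of_rat (f t) * m t)"
      by (simp add: sum_distrib_left m_def case_prod_beta mult_ac)
    then have "?F (as3 \<xi> \<eta> 0) = 0" using f \<open>c \<noteq> 0\<close> by simp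
    from genericD[OF poly this] have F0: "?F (as3 x y 0) = 0" for x y by blast
    have "of_rat (f t) = (0 :: complex)"
    proof (rule monomials_independent[of J 2 "\<lambda>t i. if i = 0 then fst t else snd t" "\<lambda>t. of_rat (f t)"])
      fix u :: "nat \<Rightarrow> complex"
      show "(\<Sum>t\<in>J. of_rat (f t) * (\<Prod>i<2. u i ^ (if i = 0 then fst t else snd t))) = 0"
        using F0[of "u 0" "u 1"] by (simp add: numeral_2_eq_2)
    next
      fix t t' :: "nat \<times> nat" assume "\<forall>i<2. (if i = 0 then fst t else snd t) = (if i = (0::nat) then fst t' else snd t')"
      from this[rule_format, of 0] this[rule_format, of 1] show "t = t'" by (simp add: prod_eq_iff)
    qed (use J \<open>t \<in> J\<close> in auto)
    then show ?thesis by simp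
  qed
  have inj: "inj_on m I"
  proof (rule inj_onI, rule ccontr)
    fix t t' assume t: "m t = m t'" "t \<noteq> t'"
    define f where "f x = (if x = t then 1 else - 1 :: rat)" for x
    have "(\<Sum>x\<in>{t, t'}. of_rat (f x) * m x) = 0" using t by (simp add: f_def of_rat_minus)
    from zero[OF this, of t] show False by (simp add: f_def)
  qed
  have "QV.independent (m ` I)"
  proof (rule QV.independent_if_scalars_zero)
    fix f v assume f: "(\<Sum>x\<in>m ` I. of_rat (f x) * x) = 0" and "v \<in> m ` I"
    then obtain t where t: "t \<in> I" "v = m t" by auto
    have "(\<Sum>t\<in>I. of_rat (f (m t)) * m t) = 0" using f by (simp add: sum.reindex[OF inj])
    from zero[OF this assms(2) t(1)] show "f v = 0" using t by simp
  qed (use assms in simp)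
  then show ?thesis using inj by (simp add: m_def)
qed

text \<open>With more sections than conditions on the grid, a nontrivial rational combination
  \<open>e\<close> satisfies all of them. Both parts of \<omega>^(2n) e then vanish by
  interpolation, so e = 0 contradicts independence.\<close>

lemma sections_upper:
  assumes S0: "finite S0" "S0 \<subseteq> canonical_sections \<rat> g D1 D2 n" "QV.independent S0"
  shows "card S0 \<le> 2 * (((2 * a - 2) * n + a + 1) * ((2 * b - 2) * n + b + 1))"
proof (rule ccontr)
  assume big: "\<not> ?thesis"
  define k l where "k = (2 * a - 2) * n" "l = (2 * b - 2) * n"
  define V where "V = canonical_sections \<rat> g D1 D2 n"
  have FF: "\<omega> ^ (2 * n) * h \<in> FF" if "h \<in> S0" for h
    using that S0(2) by (auto simp: sections_iff intro!: FF_mult FF_power reg_var)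
  have "\<forall>h\<in>S0. \<exists>P Q S. polyf \<rat> 2 P \<and> polyf \<rat> 2 Q \<and> polyf \<rat> 2 S \<and> S (as3 \<xi> \<eta> 0) \<noteq> 0 \<and>
    \<omega> ^ (2 * n) * h * S (as3 \<xi> \<eta> 0) = P (as3 \<xi> \<eta> 0) + Q (as3 \<xi> \<eta> 0) * \<omega>"
    using FF_fraction[OF FF] by blast
  then obtain P where "\<forall>h\<in>S0. \<exists>Q S. polyf \<rat> 2 (P h) \<and> polyf \<rat> 2 Q \<and> polyf \<rat> 2 S \<and> S (as3 \<xi> \<eta> 0) \<noteq> 0 \<and>
    \<omega> ^ (2 * n) * h * S (as3 \<xi> \<eta> 0) = P h (as3 \<xi> \<eta> 0) + Q (as3 \<xi> \<eta> 0) * \<omega>" by (rule bchoice[THEN exE])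
  then obtain Q where "\<forall>h\<in>S0. \<exists>S. polyf \<rat> 2 (P h) \<and> polyf \<rat> 2 (Q h) \<and> polyf \<rat> 2 S \<and> S (as3 \<xi> \<eta> 0) \<noteq> 0 \<and>
    \<omega> ^ (2 * n) * h * S (as3 \<xi> \<eta> 0) = P h (as3 \<xi> \<eta> 0) + Q h (as3 \<xi> \<eta> 0) * \<omega>" by (rule bchoice[THEN exE])
  then obtain S where PQS: "\<forall>h\<in>S0. polyf \<rat> 2 (P h) \<and> polyf \<rat> 2 (Q h) \<and> polyf \<rat> 2 (S h) \<and> S h (as3 \<xi> \<eta> 0) \<noteq> 0 \<and>
    \<omega> ^ (2 * n) * h * S h (as3 \<xi> \<eta> 0) = P h (as3 \<xi> \<eta> 0) + Q h (as3 \<xi> \<eta> 0) * \<omega>" by (rule bchoice[THEN exE])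
  \<comment> \<open>A common denominator of all sections, so that the parts of a combination are the
    combinations of the parts.\<close>
  define T where "T u = (\<Prod>h\<in>S0. S h u)" for u
  define P' Q' where P'Q'_def: "P' h u = P h u * (\<Prod>h'\<in>S0 - {h}. S h' u)" "Q' h u = Q h u * (\<Prod>h'\<in>S0 - {h}. S h' u)" for h u
  have poly: "polyf \<rat> 2 T" "\<And>h. h \<in> S0 \<Longrightarrow> polyf \<rat> 2 (P' h)" "\<And>h. h \<in> S0 \<Longrightarrow> polyf \<rat> 2 (Q' h)"
    unfolding T_def P'Q'_def using PQS by (auto intro!: polyf_mult polyf_prod)
  have T0: "T (as3 \<xi> \<eta> 0) \<noteq> 0" using PQS S0(1) by (simp add: T_def)
  have hT: "\<omega> ^ (2 * n) * h * T (as3 \<xi> \<eta> 0) = P' h (as3 \<xi> \<eta> 0) + Q' h (as3 \<xi> \<eta> 0) * \<omega>" if h: "h \<in> S0" for h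
  proof -
    have "T (as3 \<xi> \<eta> 0) = S h (as3 \<xi> \<eta> 0) * (\<Prod>h'\<in>S0 - {h}. S h' (as3 \<xi> \<eta> 0))"
      unfolding T_def using h S0(1) by (simp add: prod.remove)
    then have "\<omega> ^ (2 * n) * h * T (as3 \<xi> \<eta> 0) = (\<omega> ^ (2 * n) * h * S h (as3 \<xi> \<eta> 0)) * (\<Prod>h'\<in>S0 - {h}. S h' (as3 \<xi> \<eta> 0))"
      by simp
    also have "\<omega> ^ (2 * n) * h * S h (as3 \<xi> \<eta> 0) = P h (as3 \<xi> \<eta> 0) + Q h (as3 \<xi> \<eta> 0) * \<omega>" using PQS h by blast
    finally show ?thesis unfolding P'Q'_def by (simp only: distrib_right distrib_left mult_ac)
  qed
  obtain Vs where Vs: "finite Vs" "card Vs = l + b + 1" "Vs \<subseteq> \<rat>" "Vs \<inter> {y. T (as3 \<xi> y 0) = 0} = {}"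
    using rational_points_avoiding[OF finite_slice_zeros(2)[OF poly(1) T0]] by blast
  have "finite (\<Union>y\<in>Vs. {x. T (as3 x y 0) = 0})"
    using Vs(1,4) finite_slice_zeros(1)[OF poly(1)] by (intro finite_UN_I) blast+
  from rational_points_avoiding[OF this, of "k + a + 1"]
  obtain Us where Us: "finite Us" "card Us = k + a + 1" "Us \<subseteq> \<rat>" "Us \<inter> (\<Union>y\<in>Vs. {x. T (as3 x y 0) = 0}) = {}"
    by (elim exE conjE)
  have TUV: "T (as3 x y 0) \<noteq> 0" if "x \<in> Us" "y \<in> Vs" for x y using Us(4) that by blast
  \<comment> \<open>Two conditions per grid point, one on P and one on Q B. Grid points with
    rational coordinates make these values rational, so that the linear system can be solved over
    the rationals.\<close>
  define val where "val h = (\<lambda>(e, x, y). if e then P' h (as3 x y 0) else Q' h (as3 x y 0) * B x y)" for h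
  define A where "A h i = (SOME c::rat. of_rat c = val h i)" for h i
  have A: "of_rat (A h (e, x, y)) = val h (e, x, y)" if "h \<in> S0" "x \<in> Us" "y \<in> Vs" for h e x y
  proof -
    have R: "x \<in> \<rat>" "y \<in> \<rat>" using that Us(3) Vs(3) by auto
    have as: "as3 x y 0 i \<in> \<rat>" for i using R by (auto simp: as3_def)
    have "val h (e, x, y) \<in> \<rat>"
      using polyf_Rats[OF poly(2)[OF that(1)], of "as3 x y 0"] polyf_Rats[OF poly(3)[OF that(1)], of "as3 x y 0"]
        polyf_Rats[OF polyf_B, of "as3 x y 0"] as
      by (auto simp: val_def intro!: Rats_mult)
    then show ?thesis unfolding A_def by (intro someI_ex[of "\<lambda>c. of_rat c = val h (e, x, y)"]) (auto elim: Rats_cases)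
  qed
  \<comment> \<open>The grid has one more point in each direction than the pole orders k + a and l +
    b, and the factor 2 counts the two parts.\<close>
  have "card ((UNIV :: bool set) \<times> Us \<times> Vs) < card S0"
    using big Us(2) Vs(2) by (simp add: card_cartesian_product k_l_def not_le)
  then obtain c where c: "\<exists>h\<in>S0. c h \<noteq> 0" "\<forall>i\<in>(UNIV :: bool set) \<times> Us \<times> Vs. (\<Sum>h\<in>S0. c h * A h i) = 0"
    using homogeneous_system_solution[OF S0(1), of "(UNIV :: bool set) \<times> Us \<times> Vs" A] Us(1) Vs(1) by auto
  define e where "e = (\<Sum>h\<in>S0. of_rat (c h) * h)"
  define Ps Qs where PsQs_def: "Ps u = (\<Sum>h\<in>S0. of_rat (c h) * P' h u)" "Qs u = (\<Sum>h\<in>S0. of_rat (c h) * Q' h u)" for u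
  have polys: "polyf \<rat> 2 Ps" "polyf \<rat> 2 Qs" "polyf \<rat> 2 (\<lambda>u. Qs u * B (u 0) (u 1))"
    unfolding PsQs_def using poly(2,3) by (auto intro!: polyf_sum polyf_mult polyf_const polyf_B simp del: One_nat_def)
  have eV: "e \<in> V"
    unfolding e_def V_def using S0(2)
    by (intro QV.subspace_sum[OF sections_subspace] QV.subspace_scale[OF sections_subspace]) auto
  have eT: "\<omega> ^ (2 * n) * e * T (as3 \<xi> \<eta> 0) = Ps (as3 \<xi> \<eta> 0) + Qs (as3 \<xi> \<eta> 0) * \<omega>"
  proof -
    have "\<omega> ^ (2 * n) * e * T (as3 \<xi> \<eta> 0) = (\<Sum>h\<in>S0. of_rat (c h) * (\<omega> ^ (2 * n) * h * T (as3 \<xi> \<eta> 0)))"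
      unfolding e_def sum_distrib_left sum_distrib_right by (rule sum.cong) (simp_all add: mult_ac)
    also have "\<dots> = (\<Sum>h\<in>S0. of_rat (c h) * (P' h (as3 \<xi> \<eta> 0) + Q' h (as3 \<xi> \<eta> 0) * \<omega>))"
      by (rule sum.cong) (simp_all only: hT)
    also have "\<dots> = Ps (as3 \<xi> \<eta> 0) + Qs (as3 \<xi> \<eta> 0) * \<omega>"
      unfolding PsQs_def sum_distrib_right by (simp add: distrib_left sum.distrib mult_ac)
    finally show ?thesis .
  qed
  have eT': "\<omega> ^ (2 * n) * e * \<omega> * T (as3 \<xi> \<eta> 0) = Qs (as3 \<xi> \<eta> 0) * B (as3 \<xi> \<eta> 0 0) (as3 \<xi> \<eta> 0 1) + Ps (as3 \<xi> \<eta> 0) * \<omega>"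
  proof -
    have "\<omega> ^ (2 * n) * e * \<omega> * T (as3 \<xi> \<eta> 0) = (\<omega> ^ (2 * n) * e * T (as3 \<xi> \<eta> 0)) * \<omega>" by (simp add: mult_ac)
    then show ?thesis unfolding eT by (simp add: \<omega>[symmetric] power2_eq_square algebra_simps)
  qed
  have grid: "Ps (as3 x y 0) = 0" "Qs (as3 x y 0) * B (as3 x y 0 0) (as3 x y 0 1) = 0" if "x \<in> Us" "y \<in> Vs" for x y
  proof -
    have s: "(\<Sum>h\<in>S0. of_rat (c h) * val h (f, x, y)) = 0" for f
    proof -
      have "(\<Sum>h\<in>S0. of_rat (c h) * val h (f, x, y)) = of_rat (\<Sum>h\<in>S0. c h * A h (f, x, y))"
        unfolding of_rat_sum of_rat_mult by (rule sum.cong) (use A that in auto)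
      then show ?thesis using c(2) that by simp
    qed
    show "Ps (as3 x y 0) = 0" using s[of True] by (simp add: val_def PsQs_def)
    show "Qs (as3 x y 0) * B (as3 x y 0 0) (as3 x y 0 1) = 0"
      using s[of False] by (simp add: val_def PsQs_def sum_distrib_right mult.assoc)
  qed
  have bp: "bounded_poles (k + a) (l + b) (\<omega> ^ (2 * n) * e)" "bounded_poles (k + a) (l + b) (\<omega> ^ (2 * n) * e * \<omega>)"
    using bounded_poles_mult[OF section_bounded_poles] eV unfolding V_def k_l_def by blast+
  have "Ps (as3 \<xi> \<eta> 0) = 0"
    by (rule bounded_poles_grid[OF bp(1) polys(1,2) poly(1) eT Us(1) Vs(1)]) (use Us(2) Vs(2) TUV grid in auto)
  moreover have "(\<lambda>u. Qs u * B (u 0) (u 1)) (as3 \<xi> \<eta> 0) = 0"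
    by (rule bounded_poles_grid[OF bp(2) polys(3,1) poly(1) eT' Us(1) Vs(1)]) (use Us(2) Vs(2) TUV grid in auto)
  ultimately have "\<omega> ^ (2 * n) * e * T (as3 \<xi> \<eta> 0) = 0" unfolding eT using B_nonzero by simp
  then have "e = 0" using T0 W_nonzero by simp
  then have "\<forall>h\<in>S0. c h = 0"
    using QV.independentD[OF S0(3,1) subset_refl] unfolding e_def by blast
  then show False using c(1) by blast
qed

lemma dimension_sections:
  assumes "a \<ge> 2" "b \<ge> 2"
  shows "\<exists>d. CC.dimension d \<rat> (canonical_sections \<rat> g D1 D2 n) \<and> (n * (a - 2) + 1) * (n * (b - 2) + 1) \<le> d \<and>
    d \<le> 2 * (((2 * a - 2) * n + a + 1) * ((2 * b - 2) * n + b + 1))"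
proof -
  define I where "I = {..n * (a - 2)} \<times> {..n * (b - 2)}"
  define S0 where "S0 = (\<lambda>(i, j). \<xi> ^ i * \<eta> ^ j * (1 / \<omega> ^ n)) ` I"
  have I: "finite I" "card I = (n * (a - 2) + 1) * (n * (b - 2) + 1)" by (simp_all add: I_def card_cartesian_product)
  have "1 / \<omega> ^ n \<noteq> 0" using W_nonzero by simp
  from monomials_rational_independent[OF this I(1)]
  have S0: "card S0 = card I" "QV.independent S0" by (simp_all add: S0_def card_image)
  have "S0 \<subseteq> canonical_sections \<rat> g D1 D2 n"
    using monomial_section[OF assms] by (auto simp: S0_def I_def)
  then have "\<exists>d. CC.dimension d \<rat> (canonical_sections \<rat> g D1 D2 n) \<and> card S0 \<le> d \<and>
      d \<le> 2 * (((2 * a - 2) * n + a + 1) * ((2 * b - 2) * n + b + 1))"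
    using I(1) S0(2) by (intro dimension_between[OF sections_subspace] sections_upper) (auto simp: S0_def)
  then show ?thesis by (simp only: S0(1) I(2))
qed

text \<open>The wedge changes by the determinant of the change of basis. Expanding in the other
  direction as well shows that it is nonzero, since the wedge of \<xi> and \<eta> is 1 for the
  coordinate derivations.\<close>

lemma deriv_basis_wedge:
  assumes E: "deriv_basis \<rat> FF E1 E2"
  shows "\<exists>\<delta>\<in>FF. \<delta> \<noteq> 0 \<and> (\<forall>u\<in>FF. \<forall>v\<in>FF. wedge E1 E2 u v = \<delta> * wedge D1 D2 u v)"
proof -
  have expand: "\<exists>p\<in>FF. \<exists>q\<in>FF. \<forall>u\<in>FF. D u = p * F1 u + q * F2 u"
    if "deriv_basis \<rat> FF F1 F2" "derivation \<rat> FF D" for D F1 F2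
  proof -
    from that have "\<exists>!v. v \<in> FF \<times> FF \<and> (\<forall>u\<in>FF. D u = fst v * F1 u + snd v * F2 u)"
      unfolding deriv_basis_def by blast
    from ex1_implies_ex[OF this] obtain v where v: "v \<in> FF \<times> FF" "\<forall>u\<in>FF. D u = fst v * F1 u + snd v * F2 u"
      by (elim exE conjE)
    show ?thesis by (rule bexI[of _ "fst v"], rule bexI[of _ "snd v"]) (use v in \<open>auto simp: mem_Times_iff\<close>)
  qed
  have wedge: "\<exists>\<delta>\<in>FF. \<forall>u\<in>FF. \<forall>v\<in>FF. wedge G1 G2 u v = \<delta> * wedge F1 F2 u v"
    if F: "deriv_basis \<rat> FF F1 F2" and G: "deriv_basis \<rat> FF G1 G2" for F1 F2 G1 G2
  proof -
    have d: "derivation \<rat> FF G1" "derivation \<rat> FF G2" using G by (auto simp: deriv_basis_def)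
    obtain p1 q1 where 1: "p1 \<in> FF" "q1 \<in> FF" "\<And>u. u \<in> FF \<Longrightarrow> G1 u = p1 * F1 u + q1 * F2 u"
      using expand[OF F d(1)] by blast
    obtain p2 q2 where 2: "p2 \<in> FF" "q2 \<in> FF" "\<And>u. u \<in> FF \<Longrightarrow> G2 u = p2 * F1 u + q2 * F2 u"
      using expand[OF F d(2)] by blast
    show ?thesis
      by (rule bexI[of _ "p1 * q2 - p2 * q1"])
        (auto simp: wedge_def 1(3) 2(3) algebra_simps intro!: FF_diff FF_mult 1 2)
  qed
  obtain \<delta> where \<delta>: "\<delta> \<in> FF" "\<forall>u\<in>FF. \<forall>v\<in>FF. wedge E1 E2 u v = \<delta> * wedge D1 D2 u v"
    using wedge[OF deriv_basis_dir_deriv E] by blast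
  obtain \<delta>' where \<delta>': "\<forall>u\<in>FF. \<forall>v\<in>FF. wedge D1 D2 u v = \<delta>' * wedge E1 E2 u v"
    using wedge[OF E deriv_basis_dir_deriv] by blast
  have "wedge D1 D2 \<xi> \<eta> = 1" by (simp add: wedge_def D12)
  then have "\<delta> \<noteq> 0" using \<delta>(2) \<delta>' reg_var by (metis mult_zero_left mult_zero_right zero_neq_one)
  then show ?thesis using \<delta> by blast
qed

lemma sections_rescale:
  assumes \<delta>: "\<delta> \<in> FF" "\<delta> \<noteq> 0" and w: "\<forall>u\<in>FF. \<forall>v\<in>FF. wedge E1 E2 u v = \<delta> * wedge D1 D2 u v"
  shows "canonical_sections \<rat> g E1 E2 n = (*) (\<delta> ^ n) ` canonical_sections \<rat> g D1 D2 n"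
proof -
  have stalk: "canonical_stalk E1 E2 (regring (Xc sx) (Yc sy) (Wc sx sy) x y w) n =
      (*) (\<delta> ^ n) ` canonical_stalk D1 D2 (regring (Xc sx) (Yc sy) (Wc sx sy) x y w) n"
    if "w\<^sup>2 = Bc sx sy x y" for sx sy x y w
    using chart_subset_FF[OF that] w by (intro canonical_stalk_rescale) blast
  have mem: "h \<in> (*) (\<delta> ^ n) ` R \<longleftrightarrow> h / \<delta> ^ n \<in> R" for h R
    using \<delta>(2) by (auto simp: image_iff intro!: bexI[of _ "h / \<delta> ^ n"])
  have FF: "h \<in> FF \<longleftrightarrow> h / \<delta> ^ n \<in> FF" for h
    using FF_divide[OF _ FF_power[OF \<delta>(1)], of h n] FF_mult[OF _ FF_power[OF \<delta>(1)], of "h / \<delta> ^ n" n] \<delta>(2) by auto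
  show ?thesis
  proof (rule Set.set_eqI)
    fix h
    have "h \<in> canonical_sections \<rat> g E1 E2 n \<longleftrightarrow> h / \<delta> ^ n \<in> FF \<and> (\<forall>sx sy x y w. w\<^sup>2 = Bc sx sy x y \<longrightarrow>
        h / \<delta> ^ n \<in> canonical_stalk D1 D2 (regring (Xc sx) (Yc sy) (Wc sx sy) x y w) n)"
      by (simp only: sections_iff FF[of h] stalk mem simp_thms cong: imp_cong)
    then show "h \<in> canonical_sections \<rat> g E1 E2 n \<longleftrightarrow> h \<in> (*) (\<delta> ^ n) ` canonical_sections \<rat> g D1 D2 n"
      unfolding mem sections_iff[of "h / \<delta> ^ n"] .
  qed
qed

text \<open>The definite description is well defined: another basis of derivations multiplies the
  sections by \<delta>^n, which preserves the dimension.\<close>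

lemma plurigenus_g:
  assumes d: "CC.dimension d \<rat> (canonical_sections \<rat> g D1 D2 n)"
  shows "plurigenus \<rat> g n = d"
  unfolding plurigenus_def fun_field_g
proof (rule the_equality)
  show "\<exists>E1 E2. deriv_basis \<rat> FF E1 E2 \<and> CC.dimension d \<rat> (canonical_sections \<rat> g E1 E2 n)"
    using deriv_basis_dir_deriv d by blast
  fix e assume "\<exists>E1 E2. deriv_basis \<rat> FF E1 E2 \<and> CC.dimension e \<rat> (canonical_sections \<rat> g E1 E2 n)"
  then obtain E1 E2 where E: "deriv_basis \<rat> FF E1 E2" "CC.dimension e \<rat> (canonical_sections \<rat> g E1 E2 n)" by blast
  obtain \<delta> where \<delta>: "\<delta> \<in> FF" "\<delta> \<noteq> 0" "\<forall>u\<in>FF. \<forall>v\<in>FF. wedge E1 E2 u v = \<delta> * wedge D1 D2 u v"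
    using deriv_basis_wedge[OF E(1)] by blast
  have "CC.dimension d \<rat> (canonical_sections \<rat> g E1 E2 n)"
    unfolding sections_rescale[OF \<delta>] by (rule dimension_scale[OF d]) (use \<delta>(2) in simp)
  then show "e = d" using CC.dimension_is_inj[OF subfield_Rats E(2)] by simp
qed

lemma plurigenus_bounds:
  assumes "a \<ge> 2" "b \<ge> 2"
  shows "(n * (a - 2) + 1) * (n * (b - 2) + 1) \<le> plurigenus \<rat> g n"
    "plurigenus \<rat> g n \<le> 2 * (((2 * a - 2) * n + a + 1) * ((2 * b - 2) * n + b + 1))"
  using dimension_sections[OF assms, of n] plurigenus_g by blast+

end

section \<open>Kodaira dimension and volume\<close>

text \<open>A positive quadratic lower bound excludes linear growth, so the Kodaira dimension is 2.
  The factor 2 in the volume is the normalisation by n^2 / 2!.\<close>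

lemma general_type_quadratic_growth:
  assumes bounds: "\<And>n. n \<ge> 1 \<Longrightarrow> c * real n ^ 2 \<le> real (plurigenus k g n)"
    "\<And>n. n \<ge> 1 \<Longrightarrow> real (plurigenus k g n) \<le> C * real n ^ 2" and c: "c > 0"
  shows "general_type k g" "ereal (2 * c) \<le> canonical_volume k g" "canonical_volume k g \<le> ereal (2 * C)"
proof -
  have "plurigenus k g 1 \<noteq> 0" using bounds(1)[of 1] c by auto
  moreover have "(LEAST \<kappa>. \<exists>C::real. \<forall>n\<ge>1. real (plurigenus k g n) \<le> C * real n ^ \<kappa>) = 2"
  proof (rule Least_equality)
    show "\<exists>C::real. \<forall>n\<ge>1. real (plurigenus k g n) \<le> C * real n ^ 2" using bounds(2) by blast
    fix \<kappa> assume "\<exists>C::real. \<forall>n\<ge>1. real (plurigenus k g n) \<le> C * real n ^ \<kappa>"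
    then obtain C' :: real where C': "\<And>n. n \<ge> 1 \<Longrightarrow> real (plurigenus k g n) \<le> C' * real n ^ \<kappa>" by blast
    show "2 \<le> \<kappa>"
    proof (rule ccontr)
      assume "\<not> 2 \<le> \<kappa>"
      obtain n :: nat where n: "real n > \<bar>C'\<bar> / c" using reals_Archimedean2 by blast
      then have n1: "n \<ge> 1" using c by (cases n) (auto simp: divide_less_0_iff)
      have "c * real n ^ 2 \<le> C' * real n ^ \<kappa>" using bounds(1)[OF n1] C'[OF n1] by simp
      also have "\<dots> \<le> \<bar>C'\<bar> * real n ^ \<kappa>" by (intro mult_right_mono) auto
      also have "\<dots> \<le> \<bar>C'\<bar> * real n ^ 1"
        using n1 \<open>\<not> 2 \<le> \<kappa>\<close> by (intro mult_left_mono power_increasing) auto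
      finally have "c * real n \<le> \<bar>C'\<bar>" using n1 by (simp add: power2_eq_square)
      then show False using n c by (simp add: field_simps)
    qed
  qed
  ultimately show "general_type k g" by (auto simp: general_type_def kodaira_dim_def)
  have ev: "eventually (\<lambda>n. ereal (2 * c) \<le> ereal (real (plurigenus k g n) / (real n ^ 2 / fact 2)) \<and>
      ereal (real (plurigenus k g n) / (real n ^ 2 / fact 2)) \<le> ereal (2 * C)) sequentially"
    using eventually_ge_at_top[of 1]
  proof eventually_elim
    case (elim n)
    then have "real n ^ 2 > 0" by simp
    then show ?case using bounds[OF elim] by (simp add: fact_numeral field_simps)
  qed
  show "ereal (2 * c) \<le> canonical_volume k g"
    unfolding canonical_volume_def by (rule le_Limsup) (use ev in \<open>auto elim: eventually_mono\<close>)
  show "canonical_volume k g \<le> ereal (2 * C)"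
    unfolding canonical_volume_def by (rule Limsup_bounded) (use ev in \<open>auto elim: eventually_mono\<close>)
qed

text \<open>The plane cover and the model share the generic coordinates \<xi>, \<eta>, \<omega>;
  both function fields are the field generated by them.\<close>

lemma smooth_model_biquad:
  assumes "dmodel a b 1 3 1 (- 1) \<xi> \<eta> \<omega>"
  shows "smooth_model \<rat> (a + b) (biquad_form a b) (dmodel.g a b \<xi> \<eta> \<omega>)"
proof -
  interpret dmodel a b 1 3 1 "- 1" \<xi> \<eta> \<omega> by (rule assms)
  let ?v = "[1, \<xi>, \<eta>, \<omega>]" and ?wt = "cover_wts (a + b)"
  have f: "mp_eval [1, x, y] (biquad_form a b) = B x y" for x y
    by (simp add: mp_eval_biquad biquad_def)
  have v: "?v \<in> cover_vecs (biquad_form a b)" by (auto simp: cover_vecs_4 f \<omega>)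
  have "cover_generic \<rat> (a + b) (biquad_form a b) ?v"
    unfolding cover_generic_def
  proof (intro conjI v ballI subsetI)
    fix u F assume u: "u \<in> cover_vecs (biquad_form a b)" and "F \<in> pt \<rat> ?wt ?v"
    then obtain d where F: "wform \<rat> ?wt d F" "mp_eval ?v F = 0" by (auto simp: pt_def)
    define \<sigma> where "\<sigma> i = (if i = (0::nat) then (\<lambda>u::nat\<Rightarrow>complex. 1) else (\<lambda>u. u (i - 1)))" for i
    have \<sigma>: "map (\<lambda>i. \<sigma> i u) [0..<4] = [1, u 0, u 1, u 2]" for u by (simp add: \<sigma>_def upt_4)
    have "polyf \<rat> 3 (\<lambda>u. mp_eval (map (\<lambda>i. \<sigma> i u) [0..<4]) F)"
      by (rule rats.polyf_wform[OF F(1)]) (auto intro: polyf_const polyf_var simp: \<sigma>_def)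
    then have poly: "polyf \<rat> 3 (\<lambda>u. mp_eval [1, u 0, u 1, u 2] F)" by (simp only: \<sigma>)
    have "mp_eval [1, y, z, w] F = 0" if "w\<^sup>2 = mp_eval [1, y, z] (biquad_form a b)" for y z w
      using specialize[OF poly, of w y z] F(2) that by (simp add: f)
    then have "mp_eval u F = 0" by (rule cover_vanishI[OF F(1) wform_biquad _ u])
    then show "F \<in> pt \<rat> ?wt u" using F(1) by (auto simp: pt_def)
  qed
  moreover have "res_field \<rat> ?wt ?v = FF"
  proof
    show "res_field \<rat> ?wt ?v \<subseteq> FF"
      by (rule res_field_subset) (auto intro: reg_Rats reg_var FF_add FF_mult FF_divide)
    have "A (as3 \<xi> \<eta> \<omega>) \<in> res_field \<rat> ?wt ?v" if "polyf \<rat> 3 A" for A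
      using that
    proof (induction rule: polyf.induct)
      case (polyf_var i)
      have "?v ! Suc i \<in> res_field \<rat> ?wt ?v" by (rule rats.res_field_nth) (use polyf_var in auto)
      moreover have "?v ! Suc i = as3 \<xi> \<eta> \<omega> i" using polyf_var by (auto simp: as3_def numeral_3_eq_3 less_Suc_eq numeral_2_eq_2)
      ultimately show ?case by simp
    qed (auto intro: rats.res_field_const rats.res_field_add rats.res_field_mult)
    then show "FF \<subseteq> res_field \<rat> ?wt ?v"
      by (auto elim!: regE[OF _ \<omega>] intro!: rats.res_field_divide)
  qed
  moreover have "g \<in> nonzero_vecs (length g)" using emb_in_locus[of \<omega> False False \<xi> \<eta>] \<omega>
    by (auto simp: locus_def g_def Bc_def coef_def)
  ultimately show ?thesis
    unfolding smooth_model_def fun_field_g using smooth_surface_g by blast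
qed

text \<open>For b = 3 and n \<ge> 1 the two grid sides are at most 3 a n and 8 n. This bounds the
  plurigenus by 48 a n^2 and the volume by twice the coefficient, 96 a.\<close>

lemma biquad_surface:
  assumes "a \<ge> 3"
  shows "\<exists>g. smooth_model \<rat> (a + 3) (biquad_form a 3) g \<and> general_type \<rat> g \<and>
    ereal (2 * real (a - 2)) \<le> canonical_volume \<rat> g \<and> canonical_volume \<rat> g \<le> ereal (96 * real a)"
proof -
  obtain \<xi> \<eta> where gen: "generic2 \<xi> \<eta>" "generic2 (1 / \<xi>) \<eta>" "generic2 \<xi> (1 / \<eta>)" "generic2 (1 / \<xi>) (1 / \<eta>)"
    using exists_generic2 by blast
  define \<omega> where "\<omega> = csqrt (biquad a 3 1 3 1 (- 1) \<xi> \<eta>)"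
  have model: "dmodel a 3 1 3 1 (- 1) \<xi> \<eta> \<omega>"
    by unfold_locales (use assms gen in \<open>auto simp: \<omega>_def\<close>)
  interpret dmodel a 3 1 3 1 "- 1" \<xi> \<eta> \<omega> by (rule model)
  have low: "real (a - 2) * real n ^ 2 \<le> real (plurigenus \<rat> g n)" for n
  proof -
    have "(a - 2) * n ^ 2 \<le> (n * (a - 2) + 1) * (n * (3 - 2) + 1)" by (simp add: power2_eq_square)
    also have "\<dots> \<le> plurigenus \<rat> g n" by (rule plurigenus_bounds) (use assms in auto)
    finally show ?thesis by (metis of_nat_le_iff of_nat_mult of_nat_power)
  qed
  have up: "real (plurigenus \<rat> g n) \<le> (48 * real a) * real n ^ 2" if n: "n \<ge> 1" for n
  proof -
    obtain a' where a': "a = Suc a'" using assms by (cases a) auto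
    obtain n' where n': "n = Suc n'" using n by (cases n) auto
    have "plurigenus \<rat> g n \<le> 2 * (((2 * a - 2) * n + a + 1) * ((2 * 3 - 2) * n + 3 + 1))"
      by (rule plurigenus_bounds) (use assms in auto)
    also have "\<dots> \<le> 2 * ((3 * a * n) * (8 * n))"
    proof (intro mult_le_mono order_refl)
      show "(2 * a - 2) * n + a + 1 \<le> 3 * a * n" by (simp add: a' n' algebra_simps)
      show "(2 * 3 - 2) * n + 3 + 1 \<le> 8 * n" using n by simp
    qed
    also have "\<dots> = 48 * a * n ^ 2" by (simp add: power2_eq_square)
    finally have "real (plurigenus \<rat> g n) \<le> real (48 * a * n ^ 2)" by (simp only: of_nat_le_iff)
    then show ?thesis by simp
  qed
  have "real (a - 2) > 0" using assms by simp
  from general_type_quadratic_growth[OF low up this] smooth_model_biquad[OF model]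
  show ?thesis by (intro exI[of _ g]) simp
qed

theorem theorem2:
  shows
    "(\<forall>m::nat. 1 \<le> m \<and> m \<le> 4 \<longrightarrow>
        (\<exists>k f. number_field k \<and> plane_curve k (2 * m) f \<and> smooth_curve f \<and>
               quadratic_points_dense k m f))
     \<and>
     (\<exists>k (m :: nat \<Rightarrow> nat) (f :: nat \<Rightarrow> mpol) (Y :: nat \<Rightarrow> complex list).
        number_field k \<and> strict_mono m \<and>
        (\<forall>i. plane_curve k (2 * m i) (f i) \<and> \<not> smooth_curve (f i) \<and>
             quadratic_points_dense k (m i) (f i) \<and>
             smooth_model k (m i) (f i) (Y i) \<and> general_type k (Y i)) \<and>
        strict_mono (\<lambda>i. canonical_volume k (Y i)))"
proof (intro conjI allI impI)
  fix m :: nat assume m: "1 \<le> m \<and> m \<le> 4"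
  then obtain c where c: "c \<noteq> 0" "c \<in> \<rat>" "quadratic_points_dense \<rat> m (fermat_form m c)"
    using fermat_dense by blast
  then show "\<exists>k f. number_field k \<and> plane_curve k (2 * m) f \<and> smooth_curve f \<and> quadratic_points_dense k m f"
    using number_field_Rats plane_curve_fermat[of m c] smooth_curve_fermat[of m c] m by blast
next
  \<comment> \<open>The ratio 50 makes the volume intervals disjoint: 96 a < 2 (50 a - 2) as soon as
    a > 1. The initial value 3 gives a - 2 > 0.\<close>
  define a :: "nat \<Rightarrow> nat" where "a i = 3 * 50 ^ i" for i
  have a: "a i \<ge> 3" for i by (simp add: a_def)
  obtain G where G: "\<And>i. smooth_model \<rat> (a i + 3) (biquad_form (a i) 3) (G i)" "\<And>i. general_type \<rat> (G i)"
    "\<And>i. ereal (2 * real (a i - 2)) \<le> canonical_volume \<rat> (G i)" "\<And>i. canonical_volume \<rat> (G i) \<le> ereal (96 * real (a i))"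
    using biquad_surface[OF a] by metis
  have mono: "strict_mono (\<lambda>i. a i + 3)"
    by (rule strict_monoI_Suc) (simp add: a_def)
  have curve: "plane_curve \<rat> (2 * (a i + 3)) (biquad_form (a i) 3)" "\<not> smooth_curve (biquad_form (a i) 3)"
    "quadratic_points_dense \<rat> (a i + 3) (biquad_form (a i) 3)" for i
    using a[of i] plane_curve_biquad[of "a i" 3] not_smooth_curve_biquad[of "a i" 3] biquad_dense[of "a i"] by auto
  have vol: "strict_mono (\<lambda>i. canonical_volume \<rat> (G i))"
  proof (rule strict_monoI_Suc)
    fix i
    have "a (Suc i) = 50 * a i" by (simp add: a_def)
    then have "96 * real (a i) < 2 * real (a (Suc i) - 2)"
      using a[of i] by (simp add: of_nat_diff)
    then have "ereal (96 * real (a i)) < ereal (2 * real (a (Suc i) - 2))" by simp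
    then show "canonical_volume \<rat> (G i) < canonical_volume \<rat> (G (Suc i))"
      using G(3)[of "Suc i"] G(4)[of i] by (meson le_less_trans less_le_trans)
  qed
  show "\<exists>k (m :: nat \<Rightarrow> nat) (f :: nat \<Rightarrow> mpol) (Y :: nat \<Rightarrow> complex list).
        number_field k \<and> strict_mono m \<and>
        (\<forall>i. plane_curve k (2 * m i) (f i) \<and> \<not> smooth_curve (f i) \<and>
             quadratic_points_dense k (m i) (f i) \<and>
             smooth_model k (m i) (f i) (Y i) \<and> general_type k (Y i)) \<and>
        strict_mono (\<lambda>i. canonical_volume k (Y i))"
    by (rule exI[of _ \<rat>], rule exI[of _ "\<lambda>i. a i + 3"], rule exI[of _ "\<lambda>i. biquad_form (a i) 3"], rule exI[of _ G])
      (use number_field_Rats mono curve G(1,2) vol in blast)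
qed

end
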